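(* Let $1\le m\le n-1$ be integers, let $E\subset\mathbb{R}^n$ be a non-empty Borel set (assumed to be bounded in (ii) and (iii)) and let $0\le\gamma\le n-m$. Then (i) $\dim_{\rm H}\{V\in G(n,m):\dim_{\rm H}\pi_VE<\dim_{\rm H}^{m+\gamma}E-\gamma\}\le m(n-m)-\gamma$, (ii) $\dim_{\rm H}\{V\in G(n,m):\underline{\dim}_{\rm B}\,\pi_VE<\underline{\dim}_{\rm B}^{m+\gamma}E-\gamma\}\le m(n-m)-\gamma$, (iii) $\dim_{\rm H}\{V\in G(n,m):\overline{\dim}_{\rm B}\,\pi_VE<\overline{\dim}_{\rm B}^{m+\gamma}E-\gamma\}\le m(n-m)-\gamma$, (iv) $\dim_{\rm H}\{V\in G(n,m):\dim_{\rm P}\pi_VE<\dim_{\rm P}^{m+\gamma}E-\gamma\}\le m(n-m)-\gamma$.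
   Context: $G(n,m)$ is the Grassmannian of $m$-dimensional linear subspaces of $\mathbb{R}^n$, a manifold of dimension $m(n-m)$, equipped with a natural locally $m(n-m)$-dimensional metric (e.g. $d(V,W)=\|\pi_V-\pi_W\|$ in operator norm), with respect to which Hausdorff dimension of subsets of $G(n,m)$ is taken; $\pi_V:\mathbb{R}^n\to V$ is orthogonal projection. $\dim_{\rm H}$ is Hausdorff dimension (with $\dim_{\rm H}\emptyset=0$). Box dimensions: for non-empty bounded $E$, $N_r(E)$ is the minimum number of sets of diameter $r$ that can cover $E$; $\underline{\dim}_{\rm B}E=\liminf_{r\to0}\frac{\log N_r(E)}{-\log r}$ and $\overline{\dim}_{\rm B}E=\limsup_{r\to0}\frac{\log N_r(E)}{-\log r}$. Packing dimension: $\dim_{\rm P}E=\inf\{\sup_{i}\overline{\dim}_{\rm B}E_i: E\subset\bigcup_{i=1}^\infty E_i\}$, where the infimum is over countable covers by non-empty bounded (equivalently, compact) sets $E_i$. Dimension profiles: for $s>0$, $r>0$ let $\phi_r^s(x)=\min\{1,(r/|x|)^s\}$ for $x\in\mathbb{R}^n$ (equal to $1$ at $x=0$). For non-empty compact $E$ let $\mathcal{M}(E)$ be the set of Borel probability measures supported by $E$, and define the capacity $C_r^s(E)$ by $\frac1{C_r^s(E)}=\inf_{\mu\in\mathcal{M}(E)}\int\int\phi_r^s(x-y)\,d\mu(x)\,d\mu(y)$. For non-empty bounded $E$, $C_r^s(E)$ is defined as the capacity of the closure of $E$. Then $\underline{\dim}_{\rm B}^sE=\liminf_{r\to0}\frac{\log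 C_r^s(E)}{-\log r}$, $\overline{\dim}_{\rm B}^sE=\limsup_{r\to0}\frac{\log C_r^s(E)}{-\log r}$, and for arbitrary non-empty $E\subset\mathbb{R}^n$, $\dim_{\rm P}^sE=\inf\{\sup_i\overline{\dim}_{\rm B}^sE_i:E\subset\bigcup_{i=1}^\infty E_i,\ \text{each }E_i\text{ non-empty and compact}\}$. Also $\dim_{\rm H}^sE:=\min\{s,\dim_{\rm H}E\}$. *)

theory Defs
  imports "HOL-Probability.Probability"
begin

section \<open>Hausdorff dimension in a metric space with carrier \<open>M\<close> and metric \<open>d\<close>\<close>

definition set_diam :: "('a \<Rightarrow> 'a \<Rightarrow> real) \<Rightarrow> 'a set \<Rightarrow> ennreal" where
  "set_diam d U = (SUP x\<in>U. SUP y\<in>U. ennreal (d x y))"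

text \<open>
  Covering sets have diameter at most \<open>\<delta> < \<infinity>\<close>, so \<open>enn2real\<close> loses nothing. Finite covers are
  included, since all but finitely many \<open>U i\<close> may be empty. Because \<open>0 powr 0 = 0\<close>, these
  definitions are only meant for \<open>s > 0\<close>.
\<close>

definition hausdorff_content ::
    "'a set \<Rightarrow> ('a \<Rightarrow> 'a \<Rightarrow> real) \<Rightarrow> real \<Rightarrow> real \<Rightarrow> 'a set \<Rightarrow> ennreal" where
  "hausdorff_content M d s \<delta> A =
     Inf {(\<Sum>i. ennreal (enn2real (set_diam d (U i)) powr s)) | U :: nat \<Rightarrow> 'a set.
            (\<forall>i. U i \<subseteq> M \<and> set_diam d (U i) \<le> ennreal \<delta>) \<and> A \<subseteq> (\<Union>i. U i)}"

definition hausdorff_measure ::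
    "'a set \<Rightarrow> ('a \<Rightarrow> 'a \<Rightarrow> real) \<Rightarrow> real \<Rightarrow> 'a set \<Rightarrow> ennreal" where
  "hausdorff_measure M d s A = (SUP \<delta>\<in>{0<..}. hausdorff_content M d s \<delta> A)"

text \<open>
  Restricting the infimum to \<open>s > 0\<close> does not change its value, and gives \<open>0\<close> for the empty set.
\<close>

definition hausdorff_dim_in :: "'a set \<Rightarrow> ('a \<Rightarrow> 'a \<Rightarrow> real) \<Rightarrow> 'a set \<Rightarrow> ereal" where
  "hausdorff_dim_in M d A = Inf {ereal s | s. s > 0 \<and> hausdorff_measure M d s A = 0}"

abbreviation hausdorff_dim :: "'a::metric_space set \<Rightarrow> ereal" where
  "hausdorff_dim \<equiv> hausdorff_dim_in UNIV dist"


section \<open>Grassmannians\<close>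

definition grassmannian :: "nat \<Rightarrow> 'a::euclidean_space set set" where
  "grassmannian m = {V. subspace V \<and> dim V = m}"

definition orth_proj :: "'a::euclidean_space set \<Rightarrow> 'a \<Rightarrow> 'a" where
  "orth_proj V x = (THE p. p \<in> V \<and> (\<forall>v\<in>V. orthogonal (x - p) v))"

lemma orth_proj_ex1:
  fixes V :: "'a::euclidean_space set"
  assumes "subspace V"
  shows "\<exists>!p. p \<in> V \<and> (\<forall>v\<in>V. orthogonal (x - p) v)"
proof (rule ex_ex1I)
  have sp: "span V = V"
    using assms by (simp add: span_eq_iff)
  obtain y z where "y \<in> span V" "\<And>w. w \<in> span V \<Longrightarrow> orthogonal z w" "x = y + z"
    using orthogonal_subspace_decomp_exists by blast
  then show "\<exists>p. p \<in> V \<and> (\<forall>v\<in>V. orthogonal (x - p) v)"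
    unfolding sp by (intro exI[of _ y]) auto
next
  fix p q
  assume p: "p \<in> V \<and> (\<forall>v\<in>V. orthogonal (x - p) v)"
    and q: "q \<in> V \<and> (\<forall>v\<in>V. orthogonal (x - q) v)"
  then have "p - q \<in> V"
    using assms by (simp add: subspace_diff)
  with p q have "(x - q) \<bullet> (p - q) - (x - p) \<bullet> (p - q) = 0"
    by (simp add: orthogonal_def)
  then have "(p - q) \<bullet> (p - q) = 0"
    by (simp add: inner_diff_left)
  then show "p = q"
    by simp
qed

definition grassmann_dist :: "'a::euclidean_space set \<Rightarrow> 'a set \<Rightarrow> real" where
  "grassmann_dist V W = onorm (\<lambda>x. orth_proj V x - orth_proj W x)"


section \<open>Box and packing dimensions\<close>

definition covering_number :: "real \<Rightarrow> 'a::euclidean_space set \<Rightarrow> nat" where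
  "covering_number r E =
     (LEAST k. \<exists>F. finite F \<and> card F = k \<and> (\<forall>U\<in>F. bounded U \<and> diameter U = r) \<and> E \<subseteq> \<Union>F)"

definition lower_box_dim :: "'a::euclidean_space set \<Rightarrow> ereal" where
  "lower_box_dim E =
     Liminf (at_right 0) (\<lambda>r. ereal (ln (real (covering_number r E)) / (- ln r)))"

definition upper_box_dim :: "'a::euclidean_space set \<Rightarrow> ereal" where
  "upper_box_dim E =
     Limsup (at_right 0) (\<lambda>r. ereal (ln (real (covering_number r E)) / (- ln r)))"

definition packing_dim :: "'a::euclidean_space set \<Rightarrow> ereal" where
  "packing_dim E =
     Inf {(SUP i. upper_box_dim (F i)) | F :: nat \<Rightarrow> 'a set.
            (\<forall>i. F i \<noteq> {} \<and> bounded (F i)) \<and> E \<subseteq> (\<Union>i. F i)}"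


section \<open>Capacities and dimension profiles\<close>

definition profile_kernel :: "real \<Rightarrow> real \<Rightarrow> 'a::euclidean_space \<Rightarrow> real" where
  "profile_kernel s r x = (if x = 0 then 1 else min 1 ((r / norm x) powr s))"

definition borel_prob_measures_on :: "'a::euclidean_space set \<Rightarrow> 'a measure set" where
  "borel_prob_measures_on K = {\<mu>. prob_space \<mu> \<and> sets \<mu> = sets borel \<and> emeasure \<mu> (- K) = 0}"

text \<open>For compact \<open>E\<close> the closure is \<open>E\<close> itself, so the compact and bounded cases are covered.\<close>

definition capacity :: "real \<Rightarrow> real \<Rightarrow> 'a::euclidean_space set \<Rightarrow> real" where
  "capacity s r E =
     1 / (INF \<mu>\<in>borel_prob_measures_on (closure E).
            LINT x|\<mu>. LINT y|\<mu>. profile_kernel s r (x - y))"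

definition hausdorff_dim_profile :: "real \<Rightarrow> 'a::euclidean_space set \<Rightarrow> ereal" where
  "hausdorff_dim_profile s E = min (ereal s) (hausdorff_dim E)"

definition lower_box_dim_profile :: "real \<Rightarrow> 'a::euclidean_space set \<Rightarrow> ereal" where
  "lower_box_dim_profile s E =
     Liminf (at_right 0) (\<lambda>r. ereal (ln (capacity s r E) / (- ln r)))"

definition upper_box_dim_profile :: "real \<Rightarrow> 'a::euclidean_space set \<Rightarrow> ereal" where
  "upper_box_dim_profile s E =
     Limsup (at_right 0) (\<lambda>r. ereal (ln (capacity s r E) / (- ln r)))"

definition packing_dim_profile :: "real \<Rightarrow> 'a::euclidean_space set \<Rightarrow> ereal" where
  "packing_dim_profile s E =
     Inf {(SUP i. upper_box_dim_profile s (F i)) | F :: nat \<Rightarrow> 'a set.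
            (\<forall>i. F i \<noteq> {} \<and> compact (F i)) \<and> E \<subseteq> (\<Union>i. F i)}"

end

theory Submission
  imports Defs
begin

text \<open>
  For a finite measure \<open>\<mu>\<close>, a subspace \<open>V\<close> and a scale \<open>r = 2\<^sup>-\<^sup>k\<close>, let the slab energy be the double integral of
  a Gaussian of width \<open>r\<close> in \<open>\<pi>\<^sub>V (x - y)\<close>. If \<open>\<mu>\<close> lives on few sets whose projections to \<open>V\<close> have size \<open>r\<close>,
  the slab energy is large, by Cauchy-Schwarz. Conversely, give a finite set of directions weights
  satisfying a Frostman condition of exponent \<open>s \<ge> m (n - m) - \<gamma>\<close>. On the Fourier side the slab energies are integrals
  of the squared transform of \<open>\<mu>\<close> against Gaussian densities concentrated near \<open>V\<close>. Since the
  \<open>m\<close>-dimensional subspaces through a neighbourhood of a given vector form a set of dimension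
  \<open>(m - 1) (n - m)\<close>, the weighted average of these densities is dominated by a
  superposition of centred Gaussians, so the average slab energy is at most a constant times
  \<open>r\<^sup>-\<^sup>\<gamma>\<close> times the energy of \<open>\<mu>\<close> for the profile kernel of exponent \<open>m + \<gamma>\<close>. The directions with large slab energy at
  scale \<open>2\<^sup>-\<^sup>k\<close> therefore have geometrically small Hausdorff content, and Borel-Cantelli applies.

  For the box dimensions \<open>\<mu>\<close> is a nearly optimal measure for the capacity. The packing dimension
  reduces to the upper box dimension by a Baire category argument. For the Hausdorff dimension, \<open>\<mu>\<close> runs
  through discrete Frostman measures on nets of a compact subset of positive content, and the
  directions at each scale are selected through a pointwise cluster point of the slab energies.
\<close>

section \<open>Hausdorff measures\<close>

text \<open>A direct estimate in space is too weak. The subspaces with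
  \<open>norm (orth_proj V x) \<le> r\<close> have weight of order (r/|x|)^(s - m(n-m-1)), for the
  smallest s equal to (r/|x|)^(m-\<gamma>), which for \<gamma> > 0 is not bounded by r^-\<gamma>
  (r/|x|)^(m+\<gamma>). On the Fourier side the relevant subspaces are those nearly containing a
  frequency \<zeta>. Their weight is about |\<zeta>|^-(n-m-\<gamma>), and r^m
  |\<zeta>|^-(n-m-\<gamma>) is formally, up to a constant, the transform of r^m |x|^-(m+\<gamma>) =
  r^-\<gamma> (r/|x|)^(m+\<gamma>); this is the origin of the exponent m + \<gamma>. Gaussians make
  all transforms explicit, and domination of densities passes to energies because a kernel with
  nonnegative transform has nonnegative energy. The exceptional sets of directions come without any
  measurability. Therefore no measure is put on the Grassmannian: weights live on finite nets, and
  statements about directions are statements about Hausdorff contents, which are countably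
  subadditive on arbitrary sets.\<close>

lemma set_diam_le_iff:
  "set_diam d U \<le> ennreal c \<longleftrightarrow> (\<forall>x\<in>U. \<forall>y\<in>U. ennreal (d x y) \<le> ennreal c)"
  by (simp add: set_diam_def SUP_le_iff)

lemma set_diam_leI:
  assumes "\<And>x y. x \<in> U \<Longrightarrow> y \<in> U \<Longrightarrow> d x y \<le> c"
  shows "set_diam d U \<le> ennreal c"
  using assms by (auto simp: set_diam_le_iff intro!: ennreal_leI)

lemma set_diam_empty [simp]: "set_diam d {} = 0"
  by (simp add: set_diam_def bot_ennreal)

lemma set_diamD:
  assumes "set_diam d U \<le> ennreal \<delta>" "x \<in> U" "y \<in> U"
  shows "d x y \<le> enn2real (set_diam d U)"
proof -
  have "ennreal (d x y) \<le> set_diam d U"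
    unfolding set_diam_def using assms by (meson SUP_upper2 order_refl)
  moreover have "set_diam d U = ennreal (enn2real (set_diam d U))"
    using assms(1) by (intro ennreal_enn2real[symmetric]) (auto simp: less_top[symmetric] top_unique)
  ultimately have "ennreal (d x y) \<le> ennreal (enn2real (set_diam d U))"
    by simp
  then show ?thesis
    using enn2real_nonneg[of "set_diam d U"] by (auto simp: ennreal_le_iff2)
qed

lemma hausdorff_content_mono:
  assumes "A \<subseteq> B"
  shows "hausdorff_content M d s \<delta> A \<le> hausdorff_content M d s \<delta> B"
  unfolding hausdorff_content_def using assms by (intro Inf_superset_mono) blast

lemma hausdorff_content_le:
  assumes "\<And>i. U i \<subseteq> M" "\<And>i. set_diam d (U i) \<le> ennreal \<delta>" "A \<subseteq> (\<Union>i. U i)"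
  shows "hausdorff_content M d s \<delta> A \<le> (\<Sum>i. ennreal (enn2real (set_diam d (U i)) powr s))"
  unfolding hausdorff_content_def using assms by (intro Inf_lower) blast

lemma hausdorff_content_lessD:
  assumes "hausdorff_content M d s \<delta> A < c"
  shows "\<exists>U :: nat \<Rightarrow> 'a set. (\<forall>i. U i \<subseteq> M) \<and> (\<forall>i. set_diam d (U i) \<le> ennreal \<delta>) \<and>
    A \<subseteq> (\<Union>i. U i) \<and> (\<Sum>i. ennreal (enn2real (set_diam d (U i)) powr s)) < c"
  using assms unfolding hausdorff_content_def Inf_less_iff by blast

text \<open>Two bounds on the diameters are kept apart: \<open>\<rho> x\<close> enters the cost,
  \<open>\<delta>\<close> is the admissibility condition of the content. In the Grassmannian every
  distance is at most 2, so with \<open>\<delta> = 2\<close> the second one is free.\<close>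

lemma hausdorff_content_le_finite:
  assumes F: "finite F" and s: "s > 0"
    and W: "\<And>x. x \<in> F \<Longrightarrow> W x \<subseteq> M" "\<And>x a b. x \<in> F \<Longrightarrow> a \<in> W x \<Longrightarrow> b \<in> W x \<Longrightarrow> d a b \<le> \<rho> x"
      "\<And>x a b. x \<in> F \<Longrightarrow> a \<in> W x \<Longrightarrow> b \<in> W x \<Longrightarrow> d a b \<le> \<delta>"
    and \<rho>: "\<And>x. x \<in> F \<Longrightarrow> 0 \<le> \<rho> x"
    and A: "A \<subseteq> (\<Union>x\<in>F. W x)"
  shows "hausdorff_content M d s \<delta> A \<le> ennreal (\<Sum>x\<in>F. \<rho> x powr s)"
proof -
  obtain h where h: "bij_betw h {..<card F} F"
    using ex_bij_betw_nat_finite[OF F] by (auto simp: atLeast0LessThan)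
  define U where "U = (\<lambda>i. if i < card F then W (h i) else {})"
  have hF: "h i \<in> F" if "i < card F" for i
    using h that by (auto simp: bij_betw_def)
  have "A \<subseteq> (\<Union>i. U i)"
  proof
    fix a assume "a \<in> A"
    then obtain x where x: "x \<in> F" "a \<in> W x" using A by blast
    then obtain i where "i < card F" "h i = x"
      using h unfolding bij_betw_def by (metis imageE lessThan_iff)
    with x show "a \<in> (\<Union>i. U i)" by (auto simp: U_def)
  qed
  then have "hausdorff_content M d s \<delta> A \<le> (\<Sum>i. ennreal (enn2real (set_diam d (U i)) powr s))"
  proof (intro hausdorff_content_le)
    show "U i \<subseteq> M" for i
      using W(1)[OF hF[of i]] by (auto simp: U_def)
    show "set_diam d (U i) \<le> ennreal \<delta>" for i
      using W(3)[OF hF[of i]] by (auto simp: U_def intro!: set_diam_leI)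
  qed
  also have "\<dots> = (\<Sum>i<card F. ennreal (enn2real (set_diam d (U i)) powr s))"
    by (rule suminf_finite) (auto simp: U_def)
  also have "\<dots> \<le> (\<Sum>i<card F. ennreal (\<rho> (h i) powr s))"
  proof (intro sum_mono ennreal_leI powr_mono2)
    fix i assume i: "i \<in> {..<card F}"
    then have "set_diam d (U i) \<le> ennreal (\<rho> (h i))"
      using W(2)[OF hF[of i]] by (auto simp: U_def intro!: set_diam_leI)
    then show "enn2real (set_diam d (U i)) \<le> \<rho> (h i)"
      using \<rho> hF i by (intro enn2real_leI) auto
  qed (use s in auto)
  also have "\<dots> = ennreal (\<Sum>i<card F. \<rho> (h i) powr s)"
    by (simp add: sum_ennreal)
  also have "(\<Sum>i<card F. \<rho> (h i) powr s) = (\<Sum>x\<in>F. \<rho> x powr s)"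
    by (rule sum.reindex_bij_betw[OF h])
  finally show ?thesis .
qed

lemma hausdorff_content_UN:
  "hausdorff_content M d s \<delta> (\<Union>i::nat. A i) \<le> (\<Sum>i. hausdorff_content M d s \<delta> (A i))"
proof (rule ennreal_le_epsilon)
  fix e :: real
  let ?c = "hausdorff_content M d s \<delta>"
  assume fin: "(\<Sum>i. ?c (A i)) < top" and e: "e > 0"
  have lt: "?c (A i) < ?c (A i) + ennreal (e * (1/2) ^ Suc i)" for i
  proof -
    have "?c (A i) \<noteq> top"
      using ennreal_suminf_lessD[OF fin, of i] by simp
    moreover have "ennreal (e * (1/2) ^ Suc i) > 0" using e by simp
    ultimately show ?thesis
      using ennreal_add_left_cancel_less[of "?c (A i)" 0] by simp
  qed
  have "\<exists>U. (\<forall>j. U j \<subseteq> M) \<and> (\<forall>j. set_diam d (U j) \<le> ennreal \<delta>) \<and> A i \<subseteq> (\<Union>j::nat. U j) \<and>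
      (\<Sum>j. ennreal (enn2real (set_diam d (U j)) powr s)) < ?c (A i) + ennreal (e * (1/2) ^ Suc i)" for i
    using hausdorff_content_lessD[OF lt[of i]] .
  then obtain U where U: "\<And>i j. U i j \<subseteq> M" "\<And>i j. set_diam d (U i j) \<le> ennreal \<delta>"
     "\<And>i. A i \<subseteq> (\<Union>j::nat. U i j)"
     "\<And>i. (\<Sum>j. ennreal (enn2real (set_diam d (U i j)) powr s)) < ?c (A i) + ennreal (e * (1/2) ^ Suc i)"
    by metis
  define T where "T = (\<lambda>(i, j). ennreal (enn2real (set_diam d (U i j)) powr s))"
  have "?c (\<Union>i. A i) \<le> (\<Sum>k. ennreal (enn2real (set_diam d (case prod_decode k of (i, j) \<Rightarrow> U i j)) powr s))"
  proof (rule hausdorff_content_le)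
    show "\<Union> (range A) \<subseteq> (\<Union>i. case prod_decode i of (i, j) \<Rightarrow> U i j)"
    proof
      fix x assume "x \<in> \<Union> (range A)"
      then obtain i j where "x \<in> U i j" using U(3) by blast
      then show "x \<in> (\<Union>i. case prod_decode i of (i, j) \<Rightarrow> U i j)"
        by (intro UN_I[of "prod_encode (i, j)"]) auto
    qed
  qed (use U in \<open>auto split: prod.split\<close>)
  also have "\<dots> = (\<Sum>k. T (prod_decode k))"
    by (simp add: T_def case_prod_beta)
  also have "\<dots> = (\<Sum>i. \<Sum>j. T (i, j))"
    by (rule suminf_ennreal_2dimen) simp
  also have "\<dots> \<le> (\<Sum>i. ?c (A i) + ennreal (e * (1/2) ^ Suc i))"
    using U(4) by (intro suminf_le) (auto simp: T_def less_imp_le)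
  also have "\<dots> = (\<Sum>i. ?c (A i)) + (\<Sum>i. ennreal (e * (1/2) ^ Suc i))"
    by (intro suminf_add[symmetric]) auto
  also have "(\<Sum>i. ennreal (e * (1/2) ^ Suc i)) = ennreal e"
  proof -
    have "(\<lambda>i. e * (1/2) ^ Suc i) sums (e * 1)"
      using power_half_series by (intro sums_mult) auto
    then show ?thesis
      using e by (intro suminf_ennreal_eq) auto
  qed
  finally show "?c (\<Union>i. A i) \<le> (\<Sum>i. ?c (A i)) + ennreal e" .
qed

lemma ennreal_le_suminf: "f i \<le> (\<Sum>i. f i :: ennreal)"
proof -
  have "sum f {i} \<le> suminf f"
    by (rule sum_le_suminf) auto
  then show ?thesis by simp
qed

text \<open>A cover of total cost below \<open>\<delta>' powr s\<close> contains no set of diameter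
  \<open>\<delta>'\<close> or more, so it is automatically admissible for \<open>\<delta>'\<close>.
  Hence nullity does not depend on the scale, and every null set below is treated at one convenient
  \<open>\<delta>\<close>.\<close>

lemma hausdorff_content_eq_0_antimono:
  assumes s: "s > 0" and \<delta>: "\<delta>' > 0" and z: "hausdorff_content M d s \<delta> A = 0"
  shows "hausdorff_content M d s \<delta>' A = 0"
proof (rule ccontr)
  assume nz: "hausdorff_content M d s \<delta>' A \<noteq> 0"
  \<comment> \<open>The first term of the minimum produces the contradiction, the second keeps all
    diameters below \<open>\<delta>'\<close>.\<close>
  define c where "c = min (hausdorff_content M d s \<delta>' A) (ennreal (\<delta>' powr s))"
  have "c > 0"
    unfolding c_def min_less_iff_conj using nz \<delta> by (simp add: zero_less_iff_neq_zero)
  then have lt: "hausdorff_content M d s \<delta> A < c" using z by simp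
  obtain U :: "nat \<Rightarrow> 'a set" where "(\<forall>i. U i \<subseteq> M) \<and> (\<forall>i. set_diam d (U i) \<le> ennreal \<delta>) \<and>
    A \<subseteq> (\<Union>i. U i) \<and> (\<Sum>i. ennreal (enn2real (set_diam d (U i)) powr s)) < c"
    using hausdorff_content_lessD[OF lt] by (rule exE)
  then have U: "\<forall>i. U i \<subseteq> M" "\<forall>i. set_diam d (U i) \<le> ennreal \<delta>"
    "A \<subseteq> (\<Union>i. U i)" "(\<Sum>i. ennreal (enn2real (set_diam d (U i)) powr s)) < c" by auto
  have "set_diam d (U i) \<le> ennreal \<delta>'" for i
  proof -
    have "ennreal (enn2real (set_diam d (U i)) powr s) \<le> (\<Sum>i. ennreal (enn2real (set_diam d (U i)) powr s))"
      by (rule ennreal_le_suminf)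
    also have "\<dots> < ennreal (\<delta>' powr s)"
      using U(4) unfolding c_def min_less_iff_conj by (rule conjunct2)
    finally have "enn2real (set_diam d (U i)) powr s < \<delta>' powr s"
      by (simp add: ennreal_less_iff)
    then have lt: "enn2real (set_diam d (U i)) < \<delta>'"
      using s \<delta> powr_mono2[of s \<delta>' "enn2real (set_diam d (U i))"] by (cases "\<delta>' \<le> enn2real (set_diam d (U i))") simp_all
    show ?thesis
    proof (rule set_diam_leI)
      fix x y assume "x \<in> U i" "y \<in> U i"
      then show "d x y \<le> \<delta>'"
        by (rule order_trans[OF set_diamD[OF U(2)[rule_format, of i]] less_imp_le[OF lt]])
    qed
  qed
  then have "hausdorff_content M d s \<delta>' A \<le> (\<Sum>i. ennreal (enn2real (set_diam d (U i)) powr s))"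
    using U(1,3) by (intro hausdorff_content_le) auto
  also have "\<dots> < hausdorff_content M d s \<delta>' A"
    using U(4) unfolding c_def min_less_iff_conj by (rule conjunct1)
  finally show False by simp
qed

lemma hausdorff_measure_eq_0_iff:
  assumes "s > 0" "\<delta> > 0"
  shows "hausdorff_measure M d s A = 0 \<longleftrightarrow> hausdorff_content M d s \<delta> A = 0"
proof
  assume "hausdorff_measure M d s A = 0"
  then show "hausdorff_content M d s \<delta> A = 0"
    using assms SUP_upper[of \<delta> "{0<..}" "\<lambda>\<delta>. hausdorff_content M d s \<delta> A"]
    by (simp add: hausdorff_measure_def)
next
  assume "hausdorff_content M d s \<delta> A = 0"
  then have "hausdorff_content M d s \<delta>' A = 0" if "\<delta>' > 0" for \<delta>'
    using hausdorff_content_eq_0_antimono assms(1) that by blast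
  then show "hausdorff_measure M d s A = 0"
    by (auto simp: hausdorff_measure_def)
qed

lemma hausdorff_measure_eq_0_subset:
  assumes "s > 0" "hausdorff_measure M d s B = 0" "A \<subseteq> B"
  shows "hausdorff_measure M d s A = 0"
  using assms hausdorff_content_mono[OF assms(3), of M d s 1]
  by (simp add: hausdorff_measure_eq_0_iff[of s 1])

lemma hausdorff_measure_eq_0_UN:
  assumes s: "s > 0" and I: "countable I" and z: "\<And>i. i \<in> I \<Longrightarrow> hausdorff_measure M d s (A i) = 0"
  shows "hausdorff_measure M d s (\<Union>i\<in>I. A i) = 0"
proof (cases "I = {}")
  case True
  have "hausdorff_content M d s 1 {} \<le> (\<Sum>i::nat. ennreal (enn2real (set_diam d {}) powr s))"
    by (rule hausdorff_content_le) auto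
  then show ?thesis using True s by (simp add: hausdorff_measure_eq_0_iff[of s 1])
next
  case False
  have "hausdorff_content M d s 1 (\<Union>n. A (from_nat_into I n)) \<le>
      (\<Sum>n. hausdorff_content M d s 1 (A (from_nat_into I n)))"
    by (rule hausdorff_content_UN)
  also have "\<dots> = 0"
    using z s from_nat_into[OF False] by (simp add: hausdorff_measure_eq_0_iff[of s 1])
  also have "(\<Union>n. A (from_nat_into I n)) = (\<Union>i\<in>I. A i)"
    using range_from_nat_into[OF False I] by (metis image_image)
  finally show ?thesis using s by (simp add: hausdorff_measure_eq_0_iff[of s 1])
qed

text \<open>At scale 1 all diameters are at most 1, so raising the exponent lowers every term of a
  cover.\<close>

lemma hausdorff_measure_eq_0_powr_mono:
  assumes s: "0 < s" "s \<le> s'" and z: "hausdorff_measure M d s A = 0"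
  shows "hausdorff_measure M d s' A = 0"
proof -
  have "hausdorff_content M d s' 1 A \<le> hausdorff_content M d s 1 A"
    unfolding hausdorff_content_def
  proof (rule Inf_mono, clarsimp)
    fix U :: "nat \<Rightarrow> 'a set"
    assume U: "\<forall>i. U i \<subseteq> M \<and> set_diam d (U i) \<le> 1" "A \<subseteq> (\<Union>i. U i)"
    have "enn2real (set_diam d (U i)) powr s' \<le> enn2real (set_diam d (U i)) powr s" for i
    proof (cases "enn2real (set_diam d (U i)) = 0")
      case False
      moreover have "enn2real (set_diam d (U i)) \<le> 1"
        using U(1) by (intro enn2real_leI) auto
      ultimately show ?thesis
        using s by (intro powr_mono') auto
    qed auto
    then have "(\<Sum>i. ennreal (enn2real (set_diam d (U i)) powr s')) \<le>
         (\<Sum>i. ennreal (enn2real (set_diam d (U i)) powr s))"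
      by (intro suminf_le) (auto intro: ennreal_leI)
    with U show "\<exists>a. (\<exists>U. a = (\<Sum>i. ennreal (enn2real (set_diam d (U i)) powr s')) \<and>
           (\<forall>i. U i \<subseteq> M \<and> set_diam d (U i) \<le> 1) \<and> A \<subseteq> (\<Union>i. U i)) \<and>
           a \<le> (\<Sum>i. ennreal (enn2real (set_diam d (U i)) powr s))" by blast
  qed
  with z s show ?thesis by (simp add: hausdorff_measure_eq_0_iff[of _ 1])
qed

lemma hausdorff_dim_in_leI:
  assumes "0 \<le> x" and "\<And>s. x < s \<Longrightarrow> hausdorff_measure M d s A = 0"
  shows "hausdorff_dim_in M d A \<le> ereal x"
proof (rule ereal_le_epsilon2)
  fix e :: real assume "e > 0"
  then have "hausdorff_measure M d (x + e) A = 0" "x + e > 0"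
    using assms by auto
  then show "hausdorff_dim_in M d A \<le> ereal x + ereal e"
    unfolding hausdorff_dim_in_def by (intro Inf_lower) auto
qed

lemma hausdorff_dim_in_lessD:
  assumes "hausdorff_dim_in M d A < t"
  obtains s where "s > 0" "ereal s < t" "hausdorff_measure M d s A = 0"
  using assms unfolding hausdorff_dim_in_def Inf_less_iff by blast

lemma hausdorff_dim_in_gtD:
  assumes "ereal t < hausdorff_dim_in M d A" "t > 0"
  shows "hausdorff_measure M d t A \<noteq> 0"
proof
  assume "hausdorff_measure M d t A = 0"
  then have "hausdorff_dim_in M d A \<le> ereal t"
    using assms(2) unfolding hausdorff_dim_in_def by (intro Inf_lower) auto
  with assms(1) show False by simp
qed

text \<open>Borel-Cantelli for contents: the set lies in every tail union, whose content is bounded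
  by the tail of a geometric series. A single \<open>\<delta>\<close> is enough, because nullity
  does not depend on the scale.\<close>

lemma hausdorff_measure_limsup_eq_0:
  assumes s: "s > 0" and \<delta>: "\<delta> > 0" and q: "0 \<le> q" "q < 1"
    and B: "\<And>k. k \<ge> k0 \<Longrightarrow> hausdorff_content M d s \<delta> (B k) \<le> ennreal (C * q ^ k)"
    and A: "\<And>K. A \<subseteq> (\<Union>k\<in>{K..}. B k)"
  shows "hausdorff_measure M d s A = 0"
proof -
  define C' where "C' = \<bar>C\<bar> / (1 - q)"
  have "hausdorff_content M d s \<delta> A \<le> ennreal (C' * q ^ K)" if K: "K \<ge> k0" for K
  proof -
    have "hausdorff_content M d s \<delta> A \<le> hausdorff_content M d s \<delta> (\<Union>i. B (K + i))"
    proof (rule hausdorff_content_mono, rule order_trans[OF A[of K]])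
      show "\<Union> (B ` {K..}) \<subseteq> (\<Union>i. B (K + i))"
        by (auto simp: le_iff_add)
    qed
    also have "\<dots> \<le> (\<Sum>i. hausdorff_content M d s \<delta> (B (K + i)))"
      by (rule hausdorff_content_UN)
    also have "\<dots> \<le> (\<Sum>i. ennreal (\<bar>C\<bar> * q ^ K * q ^ i))"
    proof (intro suminf_le summableI)
      fix i
      have "hausdorff_content M d s \<delta> (B (K + i)) \<le> ennreal (C * q ^ (K + i))"
        using K by (intro B) auto
      also have "\<dots> \<le> ennreal (\<bar>C\<bar> * q ^ K * q ^ i)"
        using q by (intro ennreal_leI) (auto simp: power_add mult.assoc intro!: mult_right_mono)
      finally show "hausdorff_content M d s \<delta> (B (K + i)) \<le> ennreal (\<bar>C\<bar> * q ^ K * q ^ i)" .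
    qed
    also have "\<dots> = ennreal (\<bar>C\<bar> * q ^ K * (1 / (1 - q)))"
      using q by (intro suminf_ennreal_eq sums_mult geometric_sums) auto
    finally show ?thesis by (simp add: C'_def mult_ac)
  qed
  then have "\<forall>\<^sub>F K in sequentially. hausdorff_content M d s \<delta> A \<le> ennreal (C' * q ^ K)"
    by (auto simp: eventually_sequentially)
  moreover have "(\<lambda>K. ennreal (C' * q ^ K)) \<longlonglongrightarrow> ennreal (C' * 0)"
    using q by (intro tendsto_ennrealI tendsto_mult tendsto_const LIMSEQ_realpow_zero) auto
  ultimately have "hausdorff_content M d s \<delta> A \<le> ennreal (C' * 0)"
    by (intro tendsto_lowerbound) auto
  then show ?thesis using s \<delta> by (simp add: hausdorff_measure_eq_0_iff[of s \<delta>])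
qed

section \<open>A discrete Frostman lemma\<close>

text \<open>Greedy construction: the points of \<open>A\<close> are treated one by one, and each
  receives the largest weight that violates no cap. A set attaining that minimum becomes saturated,
  and it stays saturated since sums only grow while the caps keep holding.\<close>

lemma saturated_weights_exist:
  fixes S :: "'i \<Rightarrow> 'b set" and cap :: "'i \<Rightarrow> real"
  assumes A: "finite A" and I: "finite I" and S: "\<And>i. i \<in> I \<Longrightarrow> S i \<subseteq> A"
    and cap: "\<And>i. i \<in> I \<Longrightarrow> 0 \<le> cap i" and cov: "\<And>a. a \<in> A \<Longrightarrow> \<exists>i\<in>I. a \<in> S i"
  shows "\<exists>w. (\<forall>a. 0 \<le> w a) \<and> (\<forall>i\<in>I. sum w (S i) \<le> cap i) \<and>
    (\<forall>a\<in>A. \<exists>i\<in>I. a \<in> S i \<and> sum w (S i) = cap i)"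
proof -
  define P where "P = (\<lambda>A' w. (\<forall>a. 0 \<le> w a) \<and> (\<forall>a. a \<notin> A' \<longrightarrow> w a = 0) \<and> (\<forall>i\<in>I. sum w (S i) \<le> cap i) \<and>
    (\<forall>a\<in>A'. \<exists>i\<in>I. a \<in> S i \<and> sum w (S i) = cap i))"
  have fin: "finite (S i)" if "i \<in> I" for i
    using A S[OF that] finite_subset by blast
  have "\<exists>w. P A' w" if "finite A'" "A' \<subseteq> A" for A'
    using that
  proof (induction A' rule: finite_subset_induct')
    case empty
    have "P {} (\<lambda>_. 0)" using cap by (auto simp: P_def)
    then show ?case by blast
  next
    case (insert a A')
    then obtain w where w: "P A' w" by blast
    define J where "J = {i \<in> I. a \<in> S i}"
    \<comment> \<open>The smallest remaining capacity among the sets containing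
      \<open>a\<close>.\<close>
    define e where "e = Min ((\<lambda>i. cap i - sum w (S i)) ` J)"
    have J: "finite J" "J \<noteq> {}" using I cov[OF insert(2)] by (auto simp: J_def)
    have e_le: "e \<le> cap i - sum w (S i)" if "i \<in> J" for i
      unfolding e_def using J that by (intro Min_le) auto
    have "e \<in> (\<lambda>i. cap i - sum w (S i)) ` J"
      unfolding e_def using J by (intro Min_in) auto
    then obtain i0 where i0: "i0 \<in> J" "e = cap i0 - sum w (S i0)" by blast
    have e0: "0 \<le> e" using i0 w by (auto simp: P_def J_def)
    define w' where "w' = w(a := e)"
    have wa: "w a = 0" using w insert by (auto simp: P_def)
    have sum': "sum w' (S i) = sum w (S i) + (if a \<in> S i then e else 0)" if i: "i \<in> I" for i
    proof (cases "a \<in> S i")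
      case True
      have "sum w' (S i) = e + sum w' (S i - {a})"
        using True fin[OF i] by (subst sum.remove[of _ a]) (auto simp: w'_def)
      moreover have "sum w' (S i - {a}) = sum w (S i - {a})"
        by (intro sum.cong) (auto simp: w'_def)
      moreover have "sum w (S i) = w a + sum w (S i - {a})"
        using True fin[OF i] by (subst sum.remove[of _ a]) auto
      ultimately show ?thesis using True wa by simp
    next
      case False
      then have "sum w' (S i) = sum w (S i)"
        by (intro sum.cong) (auto simp: w'_def)
      then show ?thesis using False by simp
    qed
    have le: "sum w' (S i) \<le> cap i" if "i \<in> I" for i
      using sum'[OF that] e_le[of i] w that by (auto simp: P_def J_def)
    have "P (insert a A') w'"
      unfolding P_def
    proof (intro conjI allI impI ballI)
      show "0 \<le> w' b" for b using w e0 by (auto simp: P_def w'_def)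
      show "w' b = 0" if "b \<notin> insert a A'" for b using w that by (auto simp: P_def w'_def)
      show "sum w' (S i) \<le> cap i" if "i \<in> I" for i by (rule le[OF that])
      fix b assume "b \<in> insert a A'"
      then consider "b = a" | "b \<in> A'" by blast
      then show "\<exists>i\<in>I. b \<in> S i \<and> sum w' (S i) = cap i"
      proof cases
        case 1
        then show ?thesis using i0 sum'[of i0] by (auto simp: J_def intro!: bexI[of _ i0])
      next
        case 2
        then obtain i where i: "i \<in> I" "b \<in> S i" "sum w (S i) = cap i" using w by (auto simp: P_def)
        then have "sum w' (S i) = cap i" using le[of i] sum'[of i] e0 by auto
        with i show ?thesis by blast
      qed
    qed
    then show ?case by blast
  qed
  from this[OF A order_refl] show ?thesis unfolding P_def by blast
qed

text \<open>Greedy choice: take an index of largest \<open>\<rho>\<close>, discard everything that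
  meets its set, and continue with the rest. A discarded index meets a chosen one with at least its
  own \<open>\<rho>\<close>.\<close>

lemma Vitali_finite:
  fixes S :: "'i \<Rightarrow> 'b set" and \<rho> :: "'i \<Rightarrow> real"
  assumes "finite X" and "\<And>x. x \<in> X \<Longrightarrow> S x \<noteq> {}"
  shows "\<exists>Y\<subseteq>X. (\<forall>x\<in>Y. \<forall>y\<in>Y. x \<noteq> y \<longrightarrow> S x \<inter> S y = {}) \<and> (\<forall>x\<in>X. \<exists>y\<in>Y. S x \<inter> S y \<noteq> {} \<and> \<rho> x \<le> \<rho> y)"
  using assms
proof (induction X rule: finite_psubset_induct)
  case (psubset X)
  show ?case
  proof (cases "X = {}")
    case False
    have "\<exists>y\<in>X. \<forall>x\<in>X. \<rho> x \<le> \<rho> y"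
    proof -
      have "Max (\<rho> ` X) \<in> \<rho> ` X" using psubset(1) False by (intro Max_in) auto
      then obtain y where "y \<in> X" "\<rho> y = Max (\<rho> ` X)" by auto
      then show ?thesis using psubset(1) by (intro bexI[of _ y]) auto
    qed
    then obtain y where y: "y \<in> X" "\<And>x. x \<in> X \<Longrightarrow> \<rho> x \<le> \<rho> y" by blast
    define X' where "X' = {x \<in> X. S x \<inter> S y = {}}"
    have sub: "X' \<subset> X" using y psubset(3)[of y] by (auto simp: X'_def)
    have ne: "S x \<noteq> {}" if "x \<in> X'" for x using psubset(3) that by (auto simp: X'_def)
    from psubset.IH[OF sub ne] obtain Y where Y: "Y \<subseteq> X'"
      "\<forall>x\<in>Y. \<forall>y\<in>Y. x \<noteq> y \<longrightarrow> S x \<inter> S y = {}" "\<forall>x\<in>X'. \<exists>y\<in>Y. S x \<inter> S y \<noteq> {} \<and> \<rho> x \<le> \<rho> y"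
      by blast
    show ?thesis
    proof (intro exI[of _ "insert y Y"] conjI)
      show "insert y Y \<subseteq> X" using y Y by (auto simp: X'_def)
      show "\<forall>x\<in>insert y Y. \<forall>z\<in>insert y Y. x \<noteq> z \<longrightarrow> S x \<inter> S z = {}"
        using Y(1,2) unfolding X'_def by blast
      show "\<forall>x\<in>X. \<exists>z\<in>insert y Y. S x \<inter> S z \<noteq> {} \<and> \<rho> x \<le> \<rho> z"
      proof
        fix x assume x: "x \<in> X"
        show "\<exists>z\<in>insert y Y. S x \<inter> S z \<noteq> {} \<and> \<rho> x \<le> \<rho> z"
        proof (cases "x \<in> X'")
          case True
          with Y(3) show ?thesis by blast
        next
          case False
          with x y show ?thesis by (auto simp: X'_def)
        qed
      qed
    qed
  qed auto
qed

text \<open>Balls of the dyadic radii \<open>r * 2 ^ j\<close> are saturated, with caps equal to the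
  radius to the power \<open>s\<close>. Every point lies in a saturated ball, a disjoint subfamily
  of the saturated balls has threefold enlargements covering \<open>A\<close>, and by disjointness
  its caps add up to at most the total weight. The factor 2 in the upper bound pays for rounding an
  arbitrary radius up to a dyadic one.\<close>

lemma discrete_Frostman:
  fixes d :: "'b \<Rightarrow> 'b \<Rightarrow> real"
  assumes A: "finite A" and r: "r > 0" and s: "s > 0"
    and d0: "\<And>a. a \<in> A \<Longrightarrow> d a a = 0"
    and sym: "\<And>a b. a \<in> A \<Longrightarrow> b \<in> A \<Longrightarrow> d a b = d b a"
    and tri: "\<And>a b c. a \<in> A \<Longrightarrow> b \<in> A \<Longrightarrow> c \<in> A \<Longrightarrow> d a c \<le> d a b + d b c"
  shows "\<exists>w F. (\<forall>a. 0 \<le> w a) \<and>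
    (\<forall>a\<in>A. \<forall>\<rho>\<ge>r. (\<Sum>b\<in>{b\<in>A. d a b \<le> \<rho>}. w b) \<le> (2 * \<rho>) powr s) \<and>
    finite F \<and> (\<forall>x\<in>F. fst x \<in> A \<and> r \<le> snd x) \<and> (\<forall>b\<in>A. \<exists>x\<in>F. d (fst x) b \<le> 3 * snd x) \<and>
    (\<Sum>x\<in>F. snd x powr s) \<le> sum w A"
proof -
  have "finite ((\<lambda>(a,b). d a b) ` (A \<times> A))" using A by auto
  then obtain D where D: "\<And>a b. a \<in> A \<Longrightarrow> b \<in> A \<Longrightarrow> d a b \<le> D"
    using bdd_above_finite unfolding bdd_above_def by force
  \<comment> \<open>With \<open>J\<close> this large the balls of the last radius contain all of
    \<open>A\<close>, which settles the radii beyond \<open>r * 2 ^ J\<close>.\<close>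
  obtain J where J: "D / r < 2 ^ J" using real_arch_pow[of 2] by auto
  then have J': "D \<le> r * 2 ^ J" using r by (simp add: field_simps)
  define X where "X = A \<times> (\<lambda>j. r * 2 ^ j) ` {..J}"
  define S where "S = (\<lambda>x. {b \<in> A. d (fst x) b \<le> snd x})"
  have X: "finite X" using A by (simp add: X_def)
  have pos: "snd x \<ge> r" if "x \<in> X" for x using that r by (auto simp: X_def)
  have Ssub: "S x \<subseteq> A" for x by (auto simp: S_def)
  have cvr: "\<exists>i\<in>X. a \<in> S i" if "a \<in> A" for a
    using that r d0 by (intro bexI[of _ "(a, r * 2 ^ 0)"]) (auto simp: X_def S_def simp del: power_0)
  have "\<exists>w. (\<forall>a. 0 \<le> w a) \<and> (\<forall>x\<in>X. sum w (S x) \<le> snd x powr s) \<and>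
      (\<forall>a\<in>A. \<exists>x\<in>X. a \<in> S x \<and> sum w (S x) = snd x powr s)"
    by (rule saturated_weights_exist[where cap="\<lambda>x. snd x powr s" and S=S, OF A X Ssub powr_ge_zero cvr])
  then obtain w where "(\<forall>a. 0 \<le> w a) \<and> (\<forall>x\<in>X. sum w (S x) \<le> snd x powr s) \<and>
      (\<forall>a\<in>A. \<exists>x\<in>X. a \<in> S x \<and> sum w (S x) = snd x powr s)" by (rule exE)
  note w = this[THEN conjunct1] this[THEN conjunct2, THEN conjunct1] this[THEN conjunct2, THEN conjunct2]
  define X' where "X' = {x \<in> X. sum w (S x) = snd x powr s}"
  have X': "finite X'" "X' \<subseteq> X" using X by (auto simp: X'_def)
  have "S x \<noteq> {}" if "x \<in> X'" for x
    using that d0 r by (auto simp: X'_def X_def S_def)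
  from Vitali_finite[where \<rho>=snd and S=S, OF X'(1) this] obtain F where F: "F \<subseteq> X'"
    "\<forall>x\<in>F. \<forall>y\<in>F. x \<noteq> y \<longrightarrow> S x \<inter> S y = {}" "\<forall>x\<in>X'. \<exists>y\<in>F. S x \<inter> S y \<noteq> {} \<and> snd x \<le> snd y" by blast
  have finF: "finite F" using finite_subset[OF F(1) X'(1)] .
  have "(\<Sum>x\<in>F. snd x powr s) = (\<Sum>x\<in>F. sum w (S x))"
    using F(1) by (intro sum.cong) (auto simp: X'_def)
  also have "\<dots> = sum w (\<Union>x\<in>F. S x)"
    using F(2) finF A by (intro sum.UNION_disjoint[symmetric]) (auto simp: S_def)
  also have "\<dots> \<le> sum w A"
    using w A by (intro sum_mono2) (auto simp: S_def)
  finally have sum_le: "(\<Sum>x\<in>F. snd x powr s) \<le> sum w A" .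
  have cov: "\<exists>x\<in>F. d (fst x) b \<le> 3 * snd x" if b: "b \<in> A" for b
  proof -
    obtain x where x: "x \<in> X'" "b \<in> S x" using w b by (auto simp: X'_def)
    then obtain y where y: "y \<in> F" "S x \<inter> S y \<noteq> {}" "snd x \<le> snd y" using F(3) by blast
    \<comment> \<open>From the centre of \<open>y\<close> through the common point \<open>c\<close>
      and the centre of \<open>x\<close> to \<open>b\<close>: three steps, each of length at most
      \<open>snd y\<close>.\<close>
    then obtain c where c: "c \<in> S x" "c \<in> S y" by blast
    have A': "fst x \<in> A" "fst y \<in> A" using x y F X' by (auto simp: X_def)
    have "d (fst y) b \<le> d (fst y) c + d c b" using A' c b by (intro tri) (auto simp: S_def)
    also have "d c b \<le> d c (fst x) + d (fst x) b" using A' c b by (intro tri) (auto simp: S_def)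
    also have "d c (fst x) = d (fst x) c" using A' c by (intro sym) (auto simp: S_def)
    finally show ?thesis using x c y by (intro bexI[of _ y]) (auto simp: S_def)
  qed
  have fro: "(\<Sum>b\<in>{b\<in>A. d a b \<le> \<rho>}. w b) \<le> (2 * \<rho>) powr s" if a: "a \<in> A" and \<rho>: "r \<le> \<rho>" for a \<rho>
  proof -
    have "\<exists>j\<le>J. {b\<in>A. d a b \<le> \<rho>} \<subseteq> S (a, r * 2 ^ j) \<and> r * 2 ^ j \<le> 2 * \<rho>"
    proof (cases "r * 2 ^ J \<le> \<rho>")
      case True
      then show ?thesis using D a J' r \<rho> by (intro exI[of _ J]) (auto simp: S_def intro: order_trans)
    next
      case False
      define j where "j = (LEAST j. \<rho> \<le> r * 2 ^ j)"
      have j1: "\<rho> \<le> r * 2 ^ j" unfolding j_def by (rule LeastI[of _ J]) (use False in auto)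
      have j2: "j \<le> J" unfolding j_def by (rule Least_le) (use False in auto)
      have "r * 2 ^ j \<le> 2 * \<rho>"
      proof (cases j)
        case 0 then show ?thesis using \<rho> r by auto
      next
        case (Suc i)
        then have "\<not> \<rho> \<le> r * 2 ^ i" unfolding j_def using not_less_Least[of i "\<lambda>j. \<rho> \<le> r * 2 ^ j"] by auto
        then show ?thesis using Suc by auto
      qed
      with j1 j2 show ?thesis by (intro exI[of _ j]) (auto simp: S_def)
    qed
    then obtain j where j: "j \<le> J" "{b\<in>A. d a b \<le> \<rho>} \<subseteq> S (a, r * 2 ^ j)" "r * 2 ^ j \<le> 2 * \<rho>" by blast
    have "(\<Sum>b\<in>{b\<in>A. d a b \<le> \<rho>}. w b) \<le> sum w (S (a, r * 2 ^ j))"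
      using j w A by (intro sum_mono2) (auto simp: S_def)
    also have "\<dots> \<le> (r * 2 ^ j) powr s"
      using w(2) a j by (force simp: X_def)
    also have "\<dots> \<le> (2 * \<rho>) powr s"
      using j r s by (intro powr_mono2) auto
    finally show ?thesis .
  qed
  show ?thesis
  proof (rule exI[of _ w], rule exI[of _ F], intro conjI ballI allI impI)
    show "0 \<le> w a" for a using w(1) by simp
    show "(\<Sum>b\<in>{b\<in>A. d a b \<le> \<rho>}. w b) \<le> (2 * \<rho>) powr s" if "a \<in> A" "r \<le> \<rho>" for a \<rho>
      by (rule fro[OF that])
    show "finite F" by (rule finF)
    show "fst x \<in> A" "r \<le> snd x" if "x \<in> F" for x
    proof -
      have x: "x \<in> X" using that F(1) X'(2) by blast
      then show "r \<le> snd x" by (rule pos)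
      from x show "fst x \<in> A" by (auto simp: X_def)
    qed
    show "\<exists>x\<in>F. d (fst x) b \<le> 3 * snd x" if "b \<in> A" for b by (rule cov[OF that])
  qed (rule sum_le)
qed

section \<open>Orthogonal projections and the Grassmannian\<close>

lemma orth_proj_props:
  fixes V :: "'a::euclidean_space set"
  assumes "subspace V"
  shows orth_proj_in: "orth_proj V x \<in> V"
    and orth_proj_orth: "v \<in> V \<Longrightarrow> (x - orth_proj V x) \<bullet> v = 0"
  using theI'[OF orth_proj_ex1[OF assms, of x]] by (auto simp: orth_proj_def orthogonal_def)

lemma orth_proj_eqI:
  fixes V :: "'a::euclidean_space set"
  assumes "subspace V" "p \<in> V" "\<And>v. v \<in> V \<Longrightarrow> (x - p) \<bullet> v = 0"
  shows "orth_proj V x = p"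
  unfolding orth_proj_def
  by (rule the1_equality[OF orth_proj_ex1[OF assms(1)]]) (use assms in \<open>auto simp: orthogonal_def\<close>)

lemma linear_orth_proj:
  fixes V :: "'a::euclidean_space set"
  assumes "subspace V"
  shows "linear (orth_proj V)"
proof (rule linearI)
  note p = orth_proj_in[OF assms] orth_proj_orth[OF assms]
  show "orth_proj V (x + y) = orth_proj V x + orth_proj V y" for x y
  proof (rule orth_proj_eqI[OF assms])
    show "orth_proj V x + orth_proj V y \<in> V" using p assms by (simp add: subspace_add)
    fix v assume "v \<in> V"
    with p(2)[of v x] p(2)[of v y] show "(x + y - (orth_proj V x + orth_proj V y)) \<bullet> v = 0"
      by (simp add: inner_diff_left inner_add_left)
  qed
  show "orth_proj V (c *\<^sub>R x) = c *\<^sub>R orth_proj V x" for c x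
  proof (rule orth_proj_eqI[OF assms])
    show "c *\<^sub>R orth_proj V x \<in> V" using p assms by (simp add: subspace_scale)
    fix v assume "v \<in> V"
    with p(2)[of v x] show "(c *\<^sub>R x - c *\<^sub>R orth_proj V x) \<bullet> v = 0"
      by (simp add: inner_diff_left)
  qed
qed

lemma orth_proj_idem:
  fixes V :: "'a::euclidean_space set"
  assumes "subspace V"
  shows "orth_proj V (orth_proj V x) = orth_proj V x"
  using orth_proj_in[OF assms] by (intro orth_proj_eqI[OF assms]) auto

lemma orth_proj_selfadjoint:
  fixes V :: "'a::euclidean_space set"
  assumes "subspace V"
  shows "orth_proj V x \<bullet> y = x \<bullet> orth_proj V y"
proof -
  have "(x - orth_proj V x) \<bullet> orth_proj V y = 0" "(y - orth_proj V y) \<bullet> orth_proj V x = 0"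
    using orth_proj_in[OF assms] orth_proj_orth[OF assms] by auto
  then show ?thesis by (simp add: inner_diff_left inner_commute[of y] inner_commute[of "orth_proj V y"])
qed

lemma orth_proj_Pythagoras:
  fixes V :: "'a::euclidean_space set"
  assumes "subspace V"
  shows "(norm (orth_proj V x))\<^sup>2 + (norm (x - orth_proj V x))\<^sup>2 = (norm x)\<^sup>2"
proof -
  have "(x - orth_proj V x) \<bullet> orth_proj V x = 0"
    using orth_proj_in[OF assms] orth_proj_orth[OF assms] by auto
  then show ?thesis
    by (simp add: power2_norm_eq_inner inner_diff_left inner_diff_right inner_commute)
qed

lemma norm_orth_proj_le:
  fixes V :: "'a::euclidean_space set"
  assumes "subspace V"
  shows "norm (orth_proj V x) \<le> norm x" "norm (x - orth_proj V x) \<le> norm x"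
proof -
  have "(norm (orth_proj V x))\<^sup>2 \<le> (norm x)\<^sup>2" "(norm (x - orth_proj V x))\<^sup>2 \<le> (norm x)\<^sup>2"
    unfolding orth_proj_Pythagoras[OF assms, of x, symmetric] by simp_all
  then show "norm (orth_proj V x) \<le> norm x" "norm (x - orth_proj V x) \<le> norm x"
    by (auto intro: power2_le_imp_le)
qed

lemma orth_proj_expand:
  fixes V :: "'a::euclidean_space set"
  assumes V: "subspace V" and B: "finite B" "B \<subseteq> V" "pairwise orthogonal B" "\<And>b. b \<in> B \<Longrightarrow> norm b = 1" "span B = V"
  shows "orth_proj V x = (\<Sum>b\<in>B. (x \<bullet> b) *\<^sub>R b)"
proof -
  have "orth_proj V x = (\<Sum>b\<in>B. (orth_proj V x \<bullet> b) *\<^sub>R b)"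
    using orth_proj_in[OF V, of x] B by (intro orthonormal_basis_expand[symmetric]) auto
  also have "\<dots> = (\<Sum>b\<in>B. (x \<bullet> b) *\<^sub>R b)"
  proof (intro sum.cong refl)
    fix b assume "b \<in> B"
    then have "(x - orth_proj V x) \<bullet> b = 0" using B by (intro orth_proj_orth[OF V]) auto
    then show "(orth_proj V x \<bullet> b) *\<^sub>R b = (x \<bullet> b) *\<^sub>R b" by (simp add: inner_diff_left)
  qed
  finally show ?thesis .
qed

lemma norm_orth_proj_expand:
  fixes V :: "'a::euclidean_space set"
  assumes V: "subspace V" and B: "finite B" "B \<subseteq> V" "pairwise orthogonal B" "\<And>b. b \<in> B \<Longrightarrow> norm b = 1" "span B = V"
  shows "(norm (orth_proj V x))\<^sup>2 = (\<Sum>b\<in>B. (x \<bullet> b)\<^sup>2)"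
proof -
  have "(norm (orth_proj V x))\<^sup>2 = x \<bullet> orth_proj V x"
    using orth_proj_selfadjoint[OF V, of x "orth_proj V x"] by (simp add: power2_norm_eq_inner orth_proj_idem[OF V])
  also have "\<dots> = (\<Sum>b\<in>B. (x \<bullet> b)\<^sup>2)"
    by (subst orth_proj_expand[OF assms]) (simp_all add: inner_sum_right power2_eq_square)
  finally show ?thesis .
qed

section \<open>The metric of the Grassmannian and its finite nets\<close>

lemma subspace_grassmannian [dest]: "V \<in> grassmannian m \<Longrightarrow> subspace V"
  by (simp add: grassmannian_def)

lemma bounded_linear_orth_proj:
  fixes V :: "'a::euclidean_space set"
  shows "subspace V \<Longrightarrow> bounded_linear (orth_proj V)"
  by (simp add: linear_orth_proj linear_linear)

lemma norm_orth_proj_diff_le: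
  fixes V :: "'a::euclidean_space set"
  assumes "subspace V" "subspace W"
  shows "norm (orth_proj V x - orth_proj W x) \<le> grassmann_dist V W * norm x"
  unfolding grassmann_dist_def
  by (rule onorm[of "\<lambda>x. orth_proj V x - orth_proj W x"]) (intro bounded_linear_sub bounded_linear_orth_proj assms)

lemma grassmann_dist_leI:
  assumes "\<And>x. norm (orth_proj V x - orth_proj W x) \<le> c * norm x"
  shows "grassmann_dist V W \<le> c"
  unfolding grassmann_dist_def by (rule onorm_le) (use assms in auto)

lemma grassmann_dist_nonneg:
  fixes V :: "'a::euclidean_space set"
  assumes "subspace V" "subspace W"
  shows "0 \<le> grassmann_dist V W"
  unfolding grassmann_dist_def by (intro onorm_pos_le bounded_linear_sub bounded_linear_orth_proj assms)

lemma grassmann_dist_refl: "grassmann_dist V V = 0"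
  by (simp add: grassmann_dist_def onorm_zero)

lemma grassmann_dist_commute: "grassmann_dist V W = grassmann_dist W V"
  unfolding grassmann_dist_def using onorm_neg[of "\<lambda>x. orth_proj W x - orth_proj V x"] by simp

lemma grassmann_dist_triangle:
  fixes V :: "'a::euclidean_space set"
  assumes "subspace U" "subspace V" "subspace W"
  shows "grassmann_dist U W \<le> grassmann_dist U V + grassmann_dist V W"
proof (rule grassmann_dist_leI)
  fix x
  have "norm (orth_proj U x - orth_proj W x) \<le> norm (orth_proj U x - orth_proj V x) + norm (orth_proj V x - orth_proj W x)"
    using norm_triangle_ineq[of "orth_proj U x - orth_proj V x" "orth_proj V x - orth_proj W x"] by simp
  also have "\<dots> \<le> grassmann_dist U V * norm x + grassmann_dist V W * norm x"
    by (intro add_mono norm_orth_proj_diff_le assms)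
  finally show "norm (orth_proj U x - orth_proj W x) \<le> (grassmann_dist U V + grassmann_dist V W) * norm x"
    by (simp add: algebra_simps)
qed

lemma grassmann_dist_le_2:
  fixes V :: "'a::euclidean_space set"
  assumes "subspace V" "subspace W"
  shows "grassmann_dist V W \<le> 2"
proof (rule grassmann_dist_leI)
  fix x :: 'a
  show "norm (orth_proj V x - orth_proj W x) \<le> 2 * norm x"
    using norm_orth_proj_le(1)[OF assms(1), of x] norm_orth_proj_le(1)[OF assms(2), of x]
      norm_triangle_ineq4[of "orth_proj V x" "orth_proj W x"] by linarith
qed

lemma finite_representatives:
  assumes "finite (f ` S)"
  shows "\<exists>T\<subseteq>S. finite T \<and> (\<forall>x\<in>S. \<exists>t\<in>T. f x = f t)"
proof (intro exI conjI)
  let ?g = "\<lambda>k. SOME x. x \<in> S \<and> f x = k"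
  have g: "?g (f x) \<in> S \<and> f (?g (f x)) = f x" if "x \<in> S" for x
    using that by (intro someI[of "\<lambda>y. y \<in> S \<and> f y = f x" x]) simp
  show "?g ` f ` S \<subseteq> S" using g by auto
  show "finite (?g ` f ` S)" using assms by simp
  show "\<forall>x\<in>S. \<exists>t\<in>?g ` f ` S. f x = f t" using g by (intro ballI bexI[of _ "?g (f _)"]) auto
qed

lemma abs_floor_le:
  fixes x \<rho> :: real
  assumes "\<bar>x\<bar> \<le> 1" "0 < \<rho>"
  shows "\<lfloor>x / \<rho>\<rfloor> \<in> {- \<lceil>1 / \<rho>\<rceil> .. \<lceil>1 / \<rho>\<rceil>}"
proof -
  have *: "- (1 / \<rho>) \<le> x / \<rho>" "x / \<rho> \<le> 1 / \<rho>"
    using assms by (auto simp: field_simps abs_le_iff)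
  have "\<lfloor>- (1 / \<rho>)\<rfloor> \<le> \<lfloor>x / \<rho>\<rfloor>" using *(1) by (rule floor_mono)
  moreover have "\<lfloor>x / \<rho>\<rfloor> \<le> \<lceil>1 / \<rho>\<rceil>"
    using floor_mono[OF *(2)] floor_le_ceiling[of "1 / \<rho>"] by linarith
  ultimately show ?thesis by (simp add: ceiling_def)
qed

lemma floor_eq_imp_close:
  fixes x y \<rho> :: real
  assumes "\<lfloor>x / \<rho>\<rfloor> = \<lfloor>y / \<rho>\<rfloor>" "0 < \<rho>"
  shows "\<bar>x - y\<bar> \<le> \<rho>"
proof -
  have "\<bar>x / \<rho> - y / \<rho>\<bar> < 1" using assms(1) by linarith
  then have "\<bar>x - y\<bar> / \<rho> < 1" using assms(2) by (simp add: diff_divide_distrib[symmetric])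
  then show ?thesis using assms(2) by (simp add: field_simps)
qed

lemma abs_orth_proj_inner_le:
  fixes V :: "'a::euclidean_space set"
  assumes "subspace V" "norm u = 1" "norm v = 1"
  shows "\<bar>orth_proj V v \<bullet> u\<bar> \<le> 1"
  using Cauchy_Schwarz_ineq2[of "orth_proj V v" u] norm_orth_proj_le(1)[OF assms(1), of v] assms by simp

lemma norm_le_sum_orthonormal:
  fixes x :: "'a::euclidean_space" and c :: real
  assumes "\<And>b. b \<in> Basis \<Longrightarrow> \<bar>x \<bullet> b\<bar> \<le> c"
  shows "norm x \<le> DIM('a) * c"
  using norm_le_l1[of x] sum_bounded_above[of Basis "\<lambda>b. \<bar>x \<bullet> b\<bar>" c] assms by simp

text \<open>The entries of the projection in the standard basis are rounded to multiples of
  \<open>\<rho>\<close>; there are finitely many patterns, and equal patterns mean nearby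
  projections. The net consists of members of \<open>B\<close> itself, because later the slab
  energies must be large at each of its points.\<close>

lemma grassmannian_finite_net:
  fixes B :: "'a::euclidean_space set set"
  assumes B: "B \<subseteq> grassmannian m" and \<eta>: "\<eta> > 0"
  shows "\<exists>A\<subseteq>B. finite A \<and> (\<forall>V\<in>B. \<exists>a\<in>A. grassmann_dist a V \<le> \<eta>)"
proof -
  \<comment> \<open>One factor \<open>DIM('a)\<close> comes from bounding a norm by the coordinates,
    the other from summing over the basis vectors.\<close>
  define \<rho> where "\<rho> = \<eta> / (real DIM('a))\<^sup>2"
  have \<rho>: "\<rho> > 0" using \<eta> by (simp add: \<rho>_def)
  define key where "key V = (\<lambda>x\<in>(Basis :: 'a set) \<times> (Basis :: 'a set). \<lfloor>orth_proj V (fst x) \<bullet> snd x / \<rho>\<rfloor>)" for V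
  have "key ` B \<subseteq> (\<Pi>\<^sub>E x\<in>(Basis :: 'a set) \<times> (Basis :: 'a set). {- \<lceil>1 / \<rho>\<rceil> .. \<lceil>1 / \<rho>\<rceil>})"
  proof (intro image_subsetI PiE_I)
    fix V x assume V: "V \<in> B" and x: "x \<in> (Basis :: 'a set) \<times> (Basis :: 'a set)"
    have "subspace V" using V B by blast
    then have "\<bar>orth_proj V (fst x) \<bullet> snd x\<bar> \<le> 1"
      using x by (intro abs_orth_proj_inner_le) auto
    from abs_floor_le[OF this \<rho>] show "key V x \<in> {- \<lceil>1 / \<rho>\<rceil> .. \<lceil>1 / \<rho>\<rceil>}"
      unfolding key_def restrict_apply using x by simp
  qed (simp add: key_def)
  then have "finite (key ` B)" by (rule finite_subset) (intro finite_PiE; simp)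
  from finite_representatives[OF this] obtain A where A: "A \<subseteq> B" "finite A" "\<forall>V\<in>B. \<exists>a\<in>A. key V = key a" by blast
  have "\<exists>a\<in>A. grassmann_dist a V \<le> \<eta>" if V: "V \<in> B" for V
  proof -
    obtain a where a: "a \<in> A" "key V = key a" using A V by blast
    have sub: "subspace V" "subspace a" using a A V B by auto
    have entry: "\<bar>(orth_proj a b - orth_proj V b) \<bullet> c\<bar> \<le> \<rho>" if "b \<in> Basis" "c \<in> Basis" for b c
    proof -
      have "key V (b, c) = key a (b, c)" using a by simp
      then have "\<lfloor>orth_proj a b \<bullet> c / \<rho>\<rfloor> = \<lfloor>orth_proj V b \<bullet> c / \<rho>\<rfloor>" using that by (simp add: key_def)
      from floor_eq_imp_close[OF this \<rho>] show ?thesis by (simp add: inner_diff_left)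
    qed
    have "grassmann_dist a V \<le> \<eta>"
    proof (rule grassmann_dist_leI)
      fix x :: 'a
      define D where "D y = orth_proj a y - orth_proj V y" for y
      have lin: "linear D" unfolding D_def using sub by (intro linear_compose_sub linear_orth_proj)
      have "norm (D x) = norm (\<Sum>b\<in>Basis. (x \<bullet> b) *\<^sub>R D b)"
        by (subst euclidean_representation[of x, symmetric]) (simp add: linear_sum[OF lin] linear_scale[OF lin])
      also have "\<dots> \<le> (\<Sum>b\<in>Basis. norm ((x \<bullet> b) *\<^sub>R D b))" by (rule norm_sum)
      also have "\<dots> \<le> (\<Sum>b\<in>(Basis::'a set). norm x * (DIM('a) * \<rho>))"
      proof (intro sum_mono)
        fix b :: 'a assume b: "b \<in> Basis"
        have "norm (D b) \<le> DIM('a) * \<rho>"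
          unfolding D_def using entry[OF b] norm_le_sum_orthonormal[of "orth_proj a b - orth_proj V b" \<rho>] by simp
        then show "norm ((x \<bullet> b) *\<^sub>R D b) \<le> norm x * (DIM('a) * \<rho>)"
          using b by (auto simp: Basis_le_norm intro!: mult_mono)
      qed
      also have "\<dots> = \<eta> * norm x" by (simp add: \<rho>_def power2_eq_square)
      finally show "norm (orth_proj a x - orth_proj V x) \<le> \<eta> * norm x" by (simp add: D_def)
    qed
    with a show ?thesis by blast
  qed
  with A show ?thesis by blast
qed

section \<open>Directions near a fixed vector\<close>

text \<open>
  Two orthogonal projections near a third one differ mainly in their off-diagonal blocks: with
  \<open>D = p - p'\<close> one has \<open>p D p = D D p\<close>, so the diagonal block of \<open>D\<close> is of second order.
\<close>

lemma projection_diff_block: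
  fixes p p' q :: "'a::real_normed_vector \<Rightarrow> 'a"
  assumes lin: "linear p" "linear p'" "linear q"
    and idem: "\<And>x. p (p x) = p x" "\<And>x. p' (p' x) = p' x"
    and con: "\<And>x. norm (p x) \<le> norm x" "\<And>x. norm (q x) \<le> norm x"
    and pq: "\<And>x. norm (p x - q x) \<le> norm x / 16"
    and pp': "\<And>x. norm (p x - p' x) \<le> \<delta> * norm x" and \<delta>: "0 \<le> \<delta>" "\<delta> \<le> 1/8"
  shows "norm (q (p (q x) - p' (q x))) \<le> \<delta> / 4 * norm x"
proof -
  define D where "D y = p y - p' y" for y
  have linD: "linear D" unfolding D_def using lin by (intro linear_compose_sub)
  have D: "norm (D y) \<le> \<delta> * norm y" for y unfolding D_def by (rule pp')
  have e1: "p (D (p x)) = D (D (p x))"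
    by (simp add: D_def linear_diff[OF lin(1)] linear_diff[OF lin(2)] idem)
  \<comment> \<open>Trading the outer and the inner \<open>p\<close> for \<open>q\<close> costs at
    most \<open>\<delta> / 16\<close> each, and the second-order block costs at most
    \<open>\<delta> / 8\<close>; together this is \<open>\<delta> / 4\<close>.\<close>
  have n1: "norm (q (D (q x)) - p (D (q x))) \<le> \<delta> * norm x / 16"
  proof -
    have "norm (q (D (q x)) - p (D (q x))) \<le> norm (D (q x)) / 16"
      using pq[of "D (q x)"] by (simp add: norm_minus_commute)
    also have "norm (D (q x)) \<le> \<delta> * norm x"
      using D[of "q x"] mult_left_mono[OF con(2)[of x] \<delta>(1)] by linarith
    finally show ?thesis by simp
  qed
  have n2: "norm (p (D (q x)) - p (D (p x))) \<le> \<delta> * norm x / 16"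
  proof -
    have "norm (p (D (q x)) - p (D (p x))) = norm (p (D (q x - p x)))"
      by (simp add: linear_diff[OF lin(1)] linear_diff[OF linD])
    also have "\<dots> \<le> norm (D (q x - p x))" by (rule con)
    also have "\<dots> \<le> \<delta> * norm (q x - p x)" by (rule D)
    also have "\<dots> \<le> \<delta> * (norm x / 16)"
      using pq[of x] \<delta> by (intro mult_left_mono) (auto simp: norm_minus_commute)
    finally show ?thesis by simp
  qed
  have n3: "norm (p (D (p x))) \<le> \<delta> * norm x / 8"
  proof -
    have "norm (p (D (p x))) \<le> \<delta> * norm (D (p x))" unfolding e1 by (rule D)
    also have "\<dots> \<le> \<delta> * (\<delta> * norm x)"
      using D[of "p x"] mult_left_mono[OF con(1)[of x] \<delta>(1)] \<delta> by (intro mult_left_mono) linarith+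
    also have "\<dots> \<le> \<delta> * (1/8 * norm x)"
      using \<delta> by (intro mult_left_mono mult_right_mono) auto
    finally show ?thesis by simp
  qed
  have "q (D (q x)) = (q (D (q x)) - p (D (q x))) + (p (D (q x)) - p (D (p x))) + p (D (p x))" by simp
  then have "norm (q (D (q x))) \<le> norm (q (D (q x)) - p (D (q x))) + norm (p (D (q x)) - p (D (p x))) + norm (p (D (p x)))"
    by (metis norm_triangle_ineq norm_triangle_le add_mono order_refl)
  with n1 n2 n3 show ?thesis unfolding D_def by linarith
qed

lemma orthonormal_expand_norm_le:
  fixes y :: "'a::euclidean_space"
  assumes "finite B" "pairwise orthogonal B" "\<And>b. b \<in> B \<Longrightarrow> norm b = 1" "y \<in> span B"
  shows "norm y \<le> (\<Sum>b\<in>B. \<bar>y \<bullet> b\<bar>)"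
proof -
  have "norm y = norm (\<Sum>b\<in>B. (y \<bullet> b) *\<^sub>R b)"
    using orthonormal_basis_expand[of B y] assms by simp
  also have "\<dots> \<le> (\<Sum>b\<in>B. norm ((y \<bullet> b) *\<^sub>R b))" by (rule norm_sum)
  also have "\<dots> = (\<Sum>b\<in>B. \<bar>y \<bullet> b\<bar>)" using assms(3) by simp
  finally show ?thesis .
qed

text \<open>Split the difference \<open>D\<close> of the projections into blocks along
  \<open>Q\<close> and its complement. The diagonal blocks take at most half of the distance; an
  off-diagonal block is determined by the images of an orthonormal basis of \<open>Q\<close>. In the
  direction of \<open>orth_proj Q e\<close> the image is small since both projections nearly fix
  \<open>e\<close>, so only the entries on the orthogonal rest \<open>Bv\<close> of \<open>Q\<close>
  have to be compared. For \<open>m\<close>-dimensional \<open>Q\<close> in dimension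
  \<open>n\<close> these are \<open>(m - 1) * (n - m)\<close> entries instead of
  \<open>m * (n - m)\<close>, which is the gain in dimension.\<close>

lemma grassmann_dist_le_of_entries:
  fixes P P' Q :: "'a::euclidean_space set" and e :: 'a
  assumes sub: "subspace P" "subspace P'" "subspace Q"
    and near: "grassmann_dist P Q \<le> 1/16" "grassmann_dist P' Q \<le> 1/16"
    and e: "norm e = 1" "norm (e - orth_proj P e) \<le> \<rho>" "norm (e - orth_proj P' e) \<le> \<rho>" and \<rho>: "\<rho> \<le> 1/16"
    and Bv: "finite Bv" "pairwise orthogonal Bv" "\<And>b. b \<in> Bv \<Longrightarrow> norm b = 1"
      "span Bv = {v \<in> Q. v \<bullet> orth_proj Q e = 0}"
    and Bu: "finite Bu" "pairwise orthogonal Bu" "\<And>b. b \<in> Bu \<Longrightarrow> norm b = 1"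
      "span Bu = {u. \<forall>v\<in>Q. v \<bullet> u = 0}"
    and entries: "\<And>v u. v \<in> Bv \<Longrightarrow> u \<in> Bu \<Longrightarrow> \<bar>(orth_proj P v - orth_proj P' v) \<bullet> u\<bar> \<le> \<rho>"
    and card: "card Bv \<le> n" "card Bu \<le> n"
  shows "grassmann_dist P P' \<le> (14 + 5 * (real n)\<^sup>2) * \<rho>"
proof -
  define p p' q where "p = orth_proj P" "p' = orth_proj P'" "q = orth_proj Q"
  note pdefs = p_p'_q_def
  define q' where "q' y = y - q y" for y
  define D where "D y = p y - p' y" for y
  define \<delta> where "\<delta> = grassmann_dist P P'"
  have lin: "linear p" "linear p'" "linear q" unfolding pdefs by (auto intro!: linear_orth_proj sub)
  have linq': "linear q'" unfolding q'_def using linear_compose_sub[OF linear_ident lin(3)] by simp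
  have linD: "linear D" unfolding D_def using lin by (intro linear_compose_sub)
  have idem: "p (p x) = p x" "p' (p' x) = p' x" "q (q x) = q x" for x
    unfolding pdefs by (auto intro!: orth_proj_idem sub)
  have con: "norm (p x) \<le> norm x" "norm (q x) \<le> norm x" "norm (q' x) \<le> norm x" "norm (x - p x) \<le> norm x" for x
    unfolding pdefs q'_def by (auto intro!: norm_orth_proj_le sub)
  have sa: "q x \<bullet> y = x \<bullet> q y" "D x \<bullet> y = x \<bullet> D y" for x y
    unfolding D_def pdefs inner_diff_left inner_diff_right by (simp_all add: orth_proj_selfadjoint sub)
  have sa': "q' x \<bullet> y = x \<bullet> q' y" for x y
    unfolding q'_def inner_diff_left inner_diff_right by (simp add: sa)
  have pq: "norm (p x - q x) \<le> norm x / 16" for x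
    using norm_orth_proj_diff_le[OF sub(1,3), of x] mult_right_mono[OF near(1) norm_ge_zero[of x]] unfolding pdefs by simp
  have Dn: "norm (D x) \<le> \<delta> * norm x" for x
    using norm_orth_proj_diff_le[OF sub(1,2), of x] unfolding pdefs D_def \<delta>_def by simp
  have \<delta>: "0 \<le> \<delta>" "\<delta> \<le> 1/8"
    using grassmann_dist_nonneg[OF sub(1,2)] grassmann_dist_triangle[OF sub(1,3,2)] near
    by (auto simp: \<delta>_def grassmann_dist_commute[of Q])
  have \<rho>0: "0 \<le> \<rho>" using e(2) norm_ge_zero order_trans by blast
  have blk1: "norm (q (D (q x))) \<le> \<delta> / 4 * norm x" for x
    using projection_diff_block[OF lin idem(1,2) con(1,2) pq Dn[unfolded D_def] \<delta>] unfolding D_def .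
  have blk2: "norm (q' (D (q' x))) \<le> \<delta> / 4 * norm x" for x
  proof -
    \<comment> \<open>The complementary projections satisfy the same hypotheses, and their
      difference is \<open>- D\<close>.\<close>
    have "norm (q' ((q' x - p (q' x)) - (q' x - p' (q' x)))) \<le> \<delta> / 4 * norm x"
    proof (rule projection_diff_block)
      show "linear (\<lambda>x. x - p x)" "linear (\<lambda>x. x - p' x)" "linear q'"
        using linear_compose_sub[OF linear_ident lin(1)] linear_compose_sub[OF linear_ident lin(2)] linq' by simp_all
      show "(x - p x) - p (x - p x) = x - p x" "(x - p' x) - p' (x - p' x) = x - p' x" for x
        by (simp_all add: linear_diff[OF lin(1)] linear_diff[OF lin(2)] idem)
      show "norm (x - p x) \<le> norm x" "norm (q' x) \<le> norm x" for x by (rule con)+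
      show "norm (x - p x - q' x) \<le> norm x / 16" for x
        using pq[of x] by (simp add: q'_def norm_minus_commute)
      show "norm (x - p x - (x - p' x)) \<le> \<delta> * norm x" for x
        using Dn[of x] by (simp add: D_def norm_minus_commute)
    qed (rule \<delta>)+
    also have "q' ((q' x - p (q' x)) - (q' x - p' (q' x))) = - q' (D (q' x))"
      by (simp add: D_def linear_diff[OF linq'])
    finally show ?thesis by simp
  qed
  have De: "norm (D e) \<le> 2 * \<rho>"
  proof -
    have "D e = (e - p' e) - (e - p e)" by (simp add: D_def)
    then show ?thesis using e norm_triangle_ineq4[of "e - p' e" "e - p e"] unfolding pdefs by simp
  qed
  have q'e: "norm (q' e) \<le> 1/8"
  proof -
    have "q' e = (e - p e) + (p e - q e)" by (simp add: q'_def)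
    then show ?thesis using norm_triangle_ineq[of "e - p e" "p e - q e"] pq[of e] e \<rho> unfolding pdefs by simp
  qed
  have qe: "norm (q e) \<ge> 7/8"
  proof -
    have "e = q e + q' e" by (simp add: q'_def)
    then have "norm e \<le> norm (q e) + norm (q' e)" using norm_triangle_ineq[of "q e" "q' e"] by simp
    then show ?thesis using q'e e by simp
  qed
  define v1 where "v1 = (1 / norm (q e)) *\<^sub>R q e"
  have qe0: "q e \<noteq> 0" using qe by auto
  have v1: "norm v1 = 1" "v1 \<in> Q" "v1 \<notin> Bv" "v1 \<bullet> q e = norm (q e)"
  proof -
    show "norm v1 = 1" using qe0 by (simp add: v1_def)
    show "v1 \<in> Q" using sub by (simp add: v1_def pdefs subspace_scale orth_proj_in)
    show *: "v1 \<bullet> q e = norm (q e)" using qe0 by (simp add: v1_def power2_norm_eq_inner[symmetric] power2_eq_square)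
    show "v1 \<notin> Bv" using * qe0 Bv(4) span_base[of v1 Bv] by (auto simp: pdefs)
  qed
  have BvQ: "b \<in> Q" "b \<bullet> q e = 0" if "b \<in> Bv" for b
    using span_base[OF that] unfolding Bv(4) pdefs by auto
  have spanQ: "span (insert v1 Bv) = Q"
  proof
    show "span (insert v1 Bv) \<subseteq> Q"
      using v1 BvQ sub(3) by (intro span_minimal) auto
    show "Q \<subseteq> span (insert v1 Bv)"
    proof
      fix y assume y: "y \<in> Q"
      have "(y - (y \<bullet> v1) *\<^sub>R v1) \<bullet> q e = 0"
        using qe0 by (simp add: inner_diff_left v1_def power2_norm_eq_inner[symmetric] power2_eq_square)
      then have "y - (y \<bullet> v1) *\<^sub>R v1 \<in> span Bv"
        unfolding Bv(4) using y v1(2) sub(3) by (auto simp: pdefs subspace_diff subspace_scale)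
      then have "y - (y \<bullet> v1) *\<^sub>R v1 \<in> span (insert v1 Bv)"
        using span_mono[of Bv "insert v1 Bv"] by blast
      moreover have "(y \<bullet> v1) *\<^sub>R v1 \<in> span (insert v1 Bv)" by (simp add: span_base span_scale)
      ultimately have "(y - (y \<bullet> v1) *\<^sub>R v1) + (y \<bullet> v1) *\<^sub>R v1 \<in> span (insert v1 Bv)" by (rule span_add)
      then show "y \<in> span (insert v1 Bv)" by simp
    qed
  qed
  have orth1: "pairwise orthogonal (insert v1 Bv)"
  proof -
    have "orthogonal v1 b" if "b \<in> Bv" for b
      using BvQ(2)[OF that] by (simp add: v1_def orthogonal_def inner_commute)
    then show ?thesis using Bv(2) by (auto simp: pairwise_insert orthogonal_commute)
  qed
  have qexp: "q x = (x \<bullet> v1) *\<^sub>R v1 + (\<Sum>b\<in>Bv. (x \<bullet> b) *\<^sub>R b)" for x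
  proof -
    have "q x = (\<Sum>b\<in>insert v1 Bv. (x \<bullet> b) *\<^sub>R b)"
      unfolding pdefs using Bv v1 BvQ orth1 spanQ by (intro orth_proj_expand sub) auto
    then show ?thesis using Bv(1) v1(3) by simp
  qed
  have q'le: "norm (q' y) \<le> (\<Sum>u\<in>Bu. \<bar>y \<bullet> u\<bar>)" for y
  proof -
    have "q' y \<in> span Bu"
      unfolding Bu(4) using orth_proj_orth[OF sub(3), of _ y] by (auto simp: q'_def pdefs inner_commute)
    from orthonormal_expand_norm_le[OF Bu(1-3) this]
    have "norm (q' y) \<le> (\<Sum>u\<in>Bu. \<bar>q' y \<bullet> u\<bar>)" .
    also have "\<dots> = (\<Sum>u\<in>Bu. \<bar>y \<bullet> u\<bar>)"
    proof (intro sum.cong refl)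
      fix u assume "u \<in> Bu"
      then have "u \<in> {u. \<forall>v\<in>Q. v \<bullet> u = 0}" using span_base[of u Bu] Bu(4) by simp
      then have "q y \<bullet> u = 0" using orth_proj_in[OF sub(3)] by (simp add: pdefs)
      then show "\<bar>q' y \<bullet> u\<bar> = \<bar>y \<bullet> u\<bar>" by (simp add: q'_def inner_diff_left)
    qed
    finally show ?thesis .
  qed
  \<comment> \<open>The first summand bounds \<open>q' (D v1)\<close>:
    \<open>norm (q e) \<ge> 7/8\<close> gives the factor \<open>8/7\<close>, and
    \<open>\<delta> / 32\<close> is the diagonal block applied to \<open>q' e\<close>, whose norm is
    at most \<open>1/8\<close>. The second counts at most \<open>n\<close> basis vectors in
    \<open>Bv\<close>, each with at most \<open>n\<close> entries of size
    \<open>\<rho>\<close>.\<close>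
  define \<kappa> where "\<kappa> = 8/7 * (2 * \<rho> + \<delta> / 32) + real n * (real n * \<rho>)"
  have kv1: "norm (q' (D v1)) \<le> 8/7 * (2 * \<rho> + \<delta> / 32)"
  proof -
    have "q' (D (q e)) = q' (D e) - q' (D (q' (q' e)))"
    proof -
      have "q' (q' e) = q' e" by (simp add: q'_def linear_diff[OF lin(3)] idem)
      moreover have "D (q e) = D e - D (q' e)" by (simp add: q'_def linear_diff[OF linD])
      ultimately show ?thesis by (simp add: linear_diff[OF linq'])
    qed
    then have "norm (q' (D (q e))) \<le> norm (q' (D e)) + norm (q' (D (q' (q' e))))"
      by (simp add: norm_triangle_ineq4)
    also have "norm (q' (D e)) \<le> 2 * \<rho>" using con(3)[of "D e"] De by linarith
    also have "norm (q' (D (q' (q' e)))) \<le> \<delta> / 4 * (1/8)"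
      using blk2[of "q' e"] mult_left_mono[OF q'e, of "\<delta> / 4"] \<delta> by linarith
    finally have 1: "norm (q' (D (q e))) \<le> 2 * \<rho> + \<delta> / 32" by simp
    have "norm (q' (D v1)) = norm (q' (D (q e))) / norm (q e)"
      by (simp add: v1_def linear_scale[OF linD] linear_scale[OF linq'] divide_simps)
    also have "\<dots> \<le> (2 * \<rho> + \<delta> / 32) / (7/8)"
      using 1 qe \<rho>0 \<delta> by (intro frac_le) auto
    finally show ?thesis by simp
  qed
  have kb: "norm (q' (D b)) \<le> real n * \<rho>" if b: "b \<in> Bv" for b
  proof -
    have "norm (q' (D b)) \<le> (\<Sum>u\<in>Bu. \<bar>D b \<bullet> u\<bar>)" by (rule q'le)
    also have "\<dots> \<le> real (card Bu) * \<rho>"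
      using entries[OF b] by (intro sum_bounded_above) (simp add: D_def pdefs)
    also have "\<dots> \<le> real n * \<rho>" using card \<rho>0 by (intro mult_right_mono) auto
    finally show ?thesis .
  qed
  have kap: "norm (q' (D (q x))) \<le> \<kappa> * norm x" for x
  proof -
    have "q' (D (q x)) = (x \<bullet> v1) *\<^sub>R q' (D v1) + (\<Sum>b\<in>Bv. (x \<bullet> b) *\<^sub>R q' (D b))"
      by (simp add: qexp linear_add[OF linD] linear_add[OF linq'] linear_scale[OF linD]
          linear_scale[OF linq'] linear_sum[OF linD] linear_sum[OF linq'])
    then have "norm (q' (D (q x))) \<le> norm ((x \<bullet> v1) *\<^sub>R q' (D v1)) + norm (\<Sum>b\<in>Bv. (x \<bullet> b) *\<^sub>R q' (D b))"
      by (metis norm_triangle_ineq)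
    also have "norm ((x \<bullet> v1) *\<^sub>R q' (D v1)) \<le> norm x * (8/7 * (2 * \<rho> + \<delta> / 32))"
      unfolding norm_scaleR
      using Cauchy_Schwarz_ineq2[of x v1] v1(1) by (intro mult_mono kv1) simp_all
    also have "norm (\<Sum>b\<in>Bv. (x \<bullet> b) *\<^sub>R q' (D b)) \<le> (\<Sum>b\<in>Bv. norm x * (real n * \<rho>))"
    proof (rule sum_norm_le)
      fix b assume b: "b \<in> Bv"
      have "\<bar>x \<bullet> b\<bar> \<le> norm x" using Cauchy_Schwarz_ineq2[of x b] Bv(3)[OF b] by simp
      then show "norm ((x \<bullet> b) *\<^sub>R q' (D b)) \<le> norm x * (real n * \<rho>)"
        using kb[OF b] by (auto intro!: mult_mono)
    qed
    also have "\<dots> = real (card Bv) * (norm x * (real n * \<rho>))" by simp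
    also have "\<dots> \<le> real n * (norm x * (real n * \<rho>))"
      using card \<rho>0 by (intro mult_right_mono) auto
    finally show ?thesis by (simp add: \<kappa>_def algebra_simps)
  qed
  have kap': "norm (q (D (q' x))) \<le> \<kappa> * norm x" for x
  proof (cases "q (D (q' x)) = 0")
    case True
    have "0 \<le> \<kappa>" using \<rho>0 \<delta> by (simp add: \<kappa>_def)
    then show ?thesis using True by simp
  next
    case False
    \<comment> \<open>This block is the adjoint of the previous one, since \<open>D\<close>,
      \<open>q\<close> and \<open>q'\<close> are self-adjoint; testing it on its own value transfers
      the bound.\<close>
    define y where "y = q (D (q' x))"
    have "(norm y)\<^sup>2 = y \<bullet> y" by (rule power2_norm_eq_inner)
    also have "\<dots> = x \<bullet> q' (D (q y))"
      by (subst (1) y_def) (simp add: sa sa')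
    also have "\<dots> \<le> norm x * (\<kappa> * norm y)"
      using norm_cauchy_schwarz[of x "q' (D (q y))"] mult_left_mono[OF kap[of y] norm_ge_zero[of x]] by linarith
    finally show ?thesis using False unfolding y_def[symmetric] by (simp add: power2_eq_square mult_ac)
  qed
  have "norm (D x) \<le> (\<delta> / 2 + 2 * \<kappa>) * norm x" for x
  proof -
    have "D x = (q (D (q x)) + q' (D (q' x))) + (q (D (q' x)) + q' (D (q x)))"
    proof -
      have "D x = D (q x) + D (q' x)" by (simp add: linear_add[OF linD, symmetric]) (simp add: q'_def)
      then show ?thesis by (simp add: q'_def)
    qed
    then have "norm (D x) \<le> norm (q (D (q x)) + q' (D (q' x))) + norm (q (D (q' x)) + q' (D (q x)))"
      by (metis norm_triangle_ineq)
    also have "\<dots> \<le> (norm (q (D (q x))) + norm (q' (D (q' x)))) + (norm (q (D (q' x))) + norm (q' (D (q x))))"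
      by (intro add_mono norm_triangle_ineq)
    finally show ?thesis using blk1[of x] blk2[of x] kap[of x] kap'[of x] by (simp add: algebra_simps)
  qed
  \<comment> \<open>The terms with \<open>\<delta>\<close> on the right have total coefficient
    \<open>1/2 + 1/14\<close>, which is below 1, and are absorbed on the left.\<close>
  then have "\<delta> \<le> \<delta> / 2 + 2 * \<kappa>"
    unfolding \<delta>_def D_def pdefs by (rule grassmann_dist_leI)
  then have "6 * \<delta> \<le> 64 * \<rho> + 28 * ((real n)\<^sup>2 * \<rho>)"
    by (simp add: \<kappa>_def power2_eq_square algebra_simps)
  moreover have "0 \<le> (real n)\<^sup>2 * \<rho>" using \<rho>0 by simp
  ultimately have "\<delta> \<le> 14 * \<rho> + 5 * ((real n)\<^sup>2 * \<rho>)" using \<rho>0 by linarith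
  then show ?thesis unfolding \<delta>_def by (simp add: algebra_simps)
qed

text \<open>The growth bound is imposed at scales at least \<open>r\<close> and around points of
  \<open>A\<close> only, which is what saturation on a finite set provides and all that energies at
  resolution \<open>r\<close> detect.\<close>

definition frostman_weights :: "real \<Rightarrow> real \<Rightarrow> 'a::euclidean_space set set \<Rightarrow> ('a set \<Rightarrow> real) \<Rightarrow> bool" where
  "frostman_weights r s A w \<longleftrightarrow> (\<forall>V. 0 \<le> w V) \<and>
     (\<forall>a\<in>A. \<forall>\<rho>\<ge>r. (\<Sum>b\<in>{b\<in>A. grassmann_dist a b \<le> \<rho>}. w b) \<le> (2 * \<rho>) powr s)"

lemma frostman_weights_total:
  fixes A :: "'a::euclidean_space set set"
  assumes "frostman_weights r s A w" "A \<subseteq> grassmannian m" "r \<le> 2"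
  shows "sum w A \<le> 4 powr s"
proof (cases "A = {}")
  case False
  then obtain a where a: "a \<in> A" by blast
  have "{b\<in>A. grassmann_dist a b \<le> 2} = A"
    using assms(2) a grassmann_dist_le_2[of a] by blast
  then show ?thesis using assms(1,3) a by (force simp: frostman_weights_def)
qed simp

lemma dim_Int_orthogonal_vector:
  fixes a :: "'a::euclidean_space"
  assumes "subspace Q" "a \<in> Q" "a \<noteq> 0"
  shows "dim {v \<in> Q. v \<bullet> a = 0} = dim Q - 1"
proof -
  have "span {a} \<subseteq> Q" using assms by (simp add: span_minimal)
  then have "dim {y \<in> Q. \<forall>x\<in>span {a}. orthogonal x y} + dim (span {a}) = dim Q"
    using assms(1) by (intro dim_subspace_orthogonal_to_vectors) auto
  moreover have "{y \<in> Q. \<forall>x\<in>span {a}. orthogonal x y} = {v \<in> Q. v \<bullet> a = 0}"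
    by (auto simp: orthogonal_def span_singleton inner_commute)
  moreover have "dim (span {a}) = 1" using assms(3) by (simp add: dim_insert)
  ultimately show ?thesis by simp
qed

lemma dim_orthogonal_complement:
  fixes Q :: "'a::euclidean_space set"
  assumes "subspace Q"
  shows "dim {u. \<forall>v\<in>Q. v \<bullet> u = 0} = DIM('a) - dim Q"
  using dim_subspace_orthogonal_to_vectors[OF assms subspace_UNIV subset_UNIV] by (simp add: orthogonal_def)

definition orthonormal_basis_of :: "'a::euclidean_space set \<Rightarrow> 'a set" where
  "orthonormal_basis_of S = (SOME B. finite B \<and> pairwise orthogonal B \<and> (\<forall>b\<in>B. norm b = 1) \<and> span B = S \<and> card B = dim S)"

lemma orthonormal_basis_of:
  fixes S :: "'a::euclidean_space set"
  assumes "subspace S"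
  shows "finite (orthonormal_basis_of S) \<and> pairwise orthogonal (orthonormal_basis_of S) \<and>
    (\<forall>b\<in>orthonormal_basis_of S. norm b = 1) \<and> span (orthonormal_basis_of S) = S \<and>
    card (orthonormal_basis_of S) = dim S"
  unfolding orthonormal_basis_of_def
proof (rule someI_ex)
  show "\<exists>B. finite B \<and> pairwise orthogonal B \<and> (\<forall>b\<in>B. norm b = 1) \<and> span B = S \<and> card B = dim S"
    using orthonormal_basis_subspace[OF assms] independent_imp_finite by metis
qed

text \<open>Quantisation: a nearby member of the finite set \<open>\<Q>\<close>, together with the
  \<open>N\<close> entries of \<open>grassmann_dist_le_of_entries\<close> rounded at mesh
  \<open>\<rho>\<close>, sorts the subspaces near \<open>e\<close> into at most
  \<open>card \<Q> * (5 / \<rho>) ^ N\<close> cells of size of order \<open>\<rho>\<close>. The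
  Frostman bound applies to every cell.\<close>

lemma frostman_weights_near_vector_small:
  fixes m :: nat and A \<Q> :: "'a::euclidean_space set set" and e :: 'a
  assumes m: "1 \<le> m" and s: "s > 0" and
    Q: "finite \<Q>" "\<Q> \<subseteq> grassmannian m"
      "\<forall>V\<in>grassmannian m. \<exists>a\<in>\<Q>. grassmann_dist a V \<le> 1/16"
    and N: "N = (m - 1) * (DIM('a) - m)" and n: "n = DIM('a)"
    and A: "finite A" "A \<subseteq> grassmannian m" and w: "frostman_weights r s A w" and r: "0 < r" "r \<le> \<rho>"
    and e: "norm e = 1" and \<rho>: "\<rho> \<le> 1/16"
  shows "(\<Sum>V\<in>{V\<in>A. norm (e - orth_proj V e) \<le> \<rho>}. w V) \<le>
     card \<Q> * (5 / \<rho>) ^ N * (2 * ((14 + 5 * (real n)\<^sup>2) * \<rho>)) powr s"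
proof -
  define C1 where "C1 = 14 + 5 * (real n)\<^sup>2"
  define S where "S = {V\<in>A. norm (e - orth_proj V e) \<le> \<rho>}"
  have \<rho>0: "0 < \<rho>" using r by simp
  have finS: "finite S" using A by (simp add: S_def)
  have w0: "0 \<le> w V" for V using w by (simp add: frostman_weights_def)
  have "\<forall>V\<in>grassmannian m. \<exists>a. a \<in> \<Q> \<and> grassmann_dist a V \<le> 1/16" using Q(3) by blast
  then obtain ch where ch: "\<And>V. V \<in> grassmannian m \<Longrightarrow> ch V \<in> \<Q> \<and> grassmann_dist (ch V) V \<le> 1/16" by metis
  \<comment> \<open>A member of \<open>\<Q>\<close> orthogonal to \<open>e\<close> cannot be close
    to a subspace nearly containing \<open>e\<close>. For the others, the vectors of
    \<open>Q\<close> orthogonal to \<open>orth_proj Q e\<close> form a space of dimension exactly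
    \<open>m - 1\<close>.\<close>
  define \<Q>' where "\<Q>' = {Q\<in>\<Q>. orth_proj Q e \<noteq> 0}"
  have chS: "ch V \<in> \<Q>'" if V: "V \<in> S" for V
  proof -
    have VG: "V \<in> grassmannian m" using V A by (auto simp: S_def)
    note c = ch[OF VG]
    have sub: "subspace V" "subspace (ch V)" using VG c Q(2) by blast+
    have "norm e \<le> norm (e - orth_proj V e) + norm (orth_proj (ch V) e - orth_proj V e) + norm (orth_proj (ch V) e)"
      using norm_triangle_ineq[of "e - orth_proj V e" "orth_proj V e - orth_proj (ch V) e"]
        norm_triangle_ineq[of "e - orth_proj (ch V) e" "orth_proj (ch V) e"]
      by (simp add: norm_minus_commute)
    moreover have "norm (orth_proj (ch V) e - orth_proj V e) \<le> 1/16"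
      using norm_orth_proj_diff_le[OF sub(2,1), of e] c e by simp
    ultimately have "orth_proj (ch V) e \<noteq> 0" using V e \<rho> by (auto simp: S_def)
    then show ?thesis using c by (simp add: \<Q>'_def)
  qed
  define Bv where "Bv Q = orthonormal_basis_of {v \<in> Q. v \<bullet> orth_proj Q e = 0}" for Q
  define Bu where "Bu Q = orthonormal_basis_of {u. \<forall>v\<in>Q. v \<bullet> u = 0}" for Q :: "'a set"
  have Bv: "finite (Bv Q) \<and> pairwise orthogonal (Bv Q) \<and> (\<forall>b\<in>Bv Q. norm b = 1) \<and>
      span (Bv Q) = {v \<in> Q. v \<bullet> orth_proj Q e = 0} \<and> card (Bv Q) = dim {v \<in> Q. v \<bullet> orth_proj Q e = 0}"
    if "Q \<in> \<Q>'" for Q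
    unfolding Bv_def
  proof (rule orthonormal_basis_of)
    have "subspace Q" using that Q(2) by (auto simp: \<Q>'_def)
    then show "subspace {v \<in> Q. v \<bullet> orth_proj Q e = 0}"
      by (auto simp: subspace_def inner_add_left)
  qed
  have Bu: "finite (Bu Q) \<and> pairwise orthogonal (Bu Q) \<and> (\<forall>b\<in>Bu Q. norm b = 1) \<and>
      span (Bu Q) = {u. \<forall>v\<in>Q. v \<bullet> u = 0} \<and> card (Bu Q) = dim {u. \<forall>v\<in>Q. v \<bullet> u = 0}" for Q :: "'a set"
    unfolding Bu_def by (rule orthonormal_basis_of) (auto simp: subspace_def inner_add_right)
  have cards: "card (Bv Q) = m - 1" "card (Bu Q) = DIM('a) - m" if "Q \<in> \<Q>'" for Q
  proof -
    have QG: "subspace Q" "dim Q = m" "orth_proj Q e \<noteq> 0" using that Q(2) by (auto simp: \<Q>'_def grassmannian_def)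
    show "card (Bv Q) = m - 1"
      using Bv[OF that] dim_Int_orthogonal_vector[OF QG(1) orth_proj_in[OF QG(1)] QG(3)] QG(2) by simp
    show "card (Bu Q) = DIM('a) - m"
      using Bu[of Q] dim_orthogonal_complement[OF QG(1)] QG(2) by simp
  qed
  define Z where "Z = {- \<lceil>1 / \<rho>\<rceil> .. \<lceil>1 / \<rho>\<rceil>}"
  define key where "key V = (ch V, (\<lambda>x\<in>Bv (ch V) \<times> Bu (ch V). \<lfloor>orth_proj V (fst x) \<bullet> snd x / \<rho>\<rfloor>))" for V
  define T where "T = Sigma \<Q>' (\<lambda>Q. \<Pi>\<^sub>E x\<in>Bv Q \<times> Bu Q. Z)"
  have fin\<Q>': "finite \<Q>'" using Q by (simp add: \<Q>'_def)
  have keyT: "key V \<in> T" if V: "V \<in> S" for V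
  proof -
    have "subspace V" using V A by (auto simp: S_def)
    have "(\<lambda>x\<in>Bv (ch V) \<times> Bu (ch V). \<lfloor>orth_proj V (fst x) \<bullet> snd x / \<rho>\<rfloor>) \<in> (\<Pi>\<^sub>E x\<in>Bv (ch V) \<times> Bu (ch V). Z)"
    proof (intro PiE_I)
      fix x assume x: "x \<in> Bv (ch V) \<times> Bu (ch V)"
      have "\<bar>orth_proj V (fst x) \<bullet> snd x\<bar> \<le> 1"
        using x Bv[OF chS[OF V]] Bu[of "ch V"] \<open>subspace V\<close> by (intro abs_orth_proj_inner_le) auto
      from abs_floor_le[OF this \<rho>0] x
      show "(\<lambda>x\<in>Bv (ch V) \<times> Bu (ch V). \<lfloor>orth_proj V (fst x) \<bullet> snd x / \<rho>\<rfloor>) x \<in> Z"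
        unfolding Z_def by simp
    qed auto
    then show ?thesis using chS[OF V] by (simp add: T_def key_def)
  qed
  \<comment> \<open>A rounded entry of modulus at most 1 takes at most
    \<open>2 * \<lceil>1 / \<rho>\<rceil> + 1\<close> values.\<close>
  have cardZ: "real (card Z) \<le> 5 / \<rho>"
  proof -
    have "0 < 1 / \<rho>" using \<rho>0 by simp
    then have "0 \<le> \<lceil>1 / \<rho>\<rceil>" by linarith
    then have "real (card Z) = real_of_int (2 * \<lceil>1 / \<rho>\<rceil> + 1)" by (simp add: Z_def)
    also have "\<dots> \<le> 2 * (1 / \<rho> + 1) + 1" by (simp, linarith)
    also have "\<dots> \<le> 5 / \<rho>" using \<rho>0 \<rho> by (simp add: field_simps)
    finally show ?thesis .
  qed
  have finT: "finite T" unfolding T_def using fin\<Q>' Bv Bu by (intro finite_SigmaI finite_PiE) (auto simp: Z_def)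
  have cardT: "real (card T) \<le> card \<Q> * (5 / \<rho>) ^ N"
  proof -
    have "card T = (\<Sum>Q\<in>\<Q>'. card (\<Pi>\<^sub>E x\<in>Bv Q \<times> Bu Q. Z))"
      unfolding T_def using fin\<Q>' Bv Bu by (intro card_SigmaI) (auto simp: Z_def intro!: finite_PiE)
    also have "\<dots> = (\<Sum>Q\<in>\<Q>'. card Z ^ N)"
      using Bv Bu cards by (intro sum.cong refl) (simp add: card_PiE card_cartesian_product N)
    also have "\<dots> = card \<Q>' * card Z ^ N" by simp
    finally have "real (card T) = card \<Q>' * real (card Z) ^ N" by simp
    also have "\<dots> \<le> card \<Q> * (5 / \<rho>) ^ N"
      using cardZ Q(1) by (intro mult_mono power_mono) (auto simp: \<Q>'_def intro!: card_mono)
    finally show ?thesis .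
  qed
  have grp: "(\<Sum>V\<in>{V\<in>S. key V = k}. w V) \<le> (2 * (C1 * \<rho>)) powr s" for k
  proof (cases "{V\<in>S. key V = k} = {}")
    case False
    then obtain V0 where V0: "V0 \<in> S" "key V0 = k" by blast
    have "{V\<in>S. key V = k} \<subseteq> {b\<in>A. grassmann_dist V0 b \<le> C1 * \<rho>}"
    proof
      fix V assume "V \<in> {V\<in>S. key V = k}"
      then have V: "V \<in> S" "key V = key V0" using V0 by auto
      have G: "V \<in> grassmannian m" "V0 \<in> grassmannian m" using V V0 A by (auto simp: S_def)
      define Q where "Q = ch V0"
      have chV: "ch V = Q" using V(2) by (simp add: key_def Q_def)
      have Q': "Q \<in> \<Q>'" using chS[OF V0(1)] by (simp add: Q_def)
      have QG: "Q \<in> grassmannian m" using Q' Q(2) by (auto simp: \<Q>'_def)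
      have "grassmann_dist V0 V \<le> (14 + 5 * (real n)\<^sup>2) * \<rho>"
      proof (rule grassmann_dist_le_of_entries[where Q = Q and e = e and Bv = "Bv Q" and Bu = "Bu Q"])
        show "subspace V0" "subspace V" "subspace Q" using G QG by auto
        show "grassmann_dist V0 Q \<le> 1/16" "grassmann_dist V Q \<le> 1/16"
          using ch[OF G(1)] ch[OF G(2)] chV by (auto simp: Q_def grassmann_dist_commute)
        show "norm (e - orth_proj V0 e) \<le> \<rho>" "norm (e - orth_proj V e) \<le> \<rho>"
          using V V0 by (auto simp: S_def)
        show "card (Bv Q) \<le> n" "card (Bu Q) \<le> n"
          using cards[OF Q'] n dim_subset_UNIV[of Q] QG by (auto simp: grassmannian_def)
        fix v u assume vu: "v \<in> Bv Q" "u \<in> Bu Q"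
        have "snd (key V0) (v, u) = snd (key V) (v, u)" using V(2) by simp
        then have "\<lfloor>orth_proj V0 v \<bullet> u / \<rho>\<rfloor> = \<lfloor>orth_proj V v \<bullet> u / \<rho>\<rfloor>"
          using vu chV by (simp add: key_def Q_def)
        from floor_eq_imp_close[OF this \<rho>0]
        show "\<bar>(orth_proj V0 v - orth_proj V v) \<bullet> u\<bar> \<le> \<rho>" by (simp add: inner_diff_left)
      qed (use Bv[OF Q'] Bu[of Q] e \<rho> in auto)
      then show "V \<in> {b\<in>A. grassmann_dist V0 b \<le> C1 * \<rho>}" using V by (auto simp: S_def C1_def)
    qed
    then have "(\<Sum>V\<in>{V\<in>S. key V = k}. w V) \<le> (\<Sum>V\<in>{b\<in>A. grassmann_dist V0 b \<le> C1 * \<rho>}. w V)"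
      using A w0 by (intro sum_mono2) auto
    also have "\<dots> \<le> (2 * (C1 * \<rho>)) powr s"
    proof -
      have "1 * \<rho> \<le> C1 * \<rho>" using \<rho>0 by (intro mult_right_mono) (auto simp: C1_def)
      then have "r \<le> C1 * \<rho>" using r by linarith
      then show ?thesis using w V0 unfolding frostman_weights_def S_def by blast
    qed
    finally show ?thesis .
  next
    case True
    show ?thesis unfolding True by simp
  qed
  have "(\<Sum>V\<in>S. w V) = (\<Sum>k\<in>T. \<Sum>V\<in>{V\<in>S. key V = k}. w V)"
    using finS finT keyT by (intro sum.group[symmetric]) auto
  also have "\<dots> \<le> card T * (2 * (C1 * \<rho>)) powr s"
    by (intro sum_bounded_above grp)
  also have "\<dots> \<le> card \<Q> * (5 / \<rho>) ^ N * (2 * (C1 * \<rho>)) powr s"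
    using cardT by (intro mult_right_mono) auto
  finally show ?thesis by (simp add: S_def C1_def)
qed

text \<open>For \<open>\<rho> \<le> 1/16\<close> the cell count leaves
  \<open>\<rho> powr (s - N)\<close>, and \<open>s - N \<ge> \<alpha>\<close>. For larger
  \<open>\<rho>\<close> the total weight, at most \<open>4 powr s\<close>, is enough, and
  \<open>16 powr \<alpha>\<close> in \<open>C\<close> makes up for a small
  \<open>\<rho> powr \<alpha>\<close>.\<close>

lemma frostman_weights_near_vector:
  fixes m :: nat and \<alpha> s :: real
  assumes m: "1 \<le> m" and \<alpha>: "0 \<le> \<alpha>" and s: "s > 0" "real ((m - 1) * (DIM('a) - m)) + \<alpha> \<le> s"
  shows "\<exists>C>0. \<forall>(A :: 'a::euclidean_space set set) w r e \<rho>. finite A \<longrightarrow> A \<subseteq> grassmannian m \<longrightarrow>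
    frostman_weights r s A w \<longrightarrow> 0 < r \<longrightarrow> r \<le> 1 \<longrightarrow> norm e = 1 \<longrightarrow> r \<le> \<rho> \<longrightarrow>
    (\<Sum>V\<in>{V\<in>A. norm (e - orth_proj V e) \<le> \<rho>}. w V) \<le> C * \<rho> powr \<alpha>"
proof -
  define N where "N = (m - 1) * (DIM('a) - m)"
  define C1 where "C1 = 14 + 5 * (real DIM('a))\<^sup>2"
  have C1: "C1 > 0" unfolding C1_def by (rule add_pos_nonneg) auto
  obtain \<Q> :: "'a set set" where Q: "\<Q> \<subseteq> grassmannian m" "finite \<Q>" "\<forall>V\<in>grassmannian m. \<exists>a\<in>\<Q>. grassmann_dist a V \<le> 1/16"
    using grassmannian_finite_net[of "grassmannian m" m "1/16"] by auto
  define Ca where "Ca = card \<Q> * 5 ^ N * (2 * C1) powr s"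
  define C where "C = Ca + 4 powr s * 16 powr \<alpha>"
  have Ca: "0 \<le> Ca" using C1 by (simp add: Ca_def)
  have C: "C > 0" unfolding C_def using Ca by (intro add_nonneg_pos) auto
  have "(\<Sum>V\<in>{V\<in>A. norm (e - orth_proj V e) \<le> \<rho>}. w V) \<le> C * \<rho> powr \<alpha>"
    if A: "finite A" "A \<subseteq> grassmannian m" "frostman_weights r s A w" and r: "0 < r" "r \<le> 1" "r \<le> \<rho>" and e: "norm e = 1"
    for A :: "'a set set" and w r e \<rho>
  proof (cases "\<rho> \<le> 1/16")
    case True
    have \<rho>0: "\<rho> > 0" using r by simp
    have "(\<Sum>V\<in>{V\<in>A. norm (e - orth_proj V e) \<le> \<rho>}. w V) \<le> card \<Q> * (5 / \<rho>) ^ N * (2 * (C1 * \<rho>)) powr s"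
      unfolding C1_def
      by (rule frostman_weights_near_vector_small[OF m s(1) Q(2,1,3) N_def refl A r(1,3) e True])
    also have "\<dots> = Ca * (\<rho> powr s / \<rho> ^ N)"
      using \<rho>0 C1 by (simp add: Ca_def powr_mult power_divide)
    also have "\<rho> powr s / \<rho> ^ N = \<rho> powr (s - real N)"
      using \<rho>0 by (simp add: powr_diff powr_realpow)
    also have "Ca * \<rho> powr (s - real N) \<le> Ca * \<rho> powr \<alpha>"
      using \<rho>0 True s(2) Ca by (intro mult_left_mono powr_mono') (auto simp: N_def)
    also have "\<dots> \<le> C * \<rho> powr \<alpha>" by (intro mult_right_mono) (auto simp: C_def)
    finally show ?thesis .
  next
    case False
    have "(\<Sum>V\<in>{V\<in>A. norm (e - orth_proj V e) \<le> \<rho>}. w V) \<le> sum w A"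
      using A by (intro sum_mono2) (auto simp: frostman_weights_def)
    also have "\<dots> \<le> 4 powr s" using r by (intro frostman_weights_total[OF A(3,2)]) auto
    also have "\<dots> = 4 powr s * 16 powr \<alpha> * (1/16) powr \<alpha>" by (simp add: powr_divide)
    also have "\<dots> \<le> C * \<rho> powr \<alpha>"
      using False Ca \<alpha> C by (intro mult_mono powr_mono2) (auto simp: C_def)
    finally show ?thesis .
  qed
  with C show ?thesis by blast
qed

section \<open>Gaussian integrals\<close>

text \<open>This is the real part of the characteristic function of the standard normal
  distribution, with the normalisation removed.\<close>

lemma std_normal_cos_integral:
  "(LINT x|lborel. cos (t * x) * exp (- x\<^sup>2 / 2)) = sqrt (2 * pi) * exp (- t\<^sup>2 / 2)"
  "integrable lborel (\<lambda>x::real. exp (- x\<^sup>2 / 2))"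
proof -
  have d: "std_normal_density x = exp (- x\<^sup>2 / 2) / sqrt (2 * pi)" for x
    by (simp add: std_normal_density_def)
  have int: "integrable lborel std_normal_density" by (rule integrable_normal_density) simp
  then show i: "integrable lborel (\<lambda>x::real. exp (- x\<^sup>2 / 2))"
    using integrable_mult_right[of "sqrt (2 * pi)", OF int] by (simp add: d)
  have "complex_of_real (exp (- (t^2) / 2)) = char std_normal_distribution t"
    by (simp add: char_std_normal_distribution)
  also have "\<dots> = (CLINT x|lborel. std_normal_density x *\<^sub>R iexp (t * x))"
    unfolding char_def
    by (subst integral_density) (auto simp: normal_density_nonneg)
  finally have "exp (- (t^2) / 2) = Re (CLINT x|lborel. std_normal_density x *\<^sub>R iexp (t * x))"
    by (metis Re_complex_of_real)
  also have "\<dots> = (LINT x|lborel. Re (std_normal_density x *\<^sub>R iexp (t * x)))"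
  proof (rule integral_Re[symmetric])
    show "complex_integrable lborel (\<lambda>x. std_normal_density x *\<^sub>R iexp (t * x))"
      by (rule Bochner_Integration.integrable_bound[OF int]) (auto simp: normal_density_nonneg)
  qed
  also have "\<dots> = (LINT x|lborel. cos (t * x) * exp (- x\<^sup>2 / 2) / sqrt (2 * pi))"
    by (intro Bochner_Integration.integral_cong refl) (simp add: d Re_exp)
  also have "\<dots> = (LINT x|lborel. cos (t * x) * exp (- x\<^sup>2 / 2)) / sqrt (2 * pi)"
    by simp
  finally show "(LINT x|lborel. cos (t * x) * exp (- x\<^sup>2 / 2)) = sqrt (2 * pi) * exp (- t\<^sup>2 / 2)"
    by (simp add: field_simps)
qed

lemma gaussian_cis_integral_real:
  assumes a: "a > 0"
  shows "(CLINT x|lborel. cis (t * x) * complex_of_real (exp (- a * x\<^sup>2 / 2))) =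
     complex_of_real (sqrt (2 * pi / a) * exp (- t\<^sup>2 / (2 * a)))"
    "complex_integrable lborel (\<lambda>x. cis (t * x) * complex_of_real (exp (- a * x\<^sup>2 / 2)))"
proof -
  define b where "b = sqrt a"
  have b: "b > 0" "b\<^sup>2 = a" using a by (auto simp: b_def)
  have ex: "exp (- (b * x)\<^sup>2 / 2) = exp (- a * x\<^sup>2 / 2)" for x
    using b by (simp add: power_mult_distrib)
  have ex2: "exp (- ((b * x)\<^sup>2 / 2)) = exp (- (a * x\<^sup>2 / 2))" for x
    using ex[of x] by simp
  have "integrable lborel (\<lambda>x. exp (- (0 + b * x)\<^sup>2 / 2))"
    using std_normal_cos_integral(2) b by (intro lborel_integrable_real_affine) auto
  then have int: "integrable lborel (\<lambda>x. exp (- a * x\<^sup>2 / 2))" by (simp only: ex add_0_left)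
  show ci: "complex_integrable lborel (\<lambda>x. cis (t * x) * complex_of_real (exp (- a * x\<^sup>2 / 2)))"
    by (rule Bochner_Integration.integrable_bound[OF int])
      (auto simp: norm_mult intro!: borel_measurable_times borel_measurable_continuous_onI continuous_intros)
  have re: "(LINT x|lborel. cos (t * x) * exp (- a * x\<^sup>2 / 2)) = sqrt (2 * pi / a) * exp (- t\<^sup>2 / (2 * a))"
  proof -
    have "(LINT x|lborel. cos ((t / b) * x) * exp (- x\<^sup>2 / 2)) =
       \<bar>b\<bar> *\<^sub>R (LINT x|lborel. cos ((t / b) * (0 + b * x)) * exp (- (0 + b * x)\<^sup>2 / 2))"
      using b by (intro lborel_integral_real_affine) auto
    then have "sqrt (2 * pi) * exp (- (t / b)\<^sup>2 / 2) = b * (LINT x|lborel. cos (t * x) * exp (- a * x\<^sup>2 / 2))"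
      using b std_normal_cos_integral(1)[of "t / b"] by (simp add: ex2)
    then show ?thesis using b a by (simp add: real_sqrt_divide b_def[symmetric] power_divide field_simps)
  qed
  have im: "(LINT x|lborel. sin (t * x) * exp (- a * x\<^sup>2 / 2)) = 0"
  proof -
    have "(LINT x|lborel. sin (t * x) * exp (- a * x\<^sup>2 / 2)) =
       \<bar>- 1\<bar> *\<^sub>R (LINT x|lborel. sin (t * (0 + (- 1) * x)) * exp (- a * (0 + (- 1) * x)\<^sup>2 / 2))"
      by (rule lborel_integral_real_affine) auto
    also have "\<dots> = - (LINT x|lborel. sin (t * x) * exp (- a * x\<^sup>2 / 2))" by simp
    finally show ?thesis by simp
  qed
  show "(CLINT x|lborel. cis (t * x) * complex_of_real (exp (- a * x\<^sup>2 / 2))) =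
     complex_of_real (sqrt (2 * pi / a) * exp (- t\<^sup>2 / (2 * a)))"
    unfolding complex_eq_iff integral_Re[OF ci, symmetric] integral_Im[OF ci, symmetric]
    using re im by simp
qed

lemma gaussian_product_cis_integral:
  fixes t :: "'b \<Rightarrow> real"
  assumes "finite B" and a: "a > 0"
  shows "(CLINT x|(\<Pi>\<^sub>M b\<in>B. lborel). (\<Prod>b\<in>B. cis (t b * x b) * complex_of_real (exp (- a * (x b)\<^sup>2 / 2)))) =
      complex_of_real (sqrt (2 * pi / a) ^ card B * exp (- (\<Sum>b\<in>B. (t b)\<^sup>2) / (2 * a)))"
    "complex_integrable (\<Pi>\<^sub>M b\<in>B. lborel) (\<lambda>x. \<Prod>b\<in>B. cis (t b * x b) * complex_of_real (exp (- a * (x b)\<^sup>2 / 2)))"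
proof -
  interpret product_sigma_finite "\<lambda>b::'b. lborel :: real measure" by standard
  show "complex_integrable (\<Pi>\<^sub>M b\<in>B. lborel) (\<lambda>x. \<Prod>b\<in>B. cis (t b * x b) * complex_of_real (exp (- a * (x b)\<^sup>2 / 2)))"
    by (rule product_integrable_prod[OF assms(1) gaussian_cis_integral_real(2)[OF a]])
  have "(CLINT x|(\<Pi>\<^sub>M b\<in>B. lborel). (\<Prod>b\<in>B. cis (t b * x b) * complex_of_real (exp (- a * (x b)\<^sup>2 / 2)))) =
      (\<Prod>b\<in>B. complex_of_real (sqrt (2 * pi / a) * exp (- (t b)\<^sup>2 / (2 * a))))"
    by (subst product_integral_prod[OF assms(1) gaussian_cis_integral_real(2)[OF a]])
      (simp only: gaussian_cis_integral_real(1)[OF a])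
  also have "\<dots> = complex_of_real (\<Prod>b\<in>B. sqrt (2 * pi / a) * exp (- (t b)\<^sup>2 / (2 * a)))" by simp
  also have "(\<Prod>b\<in>B. sqrt (2 * pi / a) * exp (- (t b)\<^sup>2 / (2 * a))) =
      sqrt (2 * pi / a) ^ card B * exp (- (\<Sum>b\<in>B. (t b)\<^sup>2) / (2 * a))"
    using assms(1) by (simp add: prod.distrib exp_sum[symmetric] sum_negf sum_divide_distrib)
  finally show "(CLINT x|(\<Pi>\<^sub>M b\<in>B. lborel). (\<Prod>b\<in>B. cis (t b * x b) * complex_of_real (exp (- a * (x b)\<^sup>2 / 2)))) =
      complex_of_real (sqrt (2 * pi / a) ^ card B * exp (- (\<Sum>b\<in>B. (t b)\<^sup>2) / (2 * a)))" .
qed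

lemma prod_cis_exp:
  assumes "finite B"
  shows "(\<Prod>b\<in>B. cis (f b) * complex_of_real (exp (g b))) = cis (\<Sum>b\<in>B. f b) * complex_of_real (exp (\<Sum>b\<in>B. g b))"
  using assms by (induction B rule: finite_induct) (auto simp: cis_mult[symmetric] exp_add mult_ac)

text \<open>Lebesgue measure is the image of the product measure under the coordinate map, so the
  integral factorises into one-dimensional ones.\<close>

lemma gaussian_cis_integral:
  fixes z :: "'a::euclidean_space"
  assumes a: "a > 0"
  shows "(CLINT x|lborel. cis (z \<bullet> x) * complex_of_real (exp (- a * (norm x)\<^sup>2 / 2))) =
      complex_of_real (sqrt (2 * pi / a) ^ DIM('a) * exp (- (norm z)\<^sup>2 / (2 * a)))"
    "complex_integrable lborel (\<lambda>x::'a. cis (z \<bullet> x) * complex_of_real (exp (- a * (norm x)\<^sup>2 / 2)))"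
proof -
  let ?T = "\<lambda>f. \<Sum>b\<in>(Basis::'a set). f b *\<^sub>R b"
  let ?F = "\<lambda>x::'a. cis (z \<bullet> x) * complex_of_real (exp (- a * (norm x)\<^sup>2 / 2))"
  have meas: "?T \<in> measurable (\<Pi>\<^sub>M b\<in>Basis. lborel) borel" by measurable
  have F: "?F \<in> borel_measurable borel"
    by (intro borel_measurable_continuous_onI continuous_intros) auto
  have eq: "?F (?T f) = (\<Prod>b\<in>Basis. cis ((z \<bullet> b) * f b) * complex_of_real (exp (- a * (f b)\<^sup>2 / 2)))" for f
  proof -
    have "(norm (?T f))\<^sup>2 = (\<Sum>b\<in>Basis. (f b)\<^sup>2)"
      by (subst power2_norm_eq_inner, subst euclidean_inner) (simp add: power2_eq_square)
    moreover have "z \<bullet> ?T f = (\<Sum>b\<in>Basis. (z \<bullet> b) * f b)"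
      by (subst euclidean_inner) simp
    ultimately show ?thesis
      by (subst prod_cis_exp) (simp_all add: sum_distrib_left sum_divide_distrib sum_negf)
  qed
  have z: "(\<Sum>b\<in>Basis. (z \<bullet> b)\<^sup>2) = (norm z)\<^sup>2"
    by (subst power2_norm_eq_inner, subst euclidean_inner) (simp add: power2_eq_square)
  have "complex_integrable (\<Pi>\<^sub>M b\<in>Basis. lborel) (\<lambda>f. ?F (?T f))"
    unfolding eq by (rule gaussian_product_cis_integral(2)) (simp_all add: a)
  then show "complex_integrable lborel ?F"
    by (subst lborel_eq) (simp only: integrable_distr_eq[OF meas F])
  have "(CLINT x|lborel. ?F x) = (CLINT f|(\<Pi>\<^sub>M b\<in>Basis. lborel). ?F (?T f))"
    by (subst lborel_eq) (simp only: integral_distr[OF meas F])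
  also have "\<dots> = complex_of_real (sqrt (2 * pi / a) ^ DIM('a) * exp (- (norm z)\<^sup>2 / (2 * a)))"
    unfolding eq by (subst gaussian_product_cis_integral(1)) (simp_all add: a z)
  finally show "(CLINT x|lborel. ?F x) =
      complex_of_real (sqrt (2 * pi / a) ^ DIM('a) * exp (- (norm z)\<^sup>2 / (2 * a)))" .
qed

lemma gaussian_cos_integral:
  fixes z :: "'a::euclidean_space"
  assumes a: "a > 0"
  shows "(LINT x|lborel. cos (z \<bullet> x) * exp (- a * (norm x)\<^sup>2 / 2)) =
      sqrt (2 * pi / a) ^ DIM('a) * exp (- (norm z)\<^sup>2 / (2 * a))"
    "(LINT x|lborel. sin (z \<bullet> x) * exp (- a * (norm x)\<^sup>2 / 2)) = 0"
    "integrable lborel (\<lambda>x::'a. exp (- a * (norm x)\<^sup>2 / 2))"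
proof -
  note ci = gaussian_cis_integral(2)[OF a, of z]
  show "integrable lborel (\<lambda>x::'a. exp (- a * (norm x)\<^sup>2 / 2))"
    using integrable_norm[OF ci] by (simp add: norm_mult)
  show "(LINT x|lborel. cos (z \<bullet> x) * exp (- a * (norm x)\<^sup>2 / 2)) =
      sqrt (2 * pi / a) ^ DIM('a) * exp (- (norm z)\<^sup>2 / (2 * a))"
    "(LINT x|lborel. sin (z \<bullet> x) * exp (- a * (norm x)\<^sup>2 / 2)) = 0"
    using gaussian_cis_integral(1)[OF a, of z]
    unfolding complex_eq_iff integral_Re[OF ci, symmetric] integral_Im[OF ci, symmetric] by simp_all
qed

text \<open>Completing the square: as a function of \<open>x\<close> the product is a multiple of a
  Gaussian of inverse variance \<open>1 + a\<close> centred at \<open>y / (1 + a)\<close>.\<close>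

lemma gaussian_overlap_real:
  fixes a y :: real
  assumes a: "a > 0"
  shows "(LINT x|lborel. exp (- a * x\<^sup>2 / 2) * exp (- (y - x)\<^sup>2 / 2)) =
      sqrt (2 * pi / (1 + a)) * exp (- (a / (1 + a)) * y\<^sup>2 / 2)"
    "integrable lborel (\<lambda>x. exp (- a * x\<^sup>2 / 2) * exp (- (y - x)\<^sup>2 / 2))"
proof -
  define b where "b = 1 + a"
  have b: "b > 0" using a by (simp add: b_def)
  define f where "f = (\<lambda>x. exp (- a * x\<^sup>2 / 2) * exp (- (y - x)\<^sup>2 / 2))"
  have f: "f (y / b + 1 * x) = exp (- (a / b) * y\<^sup>2 / 2) * exp (- b * x\<^sup>2 / 2)" for x
  proof -
    have "- a * (y / b + x)\<^sup>2 - (y - (y / b + x))\<^sup>2 = - (a / b) * y\<^sup>2 - b * x\<^sup>2"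
    proof -
      have ab: "a = b - 1" by (simp add: b_def)
      show ?thesis unfolding ab using b by (simp add: field_simps power2_eq_square)
    qed
    then have "- a * (y / b + x)\<^sup>2 / 2 + - (y - (y / b + x))\<^sup>2 / 2 = - (a / b) * y\<^sup>2 / 2 + - b * x\<^sup>2 / 2"
      by argo
    then show ?thesis unfolding f_def exp_add[symmetric] by simp
  qed
  have i1: "integrable lborel (\<lambda>x::real. exp (- b * x\<^sup>2 / 2))"
    and i2: "(LINT x|lborel. exp (- b * x\<^sup>2 / 2)) = sqrt (2 * pi / b)"
    using gaussian_cos_integral(1)[OF b, of "0::real"] gaussian_cos_integral(3)[OF b, where 'a=real] by simp_all
  have "integrable lborel (\<lambda>x. f (y / b + 1 * x))"
    unfolding f using i1 by (rule integrable_mult_right)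
  then have "integrable lborel (\<lambda>x. f (y / b + 1 * ((- (y / b)) + x)))"
    using lborel_integrable_real_affine[of "\<lambda>x. f (y / b + 1 * x)" 1 "- (y / b)"] by simp
  then show "integrable lborel (\<lambda>x. exp (- a * x\<^sup>2 / 2) * exp (- (y - x)\<^sup>2 / 2))"
    by (simp add: f_def)
  have "(LINT x|lborel. f x) = \<bar>1\<bar> *\<^sub>R (LINT x|lborel. f (y / b + 1 * x))"
    by (rule lborel_integral_real_affine) simp
  also have "\<dots> = sqrt (2 * pi / b) * exp (- (a / b) * y\<^sup>2 / 2)"
    unfolding f by (simp add: i2[simplified])
  finally show "(LINT x|lborel. exp (- a * x\<^sup>2 / 2) * exp (- (y - x)\<^sup>2 / 2)) =
      sqrt (2 * pi / (1 + a)) * exp (- (a / (1 + a)) * y\<^sup>2 / 2)"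
    by (simp add: f_def b_def)
qed

definition smooth_density :: "real \<Rightarrow> 'a::euclidean_space set \<Rightarrow> 'a \<Rightarrow> real" where
  "smooth_density a V \<zeta> = sqrt (1 / (2 * pi)) ^ DIM('a) * sqrt (a / (1 + a)) ^ dim V *
     exp (- (norm (\<zeta> - orth_proj V \<zeta>))\<^sup>2 / 2 - a / (1 + a) * (norm (orth_proj V \<zeta>))\<^sup>2 / 2)"

text \<open>
  \<open>smooth_density a V\<close> is the density of the sum of a standard Gaussian vector of the whole space and
  an independent Gaussian vector of \<open>V\<close> with variance \<open>1 / a\<close>. Integrating first over the latter, in
  coordinates of an orthonormal basis of \<open>V\<close>, needs only translation invariance of Lebesgue measure.
\<close>

lemma smooth_density_Fourier:
  fixes V :: "'a::euclidean_space set"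
  assumes V: "subspace V" and a: "a > 0"
  shows "(LINT \<zeta>|lborel. cos (z \<bullet> \<zeta>) * smooth_density a V \<zeta>) =
      exp (- (norm z)\<^sup>2 / 2 - (norm (orth_proj V z))\<^sup>2 / (2 * a))"
    "integrable lborel (smooth_density a V)"
proof -
  define B where "B = orthonormal_basis_of V"
  have B: "finite B" "pairwise orthogonal B" "\<And>b. b \<in> B \<Longrightarrow> norm b = 1" "span B = V" "card B = dim V" "B \<subseteq> V"
    using orthonormal_basis_of[OF V] span_superset[of B] by (auto simp: B_def)
  define P where "P = (\<Pi>\<^sub>M b\<in>B. (lborel :: real measure))"
  define Y where "Y = (\<lambda>f. \<Sum>b\<in>B. f b *\<^sub>R b)"
  define g where "g = (\<lambda>f. \<Prod>b\<in>B. exp (- a * (f b)\<^sup>2 / 2))"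
  define e where "e = (\<lambda>x::'a. exp (- (norm x)\<^sup>2 / 2))"
  define cn where "cn = sqrt (2 * pi) ^ DIM('a)"
  define c where "c = sqrt (2 * pi / a) ^ dim V"
  \<comment> \<open>Up to normalisation, the joint density of the coordinates \<open>f\<close> of
    the Gaussian vector in \<open>V\<close> and of the sum \<open>\<zeta>\<close>. Integrating out
    \<open>f\<close> gives the density; integrating over \<open>\<zeta>\<close> first gives its
    transform.\<close>
  define F where "F = (\<lambda>(f, \<zeta>). g f * e (\<zeta> - Y f))"
  have cpos: "cn > 0" "c > 0" using a by (auto simp: cn_def c_def)
  have e0: "integrable lborel e" "(LINT x|lborel. cos (z \<bullet> x) * e x) = cn * exp (- (norm z)\<^sup>2 / 2)"
      "(LINT x|lborel. sin (z \<bullet> x) * e x) = 0" for z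
    using gaussian_cos_integral(1,2)[of 1 z] gaussian_cos_integral(3)[of 1, where 'a='a] by (simp_all add: e_def cn_def)
  have e1: "(LINT x|lborel. e x) = cn" using e0(2)[of 0] by simp
  have eint: "integrable lborel (\<lambda>x. cos (z \<bullet> x) * e x)" "integrable lborel (\<lambda>x. sin (z \<bullet> x) * e x)" for z
  proof -
    have m: "e \<in> borel_measurable borel" unfolding e_def by (intro borel_measurable_continuous_onI continuous_intros) auto
    show "integrable lborel (\<lambda>x. cos (z \<bullet> x) * e x)" "integrable lborel (\<lambda>x. sin (z \<bullet> x) * e x)"
      using m by (auto intro!: Bochner_Integration.integrable_bound[OF e0(1)] simp: abs_mult mult_left_le_one_le e_def)
  qed
  interpret P: product_sigma_finite "\<lambda>b::'a. lborel :: real measure" by standard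
  interpret Pf: finite_product_sigma_finite "\<lambda>b::'a. lborel :: real measure" B by standard (rule B)
  interpret PL: pair_sigma_finite P "lborel :: 'a measure"
    unfolding P_def by standard
  have [measurable]: "Y \<in> measurable P borel" "g \<in> borel_measurable P"
    unfolding P_def Y_def g_def by measurable
  have [measurable]: "e \<in> borel_measurable borel"
    unfolding e_def by (intro borel_measurable_continuous_onI continuous_intros) auto
  have F_meas [measurable]: "F \<in> borel_measurable (P \<Otimes>\<^sub>M lborel)"
    unfolding F_def by measurable
  have g0: "g f \<ge> 0" for f unfolding g_def by (intro prod_nonneg) simp
  have gFT: "(LINT f|P. cos (z \<bullet> Y f) * g f) = c * exp (- (norm (orth_proj V z))\<^sup>2 / (2 * a))"
    "integrable P (\<lambda>f. cos (z \<bullet> Y f) * g f)" for z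
  proof -
    note ci = gaussian_product_cis_integral[OF B(1) a, of "\<lambda>b. z \<bullet> b"]
    have eq: "(\<Prod>b\<in>B. cis ((z \<bullet> b) * f b) * complex_of_real (exp (- a * (f b)\<^sup>2 / 2))) =
       cis (z \<bullet> Y f) * complex_of_real (g f)" for f
      unfolding prod_cis_exp[OF B(1)] g_def Y_def by (simp add: inner_sum_right exp_sum[OF B(1)] mult.commute)
    note ci' = ci[unfolded eq, folded P_def]
    show "integrable P (\<lambda>f. cos (z \<bullet> Y f) * g f)"
      using integrable_Re[OF ci'(2)] by simp
    have "(LINT f|P. cos (z \<bullet> Y f) * g f) = (LINT f|P. Re (cis (z \<bullet> Y f) * complex_of_real (g f)))" by simp
    also have "\<dots> = c * exp (- (\<Sum>b\<in>B. (z \<bullet> b)\<^sup>2) / (2 * a))"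
      unfolding integral_Re[OF ci'(2)] ci'(1) Re_complex_of_real by (simp add: c_def B)
    also have "(\<Sum>b\<in>B. (z \<bullet> b)\<^sup>2) = (norm (orth_proj V z))\<^sup>2"
      using norm_orth_proj_expand[OF V B(1,6,2,3,4)] by simp
    finally show "(LINT f|P. cos (z \<bullet> Y f) * g f) = c * exp (- (norm (orth_proj V z))\<^sup>2 / (2 * a))" .
  qed
  have gint: "integrable P g" using gFT(2)[of 0] by simp
  have sh: "integrable lborel (\<lambda>\<zeta>. e (\<zeta> - y))" "(LINT \<zeta>|lborel. e (\<zeta> - y)) = cn"
     "(LINT \<zeta>|lborel. cos (z \<bullet> \<zeta>) * e (\<zeta> - y)) = cos (z \<bullet> y) * (cn * exp (- (norm z)\<^sup>2 / 2))" for y z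
  proof -
    have tr: "integrable lborel h \<Longrightarrow> integrable lborel (\<lambda>\<zeta>. h (\<zeta> - y))"
      "(LINT \<zeta>|lborel. h (\<zeta> - y)) = (LINT \<zeta>|lborel. h \<zeta>)" if [measurable]: "h \<in> borel_measurable borel" for h :: "'a \<Rightarrow> real"
    proof -
      have d: "lborel = distr lborel borel (\<lambda>x. x - y)"
      proof -
        have "(\<lambda>x. x - y) = (+) (- y)" by (auto simp: fun_eq_iff)
        then show ?thesis using lborel_distr_plus[of "- y"] by simp
      qed
      show "(LINT \<zeta>|lborel. h (\<zeta> - y)) = (LINT \<zeta>|lborel. h \<zeta>)"
        by (subst (2) d) (simp add: integral_distr)
      show "integrable lborel h \<Longrightarrow> integrable lborel (\<lambda>\<zeta>. h (\<zeta> - y))"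
        by (subst (asm) d) (simp add: integrable_distr_eq)
    qed
    show "integrable lborel (\<lambda>\<zeta>. e (\<zeta> - y))" "(LINT \<zeta>|lborel. e (\<zeta> - y)) = cn"
      using tr[of e] e0(1) e1 by simp_all
    have "cos (z \<bullet> \<zeta>) * e (\<zeta> - y) = (\<lambda>x. cos (z \<bullet> (x + y)) * e x) (\<zeta> - y)" for \<zeta> by simp
    then have "(LINT \<zeta>|lborel. cos (z \<bullet> \<zeta>) * e (\<zeta> - y)) = (LINT x|lborel. cos (z \<bullet> (x + y)) * e x)"
      using tr(2)[of "\<lambda>x. cos (z \<bullet> (x + y)) * e x"] by simp
    also have "\<dots> = (LINT x|lborel. cos (z \<bullet> y) * (cos (z \<bullet> x) * e x) - sin (z \<bullet> y) * (sin (z \<bullet> x) * e x))"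
      by (intro Bochner_Integration.integral_cong refl) (simp add: inner_add_right cos_add algebra_simps)
    also have "\<dots> = cos (z \<bullet> y) * (cn * exp (- (norm z)\<^sup>2 / 2))"
      using eint[of z] by (simp add: e0)
    finally show "(LINT \<zeta>|lborel. cos (z \<bullet> \<zeta>) * e (\<zeta> - y)) = cos (z \<bullet> y) * (cn * exp (- (norm z)\<^sup>2 / 2))" .
  qed
  have Fint: "integrable (P \<Otimes>\<^sub>M lborel) F"
  proof (rule PL.Fubini_integrable[OF F_meas])
    have "(LINT \<zeta>|lborel. norm (F (f, \<zeta>))) = g f * cn" for f
      using sh(2)[of "Y f"] g0 by (simp add: F_def abs_mult e_def)
    then show "integrable P (\<lambda>f. LINT \<zeta>|lborel. norm (F (f, \<zeta>)))" using gint by simp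
    show "AE f in P. integrable lborel (\<lambda>\<zeta>. F (f, \<zeta>))" using sh(1) by (simp add: F_def)
  qed
  have Fcos: "integrable (P \<Otimes>\<^sub>M lborel) (\<lambda>(f, \<zeta>). cos (z \<bullet> \<zeta>) * F (f, \<zeta>))" for z
    by (rule Bochner_Integration.integrable_bound[OF Fint]) (auto simp: abs_mult mult_left_le_one_le)
  have dens: "(LINT f|P. F (f, \<zeta>)) = cn * c * smooth_density a V \<zeta>" for \<zeta>
  proof -
    have "F (f, \<zeta>) = exp (- (norm (\<zeta> - orth_proj V \<zeta>))\<^sup>2 / 2) *
        (\<Prod>b\<in>B. exp (- a * (f b)\<^sup>2 / 2) * exp (- (\<zeta> \<bullet> b - f b)\<^sup>2 / 2))" for f
    proof -
      have YV: "Y f \<in> V" using B(6) V by (auto simp: Y_def intro!: subspace_sum subspace_scale)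
      have p: "orth_proj V (\<zeta> - Y f) = orth_proj V \<zeta> - Y f"
        using YV orth_proj_in[OF V, of \<zeta>] orth_proj_orth[OF V, of _ \<zeta>] V
        by (intro orth_proj_eqI) (auto simp: subspace_diff inner_diff_left)
      have Yb: "Y f \<bullet> b = f b" if "b \<in> B" for b
      proof -
        have "Y f \<bullet> b = (\<Sum>b'\<in>B. if b' = b then f b else 0)"
          unfolding Y_def inner_sum_left using B(2,3) that
          by (intro sum.cong) (auto simp: pairwise_def orthogonal_def dot_square_norm)
        then show ?thesis using that B(1) by simp
      qed
      \<comment> \<open>Since \<open>Y f\<close> lies in \<open>V\<close>, only the component along
        \<open>V\<close> sees \<open>f\<close>, and it splits into coordinates. The integral over
        \<open>f\<close> thus becomes a product of one-dimensional overlaps.\<close>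
      have "(norm (\<zeta> - Y f))\<^sup>2 = (norm (orth_proj V (\<zeta> - Y f)))\<^sup>2 + (norm (\<zeta> - orth_proj V \<zeta>))\<^sup>2"
        using orth_proj_Pythagoras[OF V, of "\<zeta> - Y f"] by (simp add: p)
      also have "(norm (orth_proj V (\<zeta> - Y f)))\<^sup>2 = (\<Sum>b\<in>B. (\<zeta> \<bullet> b - f b)\<^sup>2)"
      proof -
        have "(\<Sum>b\<in>B. ((\<zeta> - Y f) \<bullet> b)\<^sup>2) = (\<Sum>b\<in>B. (\<zeta> \<bullet> b - f b)\<^sup>2)"
          by (intro sum.cong refl) (simp add: inner_diff_left Yb)
        then show ?thesis using norm_orth_proj_expand[OF V B(1,6,2,3,4), of "\<zeta> - Y f"] by simp
      qed
      finally have "e (\<zeta> - Y f) = exp (- (norm (\<zeta> - orth_proj V \<zeta>))\<^sup>2 / 2) * (\<Prod>b\<in>B. exp (- (\<zeta> \<bullet> b - f b)\<^sup>2 / 2))"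
        using B(1) by (simp add: e_def exp_sum[symmetric] sum_negf sum_divide_distrib[symmetric] exp_add[symmetric] add_divide_distrib)
      then show ?thesis by (simp add: F_def g_def prod.distrib mult_ac)
    qed
    then have "(LINT f|P. F (f, \<zeta>)) = exp (- (norm (\<zeta> - orth_proj V \<zeta>))\<^sup>2 / 2) *
       (LINT f|P. (\<Prod>b\<in>B. exp (- a * (f b)\<^sup>2 / 2) * exp (- (\<zeta> \<bullet> b - f b)\<^sup>2 / 2)))" by simp
    also have "(LINT f|P. (\<Prod>b\<in>B. exp (- a * (f b)\<^sup>2 / 2) * exp (- (\<zeta> \<bullet> b - f b)\<^sup>2 / 2))) =
       (\<Prod>b\<in>B. sqrt (2 * pi / (1 + a)) * exp (- (a / (1 + a)) * (\<zeta> \<bullet> b)\<^sup>2 / 2))"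
      unfolding P_def
      by (subst P.product_integral_prod[OF B(1) gaussian_overlap_real(2)[OF a]])
        (simp only: gaussian_overlap_real(1)[OF a])
    also have "\<dots> = sqrt (2 * pi / (1 + a)) ^ dim V * exp (- (a / (1 + a)) * (\<Sum>b\<in>B. (\<zeta> \<bullet> b)\<^sup>2) / 2)"
      using B(1) by (simp add: prod.distrib B(5) exp_sum[symmetric] sum_negf sum_divide_distrib[symmetric] sum_distrib_left[symmetric] del: times_divide_eq_left)
    also have "(\<Sum>b\<in>B. (\<zeta> \<bullet> b)\<^sup>2) = (norm (orth_proj V \<zeta>))\<^sup>2"
      using norm_orth_proj_expand[OF V B(1,6,2,3,4)] by simp
    also have "sqrt (2 * pi / (1 + a)) ^ dim V = c * sqrt (a / (1 + a)) ^ dim V"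
      using a unfolding c_def power_mult_distrib[symmetric] real_sqrt_mult[symmetric] by simp
    finally have "(LINT f|P. F (f, \<zeta>)) = c * sqrt (a / (1 + a)) ^ dim V *
       (exp (- (norm (\<zeta> - orth_proj V \<zeta>))\<^sup>2 / 2) * exp (- (a / (1 + a)) * (norm (orth_proj V \<zeta>))\<^sup>2 / 2))"
      by (simp only: mult_ac)
    then have "(LINT f|P. F (f, \<zeta>)) = c * sqrt (a / (1 + a)) ^ dim V *
       exp (- (norm (\<zeta> - orth_proj V \<zeta>))\<^sup>2 / 2 - a / (1 + a) * (norm (orth_proj V \<zeta>))\<^sup>2 / 2)"
      unfolding exp_add[symmetric] by simp
    moreover have "cn * sqrt (1 / (2 * pi)) ^ DIM('a) = 1"
      unfolding cn_def power_mult_distrib[symmetric] real_sqrt_mult[symmetric] by simp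
    ultimately show ?thesis by (simp add: smooth_density_def)
  qed
  have "integrable lborel (\<lambda>\<zeta>. LINT f|P. F (f, \<zeta>))"
    using PL.integrable_snd[of "\<lambda>f \<zeta>. F (f, \<zeta>)"] Fint by simp
  then have "integrable lborel (\<lambda>\<zeta>. (1 / (cn * c)) * (cn * c * smooth_density a V \<zeta>))"
    unfolding dens by (rule integrable_mult_right)
  then show "integrable lborel (smooth_density a V)" using cpos by simp
  have "cn * c * (LINT \<zeta>|lborel. cos (z \<bullet> \<zeta>) * smooth_density a V \<zeta>) =
     (LINT \<zeta>|lborel. cos (z \<bullet> \<zeta>) * (LINT f|P. F (f, \<zeta>)))"
    unfolding dens by (simp flip: integral_mult_right_zero add: mult_ac)
  also have "\<dots> = (LINT \<zeta>|lborel. LINT f|P. cos (z \<bullet> \<zeta>) * F (f, \<zeta>))" by simp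
  also have "\<dots> = (LINT f|P. LINT \<zeta>|lborel. cos (z \<bullet> \<zeta>) * F (f, \<zeta>))"
    by (rule PL.Fubini_integral) (rule Fcos)
  also have "\<dots> = (LINT f|P. (cn * exp (- (norm z)\<^sup>2 / 2)) * (cos (z \<bullet> Y f) * g f))"
  proof (intro Bochner_Integration.integral_cong refl)
    fix f
    have "(LINT \<zeta>|lborel. cos (z \<bullet> \<zeta>) * F (f, \<zeta>)) = (LINT \<zeta>|lborel. g f * (cos (z \<bullet> \<zeta>) * e (\<zeta> - Y f)))"
      by (simp add: F_def mult_ac)
    also have "\<dots> = g f * (cos (z \<bullet> Y f) * (cn * exp (- (norm z)\<^sup>2 / 2)))"
      by (simp add: sh(3))
    finally show "(LINT \<zeta>|lborel. cos (z \<bullet> \<zeta>) * F (f, \<zeta>)) = (cn * exp (- (norm z)\<^sup>2 / 2)) * (cos (z \<bullet> Y f) * g f)"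
      by (simp add: mult_ac)
  qed
  also have "\<dots> = (cn * exp (- (norm z)\<^sup>2 / 2)) * (c * exp (- (norm (orth_proj V z))\<^sup>2 / (2 * a)))"
    by (simp only: integral_mult_right_zero gFT(1))
  also have "\<dots> = cn * c * (exp (- (norm z)\<^sup>2 / 2) * exp (- (norm (orth_proj V z))\<^sup>2 / (2 * a)))"
    by (simp only: mult_ac)
  also have "\<dots> = cn * c * exp (- (norm z)\<^sup>2 / 2 - (norm (orth_proj V z))\<^sup>2 / (2 * a))"
    unfolding exp_add[symmetric] by simp
  finally show "(LINT \<zeta>|lborel. cos (z \<bullet> \<zeta>) * smooth_density a V \<zeta>) =
      exp (- (norm z)\<^sup>2 / 2 - (norm (orth_proj V z))\<^sup>2 / (2 * a))"
    using cpos by simp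
qed

text \<open>The variable \<open>X\<close> separates the underlying measure space from the Euclidean
  space. A Borel probability measure and a finite point measure, which carry different
  sigma-algebras, are both handled with the identity as \<open>X\<close>.\<close>

definition double_integral :: "'b measure \<Rightarrow> ('b \<Rightarrow> 'a::euclidean_space) \<Rightarrow> ('a \<Rightarrow> real) \<Rightarrow> real" where
  "double_integral M X h = (LINT \<omega>|M. LINT \<omega>'|M. h (X \<omega> - X \<omega>'))"

lemma double_integral_integrable:
  fixes h :: "'a::euclidean_space \<Rightarrow> real"
  assumes M: "finite_measure M" and [measurable]: "X \<in> borel_measurable M" "h \<in> borel_measurable borel"
    and b: "\<And>x. \<bar>h x\<bar> \<le> b"
  shows "integrable M (\<lambda>\<omega>'. h (X \<omega> - X \<omega>'))" "integrable M (\<lambda>\<omega>. LINT \<omega>'|M. h (X \<omega> - X \<omega>'))"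
proof -
  interpret finite_measure M by (rule M)
  show i: "integrable M (\<lambda>\<omega>'. h (X \<omega> - X \<omega>'))" for \<omega>
    using b by (intro integrable_const_bound[where B = b]) auto
  have "\<bar>LINT \<omega>'|M. h (X \<omega> - X \<omega>')\<bar> \<le> (LINT \<omega>'|M. b)" for \<omega>
    by (rule order_trans[OF integral_abs_bound]) (intro integral_mono integrable_abs i b; simp)
  then show "integrable M (\<lambda>\<omega>. LINT \<omega>'|M. h (X \<omega> - X \<omega>'))"
    by (intro integrable_const_bound[where B = "LINT \<omega>'|M. b"]) auto
qed

lemma double_integral_mono_AE:
  fixes h k :: "'a::euclidean_space \<Rightarrow> real"
  assumes M: "finite_measure M" "X \<in> borel_measurable M"
    and h: "h \<in> borel_measurable borel" "\<And>x. \<bar>h x\<bar> \<le> b"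
    and k: "k \<in> borel_measurable borel" "\<And>x. \<bar>k x\<bar> \<le> b'"
    and S: "AE \<omega> in M. X \<omega> \<in> S" "\<And>x y. x \<in> S \<Longrightarrow> y \<in> S \<Longrightarrow> h (x - y) \<le> k (x - y)"
  shows "double_integral M X h \<le> double_integral M X k"
  unfolding double_integral_def
proof (rule integral_mono_AE)
  note H = double_integral_integrable[OF M h] and K = double_integral_integrable[OF M k]
  show "integrable M (\<lambda>\<omega>. LINT \<omega>'|M. h (X \<omega> - X \<omega>'))" "integrable M (\<lambda>\<omega>. LINT \<omega>'|M. k (X \<omega> - X \<omega>'))"
    by (rule H K)+
  show "AE \<omega> in M. (LINT \<omega>'|M. h (X \<omega> - X \<omega>')) \<le> (LINT \<omega>'|M. k (X \<omega> - X \<omega>'))"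
    using S(1)
  proof eventually_elim
    fix \<omega> assume "X \<omega> \<in> S"
    then have "AE \<omega>' in M. h (X \<omega> - X \<omega>') \<le> k (X \<omega> - X \<omega>')"
      using S by auto
    then show "(LINT \<omega>'|M. h (X \<omega> - X \<omega>')) \<le> (LINT \<omega>'|M. k (X \<omega> - X \<omega>'))"
      by (intro integral_mono_AE H K)
  qed
qed

text \<open>By Fubini the energy equals the integral of the squared modulus of the Fourier transform
  of the distribution of \<open>X\<close> against \<open>k\<close>; in the proof \<open>c\<close>
  and \<open>s\<close> are the real and imaginary parts of that transform.\<close>

lemma double_integral_positive_definite:
  fixes k :: "'a::euclidean_space \<Rightarrow> real"
  assumes M: "finite_measure M" and [measurable]: "X \<in> borel_measurable M"
    and k: "integrable lborel k" "\<And>\<zeta>. 0 \<le> k \<zeta>"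
  shows "0 \<le> double_integral M X (\<lambda>z. LINT \<zeta>|lborel. cos (z \<bullet> \<zeta>) * k \<zeta>)"
proof -
  interpret finite_measure M by (rule M)
  interpret PM: pair_sigma_finite M "lborel :: 'a measure" by standard
  have [measurable]: "k \<in> borel_measurable borel" using k(1) by simp
  define c where "c \<zeta> = (LINT \<omega>|M. cos (X \<omega> \<bullet> \<zeta>))" for \<zeta>
  define s where "s \<zeta> = (LINT \<omega>|M. sin (X \<omega> \<bullet> \<zeta>))" for \<zeta>
  define \<mu> where "\<mu> = measure M (space M)"
  have [measurable]: "c \<in> borel_measurable borel" "s \<in> borel_measurable borel"
    unfolding c_def s_def by measurable
  have ci: "integrable M (\<lambda>\<omega>. cos (X \<omega> \<bullet> \<zeta>))" "integrable M (\<lambda>\<omega>. sin (X \<omega> \<bullet> \<zeta>))" for \<zeta>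
    by (rule integrable_const_bound[where B = 1]; simp)+
  have kint: "integrable (M \<Otimes>\<^sub>M lborel) (\<lambda>(\<omega>, \<zeta>). k \<zeta>)"
    by (rule PM.Fubini_integrable) (use k in auto)
  have cb: "\<bar>c \<zeta>\<bar> \<le> \<mu>" "\<bar>s \<zeta>\<bar> \<le> \<mu>" for \<zeta>
  proof -
    have "\<bar>c \<zeta>\<bar> \<le> (LINT \<omega>|M. 1)" unfolding c_def
      by (rule order_trans[OF integral_abs_bound]) (intro integral_mono integrable_abs ci; simp)
    then show "\<bar>c \<zeta>\<bar> \<le> \<mu>" by (simp add: \<mu>_def)
    have "\<bar>s \<zeta>\<bar> \<le> (LINT \<omega>|M. 1)" unfolding s_def
      by (rule order_trans[OF integral_abs_bound]) (intro integral_mono integrable_abs ci; simp)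
    then show "\<bar>s \<zeta>\<bar> \<le> \<mu>" by (simp add: \<mu>_def)
  qed
  have inner: "(LINT \<omega>'|M. LINT \<zeta>|lborel. cos ((X \<omega> - X \<omega>') \<bullet> \<zeta>) * k \<zeta>) =
     (LINT \<zeta>|lborel. (cos (X \<omega> \<bullet> \<zeta>) * c \<zeta> + sin (X \<omega> \<bullet> \<zeta>) * s \<zeta>) * k \<zeta>)" for \<omega>
  proof -
    have "integrable (M \<Otimes>\<^sub>M lborel) (\<lambda>(\<omega>', \<zeta>). cos ((X \<omega> - X \<omega>') \<bullet> \<zeta>) * k \<zeta>)"
      by (rule Bochner_Integration.integrable_bound[OF kint]) (auto simp: abs_mult mult_left_le_one_le k)
    from PM.Fubini_integral[OF this]
    have "(LINT \<omega>'|M. LINT \<zeta>|lborel. cos ((X \<omega> - X \<omega>') \<bullet> \<zeta>) * k \<zeta>) =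
       (LINT \<zeta>|lborel. LINT \<omega>'|M. cos ((X \<omega> - X \<omega>') \<bullet> \<zeta>) * k \<zeta>)" by simp
    also have "\<dots> = (LINT \<zeta>|lborel. (cos (X \<omega> \<bullet> \<zeta>) * c \<zeta> + sin (X \<omega> \<bullet> \<zeta>) * s \<zeta>) * k \<zeta>)"
      using ci by (intro Bochner_Integration.integral_cong refl)
        (simp add: inner_diff_left cos_diff c_def s_def)
    finally show ?thesis .
  qed
  have "double_integral M X (\<lambda>z. LINT \<zeta>|lborel. cos (z \<bullet> \<zeta>) * k \<zeta>) =
     (LINT \<omega>|M. LINT \<zeta>|lborel. (cos (X \<omega> \<bullet> \<zeta>) * c \<zeta> + sin (X \<omega> \<bullet> \<zeta>) * s \<zeta>) * k \<zeta>)"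
    unfolding double_integral_def inner ..
  also have "\<dots> = (LINT \<zeta>|lborel. LINT \<omega>|M. (cos (X \<omega> \<bullet> \<zeta>) * c \<zeta> + sin (X \<omega> \<bullet> \<zeta>) * s \<zeta>) * k \<zeta>)"
  proof (rule PM.Fubini_integral[symmetric])
    have "integrable (M \<Otimes>\<^sub>M lborel) (\<lambda>x. 2 * \<mu> * (case x of (\<omega>, \<zeta>) \<Rightarrow> k \<zeta>))"
      using kint by (rule integrable_mult_right)
    then show "integrable (M \<Otimes>\<^sub>M lborel) (\<lambda>(\<omega>, \<zeta>). (cos (X \<omega> \<bullet> \<zeta>) * c \<zeta> + sin (X \<omega> \<bullet> \<zeta>) * s \<zeta>) * k \<zeta>)"
    proof (rule Bochner_Integration.integrable_bound)
      have "\<bar>(cos (X \<omega> \<bullet> \<zeta>) * c \<zeta> + sin (X \<omega> \<bullet> \<zeta>) * s \<zeta>) * k \<zeta>\<bar> \<le> \<bar>2 * \<mu> * k \<zeta>\<bar>" for \<omega> \<zeta>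
      proof -
        have "\<bar>cos (X \<omega> \<bullet> \<zeta>) * c \<zeta>\<bar> \<le> 1 * \<mu>" "\<bar>sin (X \<omega> \<bullet> \<zeta>) * s \<zeta>\<bar> \<le> 1 * \<mu>"
          unfolding abs_mult using cb by (intro mult_mono; simp)+
        then have "\<bar>cos (X \<omega> \<bullet> \<zeta>) * c \<zeta> + sin (X \<omega> \<bullet> \<zeta>) * s \<zeta>\<bar> \<le> 2 * \<mu>" by linarith
        then have "\<bar>cos (X \<omega> \<bullet> \<zeta>) * c \<zeta> + sin (X \<omega> \<bullet> \<zeta>) * s \<zeta>\<bar> * k \<zeta> \<le> 2 * \<mu> * k \<zeta>"
          using k by (intro mult_right_mono) auto
        then show ?thesis using k(2)[of \<zeta>] by (simp add: abs_mult \<mu>_def)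
      qed
      then show "AE x in M \<Otimes>\<^sub>M lborel. norm (case x of (\<omega>, \<zeta>) \<Rightarrow> (cos (X \<omega> \<bullet> \<zeta>) * c \<zeta> + sin (X \<omega> \<bullet> \<zeta>) * s \<zeta>) * k \<zeta>)
        \<le> norm (2 * \<mu> * (case x of (\<omega>, \<zeta>) \<Rightarrow> k \<zeta>))"
        by (auto split: prod.split)
    qed measurable
  qed
  also have "\<dots> = (LINT \<zeta>|lborel. ((c \<zeta>)\<^sup>2 + (s \<zeta>)\<^sup>2) * k \<zeta>)"
    using ci by (intro Bochner_Integration.integral_cong refl) (simp add: c_def s_def power2_eq_square)
  also have "\<dots> \<ge> 0" using k by (intro integral_nonneg_AE AE_I2) auto
  finally show ?thesis .
qed

section \<open>Average energies over directions\<close>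

lemma powr_exp_bounded:
  fixes p :: real
  assumes "0 \<le> p"
  shows "\<exists>C\<ge>1. \<forall>x\<ge>0. x powr p \<le> C * exp x"
proof -
  define N where "N = nat \<lceil>p\<rceil>"
  have N: "p \<le> real N" unfolding N_def by (rule real_nat_ceiling_ge)
  have "x powr p \<le> (1 + fact N) * exp x" if x: "x \<ge> 0" for x :: real
  proof (cases "x \<le> 1")
    case True
    have "x powr p \<le> 1" using x True assms by (intro powr_le1) auto
    also have "1 \<le> (1 + fact N) * exp x"
      using x mult_mono[of 1 "1 + fact N" 1 "exp x"] by simp
    finally show ?thesis .
  next
    case False
    then have "x powr p \<le> x powr real N" using N by (intro powr_mono) auto
    also have "\<dots> = x ^ N" using False by (simp add: powr_realpow)
    also have "\<dots> = fact N * (x ^ N / fact N)" by simp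
    also have "x ^ N / fact N \<le> exp x"
    proof -
      have "(\<lambda>n. x ^ n / fact n) sums exp x" using exp_converges[of x] by (simp add: divide_inverse mult.commute)
      then show ?thesis using x sum_le_suminf[of "\<lambda>n. x ^ n / fact n" "{N}"] by (simp add: sums_iff)
    qed
    also have "fact N * exp x \<le> (1 + fact N) * exp x" by (intro mult_right_mono) auto
    finally show ?thesis by simp
  qed
  then show ?thesis by (intro exI[of _ "1 + fact N"]) auto
qed

lemma powr_gaussian_summable:
  assumes "0 \<le> \<alpha>"
  shows "summable (\<lambda>j. exp (- (real j)\<^sup>2 / 4) * (real j + 1) powr \<alpha>)"
proof -
  obtain C where C: "C \<ge> 1" "\<And>x. x \<ge> 0 \<Longrightarrow> x powr \<alpha> \<le> C * exp x"
    using powr_exp_bounded[OF assms] by blast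
  define D where "D = 8 powr \<alpha> * C * exp (1/8)"
  have b: "exp (- (real j)\<^sup>2 / 4) * (real j + 1) powr \<alpha> \<le> D * exp (- 1/8) ^ j" for j
  proof -
    have e8: "8 * ((real j + 1) / 8) = real j + 1" by simp
    have "(8 * ((real j + 1) / 8)) powr \<alpha> = 8 powr \<alpha> * ((real j + 1) / 8) powr \<alpha>"
      by (rule powr_mult)
    then have "(real j + 1) powr \<alpha> = 8 powr \<alpha> * ((real j + 1) / 8) powr \<alpha>"
      unfolding e8 .
    also have "\<dots> \<le> 8 powr \<alpha> * (C * exp ((real j + 1) / 8))"
      by (intro mult_left_mono C) auto
    finally have 1: "(real j + 1) powr \<alpha> \<le> 8 powr \<alpha> * (C * exp ((real j + 1) / 8))" .
    have "real j \<le> (real j)\<^sup>2" by (cases j) (auto simp: power2_eq_square)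
    then have 2: "exp (- (real j)\<^sup>2 / 4) \<le> exp (- real j / 4)" by simp
    have "exp (- (real j)\<^sup>2 / 4) * (real j + 1) powr \<alpha> \<le>
       exp (- real j / 4) * (8 powr \<alpha> * (C * exp ((real j + 1) / 8)))"
      using 1 2 by (intro mult_mono) auto
    also have "\<dots> = 8 powr \<alpha> * C * (exp (- real j / 4) * exp ((real j + 1) / 8))" by simp
    also have "exp (- real j / 4) * exp ((real j + 1) / 8) = exp (1/8) * exp (- 1/8) ^ j"
      by (simp add: exp_of_nat_mult[symmetric] exp_add[symmetric] field_simps)
    finally show ?thesis by (simp add: D_def)
  qed
  have g: "summable (\<lambda>j. D * exp (- 1/8 :: real) ^ j)"
    by (intro summable_mult summable_geometric) simp
  show ?thesis
  proof (rule summable_comparison_test'[OF g, of 0])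
    fix j :: nat
    have "norm (exp (- (real j)\<^sup>2 / 4) * (real j + 1) powr \<alpha>) = exp (- (real j)\<^sup>2 / 4) * (real j + 1) powr \<alpha>"
      by (simp add: abs_mult)
    then show "norm (exp (- (real j)\<^sup>2 / 4) * (real j + 1) powr \<alpha>) \<le> D * exp (- 1/8) ^ j"
      using b[of j] by (simp only:)
  qed
qed

lemma sum_geometric_le:
  fixes q :: real
  assumes "0 \<le> q" "q < 1" "finite S"
  shows "(\<Sum>i\<in>S. q ^ i) \<le> 1 / (1 - q)"
proof -
  have "(\<Sum>i\<in>S. q ^ i) \<le> (\<Sum>i. q ^ i)"
    using assms by (intro sum_le_suminf summable_geometric) auto
  then show ?thesis using assms by (simp add: suminf_geometric)
qed

text \<open>The terms grow geometrically as long as \<open>2 ^ k * t < 1\<close> and decay at least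
  geometrically afterwards, so the sum is comparable with its largest term: the last one, or the one
  with \<open>2 ^ k\<close> near \<open>1 / t\<close>.\<close>

lemma dyadic_gaussian_sum_le:
  fixes \<sigma> :: real
  assumes \<sigma>: "\<sigma> > 0"
  shows "\<exists>C>0. \<forall>K t. t > 0 \<longrightarrow> (\<Sum>k\<le>K. (2 ^ k) powr \<sigma> * exp (- (2 ^ k * t)\<^sup>2)) \<le> C * min ((2 ^ K) powr \<sigma>) (t powr - \<sigma>)"
proof -
  define q where "q = (1/2) powr \<sigma>"
  have q: "0 < q" "q < 1" using \<sigma> powr_less_mono2[of \<sigma> "1/2" 1] by (auto simp: q_def)
  obtain C0 where C0: "C0 \<ge> 1" "\<And>x. x \<ge> 0 \<Longrightarrow> x powr \<sigma> \<le> C0 * exp x"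
    using powr_exp_bounded[of \<sigma>] \<sigma> by auto
  define C where "C = 2 * C0 / (1 - q)"
  have Cpos: "C > 0" using q C0 by (simp add: C_def)
  have pw: "(2 ^ k) powr \<sigma> = (2 powr \<sigma>) ^ k" for k :: nat
    by (simp add: powr_power mult.commute powr_realpow[symmetric] powr_powr)
  have q2: "q * 2 powr \<sigma> = 1" by (simp add: q_def powr_divide)
  have main: "(\<Sum>k\<le>K. (2 ^ k) powr \<sigma> * exp (- (2 ^ k * t)\<^sup>2)) \<le> C * (2 ^ K) powr \<sigma>"
    "(\<Sum>k\<le>K. (2 ^ k) powr \<sigma> * exp (- (2 ^ k * t)\<^sup>2)) \<le> C * t powr - \<sigma>" if t: "t > 0" for K t
  proof -
    have "(\<Sum>k\<le>K. (2 ^ k) powr \<sigma> * exp (- (2 ^ k * t)\<^sup>2)) \<le> (\<Sum>k\<le>K. (2 ^ K) powr \<sigma> * q ^ (K - k))"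
    proof (intro sum_mono)
      fix k assume k: "k \<in> {..K}"
      have "(2 powr \<sigma>) ^ K * q ^ (K - k) = (2 powr \<sigma>) ^ k * ((2 powr \<sigma>) ^ (K - k) * q ^ (K - k))"
        using k by (simp add: power_add[symmetric])
      also have "\<dots> = (2 powr \<sigma>) ^ k" using q2 by (simp add: power_mult_distrib[symmetric] mult.commute)
      finally have "(2 ^ K) powr \<sigma> * q ^ (K - k) = (2 ^ k) powr \<sigma>" by (simp add: pw)
      then show "(2 ^ k) powr \<sigma> * exp (- (2 ^ k * t)\<^sup>2) \<le> (2 ^ K) powr \<sigma> * q ^ (K - k)"
        by (simp add: mult_left_le)
    qed
    also have "\<dots> = (2 ^ K) powr \<sigma> * (\<Sum>k\<le>K. q ^ (K - k))" by (simp add: sum_distrib_left)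
    also have "(\<Sum>k\<le>K. q ^ (K - k)) = (\<Sum>k\<le>K. q ^ k)"
      using sum.nat_diff_reindex[of "\<lambda>k. q ^ k" "Suc K"] by (simp add: lessThan_Suc_atMost)
    also have "\<dots> \<le> 1 / (1 - q)" using q by (intro sum_geometric_le) auto
    also have "1 / (1 - q) \<le> C" unfolding C_def using q C0 by (intro divide_right_mono) auto
    finally show "(\<Sum>k\<le>K. (2 ^ k) powr \<sigma> * exp (- (2 ^ k * t)\<^sup>2)) \<le> C * (2 ^ K) powr \<sigma>"
      by (simp add: mult.commute mult_left_mono)
    obtain k0 where k0: "1 / t < 2 ^ k0" using real_arch_pow[of 2 "1/t"] by auto
    define ks where "ks = (LEAST k. 1 \<le> 2 ^ k * t)"
    have ks: "1 \<le> 2 ^ ks * t"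
      unfolding ks_def by (rule LeastI[of _ k0]) (use k0 t in \<open>simp add: field_simps\<close>)
    have ks': "2 ^ k * t < 1" if "k < ks" for k
      using not_less_Least[of k "\<lambda>k. 1 \<le> 2 ^ k * t"] that by (simp add: ks_def)
    have trm: "(2 ^ k) powr \<sigma> * exp (- (2 ^ k * t)\<^sup>2) \<le>
        C0 * t powr - \<sigma> * (if k < ks then q ^ (ks - Suc k) else q ^ (k - ks))" for k
    proof -
      define x where "x = 2 ^ k * t"
      have x: "x > 0" using t by (simp add: x_def)
      have xs: "(2 ^ k) powr \<sigma> = x powr \<sigma> * t powr - \<sigma>"
        using t by (simp add: x_def powr_mult powr_minus field_simps)
      have b: "x powr \<sigma> * exp (- x\<^sup>2) \<le> C0 * (if k < ks then q ^ (ks - Suc k) else q ^ (k - ks))"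
      proof (cases "k < ks")
        case True
        have "2 ^ (ks - Suc k) * x = 2 ^ (ks - 1) * t"
          unfolding x_def using True by (simp add: power_add[symmetric] mult.assoc[symmetric])
        also have "\<dots> \<le> 1" using ks'[of "ks - 1"] True by simp
        finally have "x \<le> (1/2) ^ (ks - Suc k)" by (simp add: field_simps power_divide)
        then have "x powr \<sigma> \<le> ((1/2) ^ (ks - Suc k)) powr \<sigma>" using x \<sigma> by (intro powr_mono2) auto
        also have "\<dots> = q ^ (ks - Suc k)"
          by (simp add: q_def powr_power mult.commute powr_realpow[symmetric] powr_powr)
        finally have "x powr \<sigma> * exp (- x\<^sup>2) \<le> q ^ (ks - Suc k) * 1" using q by (intro mult_mono) auto
        also have "\<dots> \<le> C0 * q ^ (ks - Suc k)" using C0 q mult_right_mono[of 1 C0 "q ^ (ks - Suc k)"] by simp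
        finally show ?thesis using True by simp
      next
        case False
        have "2 ^ (k - ks) * 1 \<le> 2 ^ (k - ks) * (2 ^ ks * t)" using ks by (intro mult_left_mono) auto
        also have "\<dots> = x" unfolding x_def using False by (simp add: power_add[symmetric] mult.assoc[symmetric])
        finally have xge: "2 ^ (k - ks) \<le> x" by simp
        have "q ^ (k - ks) = (2 ^ (k - ks)) powr - \<sigma>"
        proof -
          have "q = 1 / 2 powr \<sigma>" by (simp add: q_def powr_divide)
          then show ?thesis by (simp only: powr_minus pw power_one_over inverse_eq_divide)
        qed
        moreover have "x powr - \<sigma> \<le> (2 ^ (k - ks)) powr - \<sigma>" using xge \<sigma> by (intro powr_mono2') auto
        ultimately have xq: "x powr - \<sigma> \<le> q ^ (k - ks)" by simp
        \<comment> \<open>Applying the exponential bound to \<open>x\<^sup>2\<close> turns the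
          Gaussian decay into the decay \<open>x powr - \<sigma>\<close>, which is geometric in
          \<open>k\<close>.\<close>
        have "x powr \<sigma> * x powr \<sigma> \<le> C0 * exp (x\<^sup>2)"
          using C0(2)[of "x\<^sup>2"] x by (simp add: power2_eq_square powr_mult)
        then have "x powr \<sigma> * exp (- x\<^sup>2) \<le> C0 * x powr - \<sigma>"
          using x by (simp add: exp_minus powr_minus field_simps)
        also have "\<dots> \<le> C0 * q ^ (k - ks)" using xq C0 by (intro mult_left_mono) auto
        finally show ?thesis using False by simp
      qed
      have "(2 ^ k) powr \<sigma> * exp (- (2 ^ k * t)\<^sup>2) = t powr - \<sigma> * (x powr \<sigma> * exp (- x\<^sup>2))"
        unfolding xs by (simp add: x_def)
      also have "\<dots> \<le> t powr - \<sigma> * (C0 * (if k < ks then q ^ (ks - Suc k) else q ^ (k - ks)))"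
        by (intro mult_left_mono b) auto
      finally show ?thesis by (simp add: mult_ac)
    qed
    have "(\<Sum>k\<le>K. if k < ks then q ^ (ks - Suc k) else q ^ (k - ks)) =
       (\<Sum>k\<in>{..K} \<inter> {..<ks}. q ^ (ks - Suc k)) + (\<Sum>k\<in>{..K} \<inter> - {..<ks}. q ^ (k - ks))"
      by (subst sum.If_cases) (auto simp: lessThan_def Collect_neg_eq)
    also have "(\<Sum>k\<in>{..K} \<inter> {..<ks}. q ^ (ks - Suc k)) \<le> (\<Sum>k<ks. q ^ (ks - Suc k))"
      using q by (intro sum_mono2) auto
    also have "\<dots> = (\<Sum>k<ks. q ^ k)" by (rule sum.nat_diff_reindex)
    also have "\<dots> \<le> 1 / (1 - q)" using q by (intro sum_geometric_le) auto
    also have "(\<Sum>k\<in>{..K} \<inter> - {..<ks}. q ^ (k - ks)) = (\<Sum>i\<in>(\<lambda>k. k - ks) ` ({..K} \<inter> - {..<ks}). q ^ i)"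
      by (subst sum.reindex) (auto simp: inj_on_def)
    also have "\<dots> \<le> 1 / (1 - q)" using q by (intro sum_geometric_le) auto
    finally have sumle: "(\<Sum>k\<le>K. if k < ks then q ^ (ks - Suc k) else q ^ (k - ks)) \<le> 2 / (1 - q)" by simp
    have "(\<Sum>k\<le>K. (2 ^ k) powr \<sigma> * exp (- (2 ^ k * t)\<^sup>2)) \<le>
        (\<Sum>k\<le>K. C0 * t powr - \<sigma> * (if k < ks then q ^ (ks - Suc k) else q ^ (k - ks)))"
      by (intro sum_mono trm)
    also have "\<dots> = C0 * t powr - \<sigma> * (\<Sum>k\<le>K. if k < ks then q ^ (ks - Suc k) else q ^ (k - ks))"
      by (simp add: sum_distrib_left)
    also have "\<dots> \<le> C0 * t powr - \<sigma> * (2 / (1 - q))" using C0 sumle by (intro mult_left_mono) auto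
    finally show "(\<Sum>k\<le>K. (2 ^ k) powr \<sigma> * exp (- (2 ^ k * t)\<^sup>2)) \<le> C * t powr - \<sigma>"
      by (simp add: C_def mult_ac)
  qed
  have "(\<Sum>k\<le>K. (2 ^ k) powr \<sigma> * exp (- (2 ^ k * t)\<^sup>2)) \<le> C * min ((2 ^ K) powr \<sigma>) (t powr - \<sigma>)"
    if "t > 0" for K t using main[OF that, of K] by (simp add: min_def)
  with Cpos show ?thesis by blast
qed

lemma profile_kernel_bounds: "0 \<le> profile_kernel s r x" "profile_kernel s r x \<le> 1" "\<bar>profile_kernel s r x\<bar> \<le> 1"
  by (auto simp: profile_kernel_def)

lemma profile_kernel_measurable [measurable]:
  "profile_kernel s r \<in> borel_measurable (borel :: 'a::euclidean_space measure)"
  unfolding profile_kernel_def by measurable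

text \<open>The weights are layered by the distance of \<open>\<zeta>\<close> from \<open>V\<close>
  in steps of \<open>L = \<tau> * norm \<zeta>\<close>. Subspaces of layer \<open>j\<close> lie
  within \<open>(j + 1) * \<tau>\<close> of the unit vector along \<open>\<zeta>\<close>, and
  because \<open>L \<ge> 1\<close> the Gaussian is at most \<open>exp (- j\<^sup>2 / 4)\<close>
  there; the resulting series over \<open>j\<close> converges.\<close>

lemma frostman_weights_gaussian_sum:
  fixes m :: nat and \<alpha> s :: real
  assumes m: "1 \<le> m" and \<alpha>: "0 \<le> \<alpha>" and s: "s > 0" "real ((m - 1) * (DIM('a) - m)) + \<alpha> \<le> s"
  shows "\<exists>C>0. \<forall>(A :: 'a::euclidean_space set set) w r \<zeta> \<tau>. finite A \<longrightarrow> A \<subseteq> grassmannian m \<longrightarrow>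
    frostman_weights r s A w \<longrightarrow> 0 < r \<longrightarrow> r \<le> 1 \<longrightarrow> r \<le> \<tau> \<longrightarrow> 1 \<le> \<tau> * norm \<zeta> \<longrightarrow>
    (\<Sum>V\<in>A. w V * exp (- (norm (\<zeta> - orth_proj V \<zeta>))\<^sup>2 / 4)) \<le> C * \<tau> powr \<alpha>"
proof -
  obtain C1 where C1: "C1 > 0" and near: "\<And>(A :: 'a set set) w r e \<rho>. \<lbrakk>finite A; A \<subseteq> grassmannian m;
    frostman_weights r s A w; 0 < r; r \<le> 1; norm e = 1; r \<le> \<rho>\<rbrakk> \<Longrightarrow>
    (\<Sum>V\<in>{V\<in>A. norm (e - orth_proj V e) \<le> \<rho>}. w V) \<le> C1 * \<rho> powr \<alpha>"
    using frostman_weights_near_vector[OF m \<alpha> s] by blast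
  define c where "c = (\<lambda>j. exp (- (real j)\<^sup>2 / 4))"
  have summ: "summable (\<lambda>j. c j * (real j + 1) powr \<alpha>)"
    unfolding c_def by (rule powr_gaussian_summable[OF \<alpha>])
  define Ka where "Ka = (\<Sum>j. c j * (real j + 1) powr \<alpha>)"
  have Ka: "0 \<le> Ka" unfolding Ka_def by (rule suminf_nonneg[OF summ]) (simp add: c_def)
  have "(\<Sum>V\<in>A. w V * exp (- (norm (\<zeta> - orth_proj V \<zeta>))\<^sup>2 / 4)) \<le> (C1 * (Ka + 1)) * \<tau> powr \<alpha>"
    if A: "finite A" "A \<subseteq> grassmannian m" "frostman_weights r s A w" and r: "0 < r" "r \<le> 1" and \<tau>: "r \<le> \<tau>" "1 \<le> \<tau> * norm \<zeta>"
    for A :: "'a set set" and w r \<zeta> \<tau>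
  proof -
    have w0: "0 \<le> w V" for V using A(3) by (simp add: frostman_weights_def)
    have \<tau>0: "\<tau> > 0" using r \<tau> by simp
    have z0: "norm \<zeta> > 0" using \<tau> \<tau>0 by (auto simp: norm_ge_zero intro: ccontr)
    define L where "L = \<tau> * norm \<zeta>"
    have L: "1 \<le> L" using \<tau> by (simp add: L_def)
    \<comment> \<open>The distance of \<open>\<zeta>\<close> from a subspace is at most
      \<open>norm \<zeta> = L / \<tau>\<close>, so no layer beyond \<open>J\<close> occurs.\<close>
    define J where "J = nat \<lfloor>1 / \<tau>\<rfloor>"
    have pt: "exp (- (norm (\<zeta> - orth_proj V \<zeta>))\<^sup>2 / 4) \<le>
       (\<Sum>j\<le>J. c j * (if norm (\<zeta> - orth_proj V \<zeta>) \<le> (real j + 1) * L then 1 else 0))" if V: "V \<in> A" for V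
    proof -
      define y where "y = norm (\<zeta> - orth_proj V \<zeta>)"
      have y: "0 \<le> y" "y \<le> norm \<zeta>" using V A(2) by (auto simp: y_def intro!: norm_orth_proj_le)
      define j where "j = nat \<lfloor>y / L\<rfloor>"
      have "real j \<le> y / L" using y L by (simp add: j_def)
      then have j1: "real j * L \<le> y" using L by (simp add: field_simps)
      have "y / L \<le> real j + 1" using y L by (simp add: j_def)
      then have j2: "y \<le> (real j + 1) * L" using L by (simp add: field_simps)
      have "y / L \<le> 1 / \<tau>" using y \<tau>0 z0 by (simp add: L_def field_simps)
      then have jJ: "j \<le> J" unfolding j_def J_def by (intro nat_mono floor_mono)
      have "real j \<le> y" using j1 L mult_left_mono[of 1 L "real j"] by simp
      then have "exp (- y\<^sup>2 / 4) \<le> c j" by (simp add: c_def power_mono)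
      also have "c j = (\<Sum>i\<in>{j}. c i * (if y \<le> (real i + 1) * L then 1 else 0))" using j2 by simp
      also have "\<dots> \<le> (\<Sum>i\<le>J. c i * (if y \<le> (real i + 1) * L then 1 else 0))"
        using jJ by (intro sum_mono2) (auto simp: c_def)
      finally show ?thesis by (simp add: y_def)
    qed
    define e where "e = (1 / norm \<zeta>) *\<^sub>R \<zeta>"
    have e: "norm e = 1" using z0 by (simp add: e_def)
    have ye: "norm (\<zeta> - orth_proj V \<zeta>) = norm \<zeta> * norm (e - orth_proj V e)" if "V \<in> A" for V
    proof -
      have V: "subspace V" using that A(2) by auto
      have "\<zeta> = norm \<zeta> *\<^sub>R e" using z0 by (simp add: e_def)
      then have "\<zeta> - orth_proj V \<zeta> = norm \<zeta> *\<^sub>R (e - orth_proj V e)"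
        by (metis linear_orth_proj[OF V] linear_scale scaleR_diff_right)
      then show ?thesis by simp
    qed
    have "(\<Sum>V\<in>A. w V * exp (- (norm (\<zeta> - orth_proj V \<zeta>))\<^sup>2 / 4)) \<le>
       (\<Sum>V\<in>A. w V * (\<Sum>j\<le>J. c j * (if norm (\<zeta> - orth_proj V \<zeta>) \<le> (real j + 1) * L then 1 else 0)))"
      by (intro sum_mono mult_left_mono pt w0)
    also have "\<dots> = (\<Sum>V\<in>A. \<Sum>j\<le>J. c j * (if norm (e - orth_proj V e) \<le> (real j + 1) * \<tau> then w V else 0))"
      unfolding sum_distrib_left using ye z0 by (intro sum.cong refl) (auto simp: L_def mult_ac)
    also have "\<dots> = (\<Sum>j\<le>J. c j * (\<Sum>V\<in>A. if norm (e - orth_proj V e) \<le> (real j + 1) * \<tau> then w V else 0))"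
      by (subst sum.swap) (simp add: sum_distrib_left)
    also have "\<dots> = (\<Sum>j\<le>J. c j * (\<Sum>V\<in>{V\<in>A. norm (e - orth_proj V e) \<le> (real j + 1) * \<tau>}. w V))"
      using A(1) by (simp add: sum.inter_filter)
    also have "\<dots> \<le> (\<Sum>j\<le>J. c j * (C1 * ((real j + 1) * \<tau>) powr \<alpha>))"
    proof (intro sum_mono mult_left_mono near[OF A r e])
      fix j
      have "1 * \<tau> \<le> (real j + 1) * \<tau>" using \<tau>0 by (intro mult_right_mono) auto
      then show "r \<le> (real j + 1) * \<tau>" using \<tau> by simp
    qed (simp add: c_def)
    also have "\<dots> = C1 * \<tau> powr \<alpha> * (\<Sum>j\<le>J. c j * (real j + 1) powr \<alpha>)"
      using \<tau>0 by (simp add: sum_distrib_left powr_mult mult_ac)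
    also have "\<dots> \<le> C1 * \<tau> powr \<alpha> * (Ka + 1)"
    proof (intro mult_left_mono)
      have "(\<Sum>j\<le>J. c j * (real j + 1) powr \<alpha>) \<le> Ka"
        unfolding Ka_def by (rule sum_le_suminf[OF summ]) (auto simp: c_def)
      then show "(\<Sum>j\<le>J. c j * (real j + 1) powr \<alpha>) \<le> Ka + 1" by simp
    qed (use C1 in auto)
    finally show ?thesis by (simp add: mult_ac)
  qed
  moreover have "C1 * (Ka + 1) > 0" using C1 Ka by simp
  ultimately show ?thesis by blast
qed

text \<open>Half of the exponent normal to \<open>V\<close> is kept. The other half and the exponent
  along \<open>V\<close> together provide \<open>a * (norm \<zeta>)\<^sup>2 / 4\<close>, because
  \<open>a \<le> 1\<close> and \<open>a / (1 + a) \<ge> a / 2\<close>.\<close>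

lemma smooth_density_le:
  fixes V :: "'a::euclidean_space set"
  assumes V: "V \<in> grassmannian m" and a: "0 < a" "a \<le> 1"
  shows "smooth_density a V \<zeta> \<le> sqrt a ^ m * (exp (- (norm (\<zeta> - orth_proj V \<zeta>))\<^sup>2 / 4) * exp (- a * (norm \<zeta>)\<^sup>2 / 4))"
proof -
  have sub: "subspace V" and dim: "dim V = m" using V by (auto simp: grassmannian_def)
  define x where "x = (norm (\<zeta> - orth_proj V \<zeta>))\<^sup>2"
  define y where "y = (norm (orth_proj V \<zeta>))\<^sup>2"
  have xy: "(norm \<zeta>)\<^sup>2 = y + x" "0 \<le> x" "0 \<le> y"
    using orth_proj_Pythagoras[OF sub, of \<zeta>] by (simp_all add: x_def y_def)
  have f1: "sqrt (1 / (2 * pi)) ^ DIM('a) \<le> 1"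
    using pi_gt3 by (intro power_le_one) (auto simp: real_sqrt_le_1_iff)
  have f2: "sqrt (a / (1 + a)) ^ dim V \<le> sqrt a ^ m"
    unfolding dim using a by (intro power_mono real_sqrt_le_mono) (auto simp: field_simps)
  have "a / 2 \<le> a / (1 + a)" using a by (intro divide_left_mono) auto
  then have "a / 2 * y \<le> a / (1 + a) * y" using xy by (intro mult_right_mono) auto
  moreover have "a * x \<le> 1 * x" using a xy by (intro mult_right_mono) auto
  moreover define U where "U = a / (1 + a) * y"
  moreover have "- a * (norm \<zeta>)\<^sup>2 = - (a * y) - a * x" unfolding xy(1) by (simp add: algebra_simps)
  ultimately have e: "- x / 2 - a / (1 + a) * y / 2 \<le> - x / 4 + - a * (norm \<zeta>)\<^sup>2 / 4"
    unfolding U_def[symmetric] by linarith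
  have "smooth_density a V \<zeta> = sqrt (1 / (2 * pi)) ^ DIM('a) * sqrt (a / (1 + a)) ^ dim V * exp (- x / 2 - a / (1 + a) * y / 2)"
    by (simp add: smooth_density_def x_def y_def)
  also have "\<dots> \<le> (1 * sqrt a ^ m) * exp (- x / 4 + - a * (norm \<zeta>)\<^sup>2 / 4)"
    using a e by (intro mult_mono f1 f2) auto
  finally show ?thesis unfolding exp_add x_def by simp
qed

text \<open>
  The weighted average of the densities is dominated by a superposition of centred Gaussians, whose
  Fourier transform is comparable with the profile kernel.
\<close>

lemma frostman_weights_density_le:
  fixes m :: nat and \<alpha> s :: real
  assumes m: "1 \<le> m" and \<alpha>: "0 \<le> \<alpha>" and s: "s > 0" "real ((m - 1) * (DIM('a) - m)) + \<alpha> \<le> s"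
  shows "\<exists>C>0. \<forall>(A :: 'a::euclidean_space set set) w K \<zeta>. finite A \<longrightarrow> A \<subseteq> grassmannian m \<longrightarrow>
    frostman_weights ((1/2) ^ K) s A w \<longrightarrow>
    (\<Sum>V\<in>A. w V * smooth_density ((1/4) ^ K) V \<zeta>) \<le>
      C * (1/2) ^ (K * m) * (\<Sum>k\<le>K. (2 ^ k) powr - \<alpha> * exp (- ((1/4) ^ k) * (norm \<zeta>)\<^sup>2 / 4))"
proof -
  obtain C1 where C1: "C1 > 0" and near: "\<And>(A :: 'a set set) w r \<zeta> \<tau>. \<lbrakk>finite A; A \<subseteq> grassmannian m;
    frostman_weights r s A w; 0 < r; r \<le> 1; r \<le> \<tau>; 1 \<le> \<tau> * norm \<zeta>\<rbrakk> \<Longrightarrow>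
    (\<Sum>V\<in>A. w V * exp (- (norm (\<zeta> - orth_proj V \<zeta>))\<^sup>2 / 4)) \<le> C1 * \<tau> powr \<alpha>"
    using frostman_weights_gaussian_sum[OF m \<alpha> s] by blast
  define C where "C = exp 1 * (4 powr s + C1)"
  have C: "C > 0" using C1 by (auto simp: C_def intro!: mult_pos_pos add_nonneg_pos)
  have "(\<Sum>V\<in>A. w V * smooth_density ((1/4) ^ K) V \<zeta>) \<le>
      C * (1/2) ^ (K * m) * (\<Sum>k\<le>K. (2 ^ k) powr - \<alpha> * exp (- ((1/4) ^ k) * (norm \<zeta>)\<^sup>2 / 4))"
    if A: "finite A" "A \<subseteq> grassmannian m" "frostman_weights ((1/2) ^ K) s A w" for A :: "'a set set" and w K \<zeta>
  proof -
    define r :: real where "r = (1/2) ^ K"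
    define a :: real where "a = (1/4) ^ K"
    define N where "N = norm \<zeta>"
    have N0: "0 \<le> N" by (simp add: N_def)
    have r: "0 < r" "r \<le> 1" by (auto simp: r_def power_le_one)
    have a: "0 < a" "a \<le> 1" by (auto simp: a_def power_le_one)
    have sqa: "sqrt a = r" unfolding a_def r_def real_sqrt_power by (simp add: real_sqrt_divide)
    have w0: "0 \<le> w V" for V using A(3) by (simp add: frostman_weights_def)
    define S where "S = (\<Sum>V\<in>A. w V * exp (- (norm (\<zeta> - orth_proj V \<zeta>))\<^sup>2 / 4))"
    define G where "G = (\<lambda>k. (2 ^ k) powr - \<alpha> * exp (- ((1/4) ^ k) * N\<^sup>2 / 4))"
    have G0: "0 \<le> G k" for k by (simp add: G_def)
    have "(\<Sum>V\<in>A. w V * smooth_density a V \<zeta>) \<le>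
       (\<Sum>V\<in>A. w V * (sqrt a ^ m * (exp (- (norm (\<zeta> - orth_proj V \<zeta>))\<^sup>2 / 4) * exp (- a * N\<^sup>2 / 4))))"
      unfolding N_def using A(2) a by (intro sum_mono mult_left_mono smooth_density_le w0) auto
    also have "\<dots> = r ^ m * (S * exp (- a * N\<^sup>2 / 4))"
      unfolding sqa S_def sum_distrib_left sum_distrib_right by (intro sum.cong refl) (simp only: mult_ac)
    also have "S * exp (- a * N\<^sup>2 / 4) \<le> C * (\<Sum>k\<le>K. G k)"
    proof -
      \<comment> \<open>One Gaussian of the sum suffices for each \<open>\<zeta>\<close>: the one
        with \<open>2 ^ k\<close> comparable to \<open>N\<close>, with \<open>k\<close> cut off at 0
        and at \<open>K\<close>.\<close>
      have "\<exists>k\<le>K. S * exp (- a * N\<^sup>2 / 4) \<le> C * G k"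
      proof (cases "N \<le> 1")
        case True
        have "S \<le> (\<Sum>V\<in>A. w V)" unfolding S_def by (intro sum_mono mult_left_le w0) auto
        also have "\<dots> \<le> 4 powr s" using r by (intro frostman_weights_total[OF A(3,2)]) (auto simp: r_def)
        finally have S4: "S \<le> 4 powr s" .
        have "S * exp (- a * N\<^sup>2 / 4) \<le> 4 powr s * 1" using a by (intro mult_mono S4) auto
        also have "\<dots> \<le> (4 powr s + C1) * (exp 1 * exp (- 1 / 4))"
          unfolding exp_add[symmetric] using C1 by (intro mult_mono) auto
        also have "\<dots> = C * exp (- 1 / 4)" by (simp add: C_def)
        also have "\<dots> \<le> C * G 0"
          using True N0 C by (intro mult_left_mono) (auto simp: G_def power_le_one)
        finally show ?thesis by blast
      next
        case False
        have small: "S * exp (- a * N\<^sup>2 / 4) \<le> C1 * (2 ^ k) powr - \<alpha> * exp (- a * N\<^sup>2 / 4)" if k: "k \<le> K" "2 ^ k \<le> N" for k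
        proof (intro mult_right_mono)
          have "S \<le> C1 * ((1/2) ^ k) powr \<alpha>"
            unfolding S_def
          proof (rule near[OF A])
            show "(1/2 :: real) ^ K \<le> (1/2) ^ k" using k by (intro power_decreasing) auto
            show "1 \<le> (1/2) ^ k * norm \<zeta>" using k by (simp add: N_def field_simps)
          qed (simp_all add: power_le_one)
          also have "((1/2 :: real) ^ k) powr \<alpha> = (2 ^ k) powr - \<alpha>"
            by (simp add: powr_minus power_divide powr_divide inverse_eq_divide)
          finally show "S \<le> C1 * (2 ^ k) powr - \<alpha>" .
        qed simp
        have CC: "C1 * x \<le> C * (exp (- 1) * x)" if "0 \<le> x" for x
        proof -
          have "C * exp (- 1) = 4 powr s + C1" by (simp add: C_def exp_minus)
          then have "C1 \<le> C * exp (- 1)" by simp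
          from mult_right_mono[OF this that] show ?thesis by (simp add: mult.assoc)
        qed
        show ?thesis
        proof (cases "2 ^ K \<le> N")
          case True
          \<comment> \<open>Beyond \<open>2 ^ K\<close> the estimate for the weights stays at its
            finest scale, and the isotropic factor is exactly the exponential of the last
            Gaussian.\<close>
          have "S * exp (- a * N\<^sup>2 / 4) \<le> C1 * G K" using small[of K] True by (simp add: G_def a_def)
          also have "\<dots> \<le> C * (exp (- 1) * G K)" by (rule CC[OF G0])
          also have "\<dots> \<le> C * (1 * G K)" using C G0 by (intro mult_left_mono mult_right_mono) auto
          finally show ?thesis by auto
        next
          case False2: False
          define j where "j = (LEAST j. N < 2 ^ j)"
          have j1: "N < 2 ^ j" unfolding j_def by (rule LeastI[of _ K]) (use False2 in simp)
          have j2: "j \<le> K" unfolding j_def by (rule Least_le) (use False2 in simp)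
          have "j \<noteq> 0" using j1 False by (intro notI) simp
          then obtain k where k: "j = Suc k" by (cases j) auto
          have "\<not> N < 2 ^ k" using not_less_Least[of k "\<lambda>j. N < 2 ^ j"] k by (simp add: j_def)
          then have k2: "2 ^ k \<le> N" by simp
          have kK: "k \<le> K" using j2 k by simp
          \<comment> \<open>Here \<open>2 ^ k \<le> N < 2 ^ (k + 1)\<close>, so the exponential in
            the \<open>k\<close>-th term is at least \<open>exp (- 1)\<close>, which the factor
            \<open>exp 1\<close> in \<open>C\<close> compensates.\<close>
          have "N\<^sup>2 \<le> (2 * 2 ^ k)\<^sup>2" using j1 k N0 by (intro power_mono) auto
          also have "\<dots> = 4 * 4 ^ k" by (simp add: power_mult_distrib power_mult[symmetric] mult.commute[of k] power_mult)
          finally have "(1/4) ^ k * N\<^sup>2 / 4 \<le> 1" by (simp add: power_divide field_simps)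
          then have ex: "exp (- 1) \<le> exp (- ((1/4) ^ k) * N\<^sup>2 / 4)" by simp
          have "S * exp (- a * N\<^sup>2 / 4) \<le> C1 * (2 ^ k) powr - \<alpha> * exp (- a * N\<^sup>2 / 4)" by (rule small[OF kK k2])
          also have "\<dots> \<le> C1 * (2 ^ k) powr - \<alpha> * 1" using C1 a by (intro mult_left_mono) auto
          also have "\<dots> \<le> C * (exp (- 1) * (2 ^ k) powr - \<alpha>)" using CC by simp
          also have "\<dots> \<le> C * (exp (- ((1/4) ^ k) * N\<^sup>2 / 4) * (2 ^ k) powr - \<alpha>)"
            using C ex by (intro mult_left_mono mult_right_mono) auto
          also have "\<dots> = C * G k" by (simp add: G_def mult.commute)
          finally show ?thesis using kK by blast
        qed
      qed
      then obtain k where k: "k \<le> K" "S * exp (- a * N\<^sup>2 / 4) \<le> C * G k" by blast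
      note k(2)
      also have "C * G k \<le> C * (\<Sum>k\<le>K. G k)"
        using k(1) C G0 by (intro mult_left_mono member_le_sum) auto
      finally show ?thesis .
    qed
    finally have "(\<Sum>V\<in>A. w V * smooth_density a V \<zeta>) \<le> r ^ m * (C * (\<Sum>k\<le>K. G k))"
      using r by simp
    then show ?thesis by (simp add: r_def a_def G_def N_def power_mult mult_ac)
  qed
  with C show ?thesis by blast
qed

lemma double_integral_cmult:
  "double_integral M X (\<lambda>z. c * h z) = c * double_integral M X h"
  by (simp add: double_integral_def)

lemma double_integral_diff:
  fixes h k :: "'a::euclidean_space \<Rightarrow> real"
  assumes M: "finite_measure M" "X \<in> borel_measurable M"
    and h: "h \<in> borel_measurable borel" "\<And>x. \<bar>h x\<bar> \<le> b"
    and k: "k \<in> borel_measurable borel" "\<And>x. \<bar>k x\<bar> \<le> b'"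
  shows "double_integral M X (\<lambda>z. h z - k z) = double_integral M X h - double_integral M X k"
  unfolding double_integral_def
  using double_integral_integrable[OF M h] double_integral_integrable[OF M k] by simp

lemma double_integral_sum:
  fixes h :: "'i \<Rightarrow> 'a::euclidean_space \<Rightarrow> real"
  assumes M: "finite_measure M" "X \<in> borel_measurable M"
    and h: "\<And>i. i \<in> I \<Longrightarrow> h i \<in> borel_measurable borel" "\<And>i x. i \<in> I \<Longrightarrow> \<bar>h i x\<bar> \<le> b i"
  shows "double_integral M X (\<lambda>z. \<Sum>i\<in>I. h i z) = (\<Sum>i\<in>I. double_integral M X (h i))"
proof -
  have i: "integrable M (\<lambda>\<omega>'. h i (X \<omega> - X \<omega>'))" "integrable M (\<lambda>\<omega>. LINT \<omega>'|M. h i (X \<omega> - X \<omega>'))" if "i \<in> I" for i \<omega>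
    by (rule double_integral_integrable[OF M h(1)[OF that], of "b i"], rule h(2)[OF that])+
  then show ?thesis unfolding double_integral_def by simp
qed

lemma double_integral_exp_orth_proj:
  fixes V :: "'a::euclidean_space set"
  assumes V: "subspace V" and c: "c \<ge> 0"
  shows "(\<lambda>z. exp (- (norm (orth_proj V z))\<^sup>2 * c)) \<in> borel_measurable borel"
    "\<bar>exp (- (norm (orth_proj V z))\<^sup>2 * c)\<bar> \<le> 1"
proof -
  have [measurable]: "orth_proj V \<in> borel_measurable borel"
    by (intro borel_measurable_continuous_onI linear_continuous_on bounded_linear_orth_proj V)
  show "(\<lambda>z. exp (- (norm (orth_proj V z))\<^sup>2 * c)) \<in> borel_measurable borel" by measurable
  show "\<bar>exp (- (norm (orth_proj V z))\<^sup>2 * c)\<bar> \<le> 1" using c by simp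
qed

text \<open>Multiplied by \<open>exp (- (norm z)\<^sup>2 / 2)\<close>, the slab kernel is the
  Fourier transform of \<open>smooth_density\<close>; on differences of norm at most
  \<open>D\<close> this costs a factor \<open>exp (D\<^sup>2 / 2)\<close>. The inequality
  \<open>p \<le> q\<close> between densities becomes one between the energies of their transforms by
  positive definiteness of the transform of \<open>q - p\<close>. The transforms of the Gaussians in
  \<open>q\<close> form a dyadic series dominated by the profile kernel.\<close>

theorem frostman_weights_energy:
  fixes m :: nat and \<gamma> s D :: real
  assumes m: "1 \<le> m" "m \<le> DIM('a)" and \<gamma>: "0 \<le> \<gamma>" "\<gamma> \<le> real DIM('a) - real m"
    and s: "s > 0" "real m * (real DIM('a) - real m) - \<gamma> \<le> s"
  shows "\<exists>C>0. \<forall>(A :: 'a::euclidean_space set set) w K (M :: 'b measure) X S. finite A \<longrightarrow> A \<subseteq> grassmannian m \<longrightarrow>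
    frostman_weights ((1/2) ^ K) s A w \<longrightarrow> finite_measure M \<longrightarrow> X \<in> borel_measurable M \<longrightarrow>
    (AE \<omega> in M. X \<omega> \<in> S) \<longrightarrow> (\<forall>x\<in>S. \<forall>y\<in>S. norm (x - y) \<le> D) \<longrightarrow>
    (\<Sum>V\<in>A. w V * double_integral M X (\<lambda>z. exp (- (norm (orth_proj V z))\<^sup>2 * (4 ^ K / 2)))) \<le>
      C * (2 ^ K) powr \<gamma> * double_integral M X (profile_kernel (m + \<gamma>) ((1/2) ^ K))"
proof -
  define n where "n = DIM('a)"
  define \<alpha> where "\<alpha> = real n - real m - \<gamma>"
  define \<sigma> where "\<sigma> = real m + \<gamma>"
  have \<alpha>: "0 \<le> \<alpha>" using \<gamma> by (simp add: \<alpha>_def n_def)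
  have \<sigma>: "\<sigma> > 0" using m \<gamma> by (simp add: \<sigma>_def)
  \<comment> \<open>The number \<open>\<alpha>\<close> is what the threshold
    \<open>m (n - m) - \<gamma>\<close> leaves after subtracting the dimension
    \<open>(m - 1) (n - m)\<close> of the subspaces through a vector.\<close>
  have "real ((m - 1) * (DIM('a) - m)) + \<alpha> = real m * (real DIM('a) - real m) - \<gamma>"
  proof -
    have "real ((m - 1) * (DIM('a) - m)) = (real m - 1) * (real DIM('a) - real m)"
      using m by (simp add: of_nat_diff)
    then show ?thesis by (simp add: \<alpha>_def n_def algebra_simps)
  qed
  then have s': "real ((m - 1) * (DIM('a) - m)) + \<alpha> \<le> s" using s by simp
  obtain C1 where C1: "C1 > 0" and dens: "\<And>(A :: 'a set set) w K \<zeta>. \<lbrakk>finite A; A \<subseteq> grassmannian m;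
    frostman_weights ((1/2) ^ K) s A w\<rbrakk> \<Longrightarrow>
    (\<Sum>V\<in>A. w V * smooth_density ((1/4) ^ K) V \<zeta>) \<le>
      C1 * (1/2) ^ (K * m) * (\<Sum>k\<le>K. (2 ^ k) powr - \<alpha> * exp (- ((1/4) ^ k) * (norm \<zeta>)\<^sup>2 / 4))"
    using frostman_weights_density_le[OF m(1) \<alpha> s(1) s'] by blast
  obtain C2 where C2: "C2 > 0" and dy: "\<And>K t. t > 0 \<Longrightarrow>
     (\<Sum>k\<le>K. (2 ^ k) powr \<sigma> * exp (- (2 ^ k * t)\<^sup>2)) \<le> C2 * min ((2 ^ K) powr \<sigma>) (t powr - \<sigma>)"
    using dyadic_gaussian_sum_le[OF \<sigma>] by blast
  define \<kappa> where "\<kappa> = (2 * sqrt pi) ^ n"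
  have \<kappa>: "\<kappa> > 0" by (simp add: \<kappa>_def)
  define C where "C = exp (D\<^sup>2 / 2) * (C1 * \<kappa> * (C2 + 1))"
  have C: "C > 0" using C1 C2 \<kappa> by (simp add: C_def)
  have "(\<Sum>V\<in>A. w V * double_integral M X (\<lambda>z. exp (- (norm (orth_proj V z))\<^sup>2 * (4 ^ K / 2)))) \<le>
      C * (2 ^ K) powr \<gamma> * double_integral M X (profile_kernel (m + \<gamma>) ((1/2) ^ K))"
    if A: "finite A" "A \<subseteq> grassmannian m" "frostman_weights ((1/2) ^ K) s A w"
      and M: "finite_measure M" "X \<in> borel_measurable M"
      and S: "AE \<omega> in M. X \<omega> \<in> S" "\<forall>x\<in>S. \<forall>y\<in>S. norm (x - y) \<le> D"
    for A :: "'a set set" and w K and M :: "'b measure" and X S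
  proof -
    define a :: real where "a = (1/4) ^ K"
    have a: "a > 0" by (simp add: a_def)
    have a2: "1 / (2 * a) = 4 ^ K / 2" by (simp add: a_def power_divide)
    have w0: "0 \<le> w V" for V using A(3) by (simp add: frostman_weights_def)
    have sub: "subspace V" if "V \<in> A" for V using A(2) that by auto
    define p where "p = (\<lambda>\<zeta>. \<Sum>V\<in>A. w V * smooth_density a V \<zeta>)"
    define c where "c = C1 * (1/2) ^ (K * m)"
    have c: "c > 0" using C1 by (simp add: c_def)
    define q where "q = (\<lambda>\<zeta>::'a. \<Sum>k\<le>K. c * (2 ^ k) powr - \<alpha> * exp (- ((1/4) ^ k / 2) * (norm \<zeta>)\<^sup>2 / 2))"
    define g where "g = (\<lambda>z. \<Sum>V\<in>A. w V * exp (- (norm z)\<^sup>2 / 2 - (norm (orth_proj V z))\<^sup>2 / (2 * a)))"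
    define Q where "Q = (\<lambda>z::'a. \<Sum>k\<le>K. c * (2 ^ k) powr - \<alpha> * (\<kappa> * 2 ^ (k * n) * exp (- (2 ^ k * norm z)\<^sup>2)))"
    define h where "h = (\<lambda>z. \<Sum>V\<in>A. w V * exp (- (norm (orth_proj V z))\<^sup>2 * (4 ^ K / 2)))"
    define W where "W = sum w A"
    have pq: "p \<zeta> \<le> q \<zeta>" for \<zeta>
      using dens[OF A, of \<zeta>] by (simp add: p_def q_def c_def a_def sum_distrib_left mult.assoc)
    have cosint: "integrable lborel (\<lambda>\<zeta>. cos (z \<bullet> \<zeta>) * f \<zeta>)" if "integrable lborel f" for f :: "'a \<Rightarrow> real" and z
    proof (rule Bochner_Integration.integrable_bound[OF that])
      have [measurable]: "f \<in> borel_measurable borel" using that by simp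
      show "(\<lambda>\<zeta>. cos (z \<bullet> \<zeta>) * f \<zeta>) \<in> borel_measurable lborel" by measurable
      show "AE x in lborel. norm (cos (z \<bullet> x) * f x) \<le> norm (f x)"
        by (simp add: abs_mult mult_left_le_one_le)
    qed
    have si: "integrable lborel (smooth_density a V)" if "V \<in> A" for V
      by (rule smooth_density_Fourier(2)[OF sub[OF that] a])
    have pint: "integrable lborel p" unfolding p_def using si by (intro Bochner_Integration.integrable_sum integrable_mult_right) auto
    have gi: "integrable lborel (\<lambda>\<zeta>::'a. exp (- ((1/4) ^ k / 2) * (norm \<zeta>)\<^sup>2 / 2))" for k :: nat
      by (rule gaussian_cos_integral(3)) simp
    have qint: "integrable lborel q" unfolding q_def by (intro Bochner_Integration.integrable_sum integrable_mult_right gi)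
    have pF: "(LINT \<zeta>|lborel. cos (z \<bullet> \<zeta>) * p \<zeta>) = g z" for z
    proof -
      have "(LINT \<zeta>|lborel. cos (z \<bullet> \<zeta>) * p \<zeta>) = (LINT \<zeta>|lborel. (\<Sum>V\<in>A. w V * (cos (z \<bullet> \<zeta>) * smooth_density a V \<zeta>)))"
        by (simp add: p_def sum_distrib_left mult_ac)
      also have "\<dots> = (\<Sum>V\<in>A. w V * (LINT \<zeta>|lborel. cos (z \<bullet> \<zeta>) * smooth_density a V \<zeta>))"
        using cosint[OF si] by (subst Bochner_Integration.integral_sum) (auto intro!: integrable_mult_right)
      also have "\<dots> = g z" unfolding g_def
        by (intro sum.cong refl) (simp only: smooth_density_Fourier(1)[OF sub a])
      finally show ?thesis .
    qed
    have qF: "(LINT \<zeta>|lborel. cos (z \<bullet> \<zeta>) * q \<zeta>) = Q z" for z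
    proof -
      have one: "(LINT \<zeta>|lborel. cos (z \<bullet> \<zeta>) * exp (- ((1/4) ^ k / 2) * (norm \<zeta>)\<^sup>2 / 2)) =
          \<kappa> * 2 ^ (k * n) * exp (- (2 ^ k * norm z)\<^sup>2)" for k :: nat
      proof -
        define b :: real where "b = (1/4) ^ k / 2"
        have b: "b > 0" by (simp add: b_def)
        have "2 * pi / b = (2 * sqrt pi * 2 ^ k)\<^sup>2"
          by (simp add: b_def power_mult_distrib power_divide power_mult[symmetric] mult.commute[of k] power_mult)
        then have "sqrt (2 * pi / b) = 2 * sqrt pi * 2 ^ k" by simp
        then have 1: "sqrt (2 * pi / b) ^ DIM('a) = \<kappa> * 2 ^ (k * n)"
          by (simp add: \<kappa>_def n_def power_mult_distrib power_mult[symmetric])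
        have "(norm z)\<^sup>2 / (2 * b) = (2 ^ k * norm z)\<^sup>2"
          by (simp add: b_def power_mult_distrib power_divide power_mult[symmetric] mult.commute[of k] power_mult)
        then have 2: "- (norm z)\<^sup>2 / (2 * b) = - (2 ^ k * norm z)\<^sup>2" by simp
        show ?thesis using gaussian_cos_integral(1)[OF b, of z] unfolding 1 2 unfolding b_def .
      qed
      have "(LINT \<zeta>|lborel. cos (z \<bullet> \<zeta>) * q \<zeta>) = (LINT \<zeta>|lborel. (\<Sum>k\<le>K. c * (2 ^ k) powr - \<alpha> * (cos (z \<bullet> \<zeta>) * exp (- ((1/4) ^ k / 2) * (norm \<zeta>)\<^sup>2 / 2))))"
        unfolding q_def sum_distrib_left by (intro Bochner_Integration.integral_cong sum.cong refl) (simp only: mult_ac)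
      also have "\<dots> = (\<Sum>k\<le>K. c * (2 ^ k) powr - \<alpha> * (LINT \<zeta>|lborel. cos (z \<bullet> \<zeta>) * exp (- ((1/4) ^ k / 2) * (norm \<zeta>)\<^sup>2 / 2)))"
        by (subst Bochner_Integration.integral_sum; (intro integrable_mult_right cosint gi)?) (simp only: integral_mult_right_zero)
      also have "\<dots> = Q z" unfolding one Q_def ..
      finally show ?thesis .
    qed
    have FT: "(LINT \<zeta>|lborel. cos (z \<bullet> \<zeta>) * (q \<zeta> - p \<zeta>)) = Q z - g z" for z
      unfolding right_diff_distrib pF[symmetric] qF[symmetric]
      by (rule Bochner_Integration.integral_diff) (intro cosint pint qint)+
    have "0 \<le> double_integral M X (\<lambda>z. LINT \<zeta>|lborel. cos (z \<bullet> \<zeta>) * (q \<zeta> - p \<zeta>))"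
      using pq by (intro double_integral_positive_definite M Bochner_Integration.integrable_diff pint qint) simp
    then have "0 \<le> double_integral M X (\<lambda>z. Q z - g z)" unfolding FT .
    moreover have Qm: "Q \<in> borel_measurable borel"
      unfolding Q_def by (intro borel_measurable_continuous_onI continuous_intros)
    moreover have Q0: "0 \<le> Q z" for z unfolding Q_def using c \<kappa> by (intro sum_nonneg) auto
    moreover have Qb: "\<bar>Q z\<bar> \<le> Q 0" for z
      using Q0[of z] c \<kappa> unfolding Q_def by (auto intro!: sum_mono mult_left_mono)
    moreover have gm: "g \<in> borel_measurable borel"
    proof -
      have [measurable]: "orth_proj V \<in> borel_measurable borel" if "V \<in> A" for V
        by (intro borel_measurable_continuous_onI linear_continuous_on bounded_linear_orth_proj sub that)
      show ?thesis unfolding g_def by measurable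
    qed
    moreover have g0: "0 \<le> g z" for z unfolding g_def using w0 by (intro sum_nonneg) auto
    moreover have gb: "\<bar>g z\<bar> \<le> W" for z
    proof -
      have "exp (- (norm z)\<^sup>2 / 2 - (norm (orth_proj V z))\<^sup>2 / (2 * a)) \<le> 1" for V
      proof -
        have "0 \<le> (norm (orth_proj V z))\<^sup>2 / (2 * a)" using a by simp
        moreover have "0 \<le> (norm z)\<^sup>2" by simp
        ultimately show ?thesis unfolding exp_le_one_iff by linarith
      qed
      then have "g z \<le> W" unfolding g_def W_def using w0
        by (intro sum_mono mult_left_le)
      then show ?thesis using g0[of z] by simp
    qed
    ultimately have gQ: "double_integral M X g \<le> double_integral M X Q"
      using double_integral_diff[OF M, of Q "Q 0" g W] by simp
    have em: "(\<lambda>z. exp (- (norm (orth_proj V z))\<^sup>2 * (4 ^ K / 2))) \<in> borel_measurable borel" if "V \<in> A" for V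
      by (rule double_integral_exp_orth_proj(1)[OF sub[OF that]]) simp
    have hm: "h \<in> borel_measurable borel" unfolding h_def
      by (intro borel_measurable_sum borel_measurable_times borel_measurable_const em)
    have h0: "0 \<le> h z" for z unfolding h_def using w0 by (intro sum_nonneg) auto
    have hb: "\<bar>h z\<bar> \<le> W" for z
    proof -
      have "h z \<le> W" unfolding h_def W_def using w0 by (intro sum_mono mult_left_le) auto
      then show ?thesis using h0[of z] by simp
    qed
    have eD: "exp (D\<^sup>2 / 2) * g z = (\<Sum>V\<in>A. w V * exp (- (norm (orth_proj V z))\<^sup>2 * (4 ^ K / 2)) * exp (D\<^sup>2 / 2 - (norm z)\<^sup>2 / 2))" for z
    proof -
      have e: "exp (D\<^sup>2 / 2) * exp (- (norm z)\<^sup>2 / 2 - (norm (orth_proj V z))\<^sup>2 / (2 * a)) =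
         exp (- (norm (orth_proj V z))\<^sup>2 * (4 ^ K / 2)) * exp (D\<^sup>2 / 2 - (norm z)\<^sup>2 / 2)" for V
        unfolding exp_add[symmetric] a2[symmetric] by simp
      show ?thesis unfolding g_def sum_distrib_left
        using e by (intro sum.cong refl) (simp only: mult.left_commute mult.assoc)
    qed
    have hg: "h z \<le> exp (D\<^sup>2 / 2) * g z" if z: "norm z \<le> D" for z
      unfolding eD h_def
    proof (intro sum_mono)
      fix V
      have "(norm z)\<^sup>2 \<le> D\<^sup>2" using z by (intro power_mono) auto
      then have "1 \<le> exp (D\<^sup>2 / 2 - (norm z)\<^sup>2 / 2)" by simp
      from mult_left_mono[OF this, of "w V * exp (- (norm (orth_proj V z))\<^sup>2 * (4 ^ K / 2))"]
      show "w V * exp (- (norm (orth_proj V z))\<^sup>2 * (4 ^ K / 2)) \<le>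
        w V * exp (- (norm (orth_proj V z))\<^sup>2 * (4 ^ K / 2)) * exp (D\<^sup>2 / 2 - (norm z)\<^sup>2 / 2)"
        using w0 by simp
    qed
    have "(\<Sum>V\<in>A. w V * double_integral M X (\<lambda>z. exp (- (norm (orth_proj V z))\<^sup>2 * (4 ^ K / 2)))) = double_integral M X h"
      unfolding h_def double_integral_cmult[symmetric]
    proof (rule double_integral_sum[OF M, symmetric, where b = w])
      fix V assume V: "V \<in> A"
      show "(\<lambda>z. w V * exp (- (norm (orth_proj V z))\<^sup>2 * (4 ^ K / 2))) \<in> borel_measurable borel"
        by (intro borel_measurable_times borel_measurable_const em V)
      show "\<bar>w V * exp (- (norm (orth_proj V z))\<^sup>2 * (4 ^ K / 2))\<bar> \<le> w V" for z
        using w0[of V] by (simp add: abs_mult mult_left_le)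
    qed
    also have "\<dots> \<le> double_integral M X (\<lambda>z. exp (D\<^sup>2 / 2) * g z)"
    proof (rule double_integral_mono_AE[OF M hm hb])
      show "(\<lambda>z. exp (D\<^sup>2 / 2) * g z) \<in> borel_measurable borel" using gm by simp
      show "\<bar>exp (D\<^sup>2 / 2) * g z\<bar> \<le> exp (D\<^sup>2 / 2) * W" for z using gb by (simp add: abs_mult)
      show "AE \<omega> in M. X \<omega> \<in> S" by (rule S)
      show "h (x - y) \<le> exp (D\<^sup>2 / 2) * g (x - y)" if "x \<in> S" "y \<in> S" for x y
        using S(2) that by (intro hg) auto
    qed
    also have "\<dots> \<le> exp (D\<^sup>2 / 2) * double_integral M X Q"
      unfolding double_integral_cmult using gQ by simp
    also have "double_integral M X Q \<le> double_integral M X (\<lambda>z. (C1 * \<kappa> * (C2 + 1) * (2 ^ K) powr \<gamma>) * profile_kernel \<sigma> ((1/2) ^ K) z)"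
    proof (rule double_integral_mono_AE[OF M Qm Qb, where S = UNIV])
      define B where "B = C1 * \<kappa> * (C2 + 1) * (2 ^ K) powr \<gamma>"
      have B: "B > 0" using C1 C2 \<kappa> by (simp add: B_def)
      show "(\<lambda>z. B * profile_kernel \<sigma> ((1/2) ^ K) z) \<in> borel_measurable borel" by measurable
      show "\<bar>B * profile_kernel \<sigma> ((1/2) ^ K) z\<bar> \<le> B" for z
        using B profile_kernel_bounds[of \<sigma> "(1/2) ^ K" z] by (simp add: abs_mult mult_left_le)
      have "Q z \<le> B * profile_kernel \<sigma> ((1/2) ^ K) z" for z
      proof -
        define T where "T = (\<Sum>k\<le>K. (2 ^ k) powr \<sigma> * exp (- (2 ^ k * norm z)\<^sup>2))"
        have QT: "Q z = c * \<kappa> * T"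
        proof -
          \<comment> \<open>The transform of the \<open>k\<close>-th Gaussian contributes
            \<open>2 ^ (k * n)\<close>, and \<open>n - \<alpha> = m + \<gamma>\<close>: this
            produces the exponent of the profile kernel.\<close>
          have "(2 ^ k) powr - \<alpha> * 2 ^ (k * n) = (2 ^ k :: real) powr \<sigma>" for k
          proof -
            have "2 ^ (k * n) = (2 ^ k :: real) powr real n" by (simp add: powr_realpow power_mult)
            then show ?thesis by (simp add: powr_add[symmetric] \<alpha>_def \<sigma>_def add.commute)
          qed
          then have "c * (2 ^ k) powr - \<alpha> * (\<kappa> * 2 ^ (k * n) * x) = c * \<kappa> * ((2 ^ k) powr \<sigma> * x)" for k x
            by (simp add: mult_ac)
          then show ?thesis unfolding Q_def T_def sum_distrib_left by (intro sum.cong refl) blast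
        qed
        have cK: "c * (2 ^ K) powr \<sigma> = C1 * (2 ^ K) powr \<gamma>"
        proof -
          have "(2 ^ K :: real) powr \<sigma> = 2 ^ (K * m) * (2 ^ K) powr \<gamma>"
            by (simp add: \<sigma>_def powr_add powr_realpow power_mult)
          then show ?thesis by (simp add: c_def power_divide)
        qed
        have Tb: "T \<le> (C2 + 1) * ((2 ^ K) powr \<sigma> * profile_kernel \<sigma> ((1/2) ^ K) z)"
        proof (cases "z = 0")
          case False
          have "T \<le> C2 * min ((2 ^ K) powr \<sigma>) (norm z powr - \<sigma>)" unfolding T_def using False by (intro dy) simp
          also have "min ((2 ^ K) powr \<sigma>) (norm z powr - \<sigma>) = (2 ^ K) powr \<sigma> * profile_kernel \<sigma> ((1/2) ^ K) z"
          proof -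
            have "(2 ^ K) powr \<sigma> * (((1/2) ^ K / norm z) powr \<sigma>) = norm z powr - \<sigma>"
              using False by (simp add: powr_divide powr_mult power_divide powr_minus inverse_eq_divide)
            then show ?thesis using False by (simp add: profile_kernel_def min_mult_distrib_left)
          qed
          also have "C2 * \<dots> \<le> (C2 + 1) * \<dots>"
            by (intro mult_right_mono mult_nonneg_nonneg profile_kernel_bounds(1)) auto
          finally show ?thesis .
        next
          case True
          have pos: "0 < (1/2 :: real)" by simp
          have "T = (\<Sum>k\<le>K. (2 ^ k) powr \<sigma>)" using True by (simp add: T_def)
          \<comment> \<open>The dyadic estimate requires \<open>t > 0\<close>, so the value at 0 is
            approached from below: \<open>t\<close> is chosen such that the smallest exponential
            factor equals the given \<open>x < 1\<close>.\<close>
          also have "\<dots> \<le> (C2 + 1) * (2 ^ K) powr \<sigma>"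
          proof (rule field_le_mult_one_interval)
            fix x :: real assume x: "0 < x" "x < 1"
            define t where "t = sqrt (- ln x) / 2 ^ K"
            have lx: "- ln x > 0" using x by simp
            have t: "t > 0" using lx by (simp add: t_def)
            have "x * (\<Sum>k\<le>K. (2 ^ k) powr \<sigma>) \<le> (\<Sum>k\<le>K. (2 ^ k) powr \<sigma> * exp (- (2 ^ k * t)\<^sup>2))"
              unfolding sum_distrib_left
            proof (intro sum_mono)
              fix k assume k: "k \<in> {..K}"
              have "(2 ^ k * t)\<^sup>2 \<le> (2 ^ K * t)\<^sup>2" using k t by (intro power_mono mult_right_mono power_increasing) auto
              also have "\<dots> = - ln x" using lx by (simp add: t_def)
              finally have "exp (ln x) \<le> exp (- (2 ^ k * t)\<^sup>2)" by simp
              then have "x \<le> exp (- (2 ^ k * t)\<^sup>2)" using x by simp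
              from mult_left_mono[OF this, of "(2 ^ k) powr \<sigma>"]
              show "x * (2 ^ k) powr \<sigma> \<le> (2 ^ k) powr \<sigma> * exp (- (2 ^ k * t)\<^sup>2)" by (simp add: mult.commute)
            qed
            also have "\<dots> \<le> C2 * min ((2 ^ K) powr \<sigma>) (t powr - \<sigma>)" by (rule dy[OF t])
            also have "\<dots> \<le> (C2 + 1) * (2 ^ K) powr \<sigma>" using C2 by (intro mult_mono) auto
            finally show "x * (\<Sum>k\<le>K. (2 ^ k) powr \<sigma>) \<le> (C2 + 1) * (2 ^ K) powr \<sigma>" .
          qed
          finally show ?thesis using True by (simp add: profile_kernel_def)
        qed
        have "Q z \<le> c * \<kappa> * ((C2 + 1) * ((2 ^ K) powr \<sigma> * profile_kernel \<sigma> ((1/2) ^ K) z))"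
          unfolding QT using c \<kappa> by (intro mult_left_mono Tb) auto
        also have "\<dots> = (c * (2 ^ K) powr \<sigma>) * \<kappa> * (C2 + 1) * profile_kernel \<sigma> ((1/2) ^ K) z" by (simp only: mult_ac)
        also have "\<dots> = B * profile_kernel \<sigma> ((1/2) ^ K) z" unfolding cK B_def by (simp only: mult_ac)
        finally show ?thesis .
      qed
      then show "Q (x - y) \<le> B * profile_kernel \<sigma> ((1/2) ^ K) (x - y)" for x y by blast
    qed auto
    finally show ?thesis by (simp only: double_integral_cmult C_def \<sigma>_def mult_ac) simp
  qed
  with C show ?thesis by blast
qed

section \<open>Directions with large slab energy\<close>

definition slab_energy :: "nat \<Rightarrow> 'b measure \<Rightarrow> ('b \<Rightarrow> 'a::euclidean_space) \<Rightarrow> 'a set \<Rightarrow> real" where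
  "slab_energy K M X V = double_integral M X (\<lambda>z. exp (- (norm (orth_proj V z))\<^sup>2 * (4 ^ K / 2)))"

text \<open>Put Frostman weights on a net of \<open>B\<close> at scale \<open>2^-K\<close>. The
  bound for the average energy limits their sum, and the balls produced with the weights, enlarged
  by the mesh of the net, cover \<open>B\<close> at a cost controlled by the same sum. The measure
  \<open>M\<close> may depend on the finite set \<open>A\<close>; this freedom serves the Hausdorff
  dimension, where energies are controlled only through a cluster point.\<close>

theorem content_large_slab_energy:
  fixes m :: nat and \<gamma> s D :: real
  assumes m: "1 \<le> m" "m \<le> DIM('a)" and \<gamma>: "0 \<le> \<gamma>" "\<gamma> \<le> real DIM('a) - real m"
    and s: "s > 0" "real m * (real DIM('a) - real m) - \<gamma> \<le> s"
  shows "\<exists>C>0. \<forall>(B :: 'a::euclidean_space set set) K e lam. B \<subseteq> grassmannian m \<longrightarrow> 0 < lam \<longrightarrow>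
    (\<forall>A\<subseteq>B. finite A \<longrightarrow> (\<exists>(M :: 'b measure) X S. finite_measure M \<and> X \<in> borel_measurable M \<and>
       (AE \<omega> in M. X \<omega> \<in> S) \<and> (\<forall>x\<in>S. \<forall>y\<in>S. norm (x - y) \<le> D) \<and>
       double_integral M X (profile_kernel (m + \<gamma>) ((1/2) ^ K)) \<le> e \<and> (\<forall>V\<in>A. lam \<le> slab_energy K M X V))) \<longrightarrow>
    hausdorff_content (grassmannian m) grassmann_dist s 2 B \<le> ennreal (C * (2 ^ K) powr \<gamma> * e / lam)"
proof -
  obtain C1 where C1: "C1 > 0" and energy: "\<And>(A :: 'a set set) w K (M :: 'b measure) X S. \<lbrakk>finite A; A \<subseteq> grassmannian m;
    frostman_weights ((1/2) ^ K) s A w; finite_measure M; X \<in> borel_measurable M;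
    AE \<omega> in M. X \<omega> \<in> S; \<forall>x\<in>S. \<forall>y\<in>S. norm (x - y) \<le> D\<rbrakk> \<Longrightarrow>
    (\<Sum>V\<in>A. w V * slab_energy K M X V) \<le> C1 * (2 ^ K) powr \<gamma> * double_integral M X (profile_kernel (m + \<gamma>) ((1/2) ^ K))"
    using frostman_weights_energy[OF m \<gamma> s, of D, where 'b = 'b] unfolding slab_energy_def by blast
  define C where "C = 8 powr s * C1"
  have C: "C > 0" using C1 by (simp add: C_def)
  have "hausdorff_content (grassmannian m) grassmann_dist s 2 B \<le> ennreal (C * (2 ^ K) powr \<gamma> * e / lam)"
    if B: "B \<subseteq> grassmannian m" and lam: "0 < lam" and
      H: "\<forall>A\<subseteq>B. finite A \<longrightarrow> (\<exists>(M :: 'b measure) X S. finite_measure M \<and> X \<in> borel_measurable M \<and>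
       (AE \<omega> in M. X \<omega> \<in> S) \<and> (\<forall>x\<in>S. \<forall>y\<in>S. norm (x - y) \<le> D) \<and>
       double_integral M X (profile_kernel (m + \<gamma>) ((1/2) ^ K)) \<le> e \<and> (\<forall>V\<in>A. lam \<le> slab_energy K M X V))"
    for B :: "'a set set" and K e lam
  proof -
    define r :: real where "r = (1/2) ^ K"
    have r: "r > 0" by (simp add: r_def)
    obtain A where A: "A \<subseteq> B" "finite A" "\<forall>V\<in>B. \<exists>a\<in>A. grassmann_dist a V \<le> r"
      using grassmannian_finite_net[OF B r] by auto
    have AG: "A \<subseteq> grassmannian m" using A B by auto
    obtain M :: "'b measure" and X S where M: "finite_measure M" "X \<in> borel_measurable M"
       "AE \<omega> in M. X \<omega> \<in> S" "\<forall>x\<in>S. \<forall>y\<in>S. norm (x - y) \<le> D"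
       and e: "double_integral M X (profile_kernel (m + \<gamma>) ((1/2) ^ K)) \<le> e" and large: "\<forall>V\<in>A. lam \<le> slab_energy K M X V"
      using H A(1,2) by metis
    have sub: "subspace a" if "a \<in> A" for a using AG that by auto
    have "\<exists>w F. (\<forall>a. 0 \<le> w a) \<and>
      (\<forall>a\<in>A. \<forall>\<rho>\<ge>r. (\<Sum>b\<in>{b\<in>A. grassmann_dist a b \<le> \<rho>}. w b) \<le> (2 * \<rho>) powr s) \<and>
      finite F \<and> (\<forall>x\<in>F. fst x \<in> A \<and> r \<le> snd x) \<and> (\<forall>b\<in>A. \<exists>x\<in>F. grassmann_dist (fst x) b \<le> 3 * snd x) \<and>
      (\<Sum>x\<in>F. snd x powr s) \<le> sum w A"
      by (rule discrete_Frostman[OF A(2) r s(1)])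
        (auto simp: grassmann_dist_refl grassmann_dist_commute intro!: grassmann_dist_triangle sub)
    then obtain w F where w: "\<forall>a. 0 \<le> w a"
      "\<forall>a\<in>A. \<forall>\<rho>\<ge>r. (\<Sum>b\<in>{b\<in>A. grassmann_dist a b \<le> \<rho>}. w b) \<le> (2 * \<rho>) powr s"
      and F: "finite F" "\<forall>x\<in>F. fst x \<in> A \<and> r \<le> snd x" "\<forall>b\<in>A. \<exists>x\<in>F. grassmann_dist (fst x) b \<le> 3 * snd x"
      and Fw: "(\<Sum>x\<in>F. snd x powr s) \<le> sum w A" by auto
    have fw: "frostman_weights ((1/2) ^ K) s A w"
      using w by (simp add: frostman_weights_def r_def)
    have "lam * sum w A = (\<Sum>V\<in>A. w V * lam)" by (simp add: sum_distrib_left mult.commute)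
    also have "\<dots> \<le> (\<Sum>V\<in>A. w V * slab_energy K M X V)" using large w by (intro sum_mono mult_left_mono) auto
    also have "\<dots> \<le> C1 * (2 ^ K) powr \<gamma> * double_integral M X (profile_kernel (m + \<gamma>) ((1/2) ^ K))"
      by (rule energy[OF A(2) AG fw M])
    also have "\<dots> \<le> C1 * (2 ^ K) powr \<gamma> * e" using e C1 by (intro mult_left_mono) auto
    finally have wle: "sum w A \<le> C1 * (2 ^ K) powr \<gamma> * e / lam" using lam by (simp add: field_simps)
    \<comment> \<open>Radius \<open>3 * snd x\<close> reaches the net, and the mesh
      \<open>r \<le> snd x\<close> adds one more; two points of \<open>W x\<close> are then at most
      \<open>8 * snd x\<close> apart.\<close>
    define W where "W x = {V \<in> grassmannian m. grassmann_dist (fst x) V \<le> 4 * snd x}" for x :: "'a set \<times> real"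
    have "hausdorff_content (grassmannian m) grassmann_dist s 2 B \<le> ennreal (\<Sum>x\<in>F. (8 * snd x) powr s)"
    proof (rule hausdorff_content_le_finite[OF F(1) s(1)])
      show "W x \<subseteq> grassmannian m" for x by (auto simp: W_def)
      show "grassmann_dist a b \<le> 8 * snd x" if "x \<in> F" "a \<in> W x" "b \<in> W x" for x a b
      proof -
        have "subspace (fst x)" "subspace a" "subspace b" using that F(2) sub by (auto simp: W_def)
        from grassmann_dist_triangle[OF this(2,1,3)] show ?thesis
          using that by (auto simp: W_def grassmann_dist_commute)
      qed
      show "grassmann_dist a b \<le> 2" if "x \<in> F" "a \<in> W x" "b \<in> W x" for x a b
        using that by (intro grassmann_dist_le_2) (auto simp: W_def)
      show "0 \<le> 8 * snd x" if "x \<in> F" for x using F(2) r that by fastforce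
      show "B \<subseteq> (\<Union>x\<in>F. W x)"
      proof
        fix V assume V: "V \<in> B"
        then obtain a where a: "a \<in> A" "grassmann_dist a V \<le> r" using A(3) by blast
        then obtain x where x: "x \<in> F" "grassmann_dist (fst x) a \<le> 3 * snd x" using F(3) by blast
        have VG: "V \<in> grassmannian m" using V B by auto
        have "grassmann_dist (fst x) V \<le> grassmann_dist (fst x) a + grassmann_dist a V"
        proof (rule grassmann_dist_triangle)
          show "subspace (fst x)" "subspace a" "subspace V" using x(1) F(2) a(1) VG by (auto intro: sub)
        qed
        then have "grassmann_dist (fst x) V \<le> 4 * snd x" using a x F(2) by fastforce
        then show "V \<in> (\<Union>x\<in>F. W x)" using x(1) VG by (auto simp: W_def)
      qed
    qed
    also have "(\<Sum>x\<in>F. (8 * snd x) powr s) = 8 powr s * (\<Sum>x\<in>F. snd x powr s)"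
      using F(2) r by (simp add: sum_distrib_left powr_mult)
    also have "ennreal \<dots> \<le> ennreal (8 powr s * (C1 * (2 ^ K) powr \<gamma> * e / lam))"
      using Fw wle by (intro ennreal_leI mult_left_mono) auto
    also have "8 powr s * (C1 * (2 ^ K) powr \<gamma> * e / lam) = C * (2 ^ K) powr \<gamma> * e / lam"
      by (simp add: C_def)
    finally show ?thesis .
  qed
  note main = this
  show ?thesis
  proof (rule exI[of _ C], intro conjI allI impI)
    show "C > 0" by (rule C)
  qed (rule main)
qed

text \<open>Cauchy-Schwarz over the pieces: the sum of the squared masses is the product mass of the
  union of the \<open>D i \<times> D i\<close>, and there the kernel is at least
  \<open>exp (- 1/2)\<close>.\<close>

lemma slab_energy_disjoint_pieces:
  fixes X :: "'b \<Rightarrow> 'a::euclidean_space" and D :: "'i \<Rightarrow> 'b set"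
  assumes M: "finite_measure M" and X: "X \<in> borel_measurable M" and V: "subspace V" and I: "finite I"
    and D: "\<And>i. i \<in> I \<Longrightarrow> D i \<in> sets M" "disjoint_family_on D I"
      "\<And>i x y. i \<in> I \<Longrightarrow> x \<in> D i \<Longrightarrow> y \<in> D i \<Longrightarrow> norm (orth_proj V (X x - X y)) \<le> (1/2) ^ K"
  shows "(\<Sum>i\<in>I. measure M (D i))\<^sup>2 \<le> exp (1/2) * card I * slab_energy K M X V"
proof -
  interpret finite_measure M by (rule M)
  let ?h = "\<lambda>z. exp (- (norm (orth_proj V z))\<^sup>2 * (4 ^ K / 2))"
  note h = double_integral_exp_orth_proj[OF V, of "4 ^ K / 2"]
  note hi = double_integral_integrable[OF M X h(1), of 1, OF _ h(2)]
  have ind: "integrable M (indicat_real (D i))" if "i \<in> I" for i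
    using D(1)[OF that] by (intro integrable_const_bound[where B = 1]) auto
  have pt: "(\<Sum>i\<in>I. indicat_real (D i) x * indicat_real (D i) y) \<le> exp (1/2) * ?h (X x - X y)" for x y
  proof (cases "\<exists>i\<in>I. x \<in> D i \<and> y \<in> D i")
    case True
    then obtain i where i: "i \<in> I" "x \<in> D i" "y \<in> D i" by blast
    have "(\<Sum>j\<in>I. indicat_real (D j) x * indicat_real (D j) y) = (\<Sum>j\<in>I. if j = i then 1 else 0)"
      using D(2) i by (intro sum.cong refl) (auto simp: disjoint_family_on_def indicator_def)
    also have "\<dots> = 1" using i I by simp
    also have "1 \<le> exp (1/2) * ?h (X x - X y)"
    proof -
      have "(norm (orth_proj V (X x - X y)))\<^sup>2 \<le> ((1/2) ^ K)\<^sup>2"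
        using D(3)[OF i] by (intro power_mono) auto
      also have "((1/2 :: real) ^ K)\<^sup>2 = 1 / 4 ^ K" by (simp add: power_divide power_mult[symmetric] mult.commute[of K] power_mult)
      finally have "0 \<le> 1/2 + - (norm (orth_proj V (X x - X y)))\<^sup>2 * (4 ^ K / 2)" by (simp add: field_simps)
      then show ?thesis unfolding exp_add[symmetric] by simp
    qed
    finally show ?thesis .
  next
    case False
    then have "(\<Sum>j\<in>I. indicat_real (D j) x * indicat_real (D j) y) = 0"
      by (intro sum.neutral) (auto simp: indicator_def)
    then show ?thesis by simp
  qed
  have "(\<Sum>i\<in>I. measure M (D i))\<^sup>2 \<le> (\<Sum>i\<in>I. (measure M (D i))\<^sup>2) * card I"
    by (rule sum_squared_le_sum_of_squares)
  also have "(\<Sum>i\<in>I. (measure M (D i))\<^sup>2) = (LINT x|M. LINT y|M. (\<Sum>i\<in>I. indicat_real (D i) x * indicat_real (D i) y))"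
  proof -
    have "(LINT x|M. LINT y|M. (\<Sum>i\<in>I. indicat_real (D i) x * indicat_real (D i) y)) =
        (LINT x|M. (\<Sum>i\<in>I. indicat_real (D i) x * measure M (D i)))"
      using ind D(1) by simp
    also have "\<dots> = (\<Sum>i\<in>I. (measure M (D i))\<^sup>2)"
      using ind D(1) by (simp add: power2_eq_square)
    finally show ?thesis by simp
  qed
  also have "\<dots> \<le> (LINT x|M. LINT y|M. exp (1/2) * ?h (X x - X y))"
  proof (rule integral_mono)
    have "(LINT y|M. (\<Sum>i\<in>I. indicat_real (D i) x * indicat_real (D i) y)) = (\<Sum>i\<in>I. indicat_real (D i) x * measure M (D i))" for x
      using ind D(1) by simp
    then show "integrable M (\<lambda>x. LINT y|M. (\<Sum>i\<in>I. indicat_real (D i) x * indicat_real (D i) y))"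
      using ind by simp
    show "integrable M (\<lambda>x. LINT y|M. exp (1/2) * ?h (X x - X y))" using hi(2) by simp
    show "(LINT y|M. (\<Sum>i\<in>I. indicat_real (D i) x * indicat_real (D i) y)) \<le> (LINT y|M. exp (1/2) * ?h (X x - X y))" for x
      using ind hi(1) pt by (intro integral_mono) auto
  qed
  also have "\<dots> = exp (1/2) * slab_energy K M X V" by (simp add: slab_energy_def double_integral_def)
  finally show ?thesis by (simp add: mult_right_mono mult_ac)
qed

section \<open>Covering numbers\<close>

lemma covering_number_cover:
  fixes E :: "'a::euclidean_space set"
  assumes "bounded E" "r > 0"
  shows "\<exists>F. finite F \<and> card F = covering_number r E \<and> (\<forall>U\<in>F. bounded U \<and> diameter U = r) \<and> E \<subseteq> \<Union>F"
proof -
  let ?P = "\<lambda>k. \<exists>F. finite F \<and> card F = k \<and> (\<forall>U\<in>F. bounded U \<and> diameter U = r) \<and> E \<subseteq> \<Union>F"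
  have "\<exists>k. ?P k"
  proof -
    have cE: "compact (closure E)" using assms(1) by (simp add: compact_closure)
    have cv: "closure E \<subseteq> (\<Union>x\<in>closure E. ball x (r/2))" using assms(2) by auto
    obtain T where T: "T \<subseteq> closure E" "finite T" "closure E \<subseteq> (\<Union>x\<in>T. ball x (r/2))"
      by (rule compactE_image[OF cE _ cv]) auto
    have "E \<subseteq> \<Union>((\<lambda>x. cball x (r/2)) ` T)"
    proof
      fix y assume "y \<in> E"
      then obtain x where x: "x \<in> T" "y \<in> ball x (r/2)" using T(3) closure_subset[of E] by blast
      then have "y \<in> cball x (r/2)" by simp
      with x(1) show "y \<in> \<Union>((\<lambda>x. cball x (r/2)) ` T)" by blast
    qed
    \<comment> \<open>The definition demands diameter equal to \<open>r\<close>, and closed balls of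
      radius \<open>r / 2\<close> attain it exactly.\<close>
    moreover have "\<forall>U\<in>(\<lambda>x. cball x (r/2)) ` T. bounded U \<and> diameter U = r"
      using assms(2) by auto
    ultimately show ?thesis using T(2) by blast
  qed
  then show ?thesis unfolding covering_number_def by (rule LeastI_ex)
qed

text \<open>Closing the sets of a cover does not increase their number or change their diameters,
  and a finite union of closed sets is closed; so a cover of \<open>B\<close> yields one of
  \<open>closure B\<close>. The closure is what the Baire argument for the packing dimension
  produces.\<close>

lemma covering_number_mono:
  fixes A B :: "'a::euclidean_space set"
  assumes "A \<subseteq> closure B" "bounded B" "r > 0"
  shows "covering_number r A \<le> covering_number r B"
proof -
  obtain F where F: "finite F" "card F = covering_number r B" "\<forall>U\<in>F. bounded U \<and> diameter U = r" "B \<subseteq> \<Union>F"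
    using covering_number_cover[OF assms(2,3)] by blast
  have "closure B \<subseteq> \<Union>(closure ` F)"
    using F(1,4) closure_subset by (intro closure_minimal closed_Union) (auto, blast)
  then have "A \<subseteq> \<Union>(closure ` F)" using assms(1) by blast
  moreover have "\<forall>U\<in>closure ` F. bounded U \<and> diameter U = r" using F(3) by (auto simp: diameter_closure)
  ultimately have "covering_number r A \<le> card (closure ` F)"
    unfolding covering_number_def using F(1) by (intro Least_le exI[of _ "closure ` F"]) auto
  also have "\<dots> \<le> card F" using F(1) by (rule card_image_le)
  finally show ?thesis using F(2) by simp
qed

lemma covering_number_pos:
  fixes A :: "'a::euclidean_space set"
  assumes "A \<noteq> {}" "bounded A" "r > 0"
  shows "covering_number r A \<ge> 1"
proof -
  obtain F where F: "finite F" "card F = covering_number r A" "A \<subseteq> \<Union>F"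
    using covering_number_cover[OF assms(2,3)] by blast
  then have "F \<noteq> {}" using assms(1) by auto
  then have "card F \<noteq> 0" using F(1) by simp
  then show ?thesis using F by simp
qed

text \<open>The preimages of the closed covering sets, made disjoint, exhaust
  \<open>closure E\<close>, which has full measure. Each projects into a set of diameter
  \<open>r \<le> 2^-K\<close>, so pieces of total mass at least 1 enter the Cauchy-Schwarz
  estimate.\<close>

lemma covering_number_slab_energy:
  fixes E :: "'a::euclidean_space set"
  assumes E: "bounded E" and V: "subspace V" and r: "0 < r" "r \<le> (1/2) ^ K"
    and \<mu>: "\<mu> \<in> borel_prob_measures_on (closure E)"
  shows "1 \<le> exp (1/2) * covering_number r (orth_proj V ` E) * slab_energy K \<mu> (\<lambda>x. x) V"
proof -
  have ps: "prob_space \<mu>" and sets: "sets \<mu> = sets borel" and null: "emeasure \<mu> (- closure E) = 0"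
    using \<mu> by (auto simp: borel_prob_measures_on_def)
  interpret prob_space \<mu> by (rule ps)
  have sp: "space \<mu> = UNIV" using sets_eq_imp_space_eq[OF sets] by simp
  have bl: "bounded_linear (orth_proj V)" by (rule bounded_linear_orth_proj[OF V])
  have cont: "continuous_on A (orth_proj V)" for A by (rule linear_continuous_on[OF bl])
  obtain F where F: "finite F" "card F = covering_number r (orth_proj V ` E)"
    "\<forall>U\<in>F. bounded U \<and> diameter U = r" "orth_proj V ` E \<subseteq> \<Union>F"
    using covering_number_cover[OF bounded_linear_image[OF E bl] r(1)] by blast
  obtain h where h: "bij_betw h {..<card F} F"
    using ex_bij_betw_nat_finite[OF F(1)] by (auto simp: atLeast0LessThan)
  define T where "T i = orth_proj V -` closure (h i)" for i
  define D where "D i = T i - (\<Union>j<i. T j)" for i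
  have closedT: "closed (T i)" for i unfolding T_def by (intro closed_vimage cont closed_closure)
  have Tm: "T i \<in> sets \<mu>" for i using closedT sets by simp
  have Dm: "D i \<in> sets \<mu>" for i unfolding D_def using Tm by auto
  have UT: "(\<Union>i<card F. D i) = (\<Union>i<card F. T i)"
  proof (intro equalityI subsetI)
    fix x assume "x \<in> (\<Union>i<card F. T i)"
    then obtain i where i: "i < card F" "x \<in> T i" by blast
    define j where "j = (LEAST j. x \<in> T j)"
    have j: "x \<in> T j" unfolding j_def by (rule LeastI[of _ i]) (rule i(2))
    have "j \<le> i" unfolding j_def by (rule Least_le) (rule i(2))
    moreover have "x \<notin> T l" if "l < j" for l using not_less_Least that unfolding j_def by blast
    ultimately show "x \<in> (\<Union>i<card F. D i)" using j i(1) by (auto simp: D_def intro!: bexI[of _ j])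
  qed (auto simp: D_def)
  have cov: "closure E \<subseteq> (\<Union>i<card F. T i)"
  proof (rule closure_minimal)
    show "closed (\<Union>i<card F. T i)" using closedT by (intro closed_UN) simp_all
    show "E \<subseteq> (\<Union>i<card F. T i)"
    proof
      fix x assume "x \<in> E"
      then obtain U where "U \<in> F" "orth_proj V x \<in> U" using F(4) by blast
      moreover then obtain i where "i < card F" "h i = U" using h unfolding bij_betw_def by (metis imageE lessThan_iff)
      ultimately show "x \<in> (\<Union>i<card F. T i)" using closure_subset[of U] by (auto simp: T_def)
    qed
  qed
  have dis: "disjoint_family_on D {..<card F}"
    unfolding disjoint_family_on_def D_def
  proof (intro ballI impI)
    fix i j :: nat assume "i \<noteq> j"
    then consider "i < j" | "j < i" by linarith
    then show "(T i - (\<Union>j<i. T j)) \<inter> (T j - (\<Union>i<j. T i)) = {}" by cases auto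
  qed
  have "1 = prob (closure E)"
  proof -
    have "prob (- closure E) = 0" using null by (simp add: measure_def)
    then show ?thesis using prob_compl[of "- closure E"] sets by (simp add: sp Compl_eq_Diff_UNIV[symmetric])
  qed
  also have "\<dots> \<le> prob (\<Union>i<card F. D i)"
    unfolding UT using cov Tm by (intro finite_measure_mono) auto
  also have "\<dots> = (\<Sum>i<card F. prob (D i))"
    using dis Dm by (intro finite_measure_finite_Union) auto
  finally have "1 \<le> (\<Sum>i<card F. prob (D i))" .
  then have "1 \<le> (\<Sum>i<card F. prob (D i))\<^sup>2" by simp
  also have "\<dots> \<le> exp (1/2) * card {..<card F} * slab_energy K \<mu> (\<lambda>x. x) V"
  proof (rule slab_energy_disjoint_pieces[OF finite_measure_axioms _ V])
    show "(\<lambda>x. x) \<in> borel_measurable \<mu>" using sets by (simp add: measurable_cong_sets[OF sets refl])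
    show "norm (orth_proj V (x - y)) \<le> (1/2) ^ K" if "i \<in> {..<card F}" "x \<in> D i" "y \<in> D i" for i x y
    proof -
      have "h i \<in> F" using that h by (auto simp: bij_betw_def)
      then have "bounded (closure (h i))" "diameter (closure (h i)) = r" using F(3) by (auto simp: diameter_closure)
      moreover have "orth_proj V x \<in> closure (h i)" "orth_proj V y \<in> closure (h i)" using that by (auto simp: D_def T_def)
      ultimately have "dist (orth_proj V x) (orth_proj V y) \<le> r" using diameter_bounded_bound by metis
      then show ?thesis using r by (simp add: dist_norm linear_diff[OF linear_orth_proj[OF V]])
    qed
  qed (use Dm dis in auto)
  finally show ?thesis using F(2) by simp
qed

section \<open>Box dimensions\<close>

lemma profile_kernel_doubling:
  assumes "0 < r" "r \<le> 2 * r'" "0 \<le> s"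
  shows "profile_kernel s r x \<le> 2 powr s * profile_kernel s r' x"
proof (cases "x = 0")
  case True
  then show ?thesis using assms by (simp add: profile_kernel_def ge_one_powr_ge_zero)
next
  case False
  have "(r / norm x) powr s \<le> (2 * (r' / norm x)) powr s"
    using assms False by (intro powr_mono2) (auto simp: field_simps)
  also have "\<dots> = 2 powr s * (r' / norm x) powr s" by (rule powr_mult)
  finally have "(r / norm x) powr s \<le> 2 powr s * (r' / norm x) powr s" .
  moreover have "1 \<le> 2 powr s" using assms by (intro ge_one_powr_ge_zero) auto
  ultimately show ?thesis using False
    by (simp add: profile_kernel_def min_mult_distrib_left min_le_iff_disj)
qed

definition min_energy :: "real \<Rightarrow> real \<Rightarrow> 'a::euclidean_space set \<Rightarrow> real" where
  "min_energy s r E = (INF \<mu>\<in>borel_prob_measures_on (closure E). double_integral \<mu> (\<lambda>x. x) (profile_kernel s r))"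

lemma capacity_eq_min_energy: "capacity s r E = 1 / min_energy s r E"
  by (simp add: capacity_def min_energy_def double_integral_def)

lemma borel_prob_measures_onD:
  assumes "\<mu> \<in> borel_prob_measures_on K" "closed K"
  shows "finite_measure \<mu>" "prob_space \<mu>" "(\<lambda>x. x) \<in> borel_measurable \<mu>" "AE x in \<mu>. x \<in> K" "sets \<mu> = sets borel"
proof -
  show sets: "sets \<mu> = sets borel" and ps: "prob_space \<mu>" using assms by (auto simp: borel_prob_measures_on_def)
  then show "finite_measure \<mu>" by (simp add: prob_space_def)
  show "(\<lambda>x. x) \<in> borel_measurable \<mu>" by (simp add: measurable_cong_sets[OF sets refl])
  have "- K \<in> null_sets \<mu>" using assms sets by (auto simp: null_sets_def borel_prob_measures_on_def)
  from AE_not_in[OF this] show "AE x in \<mu>. x \<in> K" by simp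
qed

lemma double_integral_profile_mono:
  assumes \<mu>: "\<mu> \<in> borel_prob_measures_on (closure E)" and r: "0 < r" "r \<le> 2 * r'" "0 \<le> s"
  shows "double_integral \<mu> (\<lambda>x. x) (profile_kernel s r) \<le> 2 powr s * double_integral \<mu> (\<lambda>x. x) (profile_kernel s r')"
  unfolding double_integral_cmult[symmetric]
proof (rule double_integral_mono_AE[where b = 1 and b' = "2 powr s" and S = UNIV])
  show "\<bar>2 powr s * profile_kernel s r' x\<bar> \<le> 2 powr s" for x :: 'a
    using profile_kernel_bounds[of s r' x] by (simp add: abs_mult mult_left_le)
qed (use borel_prob_measures_onD[OF \<mu>] profile_kernel_bounds profile_kernel_doubling[OF r] in auto)

lemma borel_prob_measures_on_nonempty:
  assumes "E \<noteq> {}"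
  shows "borel_prob_measures_on (closure E) \<noteq> {}"
proof -
  obtain x where x: "x \<in> closure E" using assms closure_subset by blast
  have "return borel x \<in> borel_prob_measures_on (closure E)"
    using x by (auto simp: borel_prob_measures_on_def prob_space_return emeasure_return indicator_def)
  then show ?thesis by blast
qed

lemma double_integral_profile_nonneg: "0 \<le> double_integral M X (profile_kernel s r)"
  unfolding double_integral_def by (intro Bochner_Integration.integral_nonneg profile_kernel_bounds)

lemma bdd_below_energies: "bdd_below ((\<lambda>\<mu>. double_integral \<mu> (\<lambda>x. x) (profile_kernel s r)) ` A)"
  by (rule bdd_belowI[of _ 0]) (auto intro: double_integral_profile_nonneg)

text \<open>On a bounded set the kernel is bounded below by its value at a bound for the diameter.
  Positivity guarantees that the quotient in \<open>capacity\<close> is not the default value of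
  \<open>1 / 0\<close>.\<close>

lemma min_energy_pos:
  fixes E :: "'a::euclidean_space set"
  assumes E: "bounded E" "E \<noteq> {}" and r: "r > 0" "s \<ge> 0"
  shows "min_energy s r E > 0"
proof -
  obtain D0 where D0: "\<And>x y. x \<in> closure E \<Longrightarrow> y \<in> closure E \<Longrightarrow> dist x y \<le> D0"
    using diameter_bounded_bound[OF bounded_closure[OF E(1)]] by blast
  define D where "D = max 1 D0"
  define \<delta> where "\<delta> = min 1 ((r / D) powr s)"
  have D: "D > 0" "\<And>x y. x \<in> closure E \<Longrightarrow> y \<in> closure E \<Longrightarrow> norm (x - y) \<le> D"
    using D0 by (auto simp: D_def dist_norm le_max_iff_disj)
  have \<delta>: "\<delta> > 0" "\<delta> \<le> 1" using r D(1) by (auto simp: \<delta>_def)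
  have pt: "\<delta> \<le> profile_kernel s r z" if "norm z \<le> D" for z :: 'a
  proof (cases "z = 0")
    case False
    then have "(r / D) powr s \<le> (r / norm z) powr s"
      using that r D(1) by (intro powr_mono2 divide_left_mono) auto
    then show ?thesis using False unfolding profile_kernel_def \<delta>_def by (auto simp: min_le_iff_disj)
  qed (simp add: profile_kernel_def \<delta>_def)
  have "\<delta> \<le> min_energy s r E"
    unfolding min_energy_def
  proof (rule cINF_greatest[OF borel_prob_measures_on_nonempty[OF E(2)]])
    fix \<mu> assume \<mu>: "\<mu> \<in> borel_prob_measures_on (closure E)"
    note m = borel_prob_measures_onD[OF \<mu> closed_closure]
    have "double_integral \<mu> (\<lambda>x. x) (\<lambda>z. \<delta>) \<le> double_integral \<mu> (\<lambda>x. x) (profile_kernel s r)"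
    proof (rule double_integral_mono_AE[OF m(1,3), where b = \<delta> and b' = 1])
      show "AE x in \<mu>. x \<in> closure E" by (rule m)
      show "\<delta> \<le> profile_kernel s r (x - y)" if "x \<in> closure E" "y \<in> closure E" for x y
        using that D by (intro pt) auto
    qed (use \<delta> profile_kernel_bounds in auto)
    moreover have "double_integral \<mu> (\<lambda>x. x) (\<lambda>z. \<delta>) = \<delta>"
      using prob_space.prob_space[OF m(2)] by (simp add: double_integral_def)
    ultimately show "\<delta> \<le> double_integral \<mu> (\<lambda>x. x) (profile_kernel s r)" by simp
  qed
  with \<delta> show ?thesis by simp
qed

lemma capacity_pos:
  fixes E :: "'a::euclidean_space set"
  assumes "bounded E" "E \<noteq> {}" "r > 0" "s \<ge> 0"
  shows "capacity s r E > 0"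
  using min_energy_pos[OF assms] by (simp add: capacity_eq_min_energy)

lemma min_energy_doubling:
  fixes E :: "'a::euclidean_space set"
  assumes E: "E \<noteq> {}" and r: "0 < r" "r \<le> 2 * r'" "0 \<le> s"
  shows "min_energy s r E \<le> 2 powr s * min_energy s r' E"
proof -
  have "min_energy s r E / 2 powr s \<le> min_energy s r' E"
    unfolding min_energy_def[of s r']
  proof (rule cINF_greatest[OF borel_prob_measures_on_nonempty[OF E]])
    fix \<mu> assume \<mu>: "\<mu> \<in> borel_prob_measures_on (closure E)"
    have "min_energy s r E \<le> double_integral \<mu> (\<lambda>x. x) (profile_kernel s r)"
      unfolding min_energy_def by (rule cINF_lower[OF bdd_below_energies \<mu>])
    also have "\<dots> \<le> 2 powr s * double_integral \<mu> (\<lambda>x. x) (profile_kernel s r')"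
      by (rule double_integral_profile_mono[OF \<mu> r])
    finally show "min_energy s r E / 2 powr s \<le> double_integral \<mu> (\<lambda>x. x) (profile_kernel s r')"
      by (simp add: field_simps)
  qed
  then show ?thesis by (simp add: field_simps)
qed

text \<open>The factor 2 avoids the question whether the infimum is attained; it disappears in the
  limit of logarithms.\<close>

lemma near_minimal_energy:
  fixes E :: "'a::euclidean_space set"
  assumes E: "bounded E" "E \<noteq> {}" and r: "r > 0" "s \<ge> 0"
  shows "\<exists>\<mu>\<in>borel_prob_measures_on (closure E). double_integral \<mu> (\<lambda>x. x) (profile_kernel s r) \<le> 2 * min_energy s r E"
proof -
  have "min_energy s r E < 2 * min_energy s r E" using min_energy_pos[OF E r] by simp
  then have "\<exists>\<mu>\<in>borel_prob_measures_on (closure E). double_integral \<mu> (\<lambda>x. x) (profile_kernel s r) < 2 * min_energy s r E"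
    unfolding min_energy_def[of s r E, symmetric]
    by (subst cINF_less_iff[OF borel_prob_measures_on_nonempty[OF E(2)] bdd_below_energies, symmetric])
      (simp add: min_energy_def)
  then show ?thesis by (auto intro: less_imp_le)
qed

text \<open>A bound at all small scales serves the lower and the upper limit at once, so one null
  set of directions settles both box dimensions.\<close>

definition good_direction :: "real \<Rightarrow> real \<Rightarrow> 'a::euclidean_space set \<Rightarrow> 'a set \<Rightarrow> bool" where
  "good_direction \<sigma> \<beta> E V \<longleftrightarrow> (\<exists>c>0. \<exists>r0>0. \<forall>r. 0 < r \<longrightarrow> r < r0 \<longrightarrow>
     c * r powr \<beta> * capacity \<sigma> r E \<le> real (covering_number r (orth_proj V ` E)))"

lemma dyadic_scale:
  fixes r :: real
  assumes "0 < r" "r < (1/2) ^ K0"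
  shows "\<exists>K\<ge>K0. r \<le> (1/2) ^ K \<and> (1/2) ^ K \<le> 2 * r"
proof -
  have "\<exists>K. (1/2) ^ K < r" using assms(1) by (intro real_arch_pow_inv) auto
  then obtain k where k: "(1/2) ^ k < r" by blast
  define j where "j = (LEAST j. (1/2) ^ j < r)"
  have j: "(1/2) ^ j < r" unfolding j_def by (rule LeastI[of _ k]) (rule k)
  have "K0 < j"
  proof (rule ccontr)
    assume "\<not> K0 < j"
    then have "(1/2 :: real) ^ K0 \<le> (1/2) ^ j" by (intro power_decreasing) auto
    with j assms(2) show False by simp
  qed
  then obtain K where K: "j = Suc K" by (cases j) auto
  have "\<not> (1/2) ^ K < r" using not_less_Least[of K "\<lambda>j. (1/2) ^ j < r"] K by (simp add: j_def)
  then show ?thesis using j K \<open>K0 < j\<close> by (intro exI[of _ K]) auto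
qed

text \<open>At scale \<open>2^-K\<close> the directions with slab energy at least
  \<open>2 ^ (K (\<gamma> + \<epsilon>))\<close> times the near-minimal energy have content of order
  \<open>2 ^ (- \<epsilon> K)\<close>. A direction outside the limit superior of these sets has
  small slab energies at all fine scales, so its projection needs many covering sets.\<close>

theorem bad_directions_null:
  fixes E :: "'a::euclidean_space set" and m :: nat and \<gamma> s :: real
  assumes m: "1 \<le> m" "m \<le> DIM('a)" and \<gamma>: "0 \<le> \<gamma>" "\<gamma> \<le> real DIM('a) - real m"
    and s: "s > 0" "real m * (real DIM('a) - real m) - \<gamma> \<le> s"
    and E: "bounded E" "E \<noteq> {}" and \<epsilon>: "\<epsilon> > 0"
  shows "hausdorff_measure (grassmannian m) grassmann_dist s
     {V \<in> grassmannian m. \<not> good_direction (m + \<gamma>) (\<gamma> + \<epsilon>) E V} = 0"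
proof -
  define \<sigma> where "\<sigma> = real m + \<gamma>"
  have \<sigma>: "0 \<le> \<sigma>" using \<gamma> by (simp add: \<sigma>_def)
  obtain D where D: "\<And>x y. x \<in> closure E \<Longrightarrow> y \<in> closure E \<Longrightarrow> dist x y \<le> D"
    using diameter_bounded_bound[OF bounded_closure[OF E(1)]] by blast
  from content_large_slab_energy[OF m \<gamma> s, of D, where 'b = 'a]
  obtain C where C: "C > 0" and cont: "\<forall>(B :: 'a set set) K e lam. B \<subseteq> grassmannian m \<longrightarrow> 0 < lam \<longrightarrow>
    (\<forall>A\<subseteq>B. finite A \<longrightarrow> (\<exists>(M :: 'a measure) X S. finite_measure M \<and> X \<in> borel_measurable M \<and>
       (AE \<omega> in M. X \<omega> \<in> S) \<and> (\<forall>x\<in>S. \<forall>y\<in>S. norm (x - y) \<le> D) \<and>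
       double_integral M X (profile_kernel (m + \<gamma>) ((1/2) ^ K)) \<le> e \<and> (\<forall>V\<in>A. lam \<le> slab_energy K M X V))) \<longrightarrow>
    hausdorff_content (grassmannian m) grassmann_dist s 2 B \<le> ennreal (C * (2 ^ K) powr \<gamma> * e / lam)"
    by (elim exE conjE) (rule that)
  note content = cont[THEN spec, THEN spec, THEN spec, THEN spec, THEN mp, THEN mp, THEN mp]
  have "\<forall>K. \<exists>\<mu>. \<mu> \<in> borel_prob_measures_on (closure E) \<and>
     double_integral \<mu> (\<lambda>x. x) (profile_kernel \<sigma> ((1/2) ^ K)) \<le> 2 * min_energy \<sigma> ((1/2) ^ K) E"
    using near_minimal_energy[OF E _ \<sigma>] by (metis zero_less_power half_gt_zero zero_less_one)
  then obtain \<mu> where \<mu>: "\<And>K. \<mu> K \<in> borel_prob_measures_on (closure E)"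
     "\<And>K. double_integral (\<mu> K) (\<lambda>x. x) (profile_kernel \<sigma> ((1/2) ^ K)) \<le> 2 * min_energy \<sigma> ((1/2) ^ K) E" by metis
  define e where "e K = 2 * min_energy \<sigma> ((1/2) ^ K) E" for K :: nat
  have e: "e K > 0" for K using min_energy_pos[OF E _ \<sigma>] by (simp add: e_def)
  define lam where "lam K = (2 ^ K) powr (\<gamma> + \<epsilon>) * e K" for K :: nat
  have lam: "lam K > 0" for K using e by (simp add: lam_def)
  define B where "B K = {V \<in> grassmannian m. lam K \<le> slab_energy K (\<mu> K) (\<lambda>x. x) V}" for K
  define q where "q = 2 powr - \<epsilon>"
  have q: "0 \<le> q" "q < 1" using \<epsilon> powr_less_cancel_iff[of 2 "- \<epsilon>" 0] by (auto simp: q_def)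
  have cB: "hausdorff_content (grassmannian m) grassmann_dist s 2 (B K) \<le> ennreal (C * q ^ K)" for K
  proof -
    note mu = borel_prob_measures_onD[OF \<mu>(1)[of K] closed_closure]
    have "hausdorff_content (grassmannian m) grassmann_dist s 2 (B K) \<le> ennreal (C * (2 ^ K) powr \<gamma> * e K / lam K)"
    proof (rule content)
      show "B K \<subseteq> grassmannian m" by (auto simp: B_def)
      show "\<forall>A\<subseteq>B K. finite A \<longrightarrow> (\<exists>(M :: 'a measure) X S. finite_measure M \<and> X \<in> borel_measurable M \<and>
       (AE \<omega> in M. X \<omega> \<in> S) \<and> (\<forall>x\<in>S. \<forall>y\<in>S. norm (x - y) \<le> D) \<and>
       double_integral M X (profile_kernel (m + \<gamma>) ((1/2) ^ K)) \<le> e K \<and> (\<forall>V\<in>A. lam K \<le> slab_energy K M X V))"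
      proof (intro allI impI exI conjI)
        fix A assume A: "A \<subseteq> B K"
        show "\<forall>V\<in>A. lam K \<le> slab_energy K (\<mu> K) (\<lambda>x. x) V" using A by (auto simp: B_def)
        show "\<forall>x\<in>closure E. \<forall>y\<in>closure E. norm (x - y) \<le> D" using D by (simp add: dist_norm)
        show "double_integral (\<mu> K) (\<lambda>x. x) (profile_kernel (m + \<gamma>) ((1/2) ^ K)) \<le> e K"
          using \<mu>(2)[of K] by (simp add: e_def \<sigma>_def)
      qed (rule mu)+
    qed (rule lam)
    also have "C * (2 ^ K) powr \<gamma> * e K / lam K = C * q ^ K"
    proof -
      have "(2 ^ K :: real) powr (\<gamma> + \<epsilon>) = (2 ^ K) powr \<gamma> * (2 ^ K) powr \<epsilon>" by (rule powr_add)
      moreover have "q ^ K = 1 / (2 ^ K) powr \<epsilon>"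
      proof -
        have "q = 1 / 2 powr \<epsilon>" by (simp add: q_def powr_minus inverse_eq_divide)
        moreover have "(2 ^ K :: real) powr \<epsilon> = (2 powr \<epsilon>) ^ K"
          by (simp add: powr_power mult.commute powr_realpow[symmetric] powr_powr)
        ultimately show ?thesis by (simp only: power_one_over)
      qed
      ultimately show ?thesis using e[of K] by (simp add: lam_def)
    qed
    finally show ?thesis .
  qed
  show ?thesis
  proof (rule hausdorff_measure_limsup_eq_0[OF s(1) _ q, of 2 0])
    show "hausdorff_content (grassmannian m) grassmann_dist s 2 (B K) \<le> ennreal (C * q ^ K)" for K by (rule cB)
    fix K0 :: nat
    show "{V \<in> grassmannian m. \<not> good_direction (m + \<gamma>) (\<gamma> + \<epsilon>) E V} \<subseteq> (\<Union>K\<in>{K0..}. B K)"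
    proof (rule subsetI, rule ccontr)
      fix V assume V: "V \<in> {V \<in> grassmannian m. \<not> good_direction (m + \<gamma>) (\<gamma> + \<epsilon>) E V}" and nV: "V \<notin> (\<Union>K\<in>{K0..}. B K)"
      have VG: "V \<in> grassmannian m" and sub: "subspace V" using V by auto
      have small: "slab_energy K (\<mu> K) (\<lambda>x. x) V \<le> lam K" if "K0 \<le> K" for K
        using nV VG that by (auto simp: B_def not_le dest: less_imp_le)
      \<comment> \<open>The factors stem from the covering estimate, from the near-minimality of
        \<open>\<mu> K\<close>, and from passing between the scales \<open>2^-K\<close> and
        \<open>r\<close>.\<close>
      define c where "c = 1 / (exp (1/2) * 2 * 2 powr \<sigma>)"
      have c: "c > 0" by (simp add: c_def)
      have "c * r powr (\<gamma> + \<epsilon>) * capacity \<sigma> r E \<le> real (covering_number r (orth_proj V ` E))"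
        if r: "0 < r" "r < (1/2) ^ K0" for r
      proof -
        obtain K where K: "K0 \<le> K" "r \<le> (1/2) ^ K" "(1/2) ^ K \<le> 2 * r" using dyadic_scale[OF r] by blast
        define N where "N = real (covering_number r (orth_proj V ` E))"
        have "1 \<le> exp (1/2) * N * slab_energy K (\<mu> K) (\<lambda>x. x) V"
          unfolding N_def by (rule covering_number_slab_energy[OF E(1) sub r(1) K(2) \<mu>(1)])
        also have "\<dots> \<le> exp (1/2) * N * lam K"
          using small[OF K(1)] by (intro mult_left_mono) (auto simp: N_def)
        also have "lam K \<le> r powr - (\<gamma> + \<epsilon>) * (2 * (2 powr \<sigma> * min_energy \<sigma> r E))"
          unfolding lam_def e_def
        proof (intro mult_mono)
          have "(2 ^ K :: real) = inverse ((1/2) ^ K)" by (simp add: power_one_over inverse_eq_divide)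
          also have "\<dots> \<le> inverse r" using K r by (intro le_imp_inverse_le) auto
          finally have "(2 ^ K) powr (\<gamma> + \<epsilon>) \<le> (inverse r) powr (\<gamma> + \<epsilon>)" using \<gamma> \<epsilon> by (intro powr_mono2) auto
          also have "\<dots> = r powr - (\<gamma> + \<epsilon>)" using r powr_minus[of r "\<gamma> + \<epsilon>"] by (simp add: inverse_powr)
          finally show "(2 ^ K) powr (\<gamma> + \<epsilon>) \<le> r powr - (\<gamma> + \<epsilon>)" .
          show "min_energy \<sigma> ((1/2) ^ K) E \<le> 2 powr \<sigma> * min_energy \<sigma> r E"
            using K(3) \<sigma> by (intro min_energy_doubling E) auto
          show "0 \<le> 2 * min_energy \<sigma> ((1/2) ^ K) E" "0 \<le> min_energy \<sigma> ((1/2) ^ K) E"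
            using e[of K] by (simp_all add: e_def)
        qed auto
        finally have "1 \<le> exp (1/2) * N * (r powr - (\<gamma> + \<epsilon>) * (2 * (2 powr \<sigma> * min_energy \<sigma> r E)))"
          by (simp add: mult_left_mono N_def)
        then have "1 \<le> N * (r powr - (\<gamma> + \<epsilon>) * min_energy \<sigma> r E) / c"
          by (simp add: c_def mult_ac)
        then have "c \<le> N * (r powr - (\<gamma> + \<epsilon>) * min_energy \<sigma> r E)"
          using c by (simp add: field_simps)
        also have "\<dots> = N * min_energy \<sigma> r E / r powr (\<gamma> + \<epsilon>)"
          unfolding powr_minus[of r "\<gamma> + \<epsilon>"] by (simp add: divide_inverse)
        finally have "c * r powr (\<gamma> + \<epsilon>) \<le> N * min_energy \<sigma> r E"
          using r by (simp add: field_simps)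
        then show ?thesis
          using min_energy_pos[OF E r(1) \<sigma>] by (simp add: capacity_eq_min_energy N_def field_simps)
      qed
      then have "good_direction (m + \<gamma>) (\<gamma> + \<epsilon>) E V"
        unfolding good_direction_def \<sigma>_def[symmetric]
        using c by (intro exI[of _ c] exI[of _ "(1/2) ^ K0"] conjI allI impI) auto
      with V show False by simp
    qed
  qed simp
qed

lemma good_direction_eventually:
  fixes E :: "'a::euclidean_space set"
  assumes good: "good_direction \<sigma> \<beta> E V" and \<sigma>: "0 \<le> \<sigma>" and E: "bounded E" "E \<noteq> {}" and V: "subspace V" and \<epsilon>: "\<epsilon> > 0"
  shows "\<forall>\<^sub>F r in at_right 0. ereal (ln (capacity \<sigma> r E) / (- ln r)) \<le>
    ereal (ln (real (covering_number r (orth_proj V ` E))) / (- ln r)) + ereal (\<beta> + \<epsilon>)"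
proof -
  obtain c r0 where c: "c > 0" "r0 > 0" and H: "\<And>r. 0 < r \<Longrightarrow> r < r0 \<Longrightarrow>
     c * r powr \<beta> * capacity \<sigma> r E \<le> real (covering_number r (orth_proj V ` E))"
    using good unfolding good_direction_def by blast
  \<comment> \<open>Below \<open>exp (ln c / \<epsilon>)\<close> the constant is absorbed, as
    \<open>- ln c < \<epsilon> * (- ln r)\<close>; the bound \<open>1/2\<close> keeps
    \<open>- ln r\<close> positive.\<close>
  define r1 where "r1 = min r0 (min (1/2) (exp (ln c / \<epsilon>)))"
  have r1: "r1 > 0" using c by (simp add: r1_def)
  have "ereal (ln (capacity \<sigma> r E) / (- ln r)) \<le>
    ereal (ln (real (covering_number r (orth_proj V ` E))) / (- ln r)) + ereal (\<beta> + \<epsilon>)" if r: "0 < r" "r < r1" for r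
  proof -
    have r': "r < r0" "r < 1" "r < exp (ln c / \<epsilon>)" using r by (auto simp: r1_def)
    have cap: "capacity \<sigma> r E > 0" by (rule capacity_pos[OF E r(1) \<sigma>])
    have lr: "- ln r > 0" using r r' by simp
    have "ln r < ln c / \<epsilon>" using r r'(3) by (metis exp_gt_zero ln_exp ln_less_cancel_iff)
    then have lc: "- ln c < \<epsilon> * (- ln r)" using \<epsilon> by (simp add: field_simps)
    have pos: "0 < c * r powr \<beta> * capacity \<sigma> r E" using c cap r by simp
    have "ln (c * r powr \<beta> * capacity \<sigma> r E) \<le> ln (real (covering_number r (orth_proj V ` E)))"
      using pos H[OF r(1) r'(1)] by (intro ln_mono) auto
    moreover have "ln (c * r powr \<beta> * capacity \<sigma> r E) = ln c + \<beta> * ln r + ln (capacity \<sigma> r E)"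
      using c cap r by (simp add: ln_mult ln_powr)
    ultimately have "ln (capacity \<sigma> r E) \<le> ln (real (covering_number r (orth_proj V ` E))) + (\<beta> + \<epsilon>) * (- ln r)"
      using lc by (simp add: algebra_simps)
    then have "ln (capacity \<sigma> r E) / (- ln r) \<le> (ln (real (covering_number r (orth_proj V ` E))) + (\<beta> + \<epsilon>) * (- ln r)) / (- ln r)"
      using lr by (intro divide_right_mono) auto
    also have "\<dots> = ln (real (covering_number r (orth_proj V ` E))) / (- ln r) + (\<beta> + \<epsilon>)"
    proof -
      have "(x + b * L) / L = x / L + b" if "L > 0" for x b L :: real using that by (simp add: add_divide_distrib)
      then show ?thesis using lr by blast
    qed
    finally show ?thesis by simp
  qed
  then show ?thesis unfolding eventually_at_right_field using r1 by blast
qed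

lemma good_direction_box_dim:
  fixes E :: "'a::euclidean_space set"
  assumes "good_direction \<sigma> \<beta> E V" "0 \<le> \<sigma>" "bounded E" "E \<noteq> {}" "subspace V" "\<epsilon> > 0"
  shows "lower_box_dim_profile \<sigma> E \<le> lower_box_dim (orth_proj V ` E) + ereal (\<beta> + \<epsilon>)"
    "upper_box_dim_profile \<sigma> E \<le> upper_box_dim (orth_proj V ` E) + ereal (\<beta> + \<epsilon>)"
proof -
  note ev = good_direction_eventually[OF assms]
  have "lower_box_dim_profile \<sigma> E \<le> Liminf (at_right 0) (\<lambda>r. ereal (ln (real (covering_number r (orth_proj V ` E))) / (- ln r)) + ereal (\<beta> + \<epsilon>))"
    unfolding lower_box_dim_profile_def by (rule Liminf_mono[OF ev])
  also have "\<dots> = lower_box_dim (orth_proj V ` E) + ereal (\<beta> + \<epsilon>)"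
    unfolding lower_box_dim_def by (rule Liminf_add_ereal_right) auto
  finally show "lower_box_dim_profile \<sigma> E \<le> lower_box_dim (orth_proj V ` E) + ereal (\<beta> + \<epsilon>)" .
  have "upper_box_dim_profile \<sigma> E \<le> Limsup (at_right 0) (\<lambda>r. ereal (ln (real (covering_number r (orth_proj V ` E))) / (- ln r)) + ereal (\<beta> + \<epsilon>))"
    unfolding upper_box_dim_profile_def by (rule Limsup_mono[OF ev])
  also have "\<dots> = upper_box_dim (orth_proj V ` E) + ereal (\<beta> + \<epsilon>)"
    unfolding upper_box_dim_def by (rule Limsup_add_ereal_right) auto
  finally show "upper_box_dim_profile \<sigma> E \<le> upper_box_dim (orth_proj V ` E) + ereal (\<beta> + \<epsilon>)" .
qed

text \<open>One term \<open>1 / Suc j\<close> is the loss in the exponent of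
  \<open>good_direction\<close>, the other the loss in passing to logarithms. The conclusion moves
  everything to the side of \<open>x\<close> as a sum, because the dimensions are extended
  reals.\<close>

lemma ereal_less_diff_imp_not_all:
  fixes x y :: ereal
  assumes "x < y - ereal \<gamma>"
  shows "\<exists>j::nat. \<not> y \<le> x + ereal (\<gamma> + 1 / Suc j + 1 / Suc j)"
proof -
  obtain z where z: "x < ereal z" "ereal z < y - ereal \<gamma>" using ereal_dense2[OF assms] by blast
  obtain z' where z': "ereal z < ereal z'" "ereal z' < y - ereal \<gamma>" using ereal_dense2[OF z(2)] by blast
  obtain j where j: "1 / real (Suc j) < (z' - z) / 2" using z'(1) reals_Archimedean[of "(z' - z) / 2"] by (auto simp: inverse_eq_divide)
  have "x + ereal (\<gamma> + 1 / Suc j + 1 / Suc j) \<le> ereal z + ereal (\<gamma> + 1 / Suc j + 1 / Suc j)"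
    using z by (intro add_right_mono) auto
  also have "\<dots> < ereal (z' + \<gamma>)" using j by simp
  also have "\<dots> \<le> y" using z'(2) by (cases y) auto
  finally show ?thesis by (intro exI[of _ j]) (simp add: not_le)
qed

theorem box_dim_exceptional_null:
  fixes E :: "'a::euclidean_space set" and m :: nat and \<gamma> s :: real
  assumes m: "1 \<le> m" "m \<le> DIM('a)" and \<gamma>: "0 \<le> \<gamma>" "\<gamma> \<le> real DIM('a) - real m"
    and s: "s > 0" "real m * (real DIM('a) - real m) - \<gamma> \<le> s"
    and E: "bounded E" "E \<noteq> {}"
  shows "hausdorff_measure (grassmannian m) grassmann_dist s
     {V \<in> grassmannian m. lower_box_dim (orth_proj V ` E) < lower_box_dim_profile (m + \<gamma>) E - ereal \<gamma>} = 0"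
    "hausdorff_measure (grassmannian m) grassmann_dist s
     {V \<in> grassmannian m. upper_box_dim (orth_proj V ` E) < upper_box_dim_profile (m + \<gamma>) E - ereal \<gamma>} = 0"
proof -
  define Z where "Z = (\<Union>j::nat. {V \<in> grassmannian m. \<not> good_direction (m + \<gamma>) (\<gamma> + 1 / Suc j) E V})"
  have Z: "hausdorff_measure (grassmannian m) grassmann_dist s Z = 0"
    unfolding Z_def by (rule hausdorff_measure_eq_0_UN[OF s(1)]) (auto intro!: bad_directions_null m \<gamma> s E)
  have good: "good_direction (m + \<gamma>) (\<gamma> + 1 / Suc j) E V" if "V \<in> grassmannian m" "V \<notin> Z" for V j
    using that by (auto simp: Z_def)
  have sg: "0 \<le> real m + \<gamma>" using \<gamma> by simp
  show "hausdorff_measure (grassmannian m) grassmann_dist s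
     {V \<in> grassmannian m. lower_box_dim (orth_proj V ` E) < lower_box_dim_profile (m + \<gamma>) E - ereal \<gamma>} = 0"
  proof (rule hausdorff_measure_eq_0_subset[OF s(1) Z], rule subsetI, rule ccontr)
    fix V assume V: "V \<in> {V \<in> grassmannian m. lower_box_dim (orth_proj V ` E) < lower_box_dim_profile (m + \<gamma>) E - ereal \<gamma>}" "V \<notin> Z"
    then obtain j :: nat where j: "\<not> lower_box_dim_profile (m + \<gamma>) E \<le> lower_box_dim (orth_proj V ` E) + ereal (\<gamma> + 1 / Suc j + 1 / Suc j)"
      using ereal_less_diff_imp_not_all by blast
    have "lower_box_dim_profile (m + \<gamma>) E \<le> lower_box_dim (orth_proj V ` E) + ereal (\<gamma> + 1 / Suc j + 1 / Suc j)"
      using V by (intro good_direction_box_dim(1)[OF good sg E]) auto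
    with j show False by blast
  qed
  show "hausdorff_measure (grassmannian m) grassmann_dist s
     {V \<in> grassmannian m. upper_box_dim (orth_proj V ` E) < upper_box_dim_profile (m + \<gamma>) E - ereal \<gamma>} = 0"
  proof (rule hausdorff_measure_eq_0_subset[OF s(1) Z], rule subsetI, rule ccontr)
    fix V assume V: "V \<in> {V \<in> grassmannian m. upper_box_dim (orth_proj V ` E) < upper_box_dim_profile (m + \<gamma>) E - ereal \<gamma>}" "V \<notin> Z"
    then obtain j :: nat where j: "\<not> upper_box_dim_profile (m + \<gamma>) E \<le> upper_box_dim (orth_proj V ` E) + ereal (\<gamma> + 1 / Suc j + 1 / Suc j)"
      using ereal_less_diff_imp_not_all by blast
    have "upper_box_dim_profile (m + \<gamma>) E \<le> upper_box_dim (orth_proj V ` E) + ereal (\<gamma> + 1 / Suc j + 1 / Suc j)"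
      using V by (intro good_direction_box_dim(2)[OF good sg E]) auto
    with j show False by blast
  qed
qed

section \<open>Packing dimension\<close>

text \<open>The product of \<open>'a\<close> with \<open>nat \<Rightarrow> real\<close> is a
  complete space. Completeness gives the Baire theorem on the closed set above \<open>E\<close>, and
  coordinatewise bounds on the second factor give compact pieces; Borel sets enter only through this
  description.\<close>

definition analytic_set :: "'a::euclidean_space set \<Rightarrow> bool" where
  "analytic_set E \<longleftrightarrow> (\<exists>C :: ('a \<times> (nat \<Rightarrow> real)) set. closed C \<and> E = fst ` C)"

lemma analytic_set_closed:
  assumes "closed K"
  shows "analytic_set K"
  unfolding analytic_set_def
  by (rule exI[of _ "K \<times> UNIV"]) (auto intro!: closed_Times assms)

text \<open>Coordinate 0 of the witness records which set is meant, and the remaining coordinates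
  hold a witness for it. As coordinate 0 is a natural number, being different from \<open>n\<close>
  is the closed condition \<open>1 \<le> \<bar>snd z 0 - real n\<bar>\<close>.\<close>

lemma analytic_set_UN:
  fixes E :: "nat \<Rightarrow> 'a::euclidean_space set"
  assumes "\<And>n. analytic_set (E n)"
  shows "analytic_set (\<Union>n. E n)"
proof -
  have "\<forall>n. \<exists>C :: ('a \<times> (nat \<Rightarrow> real)) set. closed C \<and> E n = fst ` C"
    using assms by (simp add: analytic_set_def)
  then obtain C :: "nat \<Rightarrow> ('a \<times> (nat \<Rightarrow> real)) set" where C: "\<And>n. closed (C n)" "\<And>n. E n = fst ` C n" by metis
  define f :: "'a \<times> (nat \<Rightarrow> real) \<Rightarrow> 'a \<times> (nat \<Rightarrow> real)" where "f z = (fst z, \<lambda>k. snd z (Suc k))" for z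
  have coord: "continuous_on UNIV (\<lambda>z :: 'a \<times> (nat \<Rightarrow> real). snd z k)" for k
    by (rule continuous_on_product_then_coordinatewise[OF continuous_on_snd[OF continuous_on_id]])
  have f: "continuous_on UNIV f"
    unfolding f_def by (rule continuous_on_Pair[OF continuous_on_fst[OF continuous_on_id] continuous_on_coordinatewise_then_product[OF coord]])
  define S where "S = {z :: 'a \<times> (nat \<Rightarrow> real). snd z 0 \<in> \<nat>} \<inter> (\<Inter>n. {z. f z \<in> C n} \<union> {z. 1 \<le> \<bar>snd z 0 - real n\<bar>})"
  have c1: "closed {z. f z \<in> C n}" for n
    using closed_vimage[OF C(1)[of n] f] by (simp add: vimage_def)
  have c2: "closed {z :: 'a \<times> (nat \<Rightarrow> real). 1 \<le> \<bar>snd z 0 - real n\<bar>}" for n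
    by (intro closed_Collect_le continuous_intros coord)
  have c3: "closed {z :: 'a \<times> (nat \<Rightarrow> real). snd z 0 \<in> \<nat>}"
    using closed_vimage[OF closed_Nats coord[of 0]] by (simp add: vimage_def)
  have "closed S" unfolding S_def using c1 c2 c3 by (intro closed_Int closed_INT closed_Un ballI) auto
  moreover have "(\<Union>n. E n) = fst ` S"
  proof (intro equalityI subsetI)
    fix x assume "x \<in> (\<Union>n. E n)"
    then obtain n \<sigma> where n: "(x, \<sigma>) \<in> C n" by (auto simp: C(2))
    define \<tau> where "\<tau> = (\<lambda>k. case k of 0 \<Rightarrow> real n | Suc k \<Rightarrow> \<sigma> k)"
    have f\<tau>: "f (x, \<tau>) = (x, \<sigma>)" by (simp add: f_def \<tau>_def)
    have far: "1 \<le> \<bar>\<tau> 0 - real k\<bar>" if "k \<noteq> n" for k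
      using that by (simp add: \<tau>_def)
    have "(x, \<tau>) \<in> {z. f z \<in> C k} \<union> {z. 1 \<le> \<bar>snd z 0 - real k\<bar>}" for k
      using f\<tau> n far[of k] by (cases "k = n") simp_all
    moreover have "\<tau> 0 \<in> \<nat>" by (simp add: \<tau>_def)
    ultimately have "(x, \<tau>) \<in> S" by (simp add: S_def)
    then show "x \<in> fst ` S" by force
  next
    fix x assume "x \<in> fst ` S"
    then obtain \<tau> where \<tau>: "(x, \<tau>) \<in> S" by auto
    then obtain n where n: "\<tau> 0 = real n" by (auto simp: S_def elim: Nats_cases)
    have "f (x, \<tau>) \<in> C n \<or> 1 \<le> \<bar>\<tau> 0 - real n\<bar>" using \<tau> by (auto simp: S_def)
    then have "f (x, \<tau>) \<in> C n" using n by simp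
    then show "x \<in> (\<Union>n. E n)" by (force simp: C(2) f_def)
  qed
  ultimately show ?thesis unfolding analytic_set_def by blast
qed

text \<open>One sequence stores witnesses for all \<open>E n\<close> simultaneously, interleaved by
  \<open>prod_encode\<close>.\<close>

lemma analytic_set_INT:
  fixes E :: "nat \<Rightarrow> 'a::euclidean_space set"
  assumes "\<And>n. analytic_set (E n)"
  shows "analytic_set (\<Inter>n. E n)"
proof -
  have "\<forall>n. \<exists>C :: ('a \<times> (nat \<Rightarrow> real)) set. closed C \<and> E n = fst ` C"
    using assms by (simp add: analytic_set_def)
  then obtain C :: "nat \<Rightarrow> ('a \<times> (nat \<Rightarrow> real)) set" where C: "\<And>n. closed (C n)" "\<And>n. E n = fst ` C n" by metis
  define f :: "nat \<Rightarrow> 'a \<times> (nat \<Rightarrow> real) \<Rightarrow> 'a \<times> (nat \<Rightarrow> real)" where "f n z = (fst z, \<lambda>k. snd z (prod_encode (n, k)))" for n z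
  have coord: "continuous_on UNIV (\<lambda>z :: 'a \<times> (nat \<Rightarrow> real). snd z k)" for k
    by (rule continuous_on_product_then_coordinatewise[OF continuous_on_snd[OF continuous_on_id]])
  have f: "continuous_on UNIV (f n)" for n
    unfolding f_def by (rule continuous_on_Pair[OF continuous_on_fst[OF continuous_on_id] continuous_on_coordinatewise_then_product[OF coord]])
  define S where "S = (\<Inter>n. {z. f n z \<in> C n})"
  have c1: "closed {z. f n z \<in> C n}" for n
    using closed_vimage[OF C(1)[of n] f[of n]] by (simp add: vimage_def)
  have "closed S" unfolding S_def using c1 by (intro closed_INT ballI) auto
  moreover have "(\<Inter>n. E n) = fst ` S"
  proof (intro equalityI subsetI)
    fix x assume "x \<in> (\<Inter>n. E n)"
    then have "\<forall>n. \<exists>\<sigma>. (x, \<sigma>) \<in> C n" by (force simp: C(2))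
    then obtain \<sigma> where \<sigma>: "\<And>n. (x, \<sigma> n) \<in> C n" by metis
    define \<tau> where "\<tau> i = \<sigma> (fst (prod_decode i)) (snd (prod_decode i))" for i
    have "f n (x, \<tau>) = (x, \<sigma> n)" for n by (simp add: f_def \<tau>_def)
    then have "(x, \<tau>) \<in> S" using \<sigma> by (auto simp: S_def)
    then show "x \<in> fst ` S" by force
  next
    fix x assume "x \<in> fst ` S"
    then obtain \<tau> where "(x, \<tau>) \<in> S" by auto
    then have "f n (x, \<tau>) \<in> C n" for n by (simp add: S_def)
    then show "x \<in> (\<Inter>n. E n)" by (force simp: C(2) f_def)
  qed
  ultimately show ?thesis unfolding analytic_set_def by blast
qed

lemma analytic_set_open:
  fixes U :: "'a::euclidean_space set"
  assumes "open U"
  shows "analytic_set U"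
proof (cases "U = {}")
  case False
  obtain D where D: "countable D" "D \<subseteq> Pow U" "\<And>X. X \<in> D \<Longrightarrow> \<exists>a b. X = cbox a b" "\<Union>D = U"
    using open_countable_Union_open_cbox[OF assms] by blast
  have ne: "D \<noteq> {}" using D(4) False by auto
  have "U = (\<Union>n. from_nat_into D n)" using range_from_nat_into[OF ne D(1)] D(4) by metis
  moreover have "analytic_set (from_nat_into D n)" for n
  proof -
    obtain a b where "from_nat_into D n = cbox a b" using D(3) from_nat_into[OF ne, of n] by blast
    then show ?thesis using analytic_set_closed[OF closed_cbox[of a b]] by simp
  qed
  ultimately show ?thesis using analytic_set_UN by metis
qed (simp add: analytic_set_closed)

text \<open>The induction carries a set and its complement together, since analytic sets are not
  closed under complements.\<close>

theorem borel_analytic_set: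
  fixes E :: "'a::euclidean_space set"
  assumes "E \<in> sets borel"
  shows "analytic_set E"
proof -
  have "E \<in> sigma_sets UNIV (Collect closed)"
    using assms unfolding borel_eq_closed by simp
  then have "analytic_set E \<and> analytic_set (- E)"
  proof induction
    case (Basic K)
    then show ?case by (simp add: analytic_set_closed analytic_set_open open_Compl)
  next
    case Empty
    then show ?case by (simp add: analytic_set_closed)
  next
    case (Compl K)
    have "UNIV - K = - K" by auto
    then show ?case using Compl by simp
  next
    case (Union K)
    have "- (\<Union>n. K n) = (\<Inter>n. - K n)" by blast
    then show ?case using Union analytic_set_UN[of K] analytic_set_INT[of "\<lambda>n. - K n"] by simp
  qed
  then show ?thesis by simp
qed

text \<open>Baire category in the subspace \<open>C\<close>: some \<open>C \<inter> F i\<close> has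
  an interior point relative to \<open>C\<close>.\<close>

lemma Baire_closed_cover:
  fixes C :: "'a::complete_space set" and F :: "nat \<Rightarrow> 'a set"
  assumes C: "closed C" "C \<noteq> {}" and F: "\<And>i. closed (F i)" "C \<subseteq> (\<Union>i. F i)"
  shows "\<exists>i U. open U \<and> U \<inter> C \<noteq> {} \<and> U \<inter> C \<subseteq> F i"
proof (rule ccontr)
  assume no: "\<nexists>i U. open U \<and> U \<inter> C \<noteq> {} \<and> U \<inter> C \<subseteq> F i"
  have cm: "completely_metrizable_space (top_of_set C)"
    using C(1) by (intro completely_metrizable_space_closedin[OF completely_metrizable_space_euclidean]) simp
  have "(top_of_set C) interior_of (\<Union>(range (\<lambda>i. C \<inter> F i))) = {}"
  proof (rule Baire_category_alt)
    fix T assume "T \<in> range (\<lambda>i. C \<inter> F i)"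
    then obtain i where i: "T = C \<inter> F i" by blast
    show "closedin (top_of_set C) T \<and> top_of_set C interior_of T = {}"
    proof
      show "closedin (top_of_set C) T" unfolding i using F(1) by (rule closedin_closed_Int)
      show "top_of_set C interior_of T = {}"
      proof (rule ccontr)
        assume "top_of_set C interior_of T \<noteq> {}"
        moreover have op: "openin (top_of_set C) (top_of_set C interior_of T)" by (rule openin_interior_of)
        from op obtain U where U: "open U" "top_of_set C interior_of T = C \<inter> U" unfolding openin_open by blast
        moreover have "top_of_set C interior_of T \<subseteq> T" by (rule interior_of_subset)
        ultimately show False using no i by blast
      qed
    qed
  qed (use cm in auto)
  moreover have "\<Union>(range (\<lambda>i. C \<inter> F i)) = topspace (top_of_set C)" using F(2) by auto
  ultimately show False using C(2) by (metis interior_of_topspace topspace_euclidean_subtopology)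
qed

section \<open>Reduction of the packing dimension to portions of a closed set\<close>

lemma upper_box_dim_mono_closure:
  fixes A B :: "'a::euclidean_space set"
  assumes AB: "A \<subseteq> closure B" "bounded B" and A: "A \<noteq> {}"
  shows "upper_box_dim A \<le> upper_box_dim B"
  unfolding upper_box_dim_def
proof (rule Limsup_mono)
  have bA: "bounded A" using AB bounded_closure bounded_subset by blast
  have "ereal (ln (real (covering_number r A)) / - ln r) \<le> ereal (ln (real (covering_number r B)) / - ln r)"
    if r: "0 < r" "r < 1" for r
  proof -
    have "1 \<le> covering_number r A" by (rule covering_number_pos[OF A bA r(1)])
    moreover have "covering_number r A \<le> covering_number r B" by (rule covering_number_mono[OF AB r(1)])
    ultimately have "ln (real (covering_number r A)) \<le> ln (real (covering_number r B))" by (intro ln_mono) auto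
    then show ?thesis using r by (simp add: divide_right_mono_neg)
  qed
  then show "\<forall>\<^sub>F r in at_right 0. ereal (ln (real (covering_number r A)) / - ln r) \<le> ereal (ln (real (covering_number r B)) / - ln r)"
    unfolding eventually_at_right_field by (intro exI[of _ 1]) auto
qed

lemma upper_box_dim_profile_closure: "upper_box_dim_profile s (closure A) = upper_box_dim_profile s A"
  by (simp add: upper_box_dim_profile_def capacity_def)

text \<open>These sets form a sigma-ideal. Countable families are used instead of sequences so that
  countable unions are immediate and the empty set, covered by the empty family, belongs to
  it.\<close>

definition packing_thin :: "real \<Rightarrow> real \<Rightarrow> 'a::euclidean_space set \<Rightarrow> bool" where
  "packing_thin \<sigma> t A \<longleftrightarrow> (\<exists>\<K>. countable \<K> \<and> (\<forall>K\<in>\<K>. K \<noteq> {} \<and> compact K \<and> upper_box_dim_profile \<sigma> K \<le> ereal t) \<and> A \<subseteq> \<Union>\<K>)"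

lemma packing_thin_subset: "packing_thin \<sigma> t B \<Longrightarrow> A \<subseteq> B \<Longrightarrow> packing_thin \<sigma> t A"
  unfolding packing_thin_def by (meson order_trans)

lemma packing_thin_UN:
  assumes "countable I" "\<And>i. i \<in> I \<Longrightarrow> packing_thin \<sigma> t (A i)"
  shows "packing_thin \<sigma> t (\<Union>i\<in>I. A i)"
proof -
  have "\<forall>i\<in>I. \<exists>\<K>. countable \<K> \<and> (\<forall>K\<in>\<K>. K \<noteq> {} \<and> compact K \<and> upper_box_dim_profile \<sigma> K \<le> ereal t) \<and> A i \<subseteq> \<Union>\<K>"
    using assms(2) by (simp add: packing_thin_def)
  then obtain \<K> where K: "\<forall>i\<in>I. countable (\<K> i) \<and> (\<forall>K\<in>\<K> i. K \<noteq> {} \<and> compact K \<and> upper_box_dim_profile \<sigma> K \<le> ereal t) \<and> A i \<subseteq> \<Union>(\<K> i)"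
    by (rule bchoice[THEN exE])
  show ?thesis unfolding packing_thin_def
  proof (intro exI[of _ "\<Union>i\<in>I. \<K> i"] conjI)
    show "countable (\<Union>i\<in>I. \<K> i)" using assms(1) K by (intro countable_UN) auto
    show "(\<Union>i\<in>I. A i) \<subseteq> \<Union>(\<Union>i\<in>I. \<K> i)"
    proof
      fix x assume "x \<in> (\<Union>i\<in>I. A i)"
      then obtain i where "i \<in> I" "x \<in> A i" by blast
      moreover then have "x \<in> \<Union>(\<K> i)" using K by blast
      ultimately show "x \<in> \<Union>(\<Union>i\<in>I. \<K> i)" by blast
    qed
  qed (use K in auto)
qed

lemma packing_thin_Un:
  assumes "packing_thin \<sigma> t A" "packing_thin \<sigma> t B"
  shows "packing_thin \<sigma> t (A \<union> B)"
proof -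
  have "packing_thin \<sigma> t (\<Union>b\<in>(UNIV :: bool set). if b then A else B)"
    using assms by (intro packing_thin_UN) auto
  then show ?thesis by (simp add: UNIV_bool Un_commute)
qed

lemma packing_thin_imp_packing_dim_profile_le:
  assumes "packing_thin \<sigma> t A" "A \<noteq> {}"
  shows "packing_dim_profile \<sigma> A \<le> ereal t"
proof -
  obtain \<K> where K: "countable \<K>" "\<forall>K\<in>\<K>. K \<noteq> {} \<and> compact K \<and> upper_box_dim_profile \<sigma> K \<le> ereal t" "A \<subseteq> \<Union>\<K>"
    using assms(1) by (auto simp: packing_thin_def)
  have ne: "\<K> \<noteq> {}" using K(3) assms(2) by auto
  define F where "F = from_nat_into \<K>"
  have F: "F i \<in> \<K>" for i unfolding F_def by (rule from_nat_into[OF ne])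
  have "range F = \<K>" unfolding F_def by (rule range_from_nat_into[OF ne K(1)])
  then have "packing_dim_profile \<sigma> A \<le> (SUP i. upper_box_dim_profile \<sigma> (F i))"
    unfolding packing_dim_profile_def using F K by (intro Inf_lower) auto
  also have "\<dots> \<le> ereal t" using F K(2) by (intro SUP_least) auto
  finally show ?thesis .
qed

text \<open>Above \<open>E\<close> lies a closed set \<open>C\<close>. Removing all basic open sets
  over which \<open>C\<close> projects to a thin set leaves a closed set \<open>C' t\<close>, and
  what remains over any basic open set meeting it is not thin. If the projection of \<open>E\<close>
  to \<open>V\<close> has a countable cover of small box dimension, Baire's theorem finds a portion
  of \<open>C' t\<close> whose image in \<open>V\<close> lies in the closure of a single covering
  set, so that its upper box dimension drops. There are countably many portions and rational
  thresholds \<open>t\<close>, and each has a null set of exceptional directions by the result for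
  box dimensions.\<close>

theorem packing_dim_exceptional_null:
  fixes E :: "'a::euclidean_space set" and m :: nat and \<gamma> s :: real
  assumes m: "1 \<le> m" "m \<le> DIM('a)" and \<gamma>: "0 \<le> \<gamma>" "\<gamma> \<le> real DIM('a) - real m"
    and s: "s > 0" "real m * (real DIM('a) - real m) - \<gamma> \<le> s"
    and E: "analytic_set E" "E \<noteq> {}"
  shows "hausdorff_measure (grassmannian m) grassmann_dist s
     {V \<in> grassmannian m. packing_dim (orth_proj V ` E) < packing_dim_profile (m + \<gamma>) E - ereal \<gamma>} = 0"
proof -
  define \<sigma> where "\<sigma> = real m + \<gamma>"
  obtain C :: "('a \<times> (nat \<Rightarrow> real)) set" where C: "closed C" "E = fst ` C"
    using E(1) by (auto simp: analytic_set_def)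
  obtain \<B>0 :: "('a \<times> (nat \<Rightarrow> real)) set set" where B0: "countable \<B>0" "topological_basis \<B>0"
    using ex_countable_basis by blast
  \<comment> \<open>Cutting with balls makes every portion project to a bounded set, as the result
    for box dimensions requires.\<close>
  define \<B> where "\<B> = (\<lambda>(O', k::nat). O' \<inter> (ball 0 (real k) \<times> UNIV)) ` (\<B>0 \<times> UNIV)"
  have B: "countable \<B>" unfolding \<B>_def using B0(1) by (intro countable_image countable_SIGMA) auto
  have Bopen: "open W" if "W \<in> \<B>" for W
    using that topological_basis_open[OF B0(2)] by (auto simp: \<B>_def intro!: open_Int open_Times)
  have Bbdd: "bounded (fst ` (W \<inter> S))" if W: "W \<in> \<B>" for W S
  proof -
    obtain p where "W = (\<lambda>(O', k::nat). O' \<inter> (ball 0 (real k) \<times> UNIV)) p" "p \<in> \<B>0 \<times> UNIV"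
      using W unfolding \<B>_def by (rule imageE)
    then have "fst ` (W \<inter> S) \<subseteq> ball 0 (real (snd p))" by (cases p) auto
    then show ?thesis using bounded_ball bounded_subset by blast
  qed
  have Bbase: "\<exists>W\<in>\<B>. z \<in> W \<and> W \<subseteq> U" if Uz: "open U" "z \<in> U" for U z
  proof -
    obtain O' where O': "O' \<in> \<B>0" "z \<in> O'" "O' \<subseteq> U" using topological_basisE[OF B0(2) Uz] by blast
    obtain k :: nat where "norm (fst z) < real k" using reals_Archimedean2 by blast
    then have "z \<in> O' \<inter> (ball 0 (real k) \<times> UNIV)" using O'(2) by (auto simp: mem_Times_iff)
    then show ?thesis using O' by (intro bexI[of _ "O' \<inter> (ball 0 (real k) \<times> UNIV)"]) (auto simp: \<B>_def)
  qed
  define R where "R t = {W \<in> \<B>. packing_thin \<sigma> t (fst ` (W \<inter> C))}" for t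
  define C' where "C' t = C - \<Union>(R t)" for t
  define A where "A t W = fst ` (W \<inter> C' t)" for t W
  define I where "I = {(t, W). t \<in> \<rat> \<and> W \<in> \<B> \<and> W \<inter> C' t \<noteq> {}}"
  define Z where "Z = (\<Union>i\<in>I. {V \<in> grassmannian m. upper_box_dim (orth_proj V ` A (fst i) (snd i)) <
     upper_box_dim_profile (m + \<gamma>) (A (fst i) (snd i)) - ereal \<gamma>})"
  have cI: "countable I"
    by (rule countable_subset[of _ "\<rat> \<times> \<B>"]) (auto simp: I_def intro!: countable_SIGMA B countable_rat)
  have Z: "hausdorff_measure (grassmannian m) grassmann_dist s Z = 0"
    unfolding Z_def
  proof (rule hausdorff_measure_eq_0_UN[OF s(1) cI])
    fix i assume i: "i \<in> I"
    show "hausdorff_measure (grassmannian m) grassmann_dist s {V \<in> grassmannian m. upper_box_dim (orth_proj V ` A (fst i) (snd i)) <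
       upper_box_dim_profile (m + \<gamma>) (A (fst i) (snd i)) - ereal \<gamma>} = 0"
    proof (rule box_dim_exceptional_null(2)[OF m \<gamma> s])
      show "bounded (A (fst i) (snd i))" unfolding A_def using i by (intro Bbdd) (auto simp: I_def)
      show "A (fst i) (snd i) \<noteq> {}" using i by (auto simp: A_def I_def)
    qed
  qed
  show ?thesis
  proof (rule hausdorff_measure_eq_0_subset[OF s(1) Z], rule subsetI)
    fix V assume "V \<in> {V \<in> grassmannian m. packing_dim (orth_proj V ` E) < packing_dim_profile (m + \<gamma>) E - ereal \<gamma>}"
    then have VG: "V \<in> grassmannian m" and bad: "packing_dim (orth_proj V ` E) < packing_dim_profile \<sigma> E - ereal \<gamma>"
      by (auto simp: \<sigma>_def)
    have cont: "continuous_on UNIV (orth_proj V)"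
      by (intro linear_continuous_on bounded_linear_orth_proj) (use VG in auto)
    obtain z1 where z1: "packing_dim (orth_proj V ` E) < ereal z1" "ereal z1 < packing_dim_profile \<sigma> E - ereal \<gamma>"
      using ereal_dense2[OF bad] by blast
    obtain z2 where z2: "ereal z1 < ereal z2" "ereal z2 < packing_dim_profile \<sigma> E - ereal \<gamma>"
      using ereal_dense2[OF z1(2)] by blast
    \<comment> \<open>A rational threshold, so that countably many sets \<open>C' t\<close> suffice,
      strictly between two reals that separate the two dimensions after the shift by
      \<open>\<gamma>\<close>.\<close>
    obtain t where t: "t \<in> \<rat>" "z1 + \<gamma> < t" "t < z2 + \<gamma>" using Rats_dense_in_real[of "z1 + \<gamma>" "z2 + \<gamma>"] z2(1) by auto
    have tP: "ereal t < packing_dim_profile \<sigma> E"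
    proof -
      have "ereal (z2 + \<gamma>) \<le> packing_dim_profile \<sigma> E" using z2(2) by (cases "packing_dim_profile \<sigma> E") auto
      moreover have "ereal t < ereal (z2 + \<gamma>)" using t by simp
      ultimately show ?thesis by (rule less_le_trans[rotated])
    qed
    obtain F :: "nat \<Rightarrow> 'a set" where F: "\<And>i. F i \<noteq> {}" "\<And>i. bounded (F i)" "orth_proj V ` E \<subseteq> (\<Union>i. F i)"
        "(SUP i. upper_box_dim (F i)) < ereal z1"
      using z1(1) unfolding packing_dim_def Inf_less_iff by blast
    have notthin: "\<not> packing_thin \<sigma> t E"
      using packing_thin_imp_packing_dim_profile_le[of \<sigma> t E] E(2) tP by auto
    have thinR: "packing_thin \<sigma> t (\<Union>W\<in>R t. fst ` (W \<inter> C))"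
      by (rule packing_thin_UN) (auto simp: R_def intro: countable_subset[OF _ B])
    have ne: "C' t \<noteq> {}"
    proof
      assume "C' t = {}"
      then have "C \<subseteq> \<Union>(R t)" by (simp add: C'_def)
      then have "E \<subseteq> (\<Union>W\<in>R t. fst ` (W \<inter> C))" unfolding C(2) by blast
      from packing_thin_subset[OF thinR this] notthin show False by simp
    qed
    have cl1: "closed (C' t)"
      unfolding C'_def using Bopen by (intro closed_Diff C(1) open_Union) (auto simp: R_def)
    define H where "H i = {c :: 'a \<times> (nat \<Rightarrow> real). orth_proj V (fst c) \<in> closure (F i)}" for i
    have cl2: "closed (H i)" for i
    proof -
      have "continuous_on UNIV (\<lambda>c :: 'a \<times> (nat \<Rightarrow> real). orth_proj V (fst c))"
        by (intro continuous_on_compose2[OF cont] continuous_intros) auto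
      from closed_vimage[OF closed_closure[of "F i"] this] show ?thesis by (simp add: vimage_def H_def)
    qed
    have cl3: "C' t \<subseteq> (\<Union>i. H i)"
    proof
      fix c assume "c \<in> C' t"
      then have "orth_proj V (fst c) \<in> orth_proj V ` E" by (auto simp: C'_def C(2))
      then obtain i where "orth_proj V (fst c) \<in> F i" using F(3) by blast
      then have "c \<in> H i" using closure_subset[of "F i"] by (auto simp: H_def)
      then show "c \<in> (\<Union>i. H i)" by blast
    qed
    obtain i U where U: "open U" "U \<inter> C' t \<noteq> {}" "U \<inter> C' t \<subseteq> H i"
      using Baire_closed_cover[where F = H, OF cl1 ne cl2 cl3] by blast
    obtain z where z: "z \<in> U" "z \<in> C' t" using U(2) by blast
    obtain W where W: "W \<in> \<B>" "z \<in> W" "W \<subseteq> U" using Bbase[OF U(1) z(1)] by blast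
    have Ane: "A t W \<noteq> {}" using W z by (auto simp: A_def)
    have Abdd: "bounded (A t W)" unfolding A_def by (rule Bbdd[OF W(1)])
    have "orth_proj V ` A t W \<subseteq> closure (F i)" using U(3) W(3) by (auto simp: A_def H_def)
    then have "upper_box_dim (orth_proj V ` A t W) \<le> upper_box_dim (F i)"
      using F(2) Ane by (intro upper_box_dim_mono_closure) auto
    also have "\<dots> \<le> (SUP i. upper_box_dim (F i))" by (rule SUP_upper) simp
    also have "\<dots> < ereal z1" by (rule F(4))
    finally have 1: "upper_box_dim (orth_proj V ` A t W) < ereal z1" .
    \<comment> \<open>Otherwise \<open>closure (A t W)\<close> together with the covers of the
      removed parts would make \<open>W\<close> itself a removed set, although it meets
      \<open>C' t\<close>.\<close>
    have 2: "ereal t < upper_box_dim_profile \<sigma> (A t W)"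
    proof (rule ccontr)
      assume "\<not> ereal t < upper_box_dim_profile \<sigma> (A t W)"
      then have "packing_thin \<sigma> t (A t W)"
        unfolding packing_thin_def using Ane Abdd closure_subset[of "A t W"]
        by (intro exI[of _ "{closure (A t W)}"]) (auto simp: upper_box_dim_profile_closure compact_closure)
      then have "packing_thin \<sigma> t (A t W \<union> (\<Union>W\<in>R t. fst ` (W \<inter> C)))"
        using thinR by (rule packing_thin_Un)
      then have "packing_thin \<sigma> t (fst ` (W \<inter> C))"
        by (rule packing_thin_subset) (force simp: A_def C'_def)
      then have "W \<in> R t" using W(1) by (simp add: R_def)
      then show False using z W by (auto simp: C'_def)
    qed
    have "ereal z1 < upper_box_dim_profile \<sigma> (A t W) - ereal \<gamma>"
      using 2 t(2) by (cases "upper_box_dim_profile \<sigma> (A t W)") auto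
    with 1 have "upper_box_dim (orth_proj V ` A t W) < upper_box_dim_profile \<sigma> (A t W) - ereal \<gamma>" by (rule less_trans)
    moreover have "(t, W) \<in> I" using t W z by (auto simp: I_def)
    ultimately show "V \<in> Z" unfolding Z_def \<sigma>_def using VG by (intro UN_I[of "(t, W)"]) auto
  qed
qed

section \<open>Net contents\<close>

text \<open>As an integral over counting measure the cost makes sense for any family without an
  enumeration, and Fatou's lemma applies to a sequence of families.\<close>

definition family_cost :: "('a set \<Rightarrow> ennreal) \<Rightarrow> 'a set set \<Rightarrow> ennreal" where
  "family_cost w \<C> = (\<integral>\<^sup>+Q. w Q * indicator \<C> Q \<partial>count_space UNIV)"

definition net_content :: "'a set set \<Rightarrow> ('a set \<Rightarrow> ennreal) \<Rightarrow> 'a set \<Rightarrow> ennreal" where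
  "net_content \<D> w A = (INF \<C>\<in>{\<C>. \<C> \<subseteq> \<D> \<and> A \<subseteq> \<Union>\<C>}. family_cost w \<C>)"

definition maximal_members :: "'a set set \<Rightarrow> 'a set set" where
  "maximal_members \<C> = {Q \<in> \<C>. \<forall>P\<in>\<C>. Q \<subseteq> P \<longrightarrow> P = Q}"

lemma net_content_le: "\<C> \<subseteq> \<D> \<Longrightarrow> A \<subseteq> \<Union>\<C> \<Longrightarrow> net_content \<D> w A \<le> family_cost w \<C>"
  unfolding net_content_def by (rule INF_lower) simp

lemma net_content_mono: "A \<subseteq> B \<Longrightarrow> net_content \<D> w A \<le> net_content \<D> w B"
  unfolding net_content_def by (rule INF_superset_mono) auto

lemma net_content_cover:
  assumes "net_content \<D> w A < c"
  shows "\<exists>\<C>. \<C> \<subseteq> \<D> \<and> A \<subseteq> \<Union>\<C> \<and> family_cost w \<C> < c"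
  using assms unfolding net_content_def INF_less_iff by auto

lemma family_cost_mono: "\<A> \<subseteq> \<B> \<Longrightarrow> family_cost w \<A> \<le> family_cost w \<B>"
  unfolding family_cost_def by (intro nn_integral_mono mult_left_mono) (auto simp: indicator_def)

lemma family_cost_Un: "family_cost w (\<A> \<union> \<B>) \<le> family_cost w \<A> + family_cost w \<B>"
proof -
  have "family_cost w (\<A> \<union> \<B>) \<le> (\<integral>\<^sup>+Q. w Q * indicator \<A> Q + w Q * indicator \<B> Q \<partial>count_space UNIV)"
    unfolding family_cost_def by (intro nn_integral_mono) (auto simp: indicator_def)
  also have "\<dots> = family_cost w \<A> + family_cost w \<B>"
    unfolding family_cost_def by (rule nn_integral_add) auto
  finally show ?thesis .
qed

lemma maximal_member_exists:
  assumes N2: "\<And>Q. Q \<in> \<D> \<Longrightarrow> finite {P\<in>\<D>. Q \<subseteq> P}" and \<C>: "\<C> \<subseteq> \<D>" "Q \<in> \<C>"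
  shows "\<exists>P\<in>maximal_members \<C>. Q \<subseteq> P"
proof -
  have fin: "finite {P\<in>\<C>. Q \<subseteq> P}"
    by (rule finite_subset[OF _ N2[of Q]]) (use \<C> in auto)
  have "Q \<in> {P\<in>\<C>. Q \<subseteq> P}" using \<C>(2) by simp
  from finite_has_maximal2[OF fin this] obtain P where P: "P \<in> \<C>" "Q \<subseteq> P" "\<forall>P'\<in>{P\<in>\<C>. Q \<subseteq> P}. P \<subseteq> P' \<longrightarrow> P = P'" by auto
  then have "P \<in> maximal_members \<C>" unfolding maximal_members_def by auto
  with P(2) show ?thesis by blast
qed

lemma maximal_members_subset: "maximal_members \<C> \<subseteq> \<C>"
  by (auto simp: maximal_members_def)

text \<open>
  Strong subadditivity: of two nested members of the families, the larger one is kept to cover the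
  union and the smaller one covers the intersection.
\<close>

lemma net_content_strong_subadditive:
  assumes N1: "\<And>P Q. P \<in> \<D> \<Longrightarrow> Q \<in> \<D> \<Longrightarrow> P \<inter> Q = {} \<or> P \<subseteq> Q \<or> Q \<subseteq> P"
    and AB: "\<A> \<subseteq> \<D>" "\<B> \<subseteq> \<D>" and X: "X \<subseteq> \<Union>\<A> \<inter> \<Union>\<B>"
  shows "family_cost w (maximal_members (\<A> \<union> \<B>)) + net_content \<D> w X \<le> family_cost w \<A> + family_cost w \<B>"
proof -
  define \<M> where "\<M> = maximal_members (\<A> \<union> \<B>)"
  define \<R> where "\<R> = ((\<A> \<union> \<B>) - \<M>) \<union> (\<A> \<inter> \<B>)"
  have "X \<subseteq> \<Union>\<R>"
  proof
    fix x assume "x \<in> X"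
    then obtain A B where AB': "A \<in> \<A>" "B \<in> \<B>" "x \<in> A" "x \<in> B" using X by blast
    then have "A \<inter> B \<noteq> {}" by blast
    then consider "A = B" | "A \<subset> B" | "B \<subset> A" using N1[of A B] AB AB' by blast
    then show "x \<in> \<Union>\<R>"
    proof cases
      case 1 then show ?thesis using AB' by (auto simp: \<R>_def)
    next
      case 2
      then have "A \<notin> \<M>" using AB' by (auto simp: \<M>_def maximal_members_def)
      then show ?thesis using AB' by (auto simp: \<R>_def)
    next
      case 3
      then have "B \<notin> \<M>" using AB' by (auto simp: \<M>_def maximal_members_def)
      then show ?thesis using AB' by (auto simp: \<R>_def)
    qed
  qed
  then have "net_content \<D> w X \<le> family_cost w \<R>" using AB by (intro net_content_le) (auto simp: \<R>_def)
  then have "family_cost w \<M> + net_content \<D> w X \<le> family_cost w \<M> + family_cost w \<R>" by (rule add_left_mono)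
  also have "\<dots> = (\<integral>\<^sup>+Q. w Q * indicator \<M> Q + w Q * indicator \<R> Q \<partial>count_space UNIV)"
    unfolding family_cost_def by (rule nn_integral_add[symmetric]) auto
  also have "\<dots> \<le> (\<integral>\<^sup>+Q. w Q * indicator \<A> Q + w Q * indicator \<B> Q \<partial>count_space UNIV)"
    using maximal_members_subset[of "\<A> \<union> \<B>"]
    by (intro nn_integral_mono) (auto simp: \<R>_def \<M>_def indicator_def)
  also have "\<dots> = family_cost w \<A> + family_cost w \<B>"
    unfolding family_cost_def by (rule nn_integral_add) auto
  finally show ?thesis by (simp add: \<M>_def)
qed

text \<open>Near-optimal covers of the \<open>A j\<close> are merged one after the other, keeping
  only maximal members. Strong subadditivity bounds the cost of each merge by the change of the
  contents plus an error, and the errors sum to \<open>\<epsilon>\<close>. As a member has finitely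
  many supersets, growing chains become constant, so the members present from some stage on cover
  the union, and Fatou's lemma bounds their cost. This continuity is what the capacity argument for
  projections of closed sets rests on.\<close>

theorem net_content_increasing:
  fixes A :: "nat \<Rightarrow> 'a set"
  assumes N1: "\<And>P Q. P \<in> \<D> \<Longrightarrow> Q \<in> \<D> \<Longrightarrow> P \<inter> Q = {} \<or> P \<subseteq> Q \<or> Q \<subseteq> P"
    and N2: "\<And>Q. Q \<in> \<D> \<Longrightarrow> finite {P\<in>\<D>. Q \<subseteq> P}"
    and A: "\<And>j. A j \<subseteq> A (Suc j)" and L: "\<And>j. net_content \<D> w (A j) \<le> L"
  shows "net_content \<D> w (\<Union>j. A j) \<le> L"
proof (rule ennreal_le_epsilon)
  fix \<epsilon> :: real assume Lfin: "L < top" and \<epsilon>: "\<epsilon> > 0"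
  let ?c = "net_content \<D> w"
  have fin: "?c (A j) < top" for j using L[of j] Lfin by (rule le_less_trans)
  define \<delta> where "\<delta> j = ennreal (\<epsilon> * (1/2) ^ Suc j)" for j
  have lt: "?c (A j) < ?c (A j) + \<delta> j" for j
  proof -
    have "\<delta> j > 0" using \<epsilon> by (simp add: \<delta>_def)
    then show ?thesis using fin[of j] ennreal_add_left_cancel_less[of "?c (A j)" 0 "\<delta> j"] by simp
  qed
  have "\<forall>j. \<exists>\<C>. \<C> \<subseteq> \<D> \<and> A j \<subseteq> \<Union>\<C> \<and> family_cost w \<C> < ?c (A j) + \<delta> j"
    using net_content_cover[OF lt] by (intro allI)
  then obtain \<C> where "\<forall>j. \<C> j \<subseteq> \<D> \<and> A j \<subseteq> \<Union>(\<C> j) \<and> family_cost w (\<C> j) < ?c (A j) + \<delta> j" by (rule choice[THEN exE])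
  then have \<C>: "\<C> j \<subseteq> \<D>" "A j \<subseteq> \<Union>(\<C> j)" "family_cost w (\<C> j) \<le> ?c (A j) + \<delta> j" for j
    using less_imp_le by blast+
  define \<Q> where "\<Q> = rec_nat (maximal_members (\<C> 0)) (\<lambda>j \<Q>. maximal_members (\<Q> \<union> \<C> (Suc j)))"
  have Q0: "\<Q> 0 = maximal_members (\<C> 0)" and QS: "\<Q> (Suc j) = maximal_members (\<Q> j \<union> \<C> (Suc j))" for j
    by (simp_all add: \<Q>_def)
  have QD: "\<Q> j \<subseteq> \<D>" for j
  proof (induction j)
    case 0 then show ?case unfolding Q0 using maximal_members_subset \<C>(1) by blast
  next
    case (Suc j) then show ?case unfolding QS using maximal_members_subset[of "\<Q> j \<union> \<C> (Suc j)"] \<C>(1)[of "Suc j"] by blast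
  qed
  have up: "\<exists>P\<in>\<Q> (Suc j). Q \<subseteq> P" if "Q \<in> \<Q> j \<union> \<C> (Suc j)" for Q j
    unfolding QS using QD[of j] \<C>(1)[of "Suc j"] that by (intro maximal_member_exists[OF N2]) auto
  have cov: "A j \<subseteq> \<Union>(\<Q> j)" for j
  proof (cases j)
    case 0
    show ?thesis
    proof
      fix x assume "x \<in> A j"
      then obtain Q where "Q \<in> \<C> 0" "x \<in> Q" using \<C>(2) 0 by blast
      with maximal_member_exists[OF N2 \<C>(1)] show "x \<in> \<Union>(\<Q> j)" unfolding 0 Q0 by blast
    qed
  next
    case (Suc i)
    show ?thesis
    proof
      fix x assume "x \<in> A j"
      then obtain Q where "Q \<in> \<C> (Suc i)" "x \<in> Q" using \<C>(2)[of "Suc i"] Suc by blast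
      with up[of Q i] show "x \<in> \<Union>(\<Q> j)" unfolding Suc by blast
    qed
  qed
  have cost: "family_cost w (\<Q> j) \<le> ?c (A j) + ennreal (\<epsilon> * (1 - (1/2) ^ Suc j))" for j
  proof (induction j)
    case 0
    have "family_cost w (\<Q> 0) \<le> family_cost w (\<C> 0)" unfolding Q0 by (intro family_cost_mono maximal_members_subset)
    also have "\<dots> \<le> ?c (A 0) + \<delta> 0" by (rule \<C>(3))
    finally show ?case by (simp add: \<delta>_def)
  next
    case (Suc j)
    have "A j \<subseteq> \<Union>(\<Q> j) \<inter> \<Union>(\<C> (Suc j))" using cov[of j] \<C>(2)[of "Suc j"] A[of j] by blast
    then have "family_cost w (\<Q> (Suc j)) + ?c (A j) \<le> family_cost w (\<Q> j) + family_cost w (\<C> (Suc j))"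
      unfolding QS by (intro net_content_strong_subadditive N1 QD \<C>(1))
    also have "\<dots> \<le> (?c (A j) + ennreal (\<epsilon> * (1 - (1/2) ^ Suc j))) + (?c (A (Suc j)) + \<delta> (Suc j))"
      by (intro add_mono Suc.IH \<C>(3))
    also have "\<dots> = (?c (A (Suc j)) + (ennreal (\<epsilon> * (1 - (1/2) ^ Suc j)) + \<delta> (Suc j))) + ?c (A j)"
      by (simp add: ac_simps)
    also have "ennreal (\<epsilon> * (1 - (1/2) ^ Suc j)) + \<delta> (Suc j) = ennreal (\<epsilon> * (1 - (1/2) ^ Suc (Suc j)))"
    proof -
      have "(1/2 :: real) ^ Suc j \<le> 1" by (rule power_le_one) auto
      then have "0 \<le> \<epsilon> * (1 - (1/2) ^ Suc j)" using \<epsilon> by (intro mult_nonneg_nonneg) (simp_all del: power_Suc)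
      then have "ennreal (\<epsilon> * (1 - (1/2) ^ Suc j)) + \<delta> (Suc j) =
         ennreal (\<epsilon> * (1 - (1/2) ^ Suc j) + \<epsilon> * (1/2) ^ Suc (Suc j))"
        using \<epsilon> unfolding \<delta>_def by (intro ennreal_plus[symmetric]) auto
      also have "\<epsilon> * (1 - (1/2) ^ Suc j) + \<epsilon> * (1/2) ^ Suc (Suc j) = \<epsilon> * (1 - (1/2) ^ Suc (Suc j))"
        by (simp add: algebra_simps)
      finally show ?thesis .
    qed
    \<comment> \<open>The content of \<open>A j\<close> is finite and can be cancelled on both
      sides.\<close>
    finally show ?case using fin[of j]
      by (metis add.commute ennreal_add_left_cancel_le infinity_ennreal_def less_irrefl)
  qed
  define \<Q>' where "\<Q>' = {Q. \<forall>\<^sub>F j in sequentially. Q \<in> \<Q> j}"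
  have sub: "\<Q>' \<subseteq> \<D>" using QD by (auto simp: \<Q>'_def eventually_sequentially)
  have "(\<Union>j. A j) \<subseteq> \<Union>\<Q>'"
  proof
    fix x assume "x \<in> (\<Union>j. A j)"
    then obtain i where "x \<in> A i" by blast
    then obtain P0 where P0: "P0 \<in> \<Q> i" "x \<in> P0" using cov by blast
    have "\<exists>P. \<forall>j. (P j \<in> \<Q> (i + j)) \<and> (P j \<subseteq> P (Suc j)) \<and> (x \<in> P j)"
    proof -
      have "\<exists>P. \<forall>j. (P j \<in> \<Q> (i + j) \<and> x \<in> P j) \<and> P j \<subseteq> P (Suc j)"
      proof (rule dependent_nat_choice)
        show "\<exists>P. P \<in> \<Q> (i + 0) \<and> x \<in> P" using P0 by auto
        fix P j assume P: "P \<in> \<Q> (i + j) \<and> x \<in> P"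
        then obtain P' where "P' \<in> \<Q> (Suc (i + j))" "P \<subseteq> P'" using up[of P "i + j"] by blast
        with P show "\<exists>P'. (P' \<in> \<Q> (i + Suc j) \<and> x \<in> P') \<and> P \<subseteq> P'" by auto
      qed
      then show ?thesis by blast
    qed
    then obtain P where P: "\<And>j. P j \<in> \<Q> (i + j)" "\<And>j. P j \<subseteq> P (Suc j)" "\<And>j. x \<in> P j" by blast
    have mono: "P j \<subseteq> P k" if "j \<le> k" for j k using P(2) that by (rule lift_Suc_mono_le)
    have "range P \<subseteq> {Q\<in>\<D>. P 0 \<subseteq> Q}" using P(1) QD mono[of 0] by blast
    then have fr: "finite (range P)" using N2[of "P 0"] P(1)[of 0] QD finite_subset by blast
    \<comment> \<open>A maximal element of the finite range of an increasing chain is its eventual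
      value.\<close>
    obtain M where M: "M \<in> range P" "\<forall>Q\<in>range P. M \<subseteq> Q \<longrightarrow> M = Q"
      using finite_has_maximal[OF fr] by auto
    then obtain J where J: "M = P J" by blast
    have "P k = M" if "k \<ge> J" for k using M(2) mono[OF that] J by auto
    then have "M \<in> \<Q> k" if "k \<ge> i + J" for k using P(1)[of "k - i"] that by auto
    then have "M \<in> \<Q>'" by (auto simp: \<Q>'_def eventually_sequentially)
    then show "x \<in> \<Union>\<Q>'" using P(3) J by blast
  qed
  then have "?c (\<Union>j. A j) \<le> family_cost w \<Q>'" by (intro net_content_le sub)
  also have "\<dots> \<le> (\<integral>\<^sup>+Q. liminf (\<lambda>j. w Q * indicator (\<Q> j) Q) \<partial>count_space UNIV)"
    unfolding family_cost_def
  proof (intro nn_integral_mono)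
    fix Q show "w Q * indicator \<Q>' Q \<le> liminf (\<lambda>j. w Q * indicator (\<Q> j) Q)"
    proof (cases "Q \<in> \<Q>'")
      case True
      then have "\<forall>\<^sub>F j in sequentially. w Q \<le> w Q * indicator (\<Q> j) Q"
        unfolding \<Q>'_def by (auto elim!: eventually_mono)
      then have "w Q \<le> liminf (\<lambda>j. w Q * indicator (\<Q> j) Q)" by (rule Liminf_bounded)
      then show ?thesis using True by simp
    qed simp
  qed
  also have "\<dots> \<le> liminf (\<lambda>j. family_cost w (\<Q> j))"
    unfolding family_cost_def by (rule nn_integral_liminf) auto
  also have "\<dots> \<le> liminf (\<lambda>j. L + ennreal \<epsilon>)"
  proof (intro Liminf_mono always_eventually allI)
    fix j
    have "?c (A j) + ennreal (\<epsilon> * (1 - (1/2) ^ Suc j)) \<le> L + ennreal \<epsilon>"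
      using \<epsilon> by (intro add_mono L ennreal_leI) (simp add: mult_left_le)
    then show "family_cost w (\<Q> j) \<le> L + ennreal \<epsilon>" using cost[of j] by (rule order_trans[rotated])
  qed
  also have "\<dots> = L + ennreal \<epsilon>" by (rule Liminf_const) simp
  finally show "?c (\<Union>j. A j) \<le> L + ennreal \<epsilon>" .
qed

text \<open>The half-open cube of side \<open>2^-k\<close> containing \<open>x\<close>, named by any
  of its points. As \<open>k\<close> is natural, no cube has side larger than 1, and each has
  finitely many supersets among the cubes.\<close>

definition dyadic_cube :: "nat \<Rightarrow> 'a::euclidean_space \<Rightarrow> 'a set" where
  "dyadic_cube k x = {y. \<forall>b\<in>Basis. \<lfloor>2 ^ k * (y \<bullet> b)\<rfloor> = \<lfloor>2 ^ k * (x \<bullet> b)\<rfloor>}"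

definition dyadic_cubes :: "'a::euclidean_space set set" where
  "dyadic_cubes = {dyadic_cube k x | k x. True}"

lemma dyadic_cube_self: "x \<in> dyadic_cube k x"
  by (simp add: dyadic_cube_def)

lemma dyadic_cube_eq: "y \<in> dyadic_cube k x \<Longrightarrow> dyadic_cube k y = dyadic_cube k x"
  by (auto simp: dyadic_cube_def)

lemma dyadic_cube_antimono:
  assumes "j \<le> k"
  shows "dyadic_cube k x \<subseteq> dyadic_cube j x"
proof -
  have fl: "\<lfloor>2 ^ j * a :: real\<rfloor> = \<lfloor>2 ^ k * a\<rfloor> div 2 ^ (k - j)" for a
  proof -
    obtain l where l: "k = j + l" using assms le_Suc_ex by blast
    have "2 ^ j * a = (2 ^ k * a) / real_of_int (2 ^ (k - j))"
      by (simp add: l power_add)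
    then show ?thesis by (metis floor_divide_real_eq_div zero_le_power zero_le_numeral)
  qed
  show ?thesis unfolding dyadic_cube_def using fl by auto
qed

lemma dyadic_cubes_nested:
  assumes "P \<in> dyadic_cubes" "Q \<in> dyadic_cubes"
  shows "P \<inter> Q = {} \<or> P \<subseteq> Q \<or> Q \<subseteq> P"
proof -
  obtain j x k y where PQ: "P = dyadic_cube j x" "Q = dyadic_cube k y" using assms by (auto simp: dyadic_cubes_def)
  show ?thesis
  proof (cases "P \<inter> Q = {}")
    case False
    then obtain z where z: "z \<in> P" "z \<in> Q" by blast
    then have "P = dyadic_cube j z" "Q = dyadic_cube k z" unfolding PQ using dyadic_cube_eq by blast+
    then show ?thesis using dyadic_cube_antimono[of j k z] dyadic_cube_antimono[of k j z] by (cases "j \<le> k") auto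
  qed simp
qed

lemma dyadic_cubes_finite_supersets:
  assumes "Q \<in> dyadic_cubes"
  shows "finite {P\<in>dyadic_cubes. Q \<subseteq> P}"
proof -
  obtain k x where Q: "Q = dyadic_cube k x" using assms by (auto simp: dyadic_cubes_def)
  have "P \<in> (\<lambda>j. dyadic_cube j x) ` {..k}" if P: "P \<in> dyadic_cubes" "Q \<subseteq> P" for P
  proof -
    obtain j y where Py: "P = dyadic_cube j y" using P(1) by (auto simp: dyadic_cubes_def)
    have "x \<in> P" using P(2) dyadic_cube_self[of x k] Q by blast
    then have Px: "P = dyadic_cube j x" unfolding Py using dyadic_cube_eq by blast
    show ?thesis
    proof (cases "j \<le> k")
      case False
      then have "P \<subseteq> Q" unfolding Px Q by (intro dyadic_cube_antimono) simp
      then have "P = Q" using P(2) by simp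
      then show ?thesis using Q by auto
    qed (use Px in auto)
  qed
  then have "{P\<in>dyadic_cubes. Q \<subseteq> P} \<subseteq> (\<lambda>j. dyadic_cube j x) ` {..k}" by blast
  then show ?thesis by (rule finite_subset) simp
qed

lemma dyadic_cube_dist:
  fixes x :: "'a::euclidean_space"
  assumes "y \<in> dyadic_cube k x" "z \<in> dyadic_cube k x"
  shows "dist y z \<le> DIM('a) * (1/2) ^ k"
proof -
  have "\<bar>(y - z) \<bullet> b\<bar> \<le> (1/2) ^ k" if b: "b \<in> Basis" for b
  proof -
    have "\<lfloor>2 ^ k * (y \<bullet> b)\<rfloor> = \<lfloor>2 ^ k * (z \<bullet> b)\<rfloor>" using assms b by (simp add: dyadic_cube_def)
    then have "\<bar>2 ^ k * (y \<bullet> b) - 2 ^ k * (z \<bullet> b)\<bar> \<le> 1" by linarith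
    then have "2 ^ k * \<bar>(y - z) \<bullet> b\<bar> \<le> 1" by (simp add: inner_diff_left right_diff_distrib[symmetric] abs_mult)
    then show ?thesis by (simp add: power_one_over field_simps)
  qed
  from norm_le_sum_orthonormal[OF this] show ?thesis by (simp add: dist_norm)
qed

lemma dyadic_cubes_countable: "countable (dyadic_cubes :: 'a::euclidean_space set set)"
proof -
  let ?f = "\<lambda>(k::nat, z). {y::'a. \<forall>b\<in>Basis. \<lfloor>2 ^ k * (y \<bullet> b)\<rfloor> = z b}"
  have sub: "dyadic_cubes \<subseteq> ?f ` (UNIV \<times> (\<Pi>\<^sub>E b\<in>(Basis::'a set). UNIV))"
  proof
    fix Q :: "'a set" assume "Q \<in> dyadic_cubes"
    then obtain k x where "Q = dyadic_cube k x" by (auto simp: dyadic_cubes_def)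
    then have "Q = ?f (k, \<lambda>b\<in>Basis. \<lfloor>2 ^ k * (x \<bullet> b)\<rfloor>)" by (simp add: dyadic_cube_def)
    then show "Q \<in> ?f ` (UNIV \<times> (\<Pi>\<^sub>E b\<in>(Basis::'a set). UNIV))"
      by (rule image_eqI) (simp add: restrict_PiE_iff)
  qed
  have cnt: "countable (UNIV \<times> (\<Pi>\<^sub>E b\<in>(Basis::'a set). (UNIV :: int set)) :: (nat \<times> ('a \<Rightarrow> int)) set)"
    by (intro countable_SIGMA countable_PiE) auto
  show ?thesis by (rule countable_subset[OF sub countable_image[OF cnt]])
qed

section \<open>Compact subsets of analytic sets\<close>

lemma family_cost_finite:
  assumes "finite \<C>"
  shows "family_cost w \<C> \<le> (\<Sum>Q\<in>\<C>. w Q)"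
  using assms
proof (induction \<C> rule: finite_induct)
  case empty
  show ?case by (simp add: family_cost_def)
next
  case (insert Q \<C>)
  have "family_cost w (insert Q \<C>) \<le> family_cost w {Q} + family_cost w \<C>"
    using family_cost_Un[of w "{Q}" \<C>] by simp
  also have "family_cost w {Q} = w Q"
    unfolding family_cost_def by (subst nn_integral_indicator_singleton) auto
  also have "w Q + family_cost w \<C> \<le> w Q + (\<Sum>Q\<in>\<C>. w Q)" by (intro add_left_mono insert.IH)
  finally show ?case using insert by simp
qed

lemma net_content_UN_finite:
  assumes "finite I" "\<And>i. i \<in> I \<Longrightarrow> net_content \<D> w (A i) < b i"
  shows "net_content \<D> w (\<Union>i\<in>I. A i) \<le> (\<Sum>i\<in>I. b i)"
proof -
  have "\<forall>i\<in>I. \<exists>\<C>. \<C> \<subseteq> \<D> \<and> A i \<subseteq> \<Union>\<C> \<and> family_cost w \<C> < b i"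
    using net_content_cover[OF assms(2)] by (intro ballI)
  then obtain \<C> where "\<forall>i\<in>I. \<C> i \<subseteq> \<D> \<and> A i \<subseteq> \<Union>(\<C> i) \<and> family_cost w (\<C> i) < b i" by (rule bchoice[THEN exE])
  then have \<C>: "\<C> i \<subseteq> \<D>" "A i \<subseteq> \<Union>(\<C> i)" "family_cost w (\<C> i) \<le> b i" if "i \<in> I" for i
    using that less_imp_le by blast+
  have "net_content \<D> w (\<Union>i\<in>I. A i) \<le> family_cost w (\<Union>i\<in>I. \<C> i)"
  proof (rule net_content_le)
    show "(\<Union>i\<in>I. \<C> i) \<subseteq> \<D>" using \<C>(1) by blast
    show "(\<Union>i\<in>I. A i) \<subseteq> \<Union>(\<Union>i\<in>I. \<C> i)" using \<C>(2) by blast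
  qed
  also have "\<dots> \<le> (\<Sum>i\<in>I. family_cost w (\<C> i))"
    using assms(1)
  proof (induction I rule: finite_induct)
    case empty
    show ?case by (simp add: family_cost_def)
  next
    case (insert i I)
    have "family_cost w (\<Union>i\<in>insert i I. \<C> i) \<le> family_cost w (\<C> i) + family_cost w (\<Union>i\<in>I. \<C> i)"
      using family_cost_Un[of w "\<C> i" "\<Union>i\<in>I. \<C> i"] by simp
    also have "\<dots> \<le> family_cost w (\<C> i) + (\<Sum>i\<in>I. family_cost w (\<C> i))" by (intro add_left_mono insert.IH)
    finally show ?case using insert by simp
  qed
  also have "\<dots> \<le> (\<Sum>i\<in>I. b i)" by (intro sum_mono \<C>(3))
  finally show ?thesis .
qed

definition cube_cost :: "real \<Rightarrow> 'a::euclidean_space set \<Rightarrow> ennreal" where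
  "cube_cost t Q = ennreal (diameter Q powr t)"

abbreviation cube_content :: "real \<Rightarrow> 'a::euclidean_space set \<Rightarrow> ennreal" where
  "cube_content t \<equiv> net_content dyadic_cubes (cube_cost t)"

lemma bounded_dyadic_cube: "Q \<in> dyadic_cubes \<Longrightarrow> bounded Q"
  unfolding dyadic_cubes_def bounded_two_points using dyadic_cube_dist by blast

text \<open>A family of cost below \<open>\<epsilon> \<le> 1\<close> contains only cubes of diameter
  at most 1, so, once enumerated, it is an admissible cover for the Hausdorff content at scale
  1.\<close>

lemma cube_content_eq_0_imp_hausdorff_measure_eq_0:
  fixes A :: "'a::euclidean_space set"
  assumes z: "cube_content t A = 0" and t: "t > 0"
  shows "hausdorff_measure UNIV dist t A = 0"
proof -
  have "hausdorff_content UNIV dist t 1 A \<le> ennreal \<epsilon>" if \<epsilon>: "0 < \<epsilon>" "\<epsilon> \<le> 1" for \<epsilon>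
  proof -
    have "cube_content t A < ennreal \<epsilon>" using z \<epsilon> by simp
    from net_content_cover[OF this] obtain \<C>
      where "\<C> \<subseteq> dyadic_cubes \<and> A \<subseteq> \<Union>\<C> \<and> family_cost (cube_cost t) \<C> < ennreal \<epsilon>" by (rule exE)
    then have \<C>: "\<C> \<subseteq> dyadic_cubes" "A \<subseteq> \<Union>\<C>" "family_cost (cube_cost t) \<C> < ennreal \<epsilon>" by simp_all
    define N where "N = to_nat_on (dyadic_cubes :: 'a set set)"
    define Fr where "Fr = from_nat_into (dyadic_cubes :: 'a set set)"
    have FN: "Fr (N Q) = Q" if "Q \<in> \<C>" for Q
      unfolding Fr_def N_def using that \<C>(1) by (intro from_nat_into_to_nat_on dyadic_cubes_countable) auto
    define U where "U i = (if i \<in> N ` \<C> then Fr i else {})" for i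
    have UC: "U i \<in> \<C> \<or> U i = {}" for i using FN by (auto simp: U_def)
    have dle: "cube_cost t Q < ennreal \<epsilon>" if Q: "Q \<in> \<C>" for Q
    proof -
      have "cube_cost t Q = family_cost (cube_cost t) {Q}"
        unfolding family_cost_def by (subst nn_integral_indicator_singleton) auto
      also have "\<dots> \<le> family_cost (cube_cost t) \<C>" using Q by (intro family_cost_mono) auto
      finally show ?thesis using \<C>(3) by (rule le_less_trans)
    qed
    have d1: "diameter Q \<le> 1" if Q: "Q \<in> \<C>" for Q
    proof (rule ccontr)
      assume "\<not> diameter Q \<le> 1"
      then have "1 \<le> diameter Q powr t" using t by (intro ge_one_powr_ge_zero) auto
      moreover have "diameter Q powr t < \<epsilon>" using dle[OF Q] by (simp add: cube_cost_def ennreal_less_iff)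
      ultimately show False using \<epsilon> by simp
    qed
    have sd: "set_diam dist Q \<le> ennreal (diameter Q)" if Q: "Q \<in> \<C>" for Q
      using diameter_bounded_bound[OF bounded_dyadic_cube[of Q]] Q \<C>(1) by (intro set_diam_leI) auto
    have "hausdorff_content UNIV dist t 1 A \<le> (\<Sum>i. ennreal (enn2real (set_diam dist (U i)) powr t))"
    proof (rule hausdorff_content_le)
      show "set_diam dist (U i) \<le> ennreal 1" for i
        using UC[of i] order_trans[OF sd ennreal_leI[OF d1]] by auto
      show "A \<subseteq> (\<Union>i. U i)"
      proof
        fix x assume "x \<in> A"
        then obtain Q where Q: "Q \<in> \<C>" "x \<in> Q" using \<C>(2) by blast
        then have "x \<in> U (N Q)" using FN[OF Q(1)] by (simp add: U_def)
        then show "x \<in> (\<Union>i. U i)" by blast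
      qed
    qed simp
    also have "\<dots> \<le> (\<Sum>i. cube_cost t (Fr i) * indicator (N ` \<C>) i)"
    proof (intro suminf_le summableI)
      fix i
      show "ennreal (enn2real (set_diam dist (U i)) powr t) \<le> cube_cost t (Fr i) * indicator (N ` \<C>) i"
      proof (cases "i \<in> N ` \<C>")
        case True
        then have U: "U i = Fr i" "Fr i \<in> \<C>" using FN by (auto simp: U_def)
        have "enn2real (set_diam dist (Fr i)) \<le> diameter (Fr i)"
          using sd[OF U(2)] by (intro enn2real_leI) (auto intro!: diameter_ge_0 bounded_dyadic_cube subsetD[OF \<C>(1)] U)
        then show ?thesis using True t U by (auto simp: cube_cost_def intro!: ennreal_leI powr_mono2)
      qed (simp add: U_def)
    qed
    also have "\<dots> = (\<integral>\<^sup>+i. cube_cost t (Fr i) * indicator (N ` \<C>) i \<partial>count_space UNIV)"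
      by (rule nn_integral_count_space_nat[symmetric])
    also have "\<dots> = (\<integral>\<^sup>+i. cube_cost t (Fr i) \<partial>count_space (N ` \<C>))"
      by (simp add: nn_integral_count_space_indicator)
    also have "\<dots> = (\<integral>\<^sup>+Q. cube_cost t (Fr (N Q)) \<partial>count_space \<C>)"
    proof (rule nn_integral_bij_count_space[symmetric])
      show "bij_betw N \<C> (N ` \<C>)" using FN by (intro inj_on_imp_bij_betw inj_on_inverseI[of _ Fr]) auto
    qed
    also have "\<dots> = (\<integral>\<^sup>+Q. cube_cost t Q \<partial>count_space \<C>)"
      by (rule nn_integral_cong) (simp add: FN(1))
    also have "\<dots> = family_cost (cube_cost t) \<C>" by (simp add: family_cost_def nn_integral_count_space_indicator)
    also have "\<dots> \<le> ennreal \<epsilon>" using \<C>(3) by (rule less_imp_le)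
    finally show ?thesis .
  qed
  note small = this
  have "hausdorff_content UNIV dist t 1 A \<le> 0 + ennreal e" if "e > 0" for e :: real
  proof -
    have "hausdorff_content UNIV dist t 1 A \<le> ennreal (min e 1)" by (rule small) (use that in auto)
    also have "\<dots> \<le> ennreal e" by (intro ennreal_leI) simp
    finally show ?thesis by simp
  qed
  then have "hausdorff_content UNIV dist t 1 A \<le> 0" by (rule ennreal_le_epsilon)
  then show ?thesis using t by (simp add: hausdorff_measure_eq_0_iff[of t 1])
qed

lemma dyadic_scale_ex:
  fixes \<rho> :: real
  assumes "0 < \<rho>" "\<rho> \<le> 1"
  shows "\<exists>k. \<rho> \<le> (1/2) ^ k \<and> (1/2) ^ k \<le> 2 * \<rho>"
proof (cases "\<rho> = 1")
  case True
  then show ?thesis by (intro exI[of _ 0]) auto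
next
  case False
  then show ?thesis using dyadic_scale[of \<rho> 0] assms by auto
qed

text \<open>With \<open>\<rho> \<le> 2^-k \<le> 2 * \<rho>\<close>, the integer coordinates of a
  cube of generation \<open>k\<close> meeting the ball differ from those of the centre by at most 2.
  This leaves at most \<open>5 ^ DIM('a)\<close> cubes, all of side at most
  \<open>2 * \<rho>\<close>.\<close>

lemma cube_content_ball_le:
  fixes a :: "'a::euclidean_space"
  assumes \<rho>: "0 < \<rho>" "\<rho> \<le> 1" and t: "t > 0"
  shows "cube_content t (ball a \<rho>) \<le> ennreal (5 ^ DIM('a) * (2 * DIM('a)) powr t * \<rho> powr t)"
proof -
  obtain k where k: "\<rho> \<le> (1/2) ^ k" "(1/2) ^ k \<le> 2 * \<rho>" using dyadic_scale_ex[OF \<rho>] by blast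
  define f where "f b = \<lfloor>2 ^ k * (a \<bullet> b)\<rfloor>" for b
  define Z where "Z = (\<Pi>\<^sub>E b\<in>(Basis::'a set). {f b - 2 .. f b + 2})"
  define \<C> where "\<C> = {dyadic_cube k y | y. y \<in> ball a \<rho>}"
  define g where "g z = {y::'a. \<forall>b\<in>Basis. \<lfloor>2 ^ k * (y \<bullet> b)\<rfloor> = z b}" for z
  have CZ: "\<C> \<subseteq> g ` Z"
  proof
    fix Q assume "Q \<in> \<C>"
    then obtain y where y: "Q = dyadic_cube k y" "y \<in> ball a \<rho>" by (auto simp: \<C>_def)
    define z where "z = (\<lambda>b\<in>Basis. \<lfloor>2 ^ k * (y \<bullet> b)\<rfloor>)"
    have "Q = g z" by (simp add: y g_def z_def dyadic_cube_def)
    moreover have "z \<in> Z"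
      unfolding Z_def z_def
    proof (intro restrict_PiE_iff[THEN iffD2] ballI)
      fix b :: 'a assume b: "b \<in> Basis"
      have "\<bar>(y - a) \<bullet> b\<bar> \<le> norm (y - a)" using b by (rule Basis_le_norm)
      also have "\<dots> \<le> (1/2) ^ k" using y(2) k(1) by (simp add: dist_norm norm_minus_commute)
      finally have "2 ^ k * \<bar>(y - a) \<bullet> b\<bar> \<le> 2 ^ k * (1/2) ^ k" by (intro mult_left_mono) auto
      also have "\<dots> = (1::real)" by (simp add: power_mult_distrib[symmetric])
      finally have "\<bar>2 ^ k * (y \<bullet> b) - 2 ^ k * (a \<bullet> b)\<bar> \<le> 1"
        by (simp add: inner_diff_left right_diff_distrib[symmetric] abs_mult)
      then show "\<lfloor>2 ^ k * (y \<bullet> b)\<rfloor> \<in> {f b - 2 .. f b + 2}" unfolding f_def by (simp, linarith)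
    qed
    ultimately show "Q \<in> g ` Z" by (rule image_eqI)
  qed
  have finZ: "finite Z" unfolding Z_def by (intro finite_PiE) auto
  have cardZ: "card Z = 5 ^ DIM('a)" by (simp add: Z_def card_PiE)
  have finC: "finite \<C>" using CZ finZ finite_surj by blast
  have "card \<C> \<le> card Z" using CZ finZ by (rule surj_card_le[rotated])
  have CD: "\<C> \<subseteq> dyadic_cubes" by (auto simp: \<C>_def dyadic_cubes_def)
  have "cube_content t (ball a \<rho>) \<le> family_cost (cube_cost t) \<C>"
  proof (rule net_content_le[OF CD])
    show "ball a \<rho> \<subseteq> \<Union>\<C>"
    proof
      fix y assume "y \<in> ball a \<rho>"
      then have "dyadic_cube k y \<in> \<C>" by (auto simp: \<C>_def)
      then show "y \<in> \<Union>\<C>" using dyadic_cube_self[of y k] by blast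
    qed
  qed
  also have "\<dots> \<le> (\<Sum>Q\<in>\<C>. cube_cost t Q)" by (rule family_cost_finite[OF finC])
  also have "\<dots> \<le> (\<Sum>Q\<in>\<C>. ennreal ((DIM('a) * (2 * \<rho>)) powr t))"
  proof (intro sum_mono)
    fix Q assume Q: "Q \<in> \<C>"
    then obtain y where y: "Q = dyadic_cube k y" by (auto simp: \<C>_def)
    have "diameter Q \<le> DIM('a) * (1/2) ^ k"
      unfolding y by (rule diameter_le) (use dyadic_cube_dist[of _ k y] in \<open>auto simp: dist_norm\<close>)
    also have "\<dots> \<le> DIM('a) * (2 * \<rho>)" using k by (intro mult_left_mono) auto
    finally show "cube_cost t Q \<le> ennreal ((DIM('a) * (2 * \<rho>)) powr t)"
      unfolding cube_cost_def using t CD Q by (intro ennreal_leI powr_mono2 diameter_ge_0 bounded_dyadic_cube) auto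
  qed
  also have "\<dots> = ennreal (real (card \<C>) * (DIM('a) * (2 * \<rho>)) powr t)"
    by (simp add: ennreal_mult ennreal_of_nat_eq_real_of_nat)
  also have "\<dots> \<le> ennreal (5 ^ DIM('a) * (DIM('a) * (2 * \<rho>)) powr t)"
  proof (intro ennreal_leI mult_right_mono)
    have "real (card \<C>) \<le> real (card Z)" using \<open>card \<C> \<le> card Z\<close> by simp
    then show "real (card \<C>) \<le> 5 ^ DIM('a)" by (simp add: cardZ)
  qed simp
  also have "(DIM('a) * (2 * \<rho>)) powr t = (2 * DIM('a)) powr t * \<rho> powr t"
    unfolding powr_mult[symmetric] by (simp add: mult_ac)
  finally show ?thesis by (simp add: mult.assoc)
qed

lemma compact_function_box:
  fixes B :: "'i \<Rightarrow> 'b::topological_space set"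
  assumes "\<And>i. compact (B i)"
  shows "compact (PiE UNIV B)"
proof -
  have "compactin (product_topology (\<lambda>i. euclidean) UNIV) (PiE UNIV B)"
    using assms by (simp add: compactin_PiE)
  then show ?thesis by (simp add: euclidean_product_topology)
qed

text \<open>
  Choquet's argument: bound the coordinates of the second factor one after the other, losing
  arbitrarily little content each time.
\<close>

lemma compact_subset_of_projection:
  fixes C :: "('a::euclidean_space \<times> (nat \<Rightarrow> real)) set"
  assumes C: "closed C" "C \<subseteq> cball q R \<times> UNIV"
    and big: "\<eta> < cube_content t (fst ` C)"
  shows "\<exists>K. compact K \<and> K \<subseteq> fst ` C \<and> (\<forall>U. open U \<longrightarrow> K \<subseteq> U \<longrightarrow> \<eta> < cube_content t U)"
proof -
  have "\<exists>G. \<forall>j. (\<eta> < cube_content t (fst ` G j) \<and> (j = 0 \<longrightarrow> G j = C)) \<and> (\<exists>M::nat. G (Suc j) = {z\<in>G j. \<bar>snd z j\<bar> \<le> real M})"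
  proof (rule dependent_nat_choice)
    show "\<exists>G. \<eta> < cube_content t (fst ` G) \<and> (0 = (0::nat) \<longrightarrow> G = C)" using big by blast
    fix G and j :: nat assume G: "\<eta> < cube_content t (fst ` G) \<and> (j = 0 \<longrightarrow> G = C)"
    define A where "A M = fst ` {z\<in>G. \<bar>snd z j\<bar> \<le> real M}" for M
    have "(\<Union>M. A M) = fst ` G"
    proof (intro equalityI subsetI)
      fix x assume "x \<in> fst ` G"
      then obtain z where z: "z \<in> G" "x = fst z" by blast
      obtain M :: nat where "\<bar>snd z j\<bar> \<le> real M" using real_arch_simple by blast
      with z show "x \<in> (\<Union>M. A M)" by (auto simp: A_def)
    qed (auto simp: A_def)
    \<comment> \<open>Continuity of the content along increasing sets enters here.\<close>
    moreover have "\<exists>M. \<eta> < cube_content t (A M)"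
    proof (rule ccontr)
      assume "\<nexists>M. \<eta> < cube_content t (A M)"
      then have "cube_content t (\<Union>M. A M) \<le> \<eta>"
        by (intro net_content_increasing dyadic_cubes_nested dyadic_cubes_finite_supersets) (auto simp: A_def not_less)
      with conjunct1[OF G] \<open>(\<Union>M. A M) = fst ` G\<close> show False by (simp add: not_less[symmetric])
    qed
    ultimately show "\<exists>G'. (\<eta> < cube_content t (fst ` G') \<and> (Suc j = 0 \<longrightarrow> G' = C)) \<and> (\<exists>M::nat. G' = {z\<in>G. \<bar>snd z j\<bar> \<le> real M})"
      by (auto simp: A_def)
  qed
  then obtain G where G: "\<And>j. \<eta> < cube_content t (fst ` G j)" "G 0 = C" "\<forall>j. \<exists>M::nat. G (Suc j) = {z\<in>G j. \<bar>snd z j\<bar> \<le> real M}"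
    by blast
  from G(3) obtain M where "\<forall>j. G (Suc j) = {z\<in>G j. \<bar>snd z j\<bar> \<le> real (M j)}" by (rule choice[THEN exE])
  then have GS: "G (Suc j) = {z\<in>G j. \<bar>snd z j\<bar> \<le> real (M j)}" for j by blast
  have Gj: "G j = {z\<in>C. \<forall>i<j. \<bar>snd z i\<bar> \<le> real (M i)}" for j
  proof (induction j)
    case (Suc j)
    then show ?case unfolding GS by (auto simp: less_Suc_eq)
  qed (simp add: G(2))
  define H where "H = {z\<in>C. \<forall>i. \<bar>snd z i\<bar> \<le> real (M i)}"
  have cpt: "compact (C \<inter> (cball q R \<times> PiE UNIV (\<lambda>i. {- B i .. B i})))" for B :: "nat \<Rightarrow> real"
    using C(1) by (intro closed_Int_compact compact_Times compact_function_box) auto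
  have HB: "H = C \<inter> (cball q R \<times> PiE UNIV (\<lambda>i. {- real (M i) .. real (M i)}))"
  proof (intro equalityI subsetI)
    fix z assume z: "z \<in> H"
    then have zC: "z \<in> C" and b: "\<bar>snd z i\<bar> \<le> real (M i)" for i by (auto simp: H_def)
    have "fst z \<in> cball q R" using zC C(2) by auto
    moreover have "snd z \<in> PiE UNIV (\<lambda>i. {- real (M i) .. real (M i)})"
      using b by (auto simp: abs_le_iff minus_le_iff)
    ultimately show "z \<in> C \<inter> (cball q R \<times> PiE UNIV (\<lambda>i. {- real (M i) .. real (M i)}))"
      using zC by (simp add: mem_Times_iff)
  qed (auto simp: H_def PiE_iff abs_le_iff minus_le_iff)
  have Hc: "compact H" unfolding HB by (rule cpt)
  show ?thesis
  proof (intro exI[of _ "fst ` H"] conjI allI impI)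
    show "compact (fst ` H)" by (intro compact_continuous_image continuous_intros Hc)
    show "fst ` H \<subseteq> fst ` C" by (auto simp: H_def)
    fix U :: "'a set" assume U: "open U" "fst ` H \<subseteq> U"
    \<comment> \<open>Only \<open>H\<close> is known to be compact, not the sets \<open>G j\<close>.
      If none of them projected into \<open>U\<close>, points \<open>z j\<close> of
      \<open>G j\<close> projecting outside \<open>U\<close> would accumulate at a point of
      \<open>H\<close>.\<close>
    have "\<exists>j. fst ` G j \<subseteq> U"
    proof (rule ccontr)
      assume "\<nexists>j. fst ` G j \<subseteq> U"
      then have "\<forall>j. \<exists>z. z \<in> G j \<and> fst z \<notin> U" by blast
      then obtain z where "\<forall>j. z j \<in> G j \<and> fst (z j) \<notin> U" by (rule choice[THEN exE])
      then have z: "z j \<in> G j" "fst (z j) \<notin> U" for j by auto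
      \<comment> \<open>Coordinate \<open>i\<close> of \<open>z j\<close> can exceed
        \<open>M i\<close> only for the finitely many \<open>j \<le> i\<close>, so enlarging the
        bounds by these values puts all \<open>z j\<close> into one compact box.\<close>
      define B where "B i = real (M i) + (\<Sum>j\<le>i. \<bar>snd (z j) i\<bar>)" for i
      have zB: "\<bar>snd (z j) i\<bar> \<le> B i" for i j
      proof (cases "i < j")
        case True
        then have "\<bar>snd (z j) i\<bar> \<le> real (M i)" using z(1)[of j] by (auto simp: Gj)
        also have "\<dots> \<le> B i" unfolding B_def by (simp add: sum_nonneg)
        finally show ?thesis .
      next
        case False
        then have "\<bar>snd (z j) i\<bar> \<le> (\<Sum>j\<le>i. \<bar>snd (z j) i\<bar>)"
          by (intro member_le_sum[where f = "\<lambda>j. \<bar>snd (z j) i\<bar>"]) auto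
        then show ?thesis by (simp add: B_def)
      qed
      have zin: "z j \<in> C \<inter> (cball q R \<times> PiE UNIV (\<lambda>i. {- B i .. B i}))" for j
      proof -
        have zC: "z j \<in> C" using z(1)[of j] by (simp add: Gj)
        have "fst (z j) \<in> cball q R" using zC C(2) by auto
        moreover have "snd (z j) \<in> PiE UNIV (\<lambda>i. {- B i .. B i})"
          using zB[of j] by (auto simp: PiE_iff abs_le_iff minus_le_iff)
        ultimately show ?thesis using zC by (simp add: mem_Times_iff)
      qed
      obtain l \<phi> where l: "l \<in> C \<inter> (cball q R \<times> PiE UNIV (\<lambda>i. {- B i .. B i}))" "strict_mono \<phi>" "(z \<circ> \<phi>) \<longlonglongrightarrow> l"
        using seq_compactE[OF compact_imp_seq_compact[OF cpt], of z] zin by blast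
      have "\<bar>snd l i\<bar> \<le> real (M i)" for i
      proof -
        have c: "continuous_on UNIV (\<lambda>z :: 'a \<times> (nat \<Rightarrow> real). \<bar>snd z i\<bar>)"
          by (intro continuous_on_rabs continuous_on_product_then_coordinatewise[OF continuous_on_snd[OF continuous_on_id]])
        have lim: "(\<lambda>j. \<bar>snd ((z \<circ> \<phi>) j) i\<bar>) \<longlonglongrightarrow> \<bar>snd l i\<bar>"
          using continuous_on_tendsto_compose[OF c l(3)] by simp
        have "\<forall>\<^sub>F j in sequentially. \<bar>snd ((z \<circ> \<phi>) j) i\<bar> \<le> real (M i)"
          unfolding eventually_sequentially
        proof (intro exI[of _ "Suc i"] allI impI)
          fix j assume "Suc i \<le> j"
          then have "i < \<phi> j" using seq_suble[OF l(2), of j] by linarith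
          then show "\<bar>snd ((z \<circ> \<phi>) j) i\<bar> \<le> real (M i)" using z(1)[of "\<phi> j"] by (simp add: Gj)
        qed
        with lim show ?thesis by (intro tendsto_upperbound) auto
      qed
      then have "l \<in> H" using l(1) by (simp add: H_def)
      then have "fst l \<in> U" using U(2) by auto
      moreover have "fst l \<in> - U"
      proof (rule closed_sequentially[of "- U" "\<lambda>j. fst ((z \<circ> \<phi>) j)"])
        show "closed (- U)" using U(1) by (simp add: closed_Compl)
        show "(\<lambda>j. fst ((z \<circ> \<phi>) j)) \<longlonglongrightarrow> fst l" by (rule tendsto_fst[OF l(3)])
      qed (use z(2) in auto)
      ultimately show False by simp
    qed
    then obtain j where "fst ` G j \<subseteq> U" by blast
    with G(1)[of j] show "\<eta> < cube_content t U" by (meson less_le_trans net_content_mono)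
  qed
qed

text \<open>Positive measure forces positive dyadic content on a piece of \<open>E\<close> in some
  ball of radius \<open>1/2\<close>, and the compact subset keeps the content of all its open
  neighbourhoods above \<open>\<eta>\<close>. The conclusion speaks of finitely many closed balls
  because it is compared with the finite cover that comes with discrete Frostman weights.\<close>

lemma analytic_compact_subset:
  fixes E :: "'a::euclidean_space set"
  assumes E: "analytic_set E" and t: "t > 0" and pos: "hausdorff_measure UNIV dist t E \<noteq> 0"
  shows "\<exists>K q c. compact K \<and> K \<subseteq> E \<and> K \<subseteq> cball q (1/2) \<and> c > 0 \<and>
    (\<forall>I x \<rho>. finite (I :: ('a \<times> real) set) \<longrightarrow> (\<forall>i\<in>I. 0 < \<rho> i) \<longrightarrow> K \<subseteq> (\<Union>i\<in>I. cball (x i) (\<rho> i)) \<longrightarrow> c \<le> (\<Sum>i\<in>I. \<rho> i powr t))"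
proof -
  obtain C :: "('a \<times> (nat \<Rightarrow> real)) set" where C: "closed C" "E = fst ` C"
    using E by (auto simp: analytic_set_def)
  obtain D :: "'a set" where D: "countable D" "\<And>X. open X \<Longrightarrow> X \<noteq> {} \<Longrightarrow> \<exists>d\<in>D. d \<in> X"
    using countable_dense_exists by blast
  have "\<exists>q\<in>D. hausdorff_measure UNIV dist t (E \<inter> cball q (1/2)) \<noteq> 0"
  proof (rule ccontr)
    assume no: "\<not> ?thesis"
    have "hausdorff_measure UNIV dist t (\<Union>q\<in>D. E \<inter> cball q (1/2)) = 0"
      by (rule hausdorff_measure_eq_0_UN[OF t D(1)]) (use no in auto)
    moreover have "E \<subseteq> (\<Union>q\<in>D. E \<inter> cball q (1/2))"
    proof
      fix x assume "x \<in> E"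
      obtain d where "d \<in> D" "d \<in> ball x (1/2)" using D(2)[of "ball x (1/2)"] by auto
      with \<open>x \<in> E\<close> show "x \<in> (\<Union>q\<in>D. E \<inter> cball q (1/2))" by (auto simp: dist_commute intro!: bexI[of _ d])
    qed
    ultimately show False using hausdorff_measure_eq_0_subset[OF t] pos by blast
  qed
  then obtain q where q: "hausdorff_measure UNIV dist t (E \<inter> cball q (1/2)) \<noteq> 0" by blast
  define C' where "C' = C \<inter> (cball q (1/2) \<times> UNIV)"
  have C'E: "fst ` C' = E \<inter> cball q (1/2)" by (force simp: C'_def C(2))
  have "cube_content t (fst ` C') \<noteq> 0"
    using cube_content_eq_0_imp_hausdorff_measure_eq_0[OF _ t] q unfolding C'E by blast
  then have "0 < cube_content t (fst ` C')" by (simp add: zero_less_iff_neq_zero)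
  then obtain \<eta>' where \<eta>': "0 < \<eta>'" "\<eta>' < cube_content t (fst ` C')" using dense by blast
  then have "\<eta>' \<noteq> top" by (metis not_top_less top.not_eq_extremum order_less_trans less_top)
  then obtain \<eta> where \<eta>: "\<eta>' = ennreal \<eta>" "0 \<le> \<eta>" by (cases \<eta>') auto
  then have \<eta>0: "\<eta> > 0" using \<eta>'(1) by (simp add: ennreal_less_iff)
  have "closed C'" "C' \<subseteq> cball q (1/2) \<times> UNIV"
    unfolding C'_def using C(1) by (auto intro!: closed_Int closed_Times)
  from compact_subset_of_projection[OF this \<eta>'(2)] obtain K where K: "compact K" "K \<subseteq> fst ` C'"
    "\<And>U. open U \<Longrightarrow> K \<subseteq> U \<Longrightarrow> ennreal \<eta> < cube_content t U" unfolding \<eta>(1) by blast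
  define Cn where "Cn = 5 ^ DIM('a) * (2 * DIM('a)) powr t + (1::real)"
  have Cn: "Cn > 0" unfolding Cn_def by (intro add_nonneg_pos) auto
  \<comment> \<open>A ball of radius above \<open>1/2\<close> already costs
    \<open>(1/2) powr t\<close>. Otherwise the doubled open balls are estimated by cubes, whence
    \<open>Cn * 2 powr t\<close>; the summand 1 in \<open>Cn\<close> makes that estimate
    strict.\<close>
  define c where "c = min ((1/2) powr t) (\<eta> / (Cn * 2 powr t))"
  have c: "c > 0" using \<eta>0 Cn by (simp add: c_def)
  have "c \<le> (\<Sum>i\<in>I. \<rho> i powr t)"
    if I: "finite (I :: ('a \<times> real) set)" "\<forall>i\<in>I. 0 < \<rho> i" "K \<subseteq> (\<Union>i\<in>I. cball (x i) (\<rho> i))" for I x \<rho>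
  proof (cases "\<exists>i\<in>I. \<rho> i > 1/2")
    case True
    then obtain i where i: "i \<in> I" "\<rho> i > 1/2" by blast
    have "c \<le> (1/2) powr t" by (simp add: c_def)
    also have "\<dots> \<le> \<rho> i powr t" using i t by (intro powr_mono2) auto
    also have "\<dots> \<le> (\<Sum>i\<in>I. \<rho> i powr t)" using i(1) I(1) by (intro member_le_sum) auto
    finally show ?thesis .
  next
    case False
    define U where "U = (\<Union>i\<in>I. ball (x i) (2 * \<rho> i))"
    have "K \<subseteq> U"
    proof
      fix y assume "y \<in> K"
      then obtain i where i: "i \<in> I" "y \<in> cball (x i) (\<rho> i)" using I(3) by blast
      then have "y \<in> ball (x i) (2 * \<rho> i)" using I(2) by force
      with i(1) show "y \<in> U" by (auto simp: U_def)
    qed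
    then have "ennreal \<eta> < cube_content t U" by (intro K(3)) (auto simp: U_def)
    also have "\<dots> \<le> (\<Sum>i\<in>I. ennreal (Cn * (2 * \<rho> i) powr t))"
      unfolding U_def
    proof (rule net_content_UN_finite[OF I(1)])
      fix i assume i: "i \<in> I"
      have "cube_content t (ball (x i) (2 * \<rho> i)) \<le> ennreal (5 ^ DIM('a) * (2 * DIM('a)) powr t * (2 * \<rho> i) powr t)"
        using i I(2) False by (intro cube_content_ball_le t) (auto simp: not_less)
      also have "\<dots> < ennreal (Cn * (2 * \<rho> i) powr t)"
      proof -
        have p: "0 < (2 * \<rho> i) powr t" using i I(2) by force
        have "5 ^ DIM('a) * (2 * DIM('a)) powr t * (2 * \<rho> i) powr t < Cn * (2 * \<rho> i) powr t"
          by (rule mult_strict_right_mono[OF _ p]) (simp add: Cn_def)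
        then show ?thesis using Cn p by (intro ennreal_lessI) simp_all
      qed
      finally show "cube_content t (ball (x i) (2 * \<rho> i)) < ennreal (Cn * (2 * \<rho> i) powr t)" .
    qed
    also have "\<dots> = ennreal (\<Sum>i\<in>I. Cn * (2 * \<rho> i) powr t)" using Cn by (intro sum_ennreal) auto
    also have "(\<Sum>i\<in>I. Cn * (2 * \<rho> i) powr t) = Cn * 2 powr t * (\<Sum>i\<in>I. \<rho> i powr t)"
      by (simp add: powr_mult sum_distrib_left mult_ac)
    finally have "\<eta> < Cn * 2 powr t * (\<Sum>i\<in>I. \<rho> i powr t)" using \<eta>(2) by (simp add: ennreal_less_iff)
    then have "\<eta> / (Cn * 2 powr t) \<le> (\<Sum>i\<in>I. \<rho> i powr t)" using Cn by (simp add: field_simps)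
    then show ?thesis by (simp add: c_def)
  qed
  moreover have "K \<subseteq> E" "K \<subseteq> cball q (1/2)" using K(2) C'E by auto
  ultimately show ?thesis using K(1) c by (intro exI[of _ K] exI[of _ q] exI[of _ c] conjI allI impI) auto
qed

section \<open>Hausdorff dimension\<close>

lemma emeasure_point_measure_real:
  assumes "finite A" "\<And>a. 0 \<le> w a" "X \<subseteq> A"
  shows "emeasure (point_measure A (\<lambda>a. ennreal (w a))) X = ennreal (sum w X)"
  using assms by (simp add: emeasure_point_measure_finite sum_ennreal)

lemma measure_point_measure_real:
  assumes "finite A" "\<And>a. 0 \<le> w a" "X \<subseteq> A"
  shows "measure (point_measure A (\<lambda>a. ennreal (w a))) X = sum w X"
  using emeasure_point_measure_real[OF assms] assms(2) by (simp add: measure_def sum_nonneg)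

lemma finite_measure_point_measure_real:
  assumes "finite A" "\<And>a. 0 \<le> w a"
  shows "finite_measure (point_measure A (\<lambda>a. ennreal (w a)))"
  using emeasure_point_measure_real[OF assms, of A] by (intro finite_measureI) (simp add: space_point_measure)

lemma double_integral_point_measure:
  assumes "finite A" "\<And>a. 0 \<le> w a"
  shows "double_integral (point_measure A (\<lambda>a. ennreal (w a))) X h = (\<Sum>a\<in>A. w a * (\<Sum>b\<in>A. w b * h (X a - X b)))"
  using assms by (simp add: double_integral_def lebesgue_integral_point_measure_finite mult.commute)

lemma slab_energy_point_measure_bounds:
  assumes A: "finite A" "\<And>a. 0 \<le> w a"
  shows "0 \<le> slab_energy K (point_measure A (\<lambda>a. ennreal (w a))) X V"
    and "slab_energy K (point_measure A (\<lambda>a. ennreal (w a))) X V \<le> (sum w A)\<^sup>2"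
proof -
  show "0 \<le> slab_energy K (point_measure A (\<lambda>a. ennreal (w a))) X V"
    unfolding slab_energy_def double_integral_point_measure[OF A]
    by (intro sum_nonneg mult_nonneg_nonneg A(2)) simp
  have "slab_energy K (point_measure A (\<lambda>a. ennreal (w a))) X V \<le> (\<Sum>a\<in>A. w a * (\<Sum>b\<in>A. w b))"
    unfolding slab_energy_def double_integral_point_measure[OF A]
    by (intro sum_mono mult_left_mono A(2) mult_left_le) simp
  then show "slab_energy K (point_measure A (\<lambda>a. ennreal (w a))) X V \<le> (sum w A)\<^sup>2"
    by (simp add: sum_distrib_right[symmetric] power2_eq_square)
qed

lemma half_power_powr: "((1/2) ^ k :: real) powr x = (2 powr - x) ^ k"
  by (simp add: powr_power powr_minus_divide powr_divide power_one_over powr_realpow[symmetric] powr_powr mult.commute)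

text \<open>Choose the largest \<open>j \<le> k\<close> with \<open>norm z \<le> 2^-j\<close>.
  Unless \<open>j = k\<close>, the norm exceeds \<open>2^-(j+1)\<close>, and in both cases the
  single term \<open>j\<close> dominates the kernel.\<close>

lemma profile_kernel_dyadic_le:
  assumes \<sigma>: "\<sigma> \<ge> 0" and z: "norm z \<le> 1"
  shows "profile_kernel \<sigma> ((1/2) ^ k) z
    \<le> (\<Sum>j\<le>k. 2 powr \<sigma> * (2 powr - \<sigma>) ^ (k - j) * (if norm z \<le> (1/2) ^ j then 1 else 0))"
proof -
  define J where "J = {j. j \<le> k \<and> norm z \<le> (1/2) ^ j}"
  have J: "finite J" "J \<noteq> {}" using z by (auto simp: J_def intro!: exI[of _ 0])
  define j where "j = Max J"
  have "j \<in> J" unfolding j_def by (rule Max_in[OF J])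
  then have j: "j \<le> k" "norm z \<le> (1/2) ^ j" by (auto simp: J_def)
  let ?f = "\<lambda>j. 2 powr \<sigma> * (2 powr - \<sigma>) ^ (k - j) * (if norm z \<le> (1/2) ^ j then 1 else 0)"
  have "profile_kernel \<sigma> ((1/2) ^ k) z \<le> 2 powr \<sigma> * (2 powr - \<sigma>) ^ (k - j)"
  proof (cases "j = k")
    case True
    have "profile_kernel \<sigma> ((1/2) ^ k) z \<le> 1" by (rule profile_kernel_bounds)
    also have "1 \<le> 2 powr \<sigma>" using \<sigma> by (intro ge_one_powr_ge_zero) auto
    finally show ?thesis using True by simp
  next
    case False
    then have jk: "Suc j \<le> k" using j by simp
    have "Suc j \<notin> J"
    proof
      assume "Suc j \<in> J"
      then have "Suc j \<le> j" unfolding j_def by (rule Max_ge[OF J(1)])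
      then show False by simp
    qed
    then have nz: "(1/2) ^ Suc j < norm z" using jk unfolding J_def by (simp add: not_le)
    have z0: "0 < norm z" by (rule less_trans[OF _ nz]) simp
    have split: "(1/2 :: real) ^ k = (1/2) ^ (k - j) * (1/2) ^ j" using j by (simp flip: power_add)
    have "(1/2) ^ k / norm z \<le> (1/2) ^ k / (1/2) ^ Suc j"
      using nz z0 by (intro divide_left_mono) auto
    also have "\<dots> = 2 * (1/2) ^ (k - j)" by (subst split) simp
    finally have "((1/2) ^ k / norm z) powr \<sigma> \<le> (2 * (1/2) ^ (k - j)) powr \<sigma>"
      using \<sigma> z0 by (intro powr_mono2) auto
    also have "\<dots> = 2 powr \<sigma> * (2 powr - \<sigma>) ^ (k - j)" by (simp only: powr_mult half_power_powr)
    finally show ?thesis using z0 by (simp add: profile_kernel_def min_le_iff_disj)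
  qed
  also have "\<dots> = ?f j" using j by simp
  also have "\<dots> \<le> sum ?f {..k}" by (rule member_le_sum) (use j in auto)
  finally show ?thesis .
qed

text \<open>Summing the dyadic bound of the kernel against the growth of the weights gives a
  geometric series with ratio \<open>2 powr (t - \<sigma>) < 1\<close>, dominated by the finest
  scale \<open>k\<close>.\<close>

lemma frostman_profile_energy:
  fixes A :: "'a::euclidean_space set"
  assumes A: "finite A" "\<And>a. 0 \<le> w a" and \<sigma>: "0 < t" "t < \<sigma>"
    and diam: "\<And>a b. a \<in> A \<Longrightarrow> b \<in> A \<Longrightarrow> dist a b \<le> 1"
    and fr: "\<And>a j. a \<in> A \<Longrightarrow> j \<le> k \<Longrightarrow> (\<Sum>b\<in>{b\<in>A. dist a b \<le> (1/2) ^ j}. w b) \<le> (2 * (1/2) ^ j) powr t"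
  shows "double_integral (point_measure A (\<lambda>a. ennreal (w a))) (\<lambda>x. x) (profile_kernel \<sigma> ((1/2) ^ k))
    \<le> sum w A * (2 powr \<sigma> * 2 powr t / (1 - 2 powr (t - \<sigma>))) * (2 powr - t) ^ k"
proof -
  define c where "c = 2 powr \<sigma> * 2 powr t / (1 - 2 powr (t - \<sigma>)) * (2 powr - t) ^ k"
  have q: "0 \<le> 2 powr (t - \<sigma>)" "2 powr (t - \<sigma>) < (1::real)"
    using \<sigma> powr_less_cancel_iff[of 2 "t - \<sigma>" 0] by auto
  have inner: "(\<Sum>b\<in>A. w b * profile_kernel \<sigma> ((1/2) ^ k) (a - b)) \<le> c" if a: "a \<in> A" for a
  proof -
    have "(\<Sum>b\<in>A. w b * profile_kernel \<sigma> ((1/2) ^ k) (a - b)) \<le>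
       (\<Sum>b\<in>A. w b * (\<Sum>j\<le>k. 2 powr \<sigma> * (2 powr - \<sigma>) ^ (k - j) * (if norm (a - b) \<le> (1/2) ^ j then 1 else 0)))"
      using \<sigma> diam[OF a] by (intro sum_mono mult_left_mono A(2) profile_kernel_dyadic_le) (auto simp: dist_norm)
    also have "\<dots> = (\<Sum>b\<in>A. \<Sum>j\<le>k. 2 powr \<sigma> * (2 powr - \<sigma>) ^ (k - j) * (if dist a b \<le> (1/2) ^ j then w b else 0))"
      unfolding sum_distrib_left by (intro sum.cong refl) (simp add: dist_norm)
    also have "\<dots> = (\<Sum>j\<le>k. \<Sum>b\<in>A. 2 powr \<sigma> * (2 powr - \<sigma>) ^ (k - j) * (if dist a b \<le> (1/2) ^ j then w b else 0))"
      by (rule sum.swap)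
    also have "\<dots> = (\<Sum>j\<le>k. 2 powr \<sigma> * (2 powr - \<sigma>) ^ (k - j) * (\<Sum>b\<in>{b\<in>A. dist a b \<le> (1/2) ^ j}. w b))"
      unfolding sum_distrib_left[symmetric] using A(1) by (simp add: sum.inter_filter)
    also have "\<dots> \<le> (\<Sum>j\<le>k. 2 powr \<sigma> * (2 powr - \<sigma>) ^ (k - j) * (2 * (1/2) ^ j) powr t)"
      by (intro sum_mono mult_left_mono fr a) auto
    also have "\<dots> = (\<Sum>j\<le>k. 2 powr \<sigma> * 2 powr t * (2 powr - t) ^ k * (2 powr (t - \<sigma>)) ^ (k - j))"
    proof (intro sum.cong refl)
      fix j assume "j \<in> {..k}"
      then have j: "k = (k - j) + j" by simp
      have "(2 powr - t :: real) ^ k = (2 powr - t) ^ (k - j) * (2 powr - t) ^ j" by (subst j) (rule power_add)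
      moreover have "(2 powr - \<sigma> :: real) ^ (k - j) = (2 powr (t - \<sigma>)) ^ (k - j) * (2 powr - t) ^ (k - j)"
        by (simp flip: power_mult_distrib powr_add)
      moreover have "(2 * (1/2) ^ j :: real) powr t = 2 powr t * (2 powr - t) ^ j"
        by (simp only: powr_mult half_power_powr)
      ultimately show "2 powr \<sigma> * (2 powr - \<sigma>) ^ (k - j) * (2 * (1/2) ^ j) powr t =
          2 powr \<sigma> * 2 powr t * (2 powr - t) ^ k * (2 powr (t - \<sigma>)) ^ (k - j)"
        by (simp only: mult_ac)
    qed
    also have "\<dots> = 2 powr \<sigma> * 2 powr t * (2 powr - t) ^ k * (\<Sum>j\<le>k. (2 powr (t - \<sigma>)) ^ (k - j))"
      by (rule sum_distrib_left[symmetric])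
    also have "(\<Sum>j\<le>k. (2 powr (t - \<sigma>)) ^ (k - j)) = (\<Sum>j\<le>k. (2 powr (t - \<sigma>) :: real) ^ j)"
      by (rule sum.reindex_bij_witness[of _ "\<lambda>j. k - j" "\<lambda>j. k - j"]) auto
    also have "2 powr \<sigma> * 2 powr t * (2 powr - t) ^ k * \<dots> \<le> 2 powr \<sigma> * 2 powr t * (2 powr - t) ^ k * (1 / (1 - 2 powr (t - \<sigma>)))"
      by (intro mult_left_mono sum_geometric_le q) auto
    finally show ?thesis by (simp add: c_def mult.commute)
  qed
  have "double_integral (point_measure A (\<lambda>a. ennreal (w a))) (\<lambda>x. x) (profile_kernel \<sigma> ((1/2) ^ k)) \<le> (\<Sum>a\<in>A. w a * c)"
    unfolding double_integral_point_measure[OF A] by (intro sum_mono mult_left_mono inner A(2))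
  then show ?thesis by (simp only: c_def sum_distrib_right[symmetric] mult.assoc)
qed

text \<open>One finite measure for each resolution \<open>R\<close>, with mass and energy bounds
  that do not depend on \<open>R\<close>. The lower bound for the mass comes from the covering
  property of \<open>K\<close>, applied to the balls of the discrete Frostman lemma enlarged to
  reach all of \<open>K\<close>.\<close>

lemma discrete_Frostman_compact:
  fixes K :: "'a::euclidean_space set"
  assumes K: "compact K" "K \<subseteq> cball q (1/2)" and t: "0 < t" "t < \<sigma>"
    and cover: "\<forall>I x \<rho>. finite (I :: ('a \<times> real) set) \<longrightarrow> (\<forall>i\<in>I. 0 < \<rho> i) \<longrightarrow> K \<subseteq> (\<Union>i\<in>I. cball (x i) (\<rho> i)) \<longrightarrow> c \<le> (\<Sum>i\<in>I. \<rho> i powr t)"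
  shows "\<exists>A w. finite A \<and> A \<subseteq> K \<and> (\<forall>a. 0 \<le> w a) \<and> c / 4 powr t \<le> sum w A \<and> sum w A \<le> 2 powr t \<and>
    (\<forall>k\<le>R. double_integral (point_measure A (\<lambda>a. ennreal (w a))) (\<lambda>x. x) (profile_kernel \<sigma> ((1/2) ^ k))
       \<le> 2 powr t * (2 powr \<sigma> * 2 powr t / (1 - 2 powr (t - \<sigma>))) * (2 powr - t) ^ k)"
proof -
  define r :: real where "r = (1/2) ^ R"
  have r: "0 < r" "r \<le> 1" by (auto simp: r_def power_le_one)
  obtain A where A: "finite A" "A \<subseteq> K" "K \<subseteq> (\<Union>a\<in>A. ball a r)"
    using seq_compact_imp_totally_bounded[OF compact_imp_seq_compact[OF K(1)], rule_format, OF r(1)] by blast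
  have diam: "dist a b \<le> 1" if "a \<in> A" "b \<in> A" for a b
  proof -
    have "dist q a \<le> 1/2" "dist q b \<le> 1/2" using that A(2) K(2) by auto
    then show ?thesis using dist_triangle3[of a b q] by linarith
  qed
  from discrete_Frostman[OF A(1) r(1) t(1), of dist] obtain w F where wF:
    "(\<forall>a. 0 \<le> w a) \<and> (\<forall>a\<in>A. \<forall>\<rho>\<ge>r. (\<Sum>b\<in>{b\<in>A. dist a b \<le> \<rho>}. w b) \<le> (2 * \<rho>) powr t) \<and>
    finite F \<and> (\<forall>x\<in>F. fst x \<in> A \<and> r \<le> snd x) \<and> (\<forall>b\<in>A. \<exists>x\<in>F. dist (fst x) b \<le> 3 * snd x) \<and>
    (\<Sum>x\<in>F. snd x powr t) \<le> sum w A"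
    by (auto simp: dist_commute dist_triangle)
  then have w: "\<And>a. 0 \<le> w a" "\<And>a \<rho>. a \<in> A \<Longrightarrow> r \<le> \<rho> \<Longrightarrow> (\<Sum>b\<in>{b\<in>A. dist a b \<le> \<rho>}. w b) \<le> (2 * \<rho>) powr t"
    and F: "finite F" "\<And>x. x \<in> F \<Longrightarrow> r \<le> snd x" "\<And>b. b \<in> A \<Longrightarrow> \<exists>x\<in>F. dist (fst x) b \<le> 3 * snd x"
      "(\<Sum>x\<in>F. snd x powr t) \<le> sum w A" by auto
  have "c \<le> (\<Sum>x\<in>F. (4 * snd x) powr t)"
  proof (rule cover[THEN spec, THEN spec[of _ fst], THEN spec, THEN mp, THEN mp, THEN mp, OF F(1)])
    show "\<forall>x\<in>F. 0 < 4 * snd x" using F(2) r(1) by force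
    show "K \<subseteq> (\<Union>x\<in>F. cball (fst x) (4 * snd x))"
    proof
      fix y assume "y \<in> K"
      then obtain a where a: "a \<in> A" "dist a y < r" using A(3) by auto
      then obtain x where x: "x \<in> F" "dist (fst x) a \<le> 3 * snd x" using F(3) by blast
      have "dist (fst x) y \<le> 4 * snd x" using dist_triangle[of "fst x" y a] a x F(2)[OF x(1)] by linarith
      with x(1) show "y \<in> (\<Union>x\<in>F. cball (fst x) (4 * snd x))" by auto
    qed
  qed
  also have "\<dots> = 4 powr t * (\<Sum>x\<in>F. snd x powr t)" by (simp only: powr_mult sum_distrib_left)
  also have "\<dots> \<le> 4 powr t * sum w A" using F(4) by (intro mult_left_mono) auto
  finally have lower: "c / 4 powr t \<le> sum w A" by (simp add: field_simps)
  have upper: "sum w A \<le> 2 powr t"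
  proof (cases "A = {}")
    case False
    then obtain a where a: "a \<in> A" by blast
    have "{b\<in>A. dist a b \<le> 1} = A" using diam[OF a] by auto
    then show ?thesis using w(2)[OF a r(2)] by simp
  qed simp
  have en: "double_integral (point_measure A (\<lambda>a. ennreal (w a))) (\<lambda>x. x) (profile_kernel \<sigma> ((1/2) ^ k))
       \<le> 2 powr t * (2 powr \<sigma> * 2 powr t / (1 - 2 powr (t - \<sigma>))) * (2 powr - t) ^ k" if k: "k \<le> R" for k
  proof -
    have "2 powr (t - \<sigma>) < (1::real)" using t powr_less_cancel_iff[of 2 "t - \<sigma>" 0] by auto
    then have pos: "0 \<le> (2 powr \<sigma> * 2 powr t / (1 - 2 powr (t - \<sigma>)) :: real)" by (intro divide_nonneg_nonneg) auto
    have "double_integral (point_measure A (\<lambda>a. ennreal (w a))) (\<lambda>x. x) (profile_kernel \<sigma> ((1/2) ^ k))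
      \<le> sum w A * (2 powr \<sigma> * 2 powr t / (1 - 2 powr (t - \<sigma>))) * (2 powr - t) ^ k"
    proof (rule frostman_profile_energy[OF A(1) w(1) t diam])
      fix a j assume a: "a \<in> A" and j: "j \<le> k"
      have "r \<le> (1/2) ^ j" unfolding r_def using j k by (intro power_decreasing) auto
      then show "(\<Sum>b\<in>{b\<in>A. dist a b \<le> (1/2) ^ j}. w b) \<le> (2 * (1/2) ^ j) powr t" by (rule w(2)[OF a])
    qed
    also have "\<dots> \<le> 2 powr t * (2 powr \<sigma> * 2 powr t / (1 - 2 powr (t - \<sigma>))) * (2 powr - t) ^ k"
      by (intro mult_right_mono upper pos) auto
    finally show ?thesis .
  qed
  show ?thesis using A(1,2) w(1) lower upper en by blast
qed

text \<open>Tychonoff's theorem for an arbitrary index set. The indices will be pairs of a scale and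
  a direction, so a pointwise convergent subsequence need not exist; a cluster point is still
  approximated on every finite set of indices by arbitrarily late terms.\<close>

lemma pointwise_cluster_point:
  fixes f :: "nat \<Rightarrow> 'i \<Rightarrow> real"
  assumes f: "\<And>n i. \<bar>f n i\<bar> \<le> B"
  shows "\<exists>g. \<forall>T \<eta> N. finite T \<longrightarrow> 0 < \<eta> \<longrightarrow> (\<exists>n\<ge>N. \<forall>i\<in>T. \<bar>f n i - g i\<bar> < \<eta>)"
proof -
  define Q where "Q = PiE UNIV (\<lambda>i::'i. {- B .. B})"
  define F where "F = filtermap f sequentially"
  have Q: "compact Q" unfolding Q_def by (rule compact_function_box) simp
  have fQ: "f n \<in> Q" for n using f by (auto simp: Q_def PiE_iff abs_le_iff minus_le_iff)
  have "eventually (\<lambda>h. h \<in> Q) F" by (simp add: F_def eventually_filtermap fQ)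
  moreover have "F \<noteq> bot" by (simp add: F_def filtermap_bot_iff)
  moreover have "\<forall>F. F \<noteq> bot \<longrightarrow> eventually (\<lambda>h. h \<in> Q) F \<longrightarrow> (\<exists>g\<in>Q. inf (nhds g) F \<noteq> bot)"
    using Q by (simp only: compact_filter)
  ultimately have "\<exists>g\<in>Q. inf (nhds g) F \<noteq> bot" by blast
  then obtain g where g: "inf (nhds g) F \<noteq> bot" by blast
  have "\<exists>n\<ge>N. \<forall>i\<in>T. \<bar>f n i - g i\<bar> < \<eta>" if T: "finite T" "0 < \<eta>" for T \<eta> N
  proof (rule ccontr)
    assume no: "\<not> ?thesis"
    define W where "W = (\<Inter>i\<in>T. {h. \<bar>h i - g i\<bar> < \<eta>})"
    have "open {h. \<bar>h i - g i\<bar> < \<eta>}" for i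
      by (intro open_Collect_less continuous_intros continuous_on_product_then_coordinatewise[OF continuous_on_id])
    then have "open W" unfolding W_def using T(1) by (intro open_INT) auto
    moreover have "g \<in> W" using T(2) by (simp add: W_def)
    ultimately have "eventually (\<lambda>h. h \<in> W) (nhds g)" by (rule eventually_nhds_in_open)
    moreover have "eventually (\<lambda>h. h \<notin> W) F"
      unfolding F_def eventually_filtermap eventually_sequentially W_def using no by blast
    ultimately have "eventually (\<lambda>h. False) (inf (nhds g) F)"
      unfolding eventually_inf by blast
    with g show False by (simp add: eventually_False)
  qed
  then show ?thesis by blast
qed

text \<open>For \<open>d > 0\<close> the scale \<open>2^-k\<close> is chosen comparable with
  \<open>d\<close>. No scale matches \<open>d = 0\<close>; there a large \<open>k\<close> makes the
  left side smaller than \<open>\<eta>\<close>, and these errors will be summable.\<close>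

lemma small_scale_ex:
  fixes d u :: real
  assumes u: "u > 0" and d: "0 \<le> d" "d \<le> (1/2) ^ k0 / 8" and \<eta>: "0 < \<eta>"
  shows "\<exists>k\<ge>k0. d \<le> (1/2) ^ k / 4 \<and> (2 powr - u) ^ k \<le> 8 powr u * d powr u + \<eta>"
proof (cases "d = 0")
  case True
  have q: "0 < 2 powr - u" "2 powr - u < (1::real)" using u powr_less_cancel_iff[of 2 "- u" 0] by auto
  obtain k where k: "(2 powr - u) ^ k < \<eta>" using real_arch_pow_inv[OF \<eta> q(2)] by blast
  have "(2 powr - u) ^ max k k0 \<le> (2 powr - u) ^ k" using q by (intro power_decreasing) auto
  then show ?thesis using True k by (intro exI[of _ "max k k0"]) auto
next
  case False
  have "0 < (1/2 :: real) ^ k0" by simp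
  then have "0 < 4 * d" "4 * d < (1/2) ^ k0" using False d by auto
  from dyadic_scale[OF this] obtain k where k: "k \<ge> k0" "4 * d \<le> (1/2) ^ k" "(1/2) ^ k \<le> 2 * (4 * d)" by blast
  have "((1/2) ^ k) powr u \<le> (8 * d) powr u" using k(3) u by (intro powr_mono2) auto
  then have "(2 powr - u) ^ k \<le> 8 powr u * d powr u" by (simp only: powr_mult half_power_powr)
  then show ?thesis using k \<eta> by (intro exI[of _ k]) auto
qed

text \<open>The masses captured by the covering sets of the various scales \<open>k\<close> add up to at least \<open>c\<close>, so
  some scale captures more than the share \<open>(1 - p) p\<^sup>k\<close> of \<open>c\<close>, and it does so with few sets.\<close>

lemma null_projection_slab_energy:
  fixes K :: "'a::euclidean_space set"
  assumes V: "subspace V" and K: "compact K" and u: "u > 0" and c: "c > 0" and p: "0 < p" "p < 1"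
    and null: "hausdorff_measure UNIV dist u (orth_proj V ` K) = 0"
  shows "\<exists>R0\<ge>k0. \<forall>A w. finite A \<longrightarrow> A \<subseteq> K \<longrightarrow> (\<forall>a. 0 \<le> w a) \<longrightarrow> c \<le> sum w A \<longrightarrow>
    (\<exists>k\<in>{k0..R0}. (c * (1 - p))\<^sup>2 / (exp (1/2) * (8 powr u + 2)) * (p\<^sup>2 * 2 powr - u) ^ k
       \<le> slab_energy k (point_measure A (\<lambda>a. ennreal (w a))) (\<lambda>x. x) V)"
proof -
  define Y where "Y = orth_proj V ` K"
  have "compact Y" unfolding Y_def
    by (intro compact_continuous_image K linear_continuous_on bounded_linear_orth_proj V)
  \<comment> \<open>Covering by sets this small ensures that every scale assigned below is at least
    \<open>k0\<close>.\<close>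
  have "hausdorff_content UNIV dist u ((1/2) ^ k0 / 8) Y = 0"
    using null u by (subst hausdorff_measure_eq_0_iff[symmetric]) (auto simp: Y_def)
  then have "hausdorff_content UNIV dist u ((1/2) ^ k0 / 8) Y < 1" by simp
  from hausdorff_content_lessD[OF this] obtain U :: "nat \<Rightarrow> 'a set" where
    "(\<forall>i. U i \<subseteq> UNIV) \<and> (\<forall>i. set_diam dist (U i) \<le> ennreal ((1/2) ^ k0 / 8)) \<and>
      Y \<subseteq> (\<Union>i. U i) \<and> (\<Sum>i. ennreal (enn2real (set_diam dist (U i)) powr u)) < 1" by (rule exE)
  then have U: "\<And>i. set_diam dist (U i) \<le> ennreal ((1/2) ^ k0 / 8)" "Y \<subseteq> (\<Union>i. U i)"
    "(\<Sum>i. ennreal (enn2real (set_diam dist (U i)) powr u)) < 1" by auto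
  define d where "d i = enn2real (set_diam dist (U i))" for i
  have d: "0 \<le> d i" "d i \<le> (1/2) ^ k0 / 8" for i
    unfolding d_def by (rule enn2real_nonneg, rule enn2real_leI[OF _ U(1)]) simp
  have dU: "dist x y \<le> d i" if "x \<in> U i" "y \<in> U i" for x y i
    unfolding d_def by (rule set_diamD[OF U(1) that])
  have sumd: "(\<Sum>i\<in>T. d i powr u) \<le> 1" if T: "finite T" for T
  proof -
    have "ennreal (\<Sum>i\<in>T. d i powr u) = (\<Sum>i\<in>T. ennreal (d i powr u))" by (simp add: sum_ennreal)
    also have "\<dots> \<le> (\<Sum>i. ennreal (d i powr u))" by (rule sum_le_suminf) (use T in auto)
    also have "\<dots> \<le> ennreal 1" using U(3) by (simp add: d_def)
    finally show ?thesis by (simp add: ennreal_le_iff)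
  qed
  have "\<forall>i. \<exists>k. k0 \<le> k \<and> d i \<le> (1/2) ^ k / 4 \<and> (2 powr - u) ^ k \<le> 8 powr u * d i powr u + (1/2) ^ i"
    using small_scale_ex[OF u d] by simp
  then obtain \<kappa> where "\<forall>i. k0 \<le> \<kappa> i \<and> d i \<le> (1/2) ^ \<kappa> i / 4 \<and> (2 powr - u) ^ \<kappa> i \<le> 8 powr u * d i powr u + (1/2) ^ i"
    by (rule choice[THEN exE])
  then have \<kappa>: "k0 \<le> \<kappa> i" "d i \<le> (1/2) ^ \<kappa> i / 4" "(2 powr - u) ^ \<kappa> i \<le> 8 powr u * d i powr u + (1/2) ^ i" for i
    by auto
  \<comment> \<open>Open sets are required for a finite subcover. Diameter
    \<open>(1/2) ^ \<kappa> i / 4\<close> plus two enlargements of the same size keeps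
    \<open>W i\<close> within diameter \<open>(1/2) ^ \<kappa> i\<close>.\<close>
  define W where "W i = (\<Union>x\<in>U i. ball x ((1/2) ^ \<kappa> i / 4))" for i
  have oW: "open (W i)" for i by (auto simp: W_def)
  have dW: "dist y z \<le> (1/2) ^ \<kappa> i" if "y \<in> W i" "z \<in> W i" for y z i
  proof -
    from that obtain a b where ab: "a \<in> U i" "dist a y < (1/2) ^ \<kappa> i / 4" "b \<in> U i" "dist b z < (1/2) ^ \<kappa> i / 4"
      by (auto simp: W_def)
    have "dist y z \<le> dist a y + dist a b + dist b z"
      using dist_triangle3[of y z a] dist_triangle[of a z b] by linarith
    moreover have "dist a b \<le> (1/2) ^ \<kappa> i / 4" using dU[OF ab(1,3)] \<kappa>(2)[of i] by linarith
    moreover have "0 \<le> (1/2 :: real) ^ \<kappa> i" by simp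
    ultimately show ?thesis using ab by linarith
  qed
  have YW: "Y \<subseteq> (\<Union>i. W i)"
  proof
    fix y assume "y \<in> Y"
    then obtain i where "y \<in> U i" using U(2) by blast
    then have "y \<in> W i" unfolding W_def by (rule UN_I) simp
    then show "y \<in> (\<Union>i. W i)" by blast
  qed
  obtain T where T: "finite T" "Y \<subseteq> (\<Union>i\<in>T. W i)"
    using compactE_image[OF \<open>compact Y\<close> oW YW] by metis
  \<comment> \<open>The bound depends on \<open>V\<close> and the cover, not on the weights. This
    uniformity lets one approximation of the cluster point serve all scales up to
    \<open>R0\<close>.\<close>
  define R0 where "R0 = Max (insert k0 (\<kappa> ` T))"
  have R0: "k0 \<le> R0" "\<And>i. i \<in> T \<Longrightarrow> \<kappa> i \<le> R0" using T(1) by (auto simp: R0_def)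
  have "\<forall>x. \<exists>i. x \<in> K \<longrightarrow> i \<in> T \<and> orth_proj V x \<in> W i" using T(2) by (auto simp: Y_def)
  then obtain f where "\<forall>x. x \<in> K \<longrightarrow> f x \<in> T \<and> orth_proj V x \<in> W (f x)" by (rule choice[THEN exE])
  then have f: "\<And>x. x \<in> K \<Longrightarrow> f x \<in> T" "\<And>x. x \<in> K \<Longrightarrow> orth_proj V x \<in> W (f x)" by auto
  \<comment> \<open>Few sets belong to each scale: the cost of the cover is at most 1, and the
    errors \<open>(1/2) ^ i\<close> add at most 2.\<close>
  have card: "real (card {i\<in>T. \<kappa> i = k}) * (2 powr - u) ^ k \<le> 8 powr u + 2" for k
  proof -
    have "real (card {i\<in>T. \<kappa> i = k}) * (2 powr - u) ^ k = (\<Sum>i\<in>{i\<in>T. \<kappa> i = k}. (2 powr - u) ^ \<kappa> i)" by simp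
    also have "\<dots> \<le> (\<Sum>i\<in>T. (2 powr - u) ^ \<kappa> i)" by (rule sum_mono2) (use T(1) in auto)
    also have "\<dots> \<le> (\<Sum>i\<in>T. 8 powr u * d i powr u + (1/2) ^ i)" by (intro sum_mono \<kappa>)
    also have "\<dots> = 8 powr u * (\<Sum>i\<in>T. d i powr u) + (\<Sum>i\<in>T. (1/2) ^ i)" by (simp add: sum.distrib sum_distrib_left)
    also have "\<dots> \<le> 8 powr u * 1 + 1 / (1 - 1/2)"
      by (intro add_mono mult_left_mono sumd sum_geometric_le T(1)) auto
    finally show ?thesis by simp
  qed
  have "\<exists>k\<in>{k0..R0}. (c * (1 - p))\<^sup>2 / (exp (1/2) * (8 powr u + 2)) * (p\<^sup>2 * 2 powr - u) ^ k
       \<le> slab_energy k (point_measure A (\<lambda>a. ennreal (w a))) (\<lambda>x. x) V"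
    if A: "finite A" "A \<subseteq> K" and w: "\<forall>a. 0 \<le> w a" and cA: "c \<le> sum w A" for A w
  proof -
    have w0: "\<And>a. 0 \<le> w a" using w by blast
    define mass where "mass k = sum w {a\<in>A. \<kappa> (f a) = k}" for k
    have "\<exists>k\<in>{k0..R0}. c * ((1 - p) * p ^ k) \<le> mass k"
    proof (rule ccontr)
      assume no: "\<not> ?thesis"
      have "sum w A = (\<Sum>k\<in>{k0..R0}. mass k)"
        unfolding mass_def
        by (rule sum.group[symmetric, OF A(1)]) (use A(2) f(1) \<kappa>(1) R0(2) in auto)
      also have "\<dots> < (\<Sum>k\<in>{k0..R0}. c * ((1 - p) * p ^ k))"
        by (rule sum_strict_mono) (use no R0(1) in \<open>auto simp: not_le\<close>)
      also have "\<dots> = c * (1 - p) * (\<Sum>k\<in>{k0..R0}. p ^ k)" by (simp add: sum_distrib_left mult.assoc)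
      also have "\<dots> \<le> c * (1 - p) * (1 / (1 - p))"
        using p c by (intro mult_left_mono sum_geometric_le) auto
      also have "\<dots> = c" using p by simp
      finally show False using cA by simp
    qed
    then obtain k where k: "k \<in> {k0..R0}" "c * ((1 - p) * p ^ k) \<le> mass k" by blast
    define M where "M = point_measure A (\<lambda>a. ennreal (w a))"
    define D where "D i = {a\<in>A. f a = i}" for i
    define I where "I = {i\<in>T. \<kappa> i = k}"
    have I: "finite I" using T(1) by (simp add: I_def)
    have Msum: "measure M (D i) = sum w (D i)" for i
      unfolding M_def by (rule measure_point_measure_real[OF A(1) w0]) (auto simp: D_def)
    have mk: "(\<Sum>i\<in>I. measure M (D i)) = mass k"
    proof -
      have "(\<Sum>i\<in>I. sum w {a\<in>{a\<in>A. \<kappa> (f a) = k}. f a = i}) = mass k"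
        unfolding mass_def by (rule sum.group) (use A I f(1) in \<open>auto simp: I_def\<close>)
      moreover have "{a\<in>{a\<in>A. \<kappa> (f a) = k}. f a = i} = D i" if "i \<in> I" for i
        using that by (auto simp: D_def I_def)
      ultimately show ?thesis by (simp add: Msum cong: sum.cong)
    qed
    have "(\<Sum>i\<in>I. measure M (D i))\<^sup>2 \<le> exp (1/2) * card I * slab_energy k M (\<lambda>x. x) V"
    proof (rule slab_energy_disjoint_pieces[OF _ _ V I])
      show "finite_measure M" unfolding M_def by (rule finite_measure_point_measure_real[OF A(1) w0])
      show "(\<lambda>x. x) \<in> borel_measurable M" by (simp add: M_def)
      fix i assume i: "i \<in> I"
      show "D i \<in> sets M" by (auto simp: M_def sets_point_measure D_def)
      fix x y assume xy: "x \<in> D i" "y \<in> D i"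
      then have "orth_proj V x \<in> W i" "orth_proj V y \<in> W i" using A(2) f(2)[of x] f(2)[of y] by (auto simp: D_def)
      then have "dist (orth_proj V x) (orth_proj V y) \<le> (1/2) ^ k" using dW i by (auto simp: I_def)
      then show "norm (orth_proj V (x - y)) \<le> (1/2) ^ k"
        by (simp add: dist_norm linear_diff[OF linear_orth_proj[OF V]])
    next
      show "disjoint_family_on D I" by (auto simp: disjoint_family_on_def D_def)
    qed
    then have m2: "(mass k)\<^sup>2 \<le> exp (1/2) * card I * slab_energy k M (\<lambda>x. x) V" by (simp only: mk)
    have S0: "0 \<le> slab_energy k M (\<lambda>x. x) V" unfolding M_def by (rule slab_energy_point_measure_bounds(1)[OF A(1) w0])
    have "(c * ((1 - p) * p ^ k))\<^sup>2 \<le> (mass k)\<^sup>2" using k(2) c p by (intro power_mono) auto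
    then have "(c * ((1 - p) * p ^ k))\<^sup>2 * (2 powr - u) ^ k \<le> exp (1/2) * card I * slab_energy k M (\<lambda>x. x) V * (2 powr - u) ^ k"
      using m2 by (intro mult_right_mono) auto
    also have "\<dots> = exp (1/2) * slab_energy k M (\<lambda>x. x) V * (card I * (2 powr - u) ^ k)" by (simp only: mult_ac)
    also have "\<dots> \<le> exp (1/2) * slab_energy k M (\<lambda>x. x) V * (8 powr u + 2)"
      using card[of k] S0 by (intro mult_left_mono) (auto simp: I_def)
    finally have fin: "(c * ((1 - p) * p ^ k))\<^sup>2 * (2 powr - u) ^ k \<le> slab_energy k M (\<lambda>x. x) V * (exp (1/2) * (8 powr u + 2))"
      by (simp only: mult_ac)
    have "0 < 8 powr u + (2::real)" by (intro add_nonneg_pos) auto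
    then have den: "0 < exp (1/2) * (8 powr u + (2::real))" by simp
    have "(c * (1 - p))\<^sup>2 / (exp (1/2) * (8 powr u + 2)) * (p\<^sup>2 * 2 powr - u) ^ k =
        (c * ((1 - p) * p ^ k))\<^sup>2 * (2 powr - u) ^ k / (exp (1/2) * (8 powr u + 2))"
      by (simp add: power_mult_distrib power_mult[symmetric] mult.commute)
    also have "\<dots> \<le> slab_energy k M (\<lambda>x. x) V" using fin den by (simp only: pos_divide_le_eq)
    finally show ?thesis using k(1) by (auto simp: M_def)
  qed
  then show ?thesis using R0(1) by (intro exI[of _ R0]) blast
qed

text \<open>Instead of a limit measure, a cluster point \<open>g\<close> of the slab energies of
  finite measures \<open>M R\<close> marks the bad directions at every scale. On a finite set of
  directions \<open>g\<close> is approximated by some \<open>M R\<close> with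
  \<open>R \<ge> k\<close>, so the content bound applies to \<open>B k\<close>. A direction with
  null projection has a scale of large energy for every \<open>M R\<close>, in a range independent
  of \<open>R\<close>, and this passes to \<open>g\<close>.\<close>

lemma null_projections_null:
  fixes E :: "'a::euclidean_space set" and m :: nat and \<gamma> s :: real
  assumes m: "1 \<le> m" "m \<le> DIM('a)" and \<gamma>: "0 \<le> \<gamma>" "\<gamma> \<le> real DIM('a) - real m"
    and s: "s > 0" "real m * (real DIM('a) - real m) - \<gamma> \<le> s"
    and E: "analytic_set E" and u: "0 < u" and t: "u + \<gamma> < t" "t < real m + \<gamma>"
    and pos: "hausdorff_measure UNIV dist t E \<noteq> 0"
  shows "hausdorff_measure (grassmannian m) grassmann_dist s
     {V \<in> grassmannian m. hausdorff_measure UNIV dist u (orth_proj V ` E) = 0} = 0"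
proof -
  define \<sigma> where "\<sigma> = real m + \<gamma>"
  have t0: "0 < t" "t < \<sigma>" using u t \<gamma> by (auto simp: \<sigma>_def)
  from analytic_compact_subset[OF E t0(1) pos] obtain K q c where
    "compact K \<and> K \<subseteq> E \<and> K \<subseteq> cball q (1/2) \<and> c > 0 \<and>
    (\<forall>I x \<rho>. finite (I :: ('a \<times> real) set) \<longrightarrow> (\<forall>i\<in>I. 0 < \<rho> i) \<longrightarrow> K \<subseteq> (\<Union>i\<in>I. cball (x i) (\<rho> i)) \<longrightarrow> c \<le> (\<Sum>i\<in>I. \<rho> i powr t))"
    by (elim exE) (rule that)
  then have K: "compact K" "K \<subseteq> E" "K \<subseteq> cball q (1/2)" "c > 0"
    and cover: "\<forall>I x \<rho>. finite (I :: ('a \<times> real) set) \<longrightarrow> (\<forall>i\<in>I. 0 < \<rho> i) \<longrightarrow>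
      K \<subseteq> (\<Union>i\<in>I. cball (x i) (\<rho> i)) \<longrightarrow> c \<le> (\<Sum>i\<in>I. \<rho> i powr t)"
    by simp_all
  define CE where "CE = 2 powr t * (2 powr \<sigma> * 2 powr t / (1 - 2 powr (t - \<sigma>)))"
  have "2 powr (t - \<sigma>) < (1::real)" using t0 powr_less_cancel_iff[of 2 "t - \<sigma>" 0] by auto
  then have CE: "CE > 0" by (simp add: CE_def)
  have "\<forall>R. \<exists>z. finite (fst z) \<and> fst z \<subseteq> K \<and> (\<forall>a. 0 \<le> snd z a) \<and> c / 4 powr t \<le> sum (snd z) (fst z) \<and> sum (snd z) (fst z) \<le> 2 powr t \<and>
    (\<forall>k\<le>R. double_integral (point_measure (fst z) (\<lambda>a. ennreal (snd z a))) (\<lambda>x. x) (profile_kernel \<sigma> ((1/2) ^ k)) \<le> CE * (2 powr - t) ^ k)"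
  proof
    fix R
    from discrete_Frostman_compact[OF K(1,3) t0 cover, of R, folded CE_def] obtain A w where
      "finite A \<and> A \<subseteq> K \<and> (\<forall>a. 0 \<le> w a) \<and> c / 4 powr t \<le> sum w A \<and> sum w A \<le> 2 powr t \<and>
      (\<forall>k\<le>R. double_integral (point_measure A (\<lambda>a. ennreal (w a))) (\<lambda>x. x) (profile_kernel \<sigma> ((1/2) ^ k)) \<le> CE * (2 powr - t) ^ k)"
      by (elim exE) (rule that)
    then show "\<exists>z. finite (fst z) \<and> fst z \<subseteq> K \<and> (\<forall>a. 0 \<le> snd z a) \<and> c / 4 powr t \<le> sum (snd z) (fst z) \<and> sum (snd z) (fst z) \<le> 2 powr t \<and>
      (\<forall>k\<le>R. double_integral (point_measure (fst z) (\<lambda>a. ennreal (snd z a))) (\<lambda>x. x) (profile_kernel \<sigma> ((1/2) ^ k)) \<le> CE * (2 powr - t) ^ k)"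
      by (intro exI[of _ "(A, w)"]) simp
  qed
  then obtain z where z: "\<forall>R. finite (fst (z R)) \<and> fst (z R) \<subseteq> K \<and> (\<forall>a. 0 \<le> snd (z R) a) \<and>
    c / 4 powr t \<le> sum (snd (z R)) (fst (z R)) \<and> sum (snd (z R)) (fst (z R)) \<le> 2 powr t \<and>
    (\<forall>k\<le>R. double_integral (point_measure (fst (z R)) (\<lambda>a. ennreal (snd (z R) a))) (\<lambda>x. x) (profile_kernel \<sigma> ((1/2) ^ k)) \<le> CE * (2 powr - t) ^ k)"
    by (rule choice[THEN exE])
  define A where "A R = fst (z R)" for R
  define w where "w R = snd (z R)" for R
  define M where "M R = point_measure (A R) (\<lambda>a. ennreal (w R a))" for R
  have A: "finite (A R)" "A R \<subseteq> K" and w: "\<And>a. 0 \<le> w R a" "c / 4 powr t \<le> sum (w R) (A R)" "sum (w R) (A R) \<le> 2 powr t"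
    and en: "\<And>k. k \<le> R \<Longrightarrow> double_integral (M R) (\<lambda>x. x) (profile_kernel \<sigma> ((1/2) ^ k)) \<le> CE * (2 powr - t) ^ k" for R
    using z[rule_format, of R] by (simp_all add: A_def w_def M_def)
  define f where "f R i = slab_energy (fst i) (M R) (\<lambda>x. x) (snd i :: 'a set)" for R i
  have fb: "\<bar>f R i\<bar> \<le> (2 powr t)\<^sup>2" for R i
  proof -
    have "f R i \<le> (sum (w R) (A R))\<^sup>2" unfolding f_def M_def
      by (rule slab_energy_point_measure_bounds(2)[OF A(1) w(1)])
    also have "\<dots> \<le> (2 powr t)\<^sup>2" using w by (intro power_mono sum_nonneg) auto
    finally have "f R i \<le> (2 powr t)\<^sup>2" .
    moreover have "0 \<le> f R i" unfolding f_def M_def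
      by (rule slab_energy_point_measure_bounds(1)[OF A(1) w(1)])
    ultimately show ?thesis by simp
  qed
  from pointwise_cluster_point[of f, OF fb] obtain g where
    g: "\<forall>T \<eta> N. finite T \<longrightarrow> 0 < \<eta> \<longrightarrow> (\<exists>n\<ge>N. \<forall>i\<in>T. \<bar>f n i - g i\<bar> < \<eta>)" by (rule exE)
  \<comment> \<open>The available gap is \<open>t - u - \<gamma> = 4 * \<epsilon>\<close>. The
    shares \<open>p ^ k\<close>, squared in \<open>h\<close>, consume half of it, and
    \<open>r\<close> keeps the other half as decay of the contents.\<close>
  define \<epsilon> where "\<epsilon> = (t - u - \<gamma>) / 4"
  have \<epsilon>: "\<epsilon> > 0" using t by (simp add: \<epsilon>_def)
  define p where "p = 2 powr - \<epsilon>"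
  have p: "0 < p" "p < 1" using \<epsilon> powr_less_cancel_iff[of 2 "- \<epsilon>" 0] by (auto simp: p_def)
  define h where "h = p\<^sup>2 * 2 powr - u"
  have "2 powr - u \<le> (1::real)" using u powr_le_cancel_iff[of 2 "- u" 0] by auto
  then have "h \<le> 1 * 1" unfolding h_def using p by (intro mult_mono power_le_one) auto
  then have h: "0 < h" "h \<le> 1" using p by (auto simp: h_def)
  define c3 where "c3 = (c / 4 powr t * (1 - p))\<^sup>2 / (exp (1/2) * (8 powr u + 2))"
  have "0 < 8 powr u + (2::real)" by (intro add_nonneg_pos) auto
  then have c3: "c3 > 0" using K(4) p by (auto simp: c3_def intro!: divide_pos_pos mult_pos_pos)
  have c4: "c / 4 powr t > 0" using K(4) by simp
  \<comment> \<open>The threshold is half of the lower energy bound \<open>c3 * h ^ k\<close>: one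
    half is lost when passing from \<open>M R\<close> to \<open>g\<close>, and half of the rest when
    passing back.\<close>
  define B where "B k = {V\<in>grassmannian m. c3 * h ^ k / 2 \<le> g (k, V)}" for k
  from content_large_slab_energy[OF m \<gamma> s, of 1, where 'b = 'a]
  obtain C where C: "C > 0" and cont: "\<forall>(B :: 'a set set) K e lam. B \<subseteq> grassmannian m \<longrightarrow> 0 < lam \<longrightarrow>
    (\<forall>A\<subseteq>B. finite A \<longrightarrow> (\<exists>(M :: 'a measure) X S. finite_measure M \<and> X \<in> borel_measurable M \<and>
       (AE \<omega> in M. X \<omega> \<in> S) \<and> (\<forall>x\<in>S. \<forall>y\<in>S. norm (x - y) \<le> 1) \<and>
       double_integral M X (profile_kernel (m + \<gamma>) ((1/2) ^ K)) \<le> e \<and> (\<forall>V\<in>A. lam \<le> slab_energy K M X V))) \<longrightarrow>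
    hausdorff_content (grassmannian m) grassmann_dist s 2 B \<le> ennreal (C * (2 ^ K) powr \<gamma> * e / lam)"
    by (elim exE conjE) (rule that)
  note content = cont[THEN spec, THEN spec, THEN spec, THEN spec, THEN mp, THEN mp, THEN mp]
  define r where "r = 2 powr (- (2 * \<epsilon>))"
  have r: "0 \<le> r" "r < 1" using \<epsilon> powr_less_cancel_iff[of 2 "- (2 * \<epsilon>)" 0] by (auto simp: r_def)
  have cB: "hausdorff_content (grassmannian m) grassmann_dist s 2 (B k) \<le> ennreal (C * CE * 4 / c3 * r ^ k)" for k
  proof -
    have "hausdorff_content (grassmannian m) grassmann_dist s 2 (B k)
      \<le> ennreal (C * (2 ^ k) powr \<gamma> * (CE * (2 powr - t) ^ k) / (c3 * h ^ k / 4))"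
    proof (rule content)
      show "B k \<subseteq> grassmannian m" by (auto simp: B_def)
      show "0 < c3 * h ^ k / 4" using c3 h by simp
      show "\<forall>A\<subseteq>B k. finite A \<longrightarrow> (\<exists>(M :: 'a measure) X S. finite_measure M \<and> X \<in> borel_measurable M \<and>
       (AE \<omega> in M. X \<omega> \<in> S) \<and> (\<forall>x\<in>S. \<forall>y\<in>S. norm (x - y) \<le> 1) \<and>
       double_integral M X (profile_kernel (m + \<gamma>) ((1/2) ^ k)) \<le> CE * (2 powr - t) ^ k \<and> (\<forall>V\<in>A. c3 * h ^ k / 4 \<le> slab_energy k M X V))"
      proof (intro allI impI)
        fix \<V> assume \<V>: "\<V> \<subseteq> B k" "finite \<V>"
        have "\<exists>R\<ge>k. \<forall>i\<in>{k} \<times> \<V>. \<bar>f R i - g i\<bar> < c3 * h ^ k / 4"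
          by (rule g[rule_format]) (use \<V>(2) c3 h in auto)
        then obtain R where R: "R \<ge> k" "\<forall>i\<in>{k} \<times> \<V>. \<bar>f R i - g i\<bar> < c3 * h ^ k / 4" by blast
        show "\<exists>(M :: 'a measure) X S. finite_measure M \<and> X \<in> borel_measurable M \<and>
           (AE \<omega> in M. X \<omega> \<in> S) \<and> (\<forall>x\<in>S. \<forall>y\<in>S. norm (x - y) \<le> 1) \<and>
           double_integral M X (profile_kernel (m + \<gamma>) ((1/2) ^ k)) \<le> CE * (2 powr - t) ^ k \<and> (\<forall>V\<in>\<V>. c3 * h ^ k / 4 \<le> slab_energy k M X V)"
        proof (intro exI conjI)
          show "finite_measure (M R)" unfolding M_def by (rule finite_measure_point_measure_real[OF A(1) w(1)])
          show "(\<lambda>x. x) \<in> borel_measurable (M R)" by (simp add: M_def)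
          show "AE x in M R. x \<in> K" using A(2)[of R] by (intro AE_I2) (auto simp: M_def space_point_measure)
          show "\<forall>x\<in>K. \<forall>y\<in>K. norm (x - y) \<le> 1"
          proof (intro ballI)
            fix x y assume "x \<in> K" "y \<in> K"
            then have "dist q x \<le> 1/2" "dist q y \<le> 1/2" using K(3) by auto
            then show "norm (x - y) \<le> 1" using dist_triangle3[of x y q] by (simp add: dist_norm)
          qed
          show "double_integral (M R) (\<lambda>x. x) (profile_kernel (m + \<gamma>) ((1/2) ^ k)) \<le> CE * (2 powr - t) ^ k"
            using en[OF R(1)] by (simp add: \<sigma>_def)
          show "\<forall>V\<in>\<V>. c3 * h ^ k / 4 \<le> slab_energy k (M R) (\<lambda>x. x) V"
          proof
            fix V assume V: "V \<in> \<V>"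
            have "\<bar>f R (k, V) - g (k, V)\<bar> < c3 * h ^ k / 4" using R(2) V by simp
            moreover have "c3 * h ^ k / 2 \<le> g (k, V)" using V \<V>(1) by (auto simp: B_def)
            ultimately have "c3 * h ^ k / 4 \<le> f R (k, V)" by linarith
            then show "c3 * h ^ k / 4 \<le> slab_energy k (M R) (\<lambda>x. x) V" by (simp add: f_def)
          qed
        qed
      qed
    qed
    also have "C * (2 ^ k) powr \<gamma> * (CE * (2 powr - t) ^ k) / (c3 * h ^ k / 4) = C * CE * 4 / c3 * r ^ k"
    proof -
      have G: "(2 ^ k :: real) powr \<gamma> = (2 powr \<gamma>) ^ k"
        by (simp add: powr_power mult.commute powr_realpow[symmetric] powr_powr)
      have "h = 2 powr (- (2 * \<epsilon>) - u)" by (simp add: h_def p_def powr_power flip: powr_add)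
      moreover have "- (2 * \<epsilon>) + (- (2 * \<epsilon>) - u) = \<gamma> + - t" by (simp add: \<epsilon>_def field_simps)
      ultimately have "r * h = 2 powr \<gamma> * 2 powr - t" unfolding r_def by (simp only: powr_add[symmetric])
      then have "r ^ k * h ^ k = (2 powr \<gamma>) ^ k * (2 powr - t) ^ k" by (simp only: power_mult_distrib[symmetric])
      then show ?thesis unfolding G using c3 h by (simp add: field_simps)
    qed
    finally show ?thesis .
  qed
  show ?thesis
  proof (rule hausdorff_measure_limsup_eq_0[OF s(1) _ r, of 2 0])
    show "hausdorff_content (grassmannian m) grassmann_dist s 2 (B k) \<le> ennreal (C * CE * 4 / c3 * r ^ k)" for k by (rule cB)
    fix k0 :: nat
    show "{V \<in> grassmannian m. hausdorff_measure UNIV dist u (orth_proj V ` E) = 0} \<subseteq> (\<Union>k\<in>{k0..}. B k)"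
    proof
      fix V assume "V \<in> {V \<in> grassmannian m. hausdorff_measure UNIV dist u (orth_proj V ` E) = 0}"
      then have V: "V \<in> grassmannian m" "hausdorff_measure UNIV dist u (orth_proj V ` E) = 0" by auto
      have sub: "subspace V" using V(1) by (simp add: grassmannian_def)
      have "hausdorff_measure UNIV dist u (orth_proj V ` K) = 0"
        by (rule hausdorff_measure_eq_0_subset[OF u V(2)]) (use K(2) in blast)
      from null_projection_slab_energy[OF sub K(1) u c4 p this, of k0, folded c3_def h_def]
      obtain R0 where R0: "R0 \<ge> k0" and slab: "\<forall>A w. finite A \<longrightarrow> A \<subseteq> K \<longrightarrow> (\<forall>a. 0 \<le> w a) \<longrightarrow> c / 4 powr t \<le> sum w A \<longrightarrow>
        (\<exists>k\<in>{k0..R0}. c3 * h ^ k \<le> slab_energy k (point_measure A (\<lambda>a. ennreal (w a))) (\<lambda>x. x) V)"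
        by (elim exE conjE) (rule that)
      \<comment> \<open>Since \<open>h \<le> 1\<close>, the tolerance taken at \<open>R0\<close> is
        small enough at all scales up to \<open>R0\<close>.\<close>
      have "\<exists>R\<ge>0. \<forall>i\<in>{k0..R0} \<times> {V}. \<bar>f R i - g i\<bar> < c3 * h ^ R0 / 2"
        by (rule g[rule_format]) (use c3 h in auto)
      then obtain R where R: "\<forall>i\<in>{k0..R0} \<times> {V}. \<bar>f R i - g i\<bar> < c3 * h ^ R0 / 2" by blast
      have "\<exists>k\<in>{k0..R0}. c3 * h ^ k \<le> slab_energy k (M R) (\<lambda>x. x) V"
        unfolding M_def by (rule slab[rule_format, OF A w(1,2)])
      then obtain k where k: "k \<in> {k0..R0}" "c3 * h ^ k \<le> slab_energy k (M R) (\<lambda>x. x) V" by (rule bexE)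
      have "\<bar>f R (k, V) - g (k, V)\<bar> < c3 * h ^ R0 / 2" using R k(1) by blast
      moreover have "c3 * h ^ k \<le> f R (k, V)" using k(2) by (simp add: f_def)
      moreover have "c3 * h ^ R0 \<le> c3 * h ^ k" using k(1) c3 h by (intro mult_left_mono power_decreasing) auto
      ultimately have "c3 * h ^ k / 2 \<le> g (k, V)" by linarith
      then show "V \<in> (\<Union>k\<in>{k0..}. B k)" using V(1) k(1) by (auto simp: B_def)
    qed
  qed simp
qed

text \<open>A drop of dimension is witnessed by rationals: the projection is null in dimension
  \<open>a\<close>, while \<open>E\<close> is not null in some dimension
  \<open>b > a + \<gamma>\<close>. There are countably many such pairs, and
  \<open>b < m + \<gamma>\<close> holds because the profile is capped at
  \<open>m + \<gamma>\<close>.\<close>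

theorem hausdorff_dim_exceptional_null:
  fixes E :: "'a::euclidean_space set" and m :: nat and \<gamma> s :: real
  assumes m: "1 \<le> m" "m \<le> DIM('a)" and \<gamma>: "0 \<le> \<gamma>" "\<gamma> \<le> real DIM('a) - real m"
    and s: "s > 0" "real m * (real DIM('a) - real m) - \<gamma> \<le> s" and E: "analytic_set E"
  shows "hausdorff_measure (grassmannian m) grassmann_dist s
     {V \<in> grassmannian m. hausdorff_dim (orth_proj V ` E) < hausdorff_dim_profile (m + \<gamma>) E - ereal \<gamma>} = 0"
proof -
  define I where "I = {i. 0 < real_of_rat (fst i) \<and> real_of_rat (fst i) + \<gamma> < real_of_rat (snd i) \<and>
    real_of_rat (snd i) < real m + \<gamma> \<and> hausdorff_measure UNIV dist (real_of_rat (snd i)) E \<noteq> 0}"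
  define Z where "Z = (\<Union>i\<in>I. {V \<in> grassmannian m. hausdorff_measure UNIV dist (real_of_rat (fst i)) (orth_proj V ` E) = 0})"
  have Z: "hausdorff_measure (grassmannian m) grassmann_dist s Z = 0"
    unfolding Z_def
  proof (rule hausdorff_measure_eq_0_UN[OF s(1)])
    show "countable I" by (rule countable_subset[OF subset_UNIV]) simp
    fix i assume "i \<in> I"
    then show "hausdorff_measure (grassmannian m) grassmann_dist s
       {V \<in> grassmannian m. hausdorff_measure UNIV dist (real_of_rat (fst i)) (orth_proj V ` E) = 0} = 0"
      by (intro null_projections_null[OF m \<gamma> s E, where t = "real_of_rat (snd i)"]) (auto simp: I_def)
  qed
  show ?thesis
  proof (rule hausdorff_measure_eq_0_subset[OF s(1) Z], rule subsetI)
    fix V assume "V \<in> {V \<in> grassmannian m. hausdorff_dim (orth_proj V ` E) < hausdorff_dim_profile (m + \<gamma>) E - ereal \<gamma>}"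
    then have V: "V \<in> grassmannian m" "hausdorff_dim (orth_proj V ` E) < hausdorff_dim_profile (m + \<gamma>) E - ereal \<gamma>" by auto
    from hausdorff_dim_in_lessD[OF V(2)] obtain u where
      u: "u > 0" "ereal u < hausdorff_dim_profile (m + \<gamma>) E - ereal \<gamma>" "hausdorff_measure UNIV dist u (orth_proj V ` E) = 0" .
    have "ereal (u + \<gamma>) < hausdorff_dim_profile (m + \<gamma>) E"
      using u(2) by (cases "hausdorff_dim_profile (m + \<gamma>) E") auto
    then obtain x where x: "ereal (u + \<gamma>) < ereal x" "ereal x < hausdorff_dim_profile (m + \<gamma>) E" by (rule ereal_dense3[THEN exE]) (use that in auto)
    have x': "u + \<gamma> < x" "x < real m + \<gamma>" "ereal x < hausdorff_dim E"
      using x by (auto simp: hausdorff_dim_profile_def)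
    have gap: "u < (u + (x - \<gamma>)) / 2" "(u + (x - \<gamma>)) / 2 + \<gamma> < x" using x'(1) by (simp_all add: field_simps)
    obtain a where a: "u < real_of_rat a" "real_of_rat a < (u + (x - \<gamma>)) / 2"
      using of_rat_dense[OF gap(1)] by blast
    obtain b where b: "(u + (x - \<gamma>)) / 2 + \<gamma> < real_of_rat b" "real_of_rat b < x"
      using of_rat_dense[OF gap(2)] by blast
    have b0: "0 < real_of_rat b" using a b u(1) \<gamma>(1) by linarith
    have "ereal (real_of_rat b) < hausdorff_dim E" by (rule less_trans[OF _ x'(3)]) (use b in simp)
    from hausdorff_dim_in_gtD[OF this b0] have "hausdorff_measure UNIV dist (real_of_rat b) E \<noteq> 0" .
    moreover have "0 < real_of_rat a" using a(1) u(1) by linarith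
    moreover have "real_of_rat a + \<gamma> < real_of_rat b" using a(2) b(1) by linarith
    moreover have "real_of_rat b < real m + \<gamma>" using b(2) x'(2) by linarith
    ultimately have "(a, b) \<in> I" by (simp add: I_def)
    moreover have "hausdorff_measure UNIV dist (real_of_rat a) (orth_proj V ` E) = 0"
      by (rule hausdorff_measure_eq_0_powr_mono[OF u(1) _ u(3)]) (use a in simp)
    ultimately show "V \<in> Z" unfolding Z_def using V(1) by (intro UN_I[of "(a, b)"]) auto
  qed
qed

theorem theorem1p3:
  fixes E :: "(real ^ 'n) set" and m :: nat and \<gamma> :: real
  assumes "1 \<le> m" and "m \<le> CARD('n) - 1"
    and "E \<noteq> {}" and "E \<in> sets borel"
    and "0 \<le> \<gamma>" and "\<gamma> \<le> real CARD('n) - real m"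
  shows
    "(hausdorff_dim_in (grassmannian m) grassmann_dist
        {V \<in> grassmannian m.
           hausdorff_dim (orth_proj V ` E) < hausdorff_dim_profile (real m + \<gamma>) E - ereal \<gamma>}
      \<le> ereal (real m * (real CARD('n) - real m) - \<gamma>)) \<and>
     (bounded E \<longrightarrow>
      hausdorff_dim_in (grassmannian m) grassmann_dist
        {V \<in> grassmannian m.
           lower_box_dim (orth_proj V ` E) < lower_box_dim_profile (real m + \<gamma>) E - ereal \<gamma>}
      \<le> ereal (real m * (real CARD('n) - real m) - \<gamma>)) \<and>
     (bounded E \<longrightarrow>
      hausdorff_dim_in (grassmannian m) grassmann_dist
        {V \<in> grassmannian m.
           upper_box_dim (orth_proj V ` E) < upper_box_dim_profile (real m + \<gamma>) E - ereal \<gamma>}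
      \<le> ereal (real m * (real CARD('n) - real m) - \<gamma>)) \<and>
     (hausdorff_dim_in (grassmannian m) grassmann_dist
        {V \<in> grassmannian m.
           packing_dim (orth_proj V ` E) < packing_dim_profile (real m + \<gamma>) E - ereal \<gamma>}
      \<le> ereal (real m * (real CARD('n) - real m) - \<gamma>))"
proof -
  have m: "1 \<le> m" "m \<le> DIM(real ^ 'n)" using assms(1,2) by simp_all
  have \<gamma>: "0 \<le> \<gamma>" "\<gamma> \<le> real DIM(real ^ 'n) - real m" using assms(5,6) by simp_all
  have E: "analytic_set E" by (rule borel_analytic_set[OF assms(4)])
  define x where "x = real m * (real CARD('n) - real m) - \<gamma>"
  \<comment> \<open>Since \<open>m \<ge> 1\<close>, the claimed bound is at least
    \<open>n - m - \<gamma> \<ge> 0\<close>, so it suffices to find null measure for every exponent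
    \<open>s\<close> above it.\<close>
  have "1 * (real CARD('n) - real m) \<le> real m * (real CARD('n) - real m)"
    using assms by (intro mult_right_mono) auto
  then have x: "0 \<le> x" using assms(6) by (simp add: x_def)
  have s: "s > 0" "real m * (real DIM(real ^ 'n) - real m) - \<gamma> \<le> s" if "x < s" for s
    using that x by (simp_all add: x_def)
  show ?thesis
    unfolding x_def[symmetric]
    by (intro conjI impI hausdorff_dim_in_leI[OF x] hausdorff_dim_exceptional_null[OF m \<gamma> s E]
        box_dim_exceptional_null[OF m \<gamma> s _ assms(3)] packing_dim_exceptional_null[OF m \<gamma> s E assms(3)])
qed


end
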